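(* There is a constant $\tilde C>0$, independent of $\varepsilon,\alpha,\gamma$, such that the following holds. For any $\alpha>0$ and $0<\gamma\le1$, let $d_\alpha^\varepsilon$ be the reconstruction of $d_\alpha = d_\alpha(k(X))$ from a noisy measurement $\mathcal{M}_\varepsilon$, for a suitable choice of the regularization parameter $\lambda>0$ (depending on the noise level but not on $\alpha,\gamma$). Then $$\|d_\alpha^\varepsilon - d_\alpha\|_{L^2(\mathcal{D}_\gamma)} \le C\,\gamma^{-1/2}\left(\frac{3k_i}{\alpha(\alpha+\mu)}\right)\sqrt{\|\mathcal{M}_\varepsilon-\mathcal{M}\|_{L^2(\mathcal{D})}},$$ where the constant $C$ satisfies $$C = \left(|\mathcal{D}|^{1/2}\left(\|q\|_\infty + \tilde C\sqrt{\|q\eta\|_{H^2(\mathcal{D})}/k_i^2}\right)\right)^{1/2},$$ and $|\mathcal{D}|$ denotes the area of the measurement domain.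
   Context: Setting. Fix an angular frequency $\omega>0$, the gravitational acceleration $g>0$, a mean depth $H_0>0$, put $\mu=\omega^2/g$, and let $\eta_i(X) = a\exp(i\boldsymbol{k}_i\cdot X)$ be an incoming wave with $a>0$, $\boldsymbol{k}_i\in\mathbb{R}^2$, $k_i=|\boldsymbol{k}_i|>0$ and $\omega^2 = g k_i\tanh(k_iH_0)$. Let $\Omega\subset\mathbb{R}^2$ be a smooth, compact domain and $d(X) = H_0-h(X)$ the topography, where $h\in C_0^2(\mathbb{R}^2)$ is real-valued, $\mathrm{supp}(h)\subset\Omega$, $\min d(X)>0$, and $d$ satisfies the mild-slope condition $\frac{|\nabla d|}{d}\le\delta_0k$ with $\delta_0\ll1$. The local wavenumber $k=k(X)>0$ is the unique positive solution of $\omega^2 = g\,k(X)\tanh(k(X)d(X))$, and $q = 1-k^2/k_i^2$. The total field $\eta$ solves the simplified mild-slope scattering problem: $\Delta\eta+k^2\eta=0$ in $\mathbb{R}^2$, $\eta=\eta_i+\eta_s$, and $\lim_{|X|\to\infty}\sqrt{|X|}(\partial_{|X|}-ik_i)\eta_s=0$ uniformly for $X/|X|\in S^1$. Measurements. $\mathcal{D}\subset\mathbb{R}^2$ is a bounded domain containing $\Omega$; $\varepsilon\in L^2(\mathcal{D})\cap L^\infty(\mathcal{D})$ is the (nonzero) noise; $\mathcal{M}=\eta|_{\mathcal{D}}$, $\mathcal{M}_\varepsilon = \eta|_{\mathcal{D}}+\varepsilon$. For $0<\gamma\le1$, $$\mathcal{D}_\gamma = \left\{X\in\mathcal{D} :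 \frac{|\mathcal{M}_\varepsilon(X)|}{\|\mathcal{M}_\varepsilon\|_\infty}\ge\gamma\right\}.$$ Truncated depth function. For $\alpha>0$ define $$d_\alpha(k)=\begin{cases}\dfrac{\tanh^{-1}(\mu/k)}{k}, & k\ge\mu+\alpha,\\[2mm] \dfrac{\tanh^{-1}(\mu/(\mu+\alpha))}{\mu+\alpha}, & k<\mu+\alpha.\end{cases}$$ $d_\alpha$ in the claim also denotes the function $X\mapsto d_\alpha(k(X))$. Reconstruction. Let $G_{k_i}(X,Y)=\frac{i}{4}H_0^{(1)}(k_i|X-Y|)$ ($H_0^{(1)}$ the Hankel function of the first kind and order $0$), $Ku(X)=\int_{\mathcal{D}}G_{k_i}(X,Y)u(Y)\,\mathrm{d}Y$ on $L^2(\mathcal{D})$, and $b_\varepsilon=\eta_i-\mathcal{M}_\varepsilon$. With $\delta=\|\mathcal{M}_\varepsilon-\mathcal{M}\|_{L^2(\mathcal{D})}$, let $u_\delta^\lambda$ be the Tikhonov-regularized solution $$u_\delta^\lambda=\operatorname{argmin}_{u\in L^2(\mathcal{D})}\ \|b_\varepsilon-k_i^2Ku\|_{L^2(\mathcal{D})}^2+\lambda\|u\|_{L^2(\mathcal{D})}^2 .$$ On $\mathcal{D}_\gamma$ set $q_\varepsilon=u_\delta^\lambda/\mathcal{M}_\varepsilon$, $k_\varepsilon=k_i\sqrt{|1-q_\varepsilon|}$, and $d_\alpha^\varepsilon=d_\alpha(k_\varepsilon)$.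
   Formalization: The topography h is assumed not identically zero (for h = 0 one has q = 0 and C = 0, and the claimed bound fails for generic noise); "δ_0 ≪ 1" is read as δ_0 ≤ δ_max, with δ_max depending only on ω, g, H_0, a, k_i and Ω. *)

theory Defs
  imports "HOL-Analysis.Analysis" "HOL-Probability.Essential_Supremum"
begin

section \<open>Partial derivatives and classes of smooth functions\<close>

definition pd :: "'n::finite \<Rightarrow> (real^'n \<Rightarrow> 'a::real_normed_vector) \<Rightarrow> real^'n \<Rightarrow> 'a" where
  "pd j f X = vector_derivative (\<lambda>t. f (X + t *\<^sub>R axis j 1)) (at 0)"

primrec pds :: "'n::finite list \<Rightarrow> (real^'n \<Rightarrow> 'a::real_normed_vector) \<Rightarrow> real^'n \<Rightarrow> 'a" where
  "pds [] f = f"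
| "pds (j # js) f = pd j (pds js f)"

(* Differentiability is demanded explicitly because vector_derivative is total
   and carries no information where the derivative does not exist. *)
definition Ck :: "nat \<Rightarrow> (real^'n::finite \<Rightarrow> 'a::real_normed_vector) \<Rightarrow> bool" where
  "Ck m f \<longleftrightarrow>
     (\<forall>js. length js < m \<longrightarrow> (pds js f) differentiable_on UNIV) \<and>
     (\<forall>js. length js \<le> m \<longrightarrow> continuous_on UNIV (pds js f))"

definition smooth :: "(real^'n::finite \<Rightarrow> 'a::real_normed_vector) \<Rightarrow> bool" where
  "smooth f \<longleftrightarrow> (\<forall>m. Ck m f)"

definition grad :: "(real^'n::finite \<Rightarrow> real) \<Rightarrow> real^'n \<Rightarrow> real^'n" where
  "grad f X = (\<chi> j. pd j f X)"

definition laplacian :: "(real^'n::finite \<Rightarrow> 'a::real_normed_vector) \<Rightarrow> real^'n \<Rightarrow> 'a" where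
  "laplacian f X = (\<Sum>j\<in>UNIV. pds [j, j] f X)"

definition support :: "('a::topological_space \<Rightarrow> 'b::zero) \<Rightarrow> 'a set" where
  "support f = closure {X. f X \<noteq> 0}"

text \<open>A connected compact set with smooth boundary: near every boundary point it is the
  sublevel set of a smooth function without critical point there.\<close>

definition smooth_compact_domain :: "(real^'n::finite) set \<Rightarrow> bool" where
  "smooth_compact_domain \<Omega> \<longleftrightarrow>
     compact \<Omega> \<and> connected \<Omega> \<and> \<Omega> \<noteq> {} \<and>
     (\<forall>p\<in>frontier \<Omega>. \<exists>U \<rho>. open U \<and> p \<in> U \<and> smooth \<rho> \<and> grad \<rho> p \<noteq> 0 \<and>
        \<Omega> \<inter> U = {X \<in> U. \<rho> X \<le> 0})"

section \<open>Lebesgue and Sobolev norms\<close>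

definition L2 :: "'a::euclidean_space set \<Rightarrow> ('a \<Rightarrow> 'b::euclidean_space) \<Rightarrow> bool" where
  "L2 D f \<longleftrightarrow> f \<in> borel_measurable (lebesgue_on D) \<and>
     integrable (lebesgue_on D) (\<lambda>X. (norm (f X))\<^sup>2)"

definition L2_norm :: "'a::euclidean_space set \<Rightarrow> ('a \<Rightarrow> 'b::euclidean_space) \<Rightarrow> real" where
  "L2_norm D f = sqrt (LINT X|lebesgue_on D. (norm (f X))\<^sup>2)"

definition Linf :: "'a::euclidean_space set \<Rightarrow> ('a \<Rightarrow> 'b::euclidean_space) \<Rightarrow> bool" where
  "Linf D f \<longleftrightarrow> f \<in> borel_measurable (lebesgue_on D) \<and>
     (\<exists>B. AE X in lebesgue_on D. norm (f X) \<le> B)"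

definition Linf_norm :: "'a::euclidean_space set \<Rightarrow> ('a \<Rightarrow> 'b::euclidean_space) \<Rightarrow> real" where
  "Linf_norm D f = real_of_ereal (esssup (lebesgue_on D) (\<lambda>X. ereal (norm (f X))))"

definition test_function :: "(real^'n::finite) set \<Rightarrow> (real^'n \<Rightarrow> real) \<Rightarrow> bool" where
  "test_function D \<phi> \<longleftrightarrow> smooth \<phi> \<and> compact (support \<phi>) \<and> support \<phi> \<subseteq> D"

definition weak_pds ::
  "(real^'n::finite) set \<Rightarrow> 'n list \<Rightarrow> (real^'n \<Rightarrow> 'a::euclidean_space) \<Rightarrow> (real^'n \<Rightarrow> 'a) \<Rightarrow> bool" where
  "weak_pds D js f v \<longleftrightarrow> L2 D f \<and> L2 D v \<and>
     (\<forall>\<phi>. test_function D \<phi> \<longrightarrow>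
        (LINT X|lebesgue_on D. pds js \<phi> X *\<^sub>R f X) =
        (-1) ^ length js *\<^sub>R (LINT X|lebesgue_on D. \<phi> X *\<^sub>R v X))"

text \<open>The norm of $H^2(D)$ for planar $D$: one term for each of the six multi-indices of order
  at most two. The weak derivatives are unique up to null sets, so the choice is immaterial.\<close>

definition H2_norm :: "(real^2) set \<Rightarrow> (real^2 \<Rightarrow> 'a::euclidean_space) \<Rightarrow> real" where
  "H2_norm D f = sqrt (\<Sum>js\<in>{[], [1], [2], [1, 1], [1, 2], [2, 2]}.
     (L2_norm D (SOME v. weak_pds D js f v))\<^sup>2)"

section \<open>The outgoing fundamental solution of the Helmholtz equation in the plane\<close>

text \<open>Power series of the Bessel functions of order 0 of the first and second kind,
  for real \<open>x > 0\<close>.\<close>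

definition bessel_J0 :: "real \<Rightarrow> real" where
  "bessel_J0 x = (\<Sum>m. (-1) ^ m * (x\<^sup>2 / 4) ^ m / (fact m)\<^sup>2)"

definition bessel_Y0 :: "real \<Rightarrow> real" where
  "bessel_Y0 x = 2 / pi * (ln (x / 2) + euler_mascheroni) * bessel_J0 x
     - 2 / pi * (\<Sum>m. (-1) ^ m * harm m * (x\<^sup>2 / 4) ^ m / (fact m)\<^sup>2)"

definition hankel_H0 :: "real \<Rightarrow> complex" where
  "hankel_H0 x = Complex (bessel_J0 x) (bessel_Y0 x)"

definition helmholtz_G :: "real \<Rightarrow> real^2 \<Rightarrow> real^2 \<Rightarrow> complex" where
  "helmholtz_G \<kappa> X Y = \<i> / 4 * hankel_H0 (\<kappa> * dist X Y)"

definition helmholtz_K :: "(real^2) set \<Rightarrow> real \<Rightarrow> (real^2 \<Rightarrow> complex) \<Rightarrow> real^2 \<Rightarrow> complex" where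
  "helmholtz_K D \<kappa> u X = (LINT Y|lebesgue_on D. helmholtz_G \<kappa> X Y * u Y)"

section \<open>The simplified mild-slope scattering problem\<close>

definition wavenumber :: "real \<Rightarrow> real \<Rightarrow> real \<Rightarrow> real" where
  "wavenumber \<omega> g d = (THE \<kappa>. \<kappa> > 0 \<and> \<omega>\<^sup>2 = g * \<kappa> * tanh (\<kappa> * d))"

definition incoming_wave :: "real \<Rightarrow> real^2 \<Rightarrow> real^2 \<Rightarrow> complex" where
  "incoming_wave a kvec X = of_real a * exp (\<i> * of_real (kvec \<bullet> X))"

text \<open>\<open>mild_topography\<close> concerns the depth \<open>d X = H0 - h X\<close>.\<close>

definition mild_topography ::
  "real \<Rightarrow> real \<Rightarrow> real \<Rightarrow> (real^2) set \<Rightarrow> real \<Rightarrow> (real^2 \<Rightarrow> real) \<Rightarrow> bool" where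
  "mild_topography \<omega> g H0 \<Omega> \<delta>0 h \<longleftrightarrow>
     Ck 2 h \<and> compact (support h) \<and> support h \<subseteq> \<Omega> \<and>
     (\<forall>X. H0 - h X > 0) \<and>
     (\<forall>X. norm (grad (\<lambda>Z. H0 - h Z) X) / (H0 - h X) \<le> \<delta>0 * wavenumber \<omega> g (H0 - h X))"

definition radial_deriv :: "(real^2 \<Rightarrow> complex) \<Rightarrow> real^2 \<Rightarrow> complex" where
  "radial_deriv f X = vector_derivative (\<lambda>t. f (X + t *\<^sub>R (X /\<^sub>R norm X))) (at 0)"

text \<open>A limit along \<open>at_infinity\<close> is a limit as \<open>norm X\<close> tends to infinity, uniformly in the
  direction of \<open>X\<close>.\<close>

definition sommerfeld :: "real \<Rightarrow> (real^2 \<Rightarrow> complex) \<Rightarrow> bool" where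
  "sommerfeld \<kappa> f \<longleftrightarrow>
     ((\<lambda>X. of_real (sqrt (norm X)) * (radial_deriv f X - \<i> * of_real \<kappa> * f X)) \<longlongrightarrow> 0) at_infinity"

definition total_field ::
  "(real^2 \<Rightarrow> real) \<Rightarrow> real \<Rightarrow> (real^2 \<Rightarrow> complex) \<Rightarrow> (real^2 \<Rightarrow> complex) \<Rightarrow> bool" where
  "total_field k ki \<eta>i \<eta> \<longleftrightarrow>
     Ck 2 \<eta> \<and> (\<forall>X. laplacian \<eta> X + of_real ((k X)\<^sup>2) * \<eta> X = 0) \<and>
     sommerfeld ki (\<lambda>X. \<eta> X - \<eta>i X)"

section \<open>Reconstruction\<close>

definition trunc_depth :: "real \<Rightarrow> real \<Rightarrow> real \<Rightarrow> real" where
  "trunc_depth \<mu> \<alpha> k =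
     (if k \<ge> \<mu> + \<alpha> then artanh (\<mu> / k) / k else artanh (\<mu> / (\<mu> + \<alpha>)) / (\<mu> + \<alpha>))"

definition superlevel :: "(real^2) set \<Rightarrow> (real^2 \<Rightarrow> complex) \<Rightarrow> real \<Rightarrow> (real^2) set" where
  "superlevel D M \<gamma> = {X \<in> D. norm (M X) / Linf_norm D M \<ge> \<gamma>}"

definition tikhonov ::
  "(real^2) set \<Rightarrow> real \<Rightarrow> (real^2 \<Rightarrow> complex) \<Rightarrow> real \<Rightarrow> (real^2 \<Rightarrow> complex) \<Rightarrow> bool" where
  "tikhonov D ki b lam u \<longleftrightarrow>
     is_arg_min (\<lambda>v. (L2_norm D (\<lambda>X. b X - of_real (ki\<^sup>2) * helmholtz_K D ki v X))\<^sup>2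
                      + lam * (L2_norm D v)\<^sup>2) (L2 D) u"

definition rec_wavenumber ::
  "real \<Rightarrow> (real^2 \<Rightarrow> complex) \<Rightarrow> (real^2 \<Rightarrow> complex) \<Rightarrow> real^2 \<Rightarrow> real" where
  "rec_wavenumber ki M u X = ki * sqrt (norm (1 - u X / M X))"

end

theory Submission
  imports Defs "HOL-Complex_Analysis.Complex_Analysis" "HOL-Real_Asymp.Real_Asymp"
begin

text \<open>By the mild-slope condition and the compact support of \<open>h\<close>, the contrast \<open>q\<close> is uniformly
  small. The scattered field is radiating, so by Rellich's argument it is the volume potential of
  \<open>k\<^sub>i\<^sup>2 q \<eta>\<close>; smallness of \<open>q\<close> then gives \<open>|\<eta>| \<ge> a/2\<close> everywhere, so dividing by the measured field
  is harmless wherever the noise is small, while the set where the noise is large contributes at most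
  a multiple of \<open>\<delta>\<^sup>2\<close> by Chebyshev. Since \<open>f = q \<eta>\<close> is twice continuously differentiable with compact
  support, \<open>f = K\<^sup>* w\<close> with \<open>w\<close> built from \<open>(\<Delta> + k\<^sub>i\<^sup>2) f\<close>; this is a source condition, under which
  Tikhonov regularization with \<open>\<lambda> = \<delta>\<close> converges at the rate \<open>\<surd>\<delta>\<close>. The truncated depth is bounded and
  Lipschitz with constants proportional to \<open>1 / (\<alpha> (\<alpha> + \<mu>))\<close>, and the constant in front is absorbed
  into \<open>C\<close> because the Sobolev norm of \<open>q \<eta>\<close> is positive.\<close>

section \<open>The Hankel function\<close>

text \<open>The Hankel function is given by power series, which describe it at the origin, whereas
  the radiation argument needs its decay and its outgoing derivative at infinity. A Laplace integral
  has the opposite strengths, so both are shown to solve Bessel's equation and are matched by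
  Wronskians at the origin. Surface integrals are avoided throughout: boundary terms are averaged
  over an annulus by a cutoff, so that every integration by parts reduces to the vanishing integral
  of a compactly supported derivative. The constant may depend on everything except the noise,
  \<alpha> and \<gamma>. Hence the squared error is first bounded by an explicit multiple of
  \<delta>, uniformly in these three, and only then is \<open>Ct\<close> chosen to fit the
  prescribed form of C. The slope threshold, in contrast, has to be fixed before the topography is,
  so smallness of the contrast must hold uniformly over all admissible \<open>h\<close>; this
  dictates the logarithmic variable in which the depth is followed. The choice \<lambda> = \<delta>
  balances the terms \<delta>^2/\<lambda> and \<lambda> of the Tikhonov estimate.\<close>

definition bes_c :: "nat \<Rightarrow> complex" where
  "bes_c m = (-1) ^ m / (fact m)\<^sup>2"

definition bes_h :: "nat \<Rightarrow> complex" where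
  "bes_h m = (-1) ^ m * harm m / (fact m)\<^sup>2"

lemma bes_c_Suc: "of_nat (Suc m) ^ 2 * bes_c (Suc m) = - bes_c m"
  unfolding bes_c_def fact_Suc by (simp add: power2_eq_square field_simps del: of_nat_Suc)

text \<open>The increment 1/(m+1) of the harmonic numbers disturbs the recurrence of
  \<open>bes_c\<close> by (m+1) c_(m+1), a coefficient of the derivative of the J0 series. This
  forcing is what the logarithm in Y0 compensates.\<close>

lemma bes_h_Suc: "of_nat (Suc m) ^ 2 * bes_h (Suc m) + bes_h m = of_nat (Suc m) * bes_c (Suc m)"
  unfolding bes_c_def bes_h_def fact_Suc harm_Suc
  by (simp add: power2_eq_square field_simps inverse_eq_divide del: of_nat_Suc)

lemma summable_bes_c: "summable (\<lambda>m. bes_c m * (z::complex) ^ m)"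
proof -
  have "summable (\<lambda>m. norm z ^ m / fact m)"
    using summable_exp[of "norm z"] by (simp add: field_simps)
  moreover have "norm (bes_c m * z ^ m) \<le> norm z ^ m / fact m" for m
  proof -
    have "(1::real) \<le> fact m" by simp
    then have "norm z ^ m \<le> norm z ^ m * fact m"
      by (metis mult.right_neutral mult_left_mono norm_ge_zero zero_le_power)
    then show ?thesis
      by (simp add: bes_c_def norm_mult norm_divide norm_power power2_eq_square field_simps)
  qed
  ultimately show ?thesis
    by (rule summable_comparison_test')
qed

lemma summable_bes_h: "summable (\<lambda>m. bes_h m * (z::complex) ^ m)"
proof -
  have "summable (\<lambda>m. norm z ^ m / fact m)"
    using summable_exp[of "norm z"] by (simp add: field_simps)
  moreover have "norm (bes_h m * z ^ m) \<le> norm z ^ m / fact m" for m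
  proof -
    have h: "harm m \<le> (fact m :: real)"
    proof (induction m)
      case (Suc m)
      have "inverse (real (Suc m)) \<le> 1" by (simp add: field_simps)
      moreover have "(m = 0) \<or> 1 \<le> real m * fact m"
        by (metis One_nat_def Suc_leI bot_nat_0.not_eq_extremum fact_ge_1 mult_le_one mult_mono
            mult.right_neutral of_nat_0_le_iff of_nat_1 of_nat_le_iff zero_le_one)
      ultimately have "harm m + inverse (real (Suc m)) \<le> (real m + 1) * fact m"
        using Suc by (cases "m = 0") (auto simp: algebra_simps harm_def)
      then show ?case by (simp add: harm_Suc algebra_simps)
    qed (simp add: harm_def)
    have nn: "norm (harm m :: complex) = harm m"
      using harm_nonneg[of m, where 'a = real]
      by (metis abs_of_nonneg norm_of_real of_real_harm)
    have "norm z ^ m * harm m \<le> norm z ^ m * fact m"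
      using h by (intro mult_left_mono) auto
    then show ?thesis
      by (simp add: bes_h_def norm_mult norm_divide norm_power power2_eq_square field_simps nn)
  qed
  ultimately show ?thesis
    by (rule summable_comparison_test')
qed

text \<open>In the variable \<open>z = x\<^sup>2 / 4\<close> Bessel's equation reads \<open>z P'' + P' + P = 0\<close>.\<close>

definition bes_P :: "nat \<Rightarrow> complex \<Rightarrow> complex" where
  "bes_P n z = (\<Sum>m. ((diffs ^^ n) bes_c) m * z ^ m)"

definition bes_Q :: "nat \<Rightarrow> complex \<Rightarrow> complex" where
  "bes_Q n z = (\<Sum>m. ((diffs ^^ n) bes_h) m * z ^ m)"

lemma summable_diffs_funpow:
  fixes c :: "nat \<Rightarrow> complex"
  assumes "\<And>z. summable (\<lambda>m. c m * z ^ m)"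
  shows "summable (\<lambda>m. ((diffs ^^ n) c) m * z ^ m)"
proof (induction n arbitrary: z)
  case (Suc n)
  then show ?case using termdiff_converges_all[of "(diffs ^^ n) c" z] by simp
qed (use assms in simp)

lemma has_field_derivative_bes_P: "(bes_P n has_field_derivative bes_P (Suc n) z) (at z)"
  unfolding bes_P_def using termdiffs_strong_converges_everywhere[OF summable_diffs_funpow[OF summable_bes_c]] by simp

lemma has_field_derivative_bes_Q: "(bes_Q n has_field_derivative bes_Q (Suc n) z) (at z)"
  unfolding bes_Q_def using termdiffs_strong_converges_everywhere[OF summable_diffs_funpow[OF summable_bes_h]] by simp

text \<open>Multiplying by \<open>z\<close> shifts the index by one; the new term at m = 0 vanishes
  through its factor m, so the series can start at 0 and be added to the others coefficientwise in
  the differential equations below.\<close>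

lemma suminf_z_diffs:
  fixes c :: "nat \<Rightarrow> complex"
  assumes "\<And>z. summable (\<lambda>m. c m * z ^ m)"
  shows "z * (\<Sum>m. ((diffs ^^ 2) c) m * z ^ m) = (\<Sum>m. of_nat (Suc m) * of_nat m * c (Suc m) * z ^ m)"
    and "summable (\<lambda>m. of_nat (Suc m) * of_nat m * c (Suc m) * z ^ m)"
proof -
  have s: "summable (\<lambda>m. ((diffs ^^ 2) c) m * z ^ m)"
    using summable_diffs_funpow[OF assms] .
  have "(\<lambda>m. z * (((diffs ^^ 2) c) m * z ^ m)) sums (z * (\<Sum>m. ((diffs ^^ 2) c) m * z ^ m))"
    using s by (intro sums_mult summable_sums)
  then have "(\<lambda>m. of_nat (Suc (Suc m)) * of_nat (Suc m) * c (Suc (Suc m)) * z ^ Suc m)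
      sums (z * (\<Sum>m. ((diffs ^^ 2) c) m * z ^ m))"
    by (rule sums_cong[THEN iffD1, rotated]) (simp add: diffs_def numeral_2_eq_2 algebra_simps)
  then have "(\<lambda>m. of_nat (Suc m) * of_nat m * c (Suc m) * z ^ m) sums (z * (\<Sum>m. ((diffs ^^ 2) c) m * z ^ m))"
    by (subst (asm) sums_Suc_iff) simp
  then show "z * (\<Sum>m. ((diffs ^^ 2) c) m * z ^ m) = (\<Sum>m. of_nat (Suc m) * of_nat m * c (Suc m) * z ^ m)"
    and "summable (\<lambda>m. of_nat (Suc m) * of_nat m * c (Suc m) * z ^ m)"
    by (auto simp: sums_iff)
qed

lemma bes_P_ode: "z * bes_P 2 z + bes_P 1 z + bes_P 0 z = 0"
proof -
  note s1 = suminf_z_diffs[OF summable_bes_c, of z]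
  have s2: "summable (\<lambda>m. diffs bes_c m * z ^ m)"
    using summable_diffs_funpow[OF summable_bes_c, of 1] by simp
  have "z * bes_P 2 z + bes_P 1 z + bes_P 0 z =
    (\<Sum>m. of_nat (Suc m) * of_nat m * bes_c (Suc m) * z ^ m + diffs bes_c m * z ^ m + bes_c m * z ^ m)"
    unfolding bes_P_def using s1 s2 summable_bes_c
    by (simp add: suminf_add[symmetric] summable_add)
  also have "(\<lambda>m. of_nat (Suc m) * of_nat m * bes_c (Suc m) * z ^ m + diffs bes_c m * z ^ m + bes_c m * z ^ m) = (\<lambda>m. 0)"
  proof
    fix m
    have "of_nat (Suc m) * of_nat m * bes_c (Suc m) + diffs bes_c m + bes_c m = of_nat (Suc m) ^ 2 * bes_c (Suc m) + bes_c m"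
      by (simp add: diffs_def algebra_simps power2_eq_square)
    also have "\<dots> = 0" by (simp only: bes_c_Suc) simp
    finally show "of_nat (Suc m) * of_nat m * bes_c (Suc m) * z ^ m + diffs bes_c m * z ^ m + bes_c m * z ^ m = 0"
      by (metis distrib_right mult_zero_left)
  qed
  finally show ?thesis by simp
qed

lemma bes_Q_ode: "z * bes_Q 2 z + bes_Q 1 z + bes_Q 0 z = bes_P 1 z"
proof -
  note s1 = suminf_z_diffs[OF summable_bes_h, of z]
  have s2: "summable (\<lambda>m. diffs bes_h m * z ^ m)"
    using summable_diffs_funpow[OF summable_bes_h, of 1] by simp
  have "z * bes_Q 2 z + bes_Q 1 z + bes_Q 0 z =
    (\<Sum>m. of_nat (Suc m) * of_nat m * bes_h (Suc m) * z ^ m + diffs bes_h m * z ^ m + bes_h m * z ^ m)"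
    unfolding bes_Q_def using s1 s2 summable_bes_h
    by (simp add: suminf_add[symmetric] summable_add)
  also have "(\<lambda>m. of_nat (Suc m) * of_nat m * bes_h (Suc m) * z ^ m + diffs bes_h m * z ^ m + bes_h m * z ^ m) 
    = (\<lambda>m. diffs bes_c m * z ^ m)"
  proof
    fix m
    have "of_nat (Suc m) * of_nat m * bes_h (Suc m) + diffs bes_h m + bes_h m = of_nat (Suc m) ^ 2 * bes_h (Suc m) + bes_h m"
      by (simp add: diffs_def algebra_simps power2_eq_square)
    also have "\<dots> = diffs bes_c m" by (simp only: bes_h_Suc) (simp add: diffs_def)
    finally show "of_nat (Suc m) * of_nat m * bes_h (Suc m) * z ^ m + diffs bes_h m * z ^ m + bes_h m * z ^ m = diffs bes_c m * z ^ m"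
      by (metis distrib_right)
  qed
  finally show ?thesis by (simp add: bes_P_def)
qed

lemma bes_P_0: "bes_P 0 0 = 1" "bes_P 0 (of_real (x\<^sup>2 / 4)) = of_real (bessel_J0 x)"
proof -
  show "bes_P 0 0 = 1"
    unfolding bes_P_def by (simp add: powser_zero) (simp add: bes_c_def)
  have "summable (\<lambda>m. (-1) ^ m * (x\<^sup>2 / 4) ^ m / (fact m)\<^sup>2)"
  proof -
    have "(\<lambda>m. bes_c m * of_real (x\<^sup>2/4) ^ m) = (\<lambda>m. of_real ((-1) ^ m * (x\<^sup>2 / 4) ^ m / (fact m)\<^sup>2))"
      by (auto simp: bes_c_def)
    then show ?thesis using summable_bes_c[of "of_real (x\<^sup>2/4)"] by (simp only: summable_complex_of_real)
  qed
  then show "bes_P 0 (of_real (x\<^sup>2 / 4)) = of_real (bessel_J0 x)"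
    unfolding bes_P_def bessel_J0_def by (subst suminf_of_real) (auto simp: bes_c_def)
qed

lemma bes_Q_0: "bes_Q 0 0 = 0"
    "bes_Q 0 (of_real (x\<^sup>2 / 4)) = of_real (\<Sum>m. (-1) ^ m * harm m * (x\<^sup>2 / 4) ^ m / (fact m)\<^sup>2)"
proof -
  show "bes_Q 0 0 = 0"
    unfolding bes_Q_def by (simp add: powser_zero) (simp add: bes_h_def harm_def)
  have "summable (\<lambda>m. (-1) ^ m * harm m * (x\<^sup>2 / 4) ^ m / (fact m)\<^sup>2)"
  proof -
    have "(\<lambda>m. bes_h m * of_real (x\<^sup>2/4) ^ m) = (\<lambda>m. of_real ((-1) ^ m * harm m * (x\<^sup>2 / 4) ^ m / (fact m)\<^sup>2))"
      by (auto simp: bes_h_def of_real_harm)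
    then show ?thesis using summable_bes_h[of "of_real (x\<^sup>2/4)"] by (simp only: summable_complex_of_real)
  qed
  then show "bes_Q 0 (of_real (x\<^sup>2 / 4)) = of_real (\<Sum>m. (-1) ^ m * harm m * (x\<^sup>2 / 4) ^ m / (fact m)\<^sup>2)"
    unfolding bes_Q_def by (subst suminf_of_real) (auto simp: bes_h_def of_real_harm)
qed

section \<open>The Laplace integral of the Hankel function\<close>

definition hk_c :: "real \<Rightarrow> complex" where
  "hk_c s = csqrt ((of_real s)\<^sup>2 - 2 * \<i>)"

lemma hk_c_sq: "(hk_c s)\<^sup>2 = (of_real s)\<^sup>2 - 2 * \<i>"
  by (simp add: hk_c_def)

text \<open>The constant imaginary part -2 keeps the radicand off the cut, which makes the principal
  root a smooth function of \<open>s\<close> on the whole line.\<close>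

lemma hk_arg_not_nonpos: "(of_real s)\<^sup>2 - 2 * \<i> \<notin> \<real>\<^sub>\<le>\<^sub>0"
  by (simp add: complex_nonpos_Reals_iff)

lemma hk_c_Re: "0 \<le> Re (hk_c s)"
  unfolding hk_c_def using Re_csqrt by simp

lemma hk_c_norm: "sqrt 2 \<le> norm (hk_c s)" "\<bar>s\<bar> \<le> norm (hk_c s)"
proof -
  have a: "(norm (hk_c s))\<^sup>2 = norm ((of_real s)\<^sup>2 - 2 * \<i>)"
    by (metis hk_c_sq norm_power)
  have "2 \<le> norm ((of_real s)\<^sup>2 - 2 * \<i>)"
    using abs_Im_le_cmod[of "(of_real s)\<^sup>2 - 2 * \<i>"] by simp
  then show "sqrt 2 \<le> norm (hk_c s)" 
    using a by (metis norm_ge_zero real_le_lsqrt real_sqrt_le_iff real_sqrt_unique)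
  have "s\<^sup>2 \<le> norm ((of_real s)\<^sup>2 - 2 * \<i>)"
    using abs_Re_le_cmod[of "(of_real s)\<^sup>2 - 2 * \<i>"] by simp
  then show "\<bar>s\<bar> \<le> norm (hk_c s)"
    using a by (metis norm_ge_zero power2_abs power_mono_iff abs_ge_zero zero_less_numeral)
qed

lemma hk_c_nz [simp]: "hk_c s \<noteq> 0"
  using hk_c_norm(1)[of s] by auto

lemma hk_c_inv_norm: "1 / norm (hk_c s) \<le> 1"
proof -
  have "1 \<le> norm (hk_c s)" using hk_c_norm(1)[of s] 
    by (meson less_eq_real_def order_trans real_sqrt_ge_one one_le_numeral)
  then show ?thesis by (simp add: field_simps)
qed

lemma has_vector_derivative_hk_c:
  "(hk_c has_vector_derivative (of_real s / hk_c s)) (at s within A)"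
proof -
  have "((\<lambda>z. csqrt (z\<^sup>2 - 2 * \<i>)) has_field_derivative (of_real s / hk_c s)) (at (of_real s))"
    using hk_arg_not_nonpos[of s]
    by (auto intro!: derivative_eq_intros has_field_derivative_csqrt DERIV_chain2[of csqrt]
       simp: hk_c_def divide_simps)
  from has_vector_derivative_real_field[OF this] show ?thesis
    unfolding hk_c_def by simp
qed

lemma continuous_on_hk_c [continuous_intros]:
  "continuous_on A f \<Longrightarrow> continuous_on A (\<lambda>x. hk_c (f x))"
proof -
  have "continuous_on UNIV hk_c"
    by (metis (full_types) continuous_on_eq_continuous_within has_vector_derivative_continuous has_vector_derivative_hk_c)
  then show "continuous_on A f \<Longrightarrow> continuous_on A (\<lambda>x. hk_c (f x))"
    by (rule continuous_on_compose2) auto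
qed

text \<open>The prefactor e^(ix) and the exponential e^(-xt) of the Laplace integral combine to
  e^(-x(t-i)), here with t = s^2. The same substitution removes the endpoint singularity t^(-1/2),
  since dt = 2 s ds.\<close>

definition hk_p :: "real \<Rightarrow> complex" where "hk_p s = (of_real s)\<^sup>2 - \<i>"

text \<open>With \<open>t = s\<^sup>2\<close> the Laplace integral of the Hankel function reads
  \<open>\<pi>\<i>/2 H\<^sub>0(x) = e\<^bsup>ix\<^esup> \<integral> e\<^bsup>-xt\<^esup> (t\<^sup>2 - 2it)\<^bsup>-1/2\<^esup> dt = \<integral> hk_F 0 x s ds\<close> over the positive
  half-line; \<open>hk_F k\<close> is the \<open>k\<close>-th derivative of the integrand in \<open>x\<close>.\<close>

definition hk_F :: "nat \<Rightarrow> complex \<Rightarrow> real \<Rightarrow> complex" where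
  "hk_F k x s = 2 * (- hk_p s) ^ k * exp (- (x * hk_p s)) / hk_c s"

lemma continuous_on_hk_F [continuous_intros]:
  "continuous_on A f \<Longrightarrow> continuous_on A g \<Longrightarrow> continuous_on A (\<lambda>x. hk_F k (g x) (f x))"
  unfolding hk_F_def hk_p_def by (intro continuous_intros) auto

lemma hk_F_norm:
  "norm (hk_F k x s) = 2 * norm (hk_p s) ^ k * exp (- (Re x * s\<^sup>2) - Im x) / norm (hk_c s)"
proof -
  have "Re (x * hk_p s) = Re x * s\<^sup>2 + Im x"
    by (simp add: hk_p_def power2_eq_square algebra_simps)
  then show ?thesis
    by (simp add: hk_F_def norm_mult norm_divide norm_power)
qed

text \<open>A summable tail, uniform in \<open>x\<close> on a region bounded away from the imaginary
  axis, as needed for the Weierstrass test. Orders 0 and 1 suffice because the limit of order 2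
  comes out of the theorem on derivatives of locally uniform limits.\<close>

lemma hk_F_bound:
  assumes "k \<le> 1" "1 \<le> s" "0 < c" "c \<le> Re x" "- Im x \<le> b"
  shows "norm (hk_F k x s) \<le> (2 * exp b * 4 / c\<^sup>2) / s\<^sup>2"
proof -
  have s2: "1 \<le> s\<^sup>2" using assms by simp
  have "norm (hk_p s) \<le> norm ((of_real s)\<^sup>2::complex) + norm \<i>"
    unfolding hk_p_def by (rule norm_triangle_ineq4)
  then have p: "norm (hk_p s) \<le> 2 * s\<^sup>2"
    using s2 by (simp add: norm_power)
  have pk: "norm (hk_p s) ^ k \<le> 2 * s\<^sup>2"
    using assms(1) p s2 by (cases k) auto
  \<comment> \<open>Taken at y = c s^2, this trades the exponential for s^(-4), which leaves s^(-2)
    after the factor s^2 coming from \<open>hk_p\<close>.\<close>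
  have y: "y\<^sup>2 * exp (-y) \<le> 2" if "0 \<le> y" for y :: real
  proof -
    have "y\<^sup>2 \<le> 2 * exp y"
      using exp_lower_Taylor_quadratic[OF that] that by simp
    then show ?thesis by (simp add: exp_minus field_simps)
  qed
  have "s\<^sup>2 * exp (- (c * s\<^sup>2)) = ((c * s\<^sup>2)\<^sup>2 * exp (- (c * s\<^sup>2))) / (c\<^sup>2 * s\<^sup>2)"
    using assms s2 by (simp add: field_simps power2_eq_square)
  also have "\<dots> \<le> 2 / (c\<^sup>2 * s\<^sup>2)"
    using y[of "c * s\<^sup>2"] assms by (intro divide_right_mono) auto
  finally have e: "s\<^sup>2 * exp (- (c * s\<^sup>2)) \<le> 2 / (c\<^sup>2 * s\<^sup>2)" .
  have "exp (- (Re x * s\<^sup>2) - Im x) \<le> exp (- (c * s\<^sup>2) + b)"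
    unfolding exp_le_cancel_iff using mult_right_mono[OF \<open>c \<le> Re x\<close>, of "s\<^sup>2"] assms(5) zero_le_power2[of s] by linarith
  then have ex: "exp (- (Re x * s\<^sup>2) - Im x) \<le> exp (- (c * s\<^sup>2)) * exp b"
    by (simp add: mult_exp_exp)
  have "norm (hk_F k x s) = 2 * (norm (hk_p s) ^ k) * exp (- (Re x * s\<^sup>2) - Im x) * (1 / norm (hk_c s))"
    by (simp add: hk_F_norm)
  also have "\<dots> \<le> 2 * (norm (hk_p s) ^ k) * exp (- (Re x * s\<^sup>2) - Im x)"
    using hk_c_inv_norm[of s] by (intro mult_left_le) auto
  also have "\<dots> \<le> 2 * (2 * s\<^sup>2) * (exp (- (c * s\<^sup>2)) * exp b)"
    using pk ex by (intro mult_mono mult_nonneg_nonneg) auto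
  also have "\<dots> = 4 * exp b * (s\<^sup>2 * exp (- (c * s\<^sup>2)))" by simp
  also have "\<dots> \<le> 4 * exp b * (2 / (c\<^sup>2 * s\<^sup>2))"
    using e by (intro mult_left_mono) auto
  finally show ?thesis by (simp add: field_simps)
qed

lemma has_field_derivative_hk_F:
  "((\<lambda>x. hk_F k x s) has_field_derivative hk_F (Suc k) x s) (at x within A)"
  unfolding hk_F_def by (auto intro!: derivative_eq_intros simp: field_simps)

lemma has_field_derivative_hk_I:
  "((\<lambda>x. integral {a..b} (hk_F k x)) has_field_derivative integral {a..b} (hk_F (Suc k) x0)) (at x0)"
proof -
  have "((\<lambda>x. integral (cbox a b) (hk_F k x)) has_field_derivative integral (cbox a b) (hk_F (Suc k) x0)) (at x0 within UNIV)"
    by (rule leibniz_rule_field_derivative)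
      (auto intro!: has_field_derivative_hk_F integrable_continuous_interval continuous_intros
        simp: split_beta)
  then show ?thesis by simp
qed

definition hk_I :: "nat \<Rightarrow> nat \<Rightarrow> complex \<Rightarrow> complex" where
  "hk_I k N x = integral {0..real N} (hk_F k x)"

lemma hk_I_sum: "hk_I k N x = (\<Sum>n<N. integral {real n..real n + 1} (hk_F k x))"
proof (induction N)
  case (Suc N)
  have "integral {0..real N} (hk_F k x) + integral {real N..real N + 1} (hk_F k x)
      = integral {0..real N + 1} (hk_F k x)"
    by (rule Henstock_Kurzweil_Integration.integral_combine)
      (auto intro!: integrable_continuous_interval continuous_intros)
  then show ?case using Suc by (simp add: hk_I_def add.commute)
qed (simp add: hk_I_def)

text \<open>Cutting the half-line into unit intervals turns the improper integral into a series of
  holomorphic functions.\<close>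

definition hk_Phi :: "nat \<Rightarrow> complex \<Rightarrow> complex" where
  "hk_Phi k x = (\<Sum>n. integral {real n..real n + 1} (hk_F k x))"

lemma hk_I_uniform_limit:
  assumes "k \<le> 1" "0 < Re x0"
  shows "\<exists>d. 0 < d \<and> cball x0 d \<subseteq> {z. 0 < Re z} \<and>
    uniform_limit (cball x0 d) (hk_I k) (hk_Phi k) sequentially"
proof -
  define c where "c = Re x0 / 2"
  define b where "b = \<bar>Im x0\<bar> + c"
  have c0: "0 < c" using assms by (simp add: c_def)
  have inb: "c \<le> Re x" "- Im x \<le> b" if "x \<in> cball x0 c" for x
  proof -
    have "norm (x - x0) \<le> c" using that by (simp add: dist_norm norm_minus_commute)
    then have "\<bar>Re (x - x0)\<bar> \<le> c" "\<bar>Im (x - x0)\<bar> \<le> c"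
      using abs_Re_le_cmod abs_Im_le_cmod order_trans by blast+
    then show "c \<le> Re x" "- Im x \<le> b" unfolding c_def b_def minus_complex.sel by linarith+
  qed
  define M where "M = (\<lambda>n. (2 * exp b * 4 / c\<^sup>2) / (real n)\<^sup>2)"
  have sM: "summable M"
    unfolding M_def
    using summable_mult[OF inverse_power_summable[of 2, where 'a = real], of "2 * exp b * 4 / c\<^sup>2"]
    by (simp add: field_simps)
  have le: "norm (integral {real n..real n + 1} (hk_F k x)) \<le> M n" if "n \<ge> 1" "x \<in> cball x0 c" for n x
  proof -
    have "norm (hk_F k x s) \<le> M n" if s: "s \<in> {real n..real n + 1}" for s
    proof -
      have "norm (hk_F k x s) \<le> (2 * exp b * 4 / c\<^sup>2) / s\<^sup>2"
        using s \<open>n \<ge> 1\<close> inb[OF \<open>x \<in> cball x0 c\<close>] c0 assms(1)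
        by (intro hk_F_bound) auto
      also have "\<dots> \<le> M n"
        unfolding M_def using s \<open>n \<ge> 1\<close> c0
        by (intro divide_left_mono power_mono) auto
      finally show ?thesis .
    qed
    then have "norm (integral {real n..real n + 1} (hk_F k x)) \<le> M n * (real n + 1 - real n)"
      by (intro integral_bound) (auto intro!: continuous_intros)
    then show ?thesis by simp
  qed
  \<comment> \<open>The majorant says nothing about the first interval, since \<open>M 0\<close> is
    a division by zero and hence 0; the eventual form of the test skips it.\<close>
  have "uniform_limit (cball x0 c) (\<lambda>N x. \<Sum>n<N. integral {real n..real n + 1} (hk_F k x))
    (\<lambda>x. \<Sum>n. integral {real n..real n + 1} (hk_F k x)) sequentially"
    by (rule Weierstrass_m_test_ev[OF _ sM])
      (use le in \<open>auto simp: eventually_sequentially intro!: exI[of _ 1]\<close>)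
  moreover have "cball x0 c \<subseteq> {z. 0 < Re z}"
    using inb c0 by fastforce
  ultimately show ?thesis
    using c0 by (intro exI[of _ c]) (auto simp: hk_I_sum[abs_def] hk_Phi_def[abs_def])
qed

lemma hk_I_tendsto:
  assumes "k \<le> 1" "0 < Re x"
  shows "(\<lambda>N. hk_I k N x) \<longlonglongrightarrow> hk_Phi k x"
  using hk_I_uniform_limit[OF assms] tendsto_uniform_limitI
  by (metis centre_in_cball less_imp_le)

text \<open>Locally uniform convergence of holomorphic functions passes to their derivatives.
  Besides differentiability this yields convergence of \<open>hk_I (Suc k)\<close>, and for k = 1
  that is the second derivative, for which there is no tail bound.\<close>

lemma hk_Phi_deriv_ex:
  assumes "k \<le> 1"
  shows "\<exists>g'. \<forall>x\<in>{z. 0 < Re z}. (hk_Phi k has_field_derivative g' x) (at x) \<and> (\<lambda>N. hk_I (Suc k) N x) \<longlonglongrightarrow> g' x"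
proof (rule has_complex_derivative_uniform_sequence[where f = "hk_I k"])
  show "open {z. 0 < Re z}" by (rule open_halfspace_Re_gt)
  show "(hk_I k n has_field_derivative hk_I (Suc k) n x) (at x)" for n x
    unfolding hk_I_def[abs_def] by (rule has_field_derivative_hk_I)
qed (use hk_I_uniform_limit[OF assms] in auto)

lemma hk_Phi_deriv:
  assumes "0 < Re x"
  shows "(hk_Phi 0 has_field_derivative hk_Phi 1 x) (at x)"
  using hk_Phi_deriv_ex[of 0] hk_I_tendsto[of 1 x] assms 
  by (metis LIMSEQ_unique One_nat_def le_refl less_eq_nat.simps(1) mem_Collect_eq)

text \<open>Bessel's operator in \<open>x\<close>, applied to the integrand, gives an exact
  derivative in \<open>s\<close>. Behind this are the identities p^2 + 1 = s^2 c^2 and s^2 + c^2 = 2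
  p for p = \<open>hk_p s\<close> and c = \<open>hk_c s\<close>.\<close>

lemma hk_ode_antiderivative:
  "((\<lambda>s. - (of_real s * hk_c s * exp (- (x * hk_p s)))) has_vector_derivative
     (x * hk_F 2 x s + hk_F 1 x s + x * hk_F 0 x s)) (at s within A)"
proof -
  have p: "(hk_p has_vector_derivative (2 * of_real s)) (at s within A)"
  proof -
    have "((\<lambda>z. z\<^sup>2 - \<i>) has_field_derivative (2 * of_real s)) (at (of_real s))"
      by (auto intro!: derivative_eq_intros)
    from has_vector_derivative_real_field[OF this] show ?thesis
      unfolding hk_p_def by simp
  qed
  have e: "((\<lambda>s. exp (- (x * hk_p s))) has_vector_derivative (- (x * (2 * of_real s)) * exp (- (x * hk_p s)))) (at s within A)"
  proof -
    have "((\<lambda>s. - (x * hk_p s)) has_vector_derivative - (x * (2 * of_real s))) (at s within A)"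
      by (auto intro!: derivative_eq_intros p)
    moreover have "(exp has_field_derivative exp (- (x * hk_p s))) (at (- (x * hk_p s)) within ((\<lambda>s. - (x * hk_p s)) ` A))"
      by (auto intro!: derivative_eq_intros)
    ultimately show ?thesis
      using field_vector_diff_chain_within[of "\<lambda>s. - (x * hk_p s)" "- (x * (2 * of_real s))" s A exp "exp (- (x * hk_p s))"]
      by (simp add: o_def)
  qed
  have sc: "((\<lambda>s. of_real s * hk_c s) has_vector_derivative (of_real s * (of_real s / hk_c s) + 1 * hk_c s)) (at s within A)"
    by (rule has_vector_derivative_mult[OF _ has_vector_derivative_hk_c])
       (auto intro!: derivative_eq_intros)
  have "((\<lambda>s. - (of_real s * hk_c s * exp (- (x * hk_p s)))) has_vector_derivative
    - (of_real s * hk_c s * (- (x * (2 * of_real s)) * exp (- (x * hk_p s)))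
       + (of_real s * (of_real s / hk_c s) + 1 * hk_c s) * exp (- (x * hk_p s)))) (at s within A)"
    by (intro has_vector_derivative_minus has_vector_derivative_mult sc e)
  moreover have "- (of_real s * hk_c s * (- (x * (2 * of_real s)) * exp (- (x * hk_p s)))
       + (of_real s * (of_real s / hk_c s) + 1 * hk_c s) * exp (- (x * hk_p s)))
     = x * hk_F 2 x s + hk_F 1 x s + x * hk_F 0 x s"
  proof -
    have "- (of_real s * hk_c s * (- (x * (2 * of_real s)) * exp (- (x * hk_p s)))
       + (of_real s * (of_real s / hk_c s) + 1 * hk_c s) * exp (- (x * hk_p s)))
      = exp (- (x * hk_p s)) * (2 * x * (of_real s)\<^sup>2 * (hk_c s)\<^sup>2 - (of_real s)\<^sup>2 - (hk_c s)\<^sup>2) / hk_c s"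
      by (simp add: field_simps power2_eq_square)
    also have "\<dots> = exp (- (x * hk_p s)) * (2 * x * (hk_p s)\<^sup>2 - 2 * hk_p s + 2 * x) / hk_c s"
      unfolding hk_c_sq hk_p_def by (simp add: algebra_simps power2_eq_square)
    also have "\<dots> = x * hk_F 2 x s + hk_F 1 x s + x * hk_F 0 x s"
      unfolding hk_F_def by (simp add: field_simps power2_eq_square)
    finally show ?thesis .
  qed
  ultimately show ?thesis by simp
qed

text \<open>The antiderivative carries the factor \<open>s\<close>, so nothing remains at the lower
  end; the boundary term at N is killed by its Gaussian factor in the limit.\<close>

lemma hk_I_ode:
  "x * hk_I 2 N x + hk_I 1 N x + x * hk_I 0 N x = - (of_nat N * hk_c (real N) * exp (- (x * hk_p (real N))))"
proof -
  have "((\<lambda>s. x * hk_F 2 x s + hk_F 1 x s + x * hk_F 0 x s) has_integral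
     (- (of_real (real N) * hk_c (real N) * exp (- (x * hk_p (real N)))) - - (of_real 0 * hk_c 0 * exp (- (x * hk_p 0))))) {0..real N}"
    by (rule fundamental_theorem_of_calculus) (auto intro: hk_ode_antiderivative simp del: One_nat_def)
  moreover have "((\<lambda>s. x * hk_F 2 x s + hk_F 1 x s + x * hk_F 0 x s) has_integral
    (x * hk_I 2 N x + hk_I 1 N x + x * hk_I 0 N x)) {0..real N}"
    unfolding hk_I_def
    by (intro has_integral_add has_integral_mult_right integrable_integral integrable_continuous_interval continuous_intros)
  ultimately show ?thesis
    by (metis (no_types, lifting) has_integral_unique mult_zero_left of_real_0 minus_zero diff_zero of_real_of_nat_eq)
qed

lemma hk_boundary_tendsto:
  assumes "0 < Re x"
  shows "(\<lambda>N. - (of_nat N * hk_c (real N) * exp (- (x * hk_p (real N))))) \<longlonglongrightarrow> 0"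
proof (rule Lim_null_comparison)
  have "norm (hk_c s) \<le> s + 2" if "0 \<le> s" for s
  proof -
    have "(norm (hk_c s))\<^sup>2 = norm ((of_real s)\<^sup>2 - 2 * \<i>)"
      by (metis hk_c_sq norm_power)
    also have "\<dots> \<le> norm ((of_real s)\<^sup>2::complex) + norm (2 * \<i>)" by (rule norm_triangle_ineq4)
    also have "\<dots> = s\<^sup>2 + 2" by (simp add: norm_power norm_mult)
    also have "\<dots> \<le> (s + 2)\<^sup>2" using that by (simp add: power2_eq_square algebra_simps)
    finally show ?thesis using that by (meson add_nonneg_nonneg power2_le_imp_le zero_le_numeral)
  qed
  then have b: "norm (hk_c (real N)) \<le> real N + 2" for N by simp
  have e: "norm (exp (- (x * hk_p (real N)))) = exp (- (Re x * (real N)\<^sup>2) - Im x)" for N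
    by (simp add: hk_p_def power2_eq_square algebra_simps)
  show "\<forall>\<^sub>F N in sequentially. norm (- (of_nat N * hk_c (real N) * exp (- (x * hk_p (real N)))))
     \<le> real N * (real N + 2) * exp (- (Re x * (real N)\<^sup>2) - Im x)"
    unfolding norm_minus_cancel norm_mult e norm_of_nat
    by (intro always_eventually allI mult_right_mono mult_left_mono b) auto
  show "(\<lambda>N. real N * (real N + 2) * exp (- (Re x * (real N)\<^sup>2) - Im x)) \<longlonglongrightarrow> 0"
    using assms by real_asymp
qed

lemma hk_Phi_ode:
  assumes "0 < Re x"
  obtains d2 where "(hk_Phi 1 has_field_derivative d2) (at x)" "x * d2 + hk_Phi 1 x + x * hk_Phi 0 x = 0"
proof -
  obtain d2 where d2: "(hk_Phi 1 has_field_derivative d2) (at x)" "(\<lambda>N. hk_I 2 N x) \<longlonglongrightarrow> d2"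
    using hk_Phi_deriv_ex[of 1] assms by (auto simp: numeral_2_eq_2)
  have "(\<lambda>N. x * hk_I 2 N x + hk_I 1 N x + x * hk_I 0 N x) \<longlonglongrightarrow> x * d2 + hk_Phi 1 x + x * hk_Phi 0 x"
    by (intro tendsto_intros d2 hk_I_tendsto assms) auto
  then have "x * d2 + hk_Phi 1 x + x * hk_Phi 0 x = 0"
    unfolding hk_I_ode using hk_boundary_tendsto[OF assms] LIMSEQ_unique by blast
  with d2 that show ?thesis by blast
qed

section \<open>Decay and outgoing behaviour at infinity\<close>

lemma integral_inverse_quadratic_le:
  fixes x N :: real
  assumes "0 < x" "0 \<le> N"
  shows "(\<lambda>s. 1 / (1 + x * s\<^sup>2)) integrable_on {0..N}" "integral {0..N} (\<lambda>s. 1 / (1 + x * s\<^sup>2)) \<le> pi / (2 * sqrt x)"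
proof -
  have nz: "1 + x * s\<^sup>2 \<noteq> 0" for s :: real
    using assms by (metis add_nonneg_eq_0_iff less_imp_le mult_nonneg_nonneg zero_le_one zero_le_power2 zero_neq_one)
  have "((\<lambda>s. 1 / (1 + x * s\<^sup>2)) has_integral (arctan (sqrt x * N) / sqrt x - arctan (sqrt x * 0) / sqrt x)) {0..N}"
  proof (rule fundamental_theorem_of_calculus)
    fix s :: real
    have "((\<lambda>s. arctan (sqrt x * s) / sqrt x) has_real_derivative (1 / (1 + x * s\<^sup>2))) (at s within {0..N})"
      using assms nz[of s] by (auto intro!: derivative_eq_intros simp: power_mult_distrib inverse_eq_divide)
    then show "((\<lambda>s. arctan (sqrt x * s) / sqrt x) has_vector_derivative (1 / (1 + x * s\<^sup>2))) (at s within {0..N})"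
      by (rule has_real_derivative_iff_has_vector_derivative[THEN iffD1])
  qed (use assms in auto)
  then show "(\<lambda>s. 1 / (1 + x * s\<^sup>2)) integrable_on {0..N}" "integral {0..N} (\<lambda>s. 1 / (1 + x * s\<^sup>2)) \<le> pi / (2 * sqrt x)"
    using arctan_ubound[of "sqrt x * N"] assms
    by (auto simp: has_integral_iff field_simps)
qed

lemma exp_neg_le: "0 \<le> y \<Longrightarrow> exp (- y) \<le> 1 / (1 + y)" for y :: real
  using exp_ge_add_one_self[of y] by (simp add: exp_minus field_simps)

lemma y_exp_neg_le: "y * exp (- y) \<le> 2 / (1 + y)" if "0 \<le> y" for y :: real
proof -
  have "y * (1 + y) \<le> 2 * exp y"
    using exp_lower_Taylor_quadratic[OF that] that by (simp add: power2_eq_square algebra_simps)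
  then show ?thesis using that by (simp add: exp_minus field_simps)
qed

text \<open>Replacing the Gaussian e^(-x s^2) by 1/(1 + x s^2) makes the integral an arctangent of
  size x^(-1/2), uniformly in \<open>N\<close>. In the second estimate, differentiation brings down
  the factor -(s^2 - i); subtracting i times the function leaves s^2, which is worth another factor
  1/x. This gain is the radiation condition.\<close>

lemma hk_I_norm_le:
  assumes "0 < x"
  shows "norm (hk_I 0 N (of_real x)) \<le> pi / sqrt x"
    and "norm (hk_I 1 N (of_real x) - \<i> * hk_I 0 N (of_real x)) \<le> 2 * pi / (x * sqrt x)"
proof -
  have F0: "norm (hk_F 0 (of_real x) s) \<le> 2 * exp (- (x * s\<^sup>2))" for s
  proof -
    have "norm (hk_F 0 (of_real x) s) = (2 * exp (- (x * s\<^sup>2))) * (1 / norm (hk_c s))"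
      by (simp add: hk_F_norm)
    also have "\<dots> \<le> 2 * exp (- (x * s\<^sup>2))"
      using hk_c_inv_norm[of s] by (intro mult_left_le) auto
    finally show ?thesis .
  qed
  have xs: "0 \<le> x * s\<^sup>2" for s using assms by simp
  note int = integral_inverse_quadratic_le[OF assms, of "real N"]
  have i2: "(\<lambda>s. c * (1 / (1 + x * s\<^sup>2))) integrable_on {0..real N}" for c
    using integrable_cmul[OF int(1), of c] by simp
  have "norm (hk_I 0 N (of_real x)) \<le> integral {0..real N} (\<lambda>s. 2 * (1 / (1 + x * s\<^sup>2)))"
    unfolding hk_I_def
  proof (rule integral_norm_bound_integral)
    fix s
    show "norm (hk_F 0 (of_real x) s) \<le> 2 * (1 / (1 + x * s\<^sup>2))"
      using F0[of s] exp_neg_le[OF xs[of s]] by linarith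
  qed (intro i2 integrable_continuous_interval continuous_intros; simp)+
  also have "\<dots> = 2 * integral {0..real N} (\<lambda>s. 1 / (1 + x * s\<^sup>2))" by (rule integral_mult_right)
  finally show "norm (hk_I 0 N (of_real x)) \<le> pi / sqrt x"
    using int by simp
  have "hk_I 1 N (of_real x) - \<i> * hk_I 0 N (of_real x)
     = integral {0..real N} (\<lambda>s. hk_F 1 (of_real x) s - \<i> * hk_F 0 (of_real x) s)"
    unfolding hk_I_def
    by (subst Henstock_Kurzweil_Integration.integral_diff)
      (auto intro!: integrable_continuous_interval continuous_intros)
  also have "(\<lambda>s. hk_F 1 (of_real x) s - \<i> * hk_F 0 (of_real x) s) = (\<lambda>s. - (of_real (s\<^sup>2) * hk_F 0 (of_real x) s))"
    by (rule ext) (simp add: hk_F_def hk_p_def field_simps)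
  finally have eq: "hk_I 1 N (of_real x) - \<i> * hk_I 0 N (of_real x) =
    integral {0..real N} (\<lambda>s. - (of_real (s\<^sup>2) * hk_F 0 (of_real x) s))" .
  have "norm (hk_I 1 N (of_real x) - \<i> * hk_I 0 N (of_real x)) \<le> integral {0..real N} (\<lambda>s. (4 / x) * (1 / (1 + x * s\<^sup>2)))"
    unfolding eq
  proof (rule integral_norm_bound_integral)
    fix s
    have "norm (- (of_real (s\<^sup>2) * hk_F 0 (of_real x) s)) = s\<^sup>2 * norm (hk_F 0 (of_real x) s)"
      by (simp add: norm_mult norm_power)
    also have "\<dots> \<le> s\<^sup>2 * (2 * exp (- (x * s\<^sup>2)))"
      by (rule mult_left_mono[OF F0]) simp
    also have "\<dots> = (2 / x) * (x * s\<^sup>2 * exp (- (x * s\<^sup>2)))" using assms by simp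
    also have "\<dots> \<le> (2 / x) * (2 / (1 + x * s\<^sup>2))"
      by (rule mult_left_mono[OF y_exp_neg_le[OF xs]]) (use assms in auto)
    finally show "norm (- (of_real (s\<^sup>2) * hk_F 0 (of_real x) s)) \<le> (4 / x) * (1 / (1 + x * s\<^sup>2))" by simp
  qed (intro i2 integrable_continuous_interval continuous_intros; simp)+
  also have "\<dots> = (4 / x) * integral {0..real N} (\<lambda>s. 1 / (1 + x * s\<^sup>2))" by (rule integral_mult_right)
  also have "\<dots> \<le> (4 / x) * (pi / (2 * sqrt x))"
    using int assms by (intro mult_left_mono) auto
  finally show "norm (hk_I 1 N (of_real x) - \<i> * hk_I 0 N (of_real x)) \<le> 2 * pi / (x * sqrt x)"
    by (simp add: field_simps)
qed

lemma hk_Phi_norm_le: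
  assumes "0 < x"
  shows "norm (hk_Phi 0 (of_real x)) \<le> pi / sqrt x"
    and "norm (hk_Phi 1 (of_real x) - \<i> * hk_Phi 0 (of_real x)) \<le> 2 * pi / (x * sqrt x)"
proof -
  have l: "(\<lambda>N. hk_I 0 N (of_real x)) \<longlonglongrightarrow> hk_Phi 0 (of_real x)"
     "(\<lambda>N. hk_I 1 N (of_real x)) \<longlonglongrightarrow> hk_Phi 1 (of_real x)"
    using assms by (auto intro!: hk_I_tendsto simp del: One_nat_def)
  show "norm (hk_Phi 0 (of_real x)) \<le> pi / sqrt x"
    by (rule Lim_norm_ubound[OF _ l(1)]) (use hk_I_norm_le[OF assms] in auto)
  show "norm (hk_Phi 1 (of_real x) - \<i> * hk_Phi 0 (of_real x)) \<le> 2 * pi / (x * sqrt x)"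
    by (rule Lim_norm_ubound[OF _ tendsto_diff[OF l(2) tendsto_mult_left[OF l(1)]]])
      (use hk_I_norm_le[OF assms] in \<open>auto simp del: One_nat_def\<close>)
qed

section \<open>Logarithmic behaviour at the origin\<close>

lemma exp_ln_integral:
  "(\<lambda>t::real. exp (- t) * ln t) absolutely_integrable_on {0..}" (is ?A)
  "integral {0..} (\<lambda>t::real. exp (- t) * ln t) = - euler_mascheroni"
proof -
  define f where "f = (\<lambda>t::real. exp (- t) * ln t)"
  \<comment> \<open>The inequality ln v <= v - 1 at v = t^h and at v = t^(-h) squeezes ln t between
    two difference quotients of t^h in the exponent h. Integrated against e^(-t) they become
    difference quotients of Gamma at 1, both tending to the derivative there, which is
    \<open>- euler_mascheroni\<close>.\<close>
  have hi: "f t \<le> (1 / h) * (t powr (1 + h - 1) / exp t) - (1 / h) * (t powr (1 - 1) / exp t)"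
    if "0 < h" "0 \<le> t" for h t
  proof (cases "t = 0")
    case False
    then have "h * ln t \<le> t powr h - 1"
      using that ln_le_minus_one[of "t powr h"] by (simp add: ln_powr)
    then have "ln t \<le> (t powr h - 1) / h" using that by (simp add: field_simps)
    then have "exp (-t) * ln t \<le> exp (-t) * ((t powr h - 1) / h)" by (intro mult_left_mono) auto
    also have "\<dots> = (1 / h) * (t powr h / exp t) - (1 / h) * (1 / exp t)"
      using that by (simp add: exp_minus field_simps)
    finally show ?thesis using False that by (simp add: f_def)
  qed (simp add: f_def)
  have lo: "(1 / h) * (t powr (1 - 1) / exp t) - (1 / h) * (t powr (1 - h - 1) / exp t) \<le> f t"
    if "0 < h" "0 \<le> t" for h t
  proof (cases "t = 0")
    case False
    then have "- h * ln t \<le> t powr (- h) - 1"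
      using that ln_le_minus_one[of "t powr (- h)"] by (simp add: ln_powr)
    then have "(1 - t powr (- h)) / h \<le> ln t" using that by (simp add: field_simps)
    then have "exp (-t) * ((1 - t powr (- h)) / h) \<le> exp (-t) * ln t" by (intro mult_left_mono) auto
    also have "exp (-t) * ((1 - t powr (- h)) / h) = (1 / h) * (1 / exp t) - (1 / h) * (t powr (- h) / exp t)"
      using that by (simp add: exp_minus field_simps)
    finally show ?thesis using False that by (simp add: f_def)
  qed (simp add: f_def)
  have U: "((\<lambda>t. (1 / h) * (t powr (1 + h - 1) / exp t) - (1 / h) * (t powr (1 - 1) / exp t)) has_integral
      (1 / h) * Gamma (1 + h) - (1 / h) * Gamma 1) {0..}" if "0 < h" for h :: real
    using that by (intro has_integral_diff has_integral_mult_right Gamma_integral_real) auto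
  have V: "((\<lambda>t. (1 / h) * (t powr (1 - 1) / exp t) - (1 / h) * (t powr (1 - h - 1) / exp t)) has_integral
      (1 / h) * Gamma 1 - (1 / h) * Gamma (1 - h)) {0..}" if "0 < h" "h < 1" for h :: real
    using that by (intro has_integral_diff has_integral_mult_right Gamma_integral_real) auto
  have B: "((\<lambda>t::real. 2 * (t powr (3/2 - 1) / exp t) + 2 * (t powr (1/2 - 1) / exp t)) has_integral
      2 * Gamma (3/2) + 2 * Gamma (1/2)) {0..}"
    by (intro has_integral_add has_integral_mult_right Gamma_integral_real) auto
  have fb: "\<bar>f t\<bar> \<le> 2 * (t powr (3/2 - 1) / exp t) + 2 * (t powr (1/2 - 1) / exp t)" if "0 \<le> t" for t
  proof -
    \<comment> \<open>The power \<open>t powr 0\<close> is 0 at \<open>t = 0\<close> and 1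
      elsewhere, hence the case distinction in \<open>r\<close>.\<close>
    define p q r where "p = t powr (1/2) / exp t" and "q = t powr (- (1/2)) / exp t"
      and "r = (if t = 0 then 0 else 1) / exp t"
    have "f t \<le> 2 * p - 2 * r" "2 * r - 2 * q \<le> f t"
      using hi[of "1/2" t] lo[of "1/2" t] that by (simp_all add: p_def q_def r_def)
    moreover have "0 \<le> p" "0 \<le> q" "0 \<le> r" by (auto simp: p_def q_def r_def)
    ultimately have "\<bar>f t\<bar> \<le> 2 * p + 2 * q" by linarith
    then show ?thesis by (simp add: p_def q_def)
  qed
  have fi: "f absolutely_integrable_on {0..}"
  proof (rule measurable_bounded_by_integrable_imp_absolutely_integrable)
    show "f \<in> borel_measurable (lebesgue_on {0..})"
      unfolding f_def by (intro measurable_restrict_space1 measurable_completion) simp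
    show "(\<lambda>t::real. 2 * (t powr (3/2 - 1) / exp t) + 2 * (t powr (1/2 - 1) / exp t)) integrable_on {0..}"
      using B by blast
  qed (use fb in auto)
  then show ?A by (simp add: f_def)
  have fi': "(f has_integral integral {0..} f) {0..}"
    using fi set_lebesgue_integral_eq_integral(1) by blast
  define h where "h = (\<lambda>n. 1 / (real n + 2))"
  have h: "0 < h n" "h n < 1" for n by (auto simp: h_def)
  have h0: "h \<longlonglongrightarrow> 0" unfolding h_def by real_asymp
  have G: "(Gamma has_real_derivative - euler_mascheroni) (at 1)"
    using has_field_derivative_Gamma[of "1::real" UNIV] by (simp add: Gamma_eq_zero_iff)
  have lim: "((\<lambda>y. (Gamma (1 + y) - Gamma 1) / y) \<longlongrightarrow> - euler_mascheroni) (at (0::real))"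
    using G unfolding DERIV_def .
  have l1: "(\<lambda>n. (Gamma (1 + h n) - Gamma 1) / h n) \<longlonglongrightarrow> - euler_mascheroni"
    by (rule filterlim_compose[OF lim]) 
      (use h h0 in \<open>auto simp: filterlim_at eventually_sequentially less_le\<close>)
  have l2: "(\<lambda>n. (Gamma (1 + (- h n)) - Gamma 1) / (- h n)) \<longlonglongrightarrow> - euler_mascheroni"
    by (rule filterlim_compose[OF lim])
      (use h tendsto_minus[OF h0] in \<open>auto simp: filterlim_at eventually_sequentially less_le\<close>)
  have "integral {0..} f \<le> - euler_mascheroni"
  proof (rule LIMSEQ_le_const[OF l1], intro exI allI impI)
    fix n :: nat
    have "integral {0..} f \<le> (1 / h n) * Gamma (1 + h n) - (1 / h n) * Gamma 1"
      by (rule has_integral_le[OF fi' U[OF h(1)]]) (use hi h in auto)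
    then show "integral {0..} f \<le> (Gamma (1 + h n) - Gamma 1) / h n"
      using h[of n] by (simp add: field_simps)
  qed
  moreover have "- euler_mascheroni \<le> integral {0..} f"
  proof (rule LIMSEQ_le_const2[OF l2], intro exI allI impI)
    fix n :: nat
    have "(1 / h n) * Gamma 1 - (1 / h n) * Gamma (1 - h n) \<le> integral {0..} f"
      by (rule has_integral_le[OF V[OF h] fi']) (use lo h in auto)
    then show "(Gamma (1 + (- h n)) - Gamma 1) / (- h n) \<le> integral {0..} f"
      using h[of n] by (simp add: field_simps)
  qed
  ultimately show "integral {0..} (\<lambda>t::real. exp (- t) * ln t) = - euler_mascheroni"
    by (simp add: f_def)
qed

lemma exp_ln_integral_tendsto:
  "((\<lambda>y. integral {0..y} (\<lambda>t::real. exp (- t) * ln t)) \<longlongrightarrow> - euler_mascheroni) at_top"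
proof -
  define f where "f = (\<lambda>t::real. exp (- t) * ln t)"
  have mf: "f \<in> borel_measurable borel" unfolding f_def by measurable
  have ai: "f absolutely_integrable_on {0..}" "integral {0..} f = - euler_mascheroni"
    using exp_ln_integral by (auto simp: f_def)
  have si: "set_integrable lborel {0..} f"
    using ai(1) mf unfolding set_integrable_def
    by (subst (asm) integrable_completion) auto
  have "((\<lambda>y. \<integral>x. indicator {..y} x *\<^sub>R (indicator {0..} x *\<^sub>R f x) \<partial>lborel) \<longlongrightarrow> (\<integral>x. indicator {0..} x *\<^sub>R f x \<partial>lborel)) at_top"
    using si unfolding set_integrable_def by (intro tendsto_integral_at_top) auto
  moreover have "(\<integral>x. indicator {..y} x *\<^sub>R (indicator {0..} x *\<^sub>R f x) \<partial>lborel) = integral {0..y} f" for y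
  proof -
    have "(\<lambda>x. indicator {..y} x *\<^sub>R (indicator {0..} x *\<^sub>R f x)) = (\<lambda>x. indicator {0..y} x *\<^sub>R f x)"
      by (auto simp: indicator_def)
    then have "(\<integral>x. indicator {..y} x *\<^sub>R (indicator {0..} x *\<^sub>R f x) \<partial>lborel) = (LINT x:{0..y}|lborel. f x)"
      by (simp add: set_lebesgue_integral_def)
    also have "\<dots> = integral {0..y} f"
      by (rule set_borel_integral_eq_integral(2)[OF set_integrable_subset[OF si]]) auto
    finally show ?thesis .
  qed
  moreover have "(\<integral>x. indicator {0..} x *\<^sub>R f x \<partial>lborel) = integral {0..} f"
    using set_borel_integral_eq_integral(2)[OF si] by (simp add: set_lebesgue_integral_def)
  ultimately show ?thesis using ai(2) by (simp add: f_def)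
qed

text \<open>An antiderivative of \<open>2 / hk_c s\<close>, the integrand without its exponential.
  The argument of the logarithm stays off the cut because \<open>hk_c s\<close> is never
  real.\<close>

definition hk_L :: "real \<Rightarrow> complex" where
  "hk_L s = 2 * Ln (of_real s + hk_c s)"

lemma hk_c_Im: "Im (hk_c s) \<noteq> 0"
proof
  assume "Im (hk_c s) = 0"
  moreover have "Im ((hk_c s)\<^sup>2) = -2"
    unfolding hk_c_sq by simp
  ultimately show False by (simp add: power2_eq_square)
qed

lemma has_vector_derivative_hk_L:
  "(hk_L has_vector_derivative (2 / hk_c s)) (at s within A)"
proof -
  have n: "of_real s + hk_c s \<notin> \<real>\<^sub>\<le>\<^sub>0"
    using hk_c_Im[of s] by (simp add: complex_nonpos_Reals_iff)
  then have nz: "of_real s + hk_c s \<noteq> 0" by (metis nonpos_Reals_zero_I)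
  have "((\<lambda>s. of_real s + hk_c s) has_vector_derivative (1 + of_real s / hk_c s)) (at s within A)"
  proof (intro has_vector_derivative_add has_vector_derivative_hk_c)
    have "((\<lambda>s. complex_of_real s) has_vector_derivative of_real 1) (at s within A)"
      by (rule has_vector_derivative_of_real[OF DERIV_ident])
    then show "((\<lambda>s. complex_of_real s) has_vector_derivative 1) (at s within A)" by simp
  qed
  moreover have "(Ln has_field_derivative inverse (of_real s + hk_c s)) (at (of_real s + hk_c s) within ((\<lambda>s. of_real s + hk_c s) ` A))"
    by (rule has_field_derivative_at_within[OF has_field_derivative_Ln[OF n]])
  ultimately have "((\<lambda>s. Ln (of_real s + hk_c s)) has_vector_derivative
      ((1 + of_real s / hk_c s) * inverse (of_real s + hk_c s))) (at s within A)"
    using field_vector_diff_chain_within[of "\<lambda>s. of_real s + hk_c s" _ s A Ln] by (simp add: o_def)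
  moreover have "(1 + of_real s / hk_c s) * inverse (of_real s + hk_c s) = 1 / hk_c s"
    using nz by (simp add: field_simps)
  ultimately have "((\<lambda>s. Ln (of_real s + hk_c s)) has_vector_derivative (1 / hk_c s)) (at s within A)"
    by simp
  from has_vector_derivative_mult_right[OF this, of 2] show ?thesis
    by (simp add: hk_L_def[abs_def])
qed

text \<open>For large \<open>s\<close> the root \<open>hk_c s\<close> is close to \<open>s\<close>,
  so \<open>hk_L s\<close> is close to 2 ln (2 s). The ratio w of the two arguments stays in the
  half-plane Re >= 1/2, where the logarithm has Lipschitz constant 2, and (c - s)(c + s) = -2i
  bounds w - 1.\<close>

lemma hk_L_asymp:
  assumes "0 < s"
  shows "norm (hk_L s - of_real (ln 4 + 2 * ln s)) \<le> 4 / s"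
proof -
  define w where "w = (1 + hk_c s / of_real s) / 2"
  have "Re (hk_c s / of_real s) \<ge> 0" using hk_c_Re[of s] assms by simp
  then have Rew: "Re w \<ge> 1/2" by (simp add: w_def)
  then have wnz: "w \<noteq> 0" by auto
  have "of_real s + hk_c s = of_real (2 * s) * w"
    using assms by (simp add: w_def field_simps)
  moreover have "Ln (of_real (2 * s) * w) = of_real (ln (2 * s)) + Ln w"
    using assms wnz Ln_of_real[of "2 * s"]
    by (subst Ln_times_of_real) (auto simp del: of_real_mult)
  ultimately have "Ln (of_real s + hk_c s) = of_real (ln (2 * s)) + Ln w"
    by simp
  then have LL: "hk_L s - of_real (ln 4 + 2 * ln s) = 2 * Ln w"
  proof -
    have "ln (4::real) = 2 * ln 2" using ln_realpow[of 2 2] by simp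
    moreover have "ln (2 * s) = ln 2 + ln s" using assms by (simp add: ln_mult)
    ultimately show ?thesis
      unfolding hk_L_def \<open>Ln (of_real s + hk_c s) = _\<close> by simp
  qed
  have "norm (Ln w - Ln 1) \<le> 2 * norm (w - 1)"
  proof (rule field_differentiable_bound[of "{z. 1/2 \<le> Re z}" Ln inverse 2])
    show "convex {z. 1/2 \<le> Re z}"
      by (rule convex_halfspace_Re_ge)
    fix z :: complex assume z: "z \<in> {z. 1/2 \<le> Re z}"
    then have "z \<notin> \<real>\<^sub>\<le>\<^sub>0" by (auto simp: complex_nonpos_Reals_iff)
    then show "(Ln has_field_derivative inverse z) (at z within {z. 1/2 \<le> Re z})"
      by (rule has_field_derivative_at_within[OF has_field_derivative_Ln])
    have "1/2 \<le> norm z" using z complex_Re_le_cmod[of z] by simp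
    then have "inverse (norm z) \<le> inverse (1/2)" by (intro le_imp_inverse_le) auto
    then show "norm (inverse z) \<le> 2" by (simp add: norm_inverse)
  qed (use Rew in auto)
  moreover have "norm (w - 1) \<le> 1 / s"
  proof -
    have "sqrt 2 \<le> norm (of_real s + hk_c s)"
    proof -
      have "norm (hk_c s) \<le> norm (of_real s + hk_c s)"
        unfolding cmod_def using assms hk_c_Re[of s] power_mono[of "Re (hk_c s)" "s + Re (hk_c s)" 2]
        by simp
      then show ?thesis using hk_c_norm(1)[of s] by linarith
    qed
    then have g: "1 \<le> norm (of_real s + hk_c s)"
      by (meson order_trans real_sqrt_ge_one one_le_numeral)
    have "(hk_c s - of_real s) * (of_real s + hk_c s) = - 2 * \<i>"
    proof -
      have "(hk_c s - of_real s) * (of_real s + hk_c s) = (hk_c s)\<^sup>2 - (of_real s)\<^sup>2"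
        by (simp add: algebra_simps power2_eq_square)
      then show ?thesis by (simp add: hk_c_sq)
    qed
    then have "norm (hk_c s - of_real s) * norm (of_real s + hk_c s) = 2"
      by (metis norm_mult norm_minus_cancel mult_minus_left norm_numeral norm_ii mult.right_neutral)
    moreover have "norm (hk_c s - of_real s) * 1 \<le> norm (hk_c s - of_real s) * norm (of_real s + hk_c s)"
      using g by (intro mult_left_mono) auto
    ultimately have "norm (hk_c s - of_real s) \<le> 2" by simp
    moreover have "w - 1 = (hk_c s - of_real s) / of_real (2 * s)"
      using assms by (simp add: w_def field_simps)
    ultimately show ?thesis
      using assms divide_right_mono[of "norm (hk_c s - of_real s)" 2 "2 * s"]
      by (simp add: norm_divide norm_mult)
  qed
  ultimately have "norm (2 * Ln w) \<le> 4 / s" by (simp add: norm_mult)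
  then show ?thesis by (simp only: LL)
qed

text \<open>The value is 2 Ln (1 - i). Its imaginary part is the source of the constant i pi/2 that
  makes the limit the outgoing combination of J0 and Y0.\<close>

lemma hk_L_0: "hk_L 0 = of_real (ln 2) - \<i> * of_real (pi / 2)"
proof -
  have c: "hk_c 0 = 1 - \<i>"
    unfolding hk_c_def by (rule csqrt_unique) (simp_all add: power2_diff)
  define x where "x = of_real (ln 2 / 2) - \<i> * of_real (pi / 4)"
  have "exp (ln 2 / 2) = sqrt (2::real)"
    using powr_half_sqrt[of 2] by (simp add: powr_def)
  then have "exp x = 1 - \<i>"
    by (intro complex_eqI) (simp_all add: x_def Re_exp Im_exp cos_45 sin_45)
  moreover have "Ln (exp x) = x"
    by (rule Ln_exp) (simp_all add: x_def, use pi_gt_zero in linarith)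
  ultimately show ?thesis
    by (simp add: hk_L_def c x_def)
qed

lemma exp_ln_substitution:
  fixes x N :: real
  assumes "0 < x" "0 \<le> N"
  shows "((\<lambda>s. 2 * x * s * (exp (- (x * s\<^sup>2)) * ln (x * s\<^sup>2))) has_integral
    integral {0..x * N\<^sup>2} (\<lambda>t. exp (- t) * ln t)) {0..N}"
proof -
  define f where "f = (\<lambda>t::real. exp (- t) * ln t)"
  have im: "(\<lambda>s. x * s\<^sup>2) ` {0..N} = {0..x * N\<^sup>2}"
  proof (intro equalityI subsetI)
    fix t assume t: "t \<in> {0..x * N\<^sup>2}"
    then have "t / x \<le> N\<^sup>2" using assms by (simp add: field_simps)
    then have "sqrt (t / x) \<le> N" using assms by (metis real_le_lsqrt t atLeastAtMost_iff divide_nonneg_pos)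
    then show "t \<in> (\<lambda>s. x * s\<^sup>2) ` {0..N}"
      using t assms by (intro image_eqI[of _ _ "sqrt (t / x)"]) auto
  qed (use assms in \<open>auto intro!: mult_left_mono power_mono\<close>)
  have "f absolutely_integrable_on {0..x * N\<^sup>2}"
    using set_integrable_subset[OF exp_ln_integral(1)] unfolding f_def by auto
  then have "f absolutely_integrable_on ((\<lambda>s. x * s\<^sup>2) ` {0..N}) \<and>
      integral ((\<lambda>s. x * s\<^sup>2) ` {0..N}) f = integral {0..x * N\<^sup>2} f"
    unfolding im by simp
  moreover have "inj_on (\<lambda>s. x * s\<^sup>2) {0..N}"
    using assms by (auto simp: inj_on_def power2_eq_iff_nonneg)
  ultimately have "(\<lambda>s. \<bar>2 * x * s\<bar> * f (x * s\<^sup>2)) absolutely_integrable_on {0..N} \<and>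
     integral {0..N} (\<lambda>s. \<bar>2 * x * s\<bar> * f (x * s\<^sup>2)) = integral {0..x * N\<^sup>2} f"
    by (subst has_absolute_integral_change_of_variables_1') (auto intro!: derivative_eq_intros)
  then have "((\<lambda>s. \<bar>2 * x * s\<bar> * f (x * s\<^sup>2)) has_integral integral {0..x * N\<^sup>2} f) {0..N}"
    using set_lebesgue_integral_eq_integral(1) by (metis has_integral_iff)
  then show ?thesis
    unfolding f_def using assms by (subst has_integral_cong[where g="\<lambda>s. \<bar>2 * x * s\<bar> * (exp (- (x * s\<^sup>2)) * ln (x * s\<^sup>2))"]) auto
qed

text \<open>Integration by parts moves the derivative from \<open>hk_L\<close> to the Gaussian and
  leaves the weight 2 x s e^(-x s^2). Against this weight \<open>hk_L\<close> may be replaced by ln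
  4 + 2 ln s: the error 4/s cancels the factor s, so the total cost is of order sqrt x. The
  substitution t = x s^2 then produces ln x and the integral of e^(-t) ln t. The factor e^(-ix)
  strips the oscillation off the integrand.\<close>

lemma hk_I_near_0:
  fixes x :: real
  assumes x: "0 < x"
  defines "e \<equiv> (\<lambda>N. exp (- (x * (real N)\<^sup>2)))"
  shows "norm (exp (- (\<i> * of_real x)) * hk_I 0 N (of_real x)
      - (of_real (e N) * hk_L (real N) - hk_L 0
         + of_real ((ln 4 - ln x) * (1 - e N) + integral {0..x * (real N)\<^sup>2} (\<lambda>t. exp (- t) * ln t))))
     \<le> 4 * pi * sqrt x"
proof -
  define G where "G = (\<lambda>s. 2 * x * s * exp (- (x * s\<^sup>2)))"
  have dE: "((\<lambda>s. complex_of_real (exp (- (x * s\<^sup>2)))) has_vector_derivative - of_real (G s)) (at s within A)" for s A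
  proof -
    have "((\<lambda>s. exp (- (x * s\<^sup>2))) has_real_derivative - G s) (at s within A)"
      unfolding G_def by (auto intro!: derivative_eq_intros simp: power2_eq_square)
    from has_vector_derivative_of_real[OF this] show ?thesis by simp
  qed
  have i1: "((\<lambda>s. of_real (exp (- (x * s\<^sup>2))) * (2 / hk_c s) + - of_real (G s) * hk_L s) has_integral
     of_real (e N) * hk_L (real N) - hk_L 0) {0..real N}"
  proof -
    have "((\<lambda>s. of_real (exp (- (x * s\<^sup>2))) * (2 / hk_c s) + - of_real (G s) * hk_L s) has_integral
     of_real (exp (- (x * (real N)\<^sup>2))) * hk_L (real N) - of_real (exp (- (x * 0\<^sup>2))) * hk_L 0) {0..real N}"
      by (rule fundamental_theorem_of_calculus)
        (simp, intro has_vector_derivative_mult dE has_vector_derivative_hk_L)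
    then show ?thesis by (simp add: e_def)
  qed
  have "((\<lambda>s. - exp (- (x * s\<^sup>2))) has_vector_derivative G s) (at s within A)" for s A
    unfolding G_def has_real_derivative_iff_has_vector_derivative[symmetric]
    by (auto intro!: derivative_eq_intros simp: power2_eq_square)
  then have "(G has_integral (- exp (- (x * (real N)\<^sup>2)) - - exp (- (x * 0\<^sup>2)))) {0..real N}"
    by (intro fundamental_theorem_of_calculus) auto
  then have i2: "(G has_integral (1 - e N)) {0..real N}" by (simp add: e_def)
  \<comment> \<open>The logarithm ln 4 + 2 ln s is split as (ln 4 - ln x) + ln (x s^2): a constant,
    and a function of the new variable.\<close>
  have "((\<lambda>s. (ln 4 - ln x) * G s + 2 * x * s * (exp (- (x * s\<^sup>2)) * ln (x * s\<^sup>2))) has_integral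
     ((ln 4 - ln x) * (1 - e N) + integral {0..x * (real N)\<^sup>2} (\<lambda>t. exp (- t) * ln t))) {0..real N}"
    by (intro has_integral_add has_integral_mult_right i2 exp_ln_substitution x) auto
  then have "((\<lambda>s. G s * (ln 4 + 2 * ln s)) has_integral
     ((ln 4 - ln x) * (1 - e N) + integral {0..x * (real N)\<^sup>2} (\<lambda>t. exp (- t) * ln t))) {0..real N}"
  proof (rule has_integral_eq[rotated])
    fix s :: real assume "s \<in> {0..real N}"
    then show "(ln 4 - ln x) * G s + 2 * x * s * (exp (- (x * s\<^sup>2)) * ln (x * s\<^sup>2)) = G s * (ln 4 + 2 * ln s)"
      using x by (cases "s = 0") (auto simp: G_def ln_mult ln_realpow algebra_simps)
  qed
  then have i3: "((\<lambda>s. complex_of_real (G s * (ln 4 + 2 * ln s))) has_integral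
     of_real ((ln 4 - ln x) * (1 - e N) + integral {0..x * (real N)\<^sup>2} (\<lambda>t. exp (- t) * ln t))) {0..real N}"
    by (rule has_integral_of_real)
  \<comment> \<open>What remains of the integrand after subtracting the derivative of the boundary
    term and the asymptotic form of \<open>hk_L\<close>; away from 0 it equals
    \<open>G s * (hk_L s - of_real (ln 4 + 2 * ln s))\<close>.\<close>
  define D where "D = (\<lambda>s. of_real (exp (- (x * s\<^sup>2))) * (2 / hk_c s) - (of_real (exp (- (x * s\<^sup>2))) * (2 / hk_c s) + - of_real (G s) * hk_L s)
      - complex_of_real (G s * (ln 4 + 2 * ln s)))"
  have i4: "((\<lambda>s. of_real (exp (- (x * s\<^sup>2))) * (2 / hk_c s)) has_integral (exp (- (\<i> * of_real x)) * hk_I 0 N (of_real x))) {0..real N}"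
  proof -
    have "(hk_F 0 (of_real x) has_integral hk_I 0 N (of_real x)) {0..real N}"
      unfolding hk_I_def by (intro integrable_integral integrable_continuous_interval continuous_intros)
    from has_integral_mult_right[OF this, of "exp (- (\<i> * of_real x))"]
    show ?thesis
    proof (rule has_integral_eq[rotated])
      fix s
      have "exp (- (\<i> * of_real x)) * exp (- (of_real x * hk_p s)) = exp (of_real (- (x * s\<^sup>2)))"
        by (simp add: mult_exp_exp hk_p_def algebra_simps)
      also have "\<dots> = of_real (exp (- (x * s\<^sup>2)))" by (rule exp_of_real)
      finally show "exp (- (\<i> * of_real x)) * hk_F 0 (of_real x) s = of_real (exp (- (x * s\<^sup>2))) * (2 / hk_c s)"
        by (simp add: hk_F_def field_simps)
    qed
  qed
  have iD: "(D has_integral (exp (- (\<i> * of_real x)) * hk_I 0 N (of_real x) - (of_real (e N) * hk_L (real N) - hk_L 0)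
     - of_real ((ln 4 - ln x) * (1 - e N) + integral {0..x * (real N)\<^sup>2} (\<lambda>t. exp (- t) * ln t)))) {0..real N}"
    unfolding D_def by (intro has_integral_diff i1 i3 i4)
  note int = integral_inverse_quadratic_le[OF x, of "real N"]
  have "norm (integral {0..real N} D) \<le> integral {0..real N} (\<lambda>s. (8 * x) * (1 / (1 + x * s\<^sup>2)))"
  proof (rule integral_norm_bound_integral)
    show "D integrable_on {0..real N}" using iD by blast
    show "(\<lambda>s. (8 * x) * (1 / (1 + x * s\<^sup>2))) integrable_on {0..real N}"
      using integrable_cmul[OF int(1), of "8 * x"] by simp
    fix s assume s: "s \<in> {0..real N}"
    have nn: "0 \<le> x * s\<^sup>2" using x by simp
    have "norm (D s) \<le> 8 * x * exp (- (x * s\<^sup>2))"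
    proof (cases "s = 0")
      case False
      then have s0: "0 < s" using s by auto
      have "D s = of_real (G s) * (hk_L s - of_real (ln 4 + 2 * ln s))"
        by (simp add: D_def algebra_simps)
      then have "norm (D s) = G s * norm (hk_L s - of_real (ln 4 + 2 * ln s))"
        using s0 x by (simp add: norm_mult G_def del: of_real_add)
      also have "\<dots> \<le> G s * (4 / s)"
        using s0 x by (intro mult_left_mono hk_L_asymp) (auto simp: G_def)
      finally show ?thesis using s0 by (simp add: G_def)
    qed (use x in \<open>simp add: D_def G_def\<close>)
    also have "\<dots> \<le> 8 * x * (1 / (1 + x * s\<^sup>2))"
      using x exp_neg_le[OF nn] by (intro mult_left_mono) auto
    finally show "norm (D s) \<le> (8 * x) * (1 / (1 + x * s\<^sup>2))" .
  qed
  also have "\<dots> = (8 * x) * integral {0..real N} (\<lambda>s. 1 / (1 + x * s\<^sup>2))" by (rule integral_mult_right)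
  also have "\<dots> \<le> (8 * x) * (pi / (2 * sqrt x))"
    using x int by (intro mult_left_mono) auto
  also have "\<dots> = 4 * pi * sqrt x"
    using x by (simp add: field_simps real_sqrt_mult_self)
  finally show ?thesis
    using integral_unique[OF iD] by (simp add: algebra_simps)
qed

lemma hk_Phi_near_0:
  fixes x :: real
  assumes x: "0 < x"
  shows "norm (exp (- (\<i> * of_real x)) * hk_Phi 0 (of_real x)
      - (\<i> * of_real (pi / 2) - of_real (ln (x / 2) + euler_mascheroni))) \<le> 4 * pi * sqrt x"
proof -
  define e where "e = (\<lambda>N. exp (- (x * (real N)\<^sup>2)))"
  have e0: "e \<longlonglongrightarrow> 0" unfolding e_def using x by real_asymp
  have L0: "(\<lambda>N. of_real (e N) * hk_L (real N)) \<longlonglongrightarrow> 0"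
  proof (rule Lim_null_comparison)
    show "\<forall>\<^sub>F N in sequentially. norm (of_real (e N) * hk_L (real N)) \<le> exp (- (x * (real N)\<^sup>2)) * (\<bar>ln 4 + 2 * ln (real N)\<bar> + 4)"
      using eventually_gt_at_top[of 0]
    proof eventually_elim
      case (elim N)
      have "norm (hk_L (real N)) \<le> norm (hk_L (real N) - of_real (ln 4 + 2 * ln (real N))) + norm (complex_of_real (ln 4 + 2 * ln (real N)))"
        using norm_triangle_ineq[of "hk_L (real N) - of_real (ln 4 + 2 * ln (real N))" "complex_of_real (ln 4 + 2 * ln (real N))"] by simp
      also have "\<dots> \<le> 4 / real N + \<bar>ln 4 + 2 * ln (real N)\<bar>"
        using hk_L_asymp[of "real N"] elim by (simp del: of_real_add)
      also have "4 / real N \<le> 4" using elim by (simp add: field_simps)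
      finally show ?case by (simp add: e_def norm_mult)
    qed
    show "(\<lambda>N. exp (- (x * (real N)\<^sup>2)) * (\<bar>ln 4 + 2 * ln (real N)\<bar> + 4)) \<longlonglongrightarrow> 0"
      using x by real_asymp
  qed
  have A: "(\<lambda>N. integral {0..x * (real N)\<^sup>2} (\<lambda>t. exp (- t) * ln t)) \<longlonglongrightarrow> - euler_mascheroni"
  proof (rule filterlim_compose[OF exp_ln_integral_tendsto])
    show "filterlim (\<lambda>N. x * (real N)\<^sup>2) at_top sequentially" using x by real_asymp
  qed
  have I: "(\<lambda>N. hk_I 0 N (of_real x)) \<longlonglongrightarrow> hk_Phi 0 (of_real x)"
    by (rule hk_I_tendsto) (use x in auto)
  have lim: "(\<lambda>N. exp (- (\<i> * of_real x)) * hk_I 0 N (of_real x)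
      - (of_real (e N) * hk_L (real N) - hk_L 0
         + of_real ((ln 4 - ln x) * (1 - e N) + integral {0..x * (real N)\<^sup>2} (\<lambda>t. exp (- t) * ln t))))
    \<longlonglongrightarrow> exp (- (\<i> * of_real x)) * hk_Phi 0 (of_real x) - (0 - hk_L 0 + of_real ((ln 4 - ln x) * (1 - 0) + - euler_mascheroni))"
    by (intro tendsto_intros I L0 A e0)
  have "norm (exp (- (\<i> * of_real x)) * hk_Phi 0 (of_real x) - (0 - hk_L 0 + of_real ((ln 4 - ln x) * (1 - 0) + - euler_mascheroni))) \<le> 4 * pi * sqrt x"
    by (rule Lim_norm_ubound[OF _ lim]) (use hk_I_near_0[OF x] in \<open>auto simp: e_def\<close>)
  moreover have "0 - hk_L 0 + of_real ((ln 4 - ln x) * (1 - 0) + - euler_mascheroni)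
    = \<i> * of_real (pi / 2) - complex_of_real (ln (x / 2) + euler_mascheroni)"
  proof -
    have "ln (4::real) = 2 * ln 2" using ln_realpow[of 2 2] by simp
    then show ?thesis using x by (simp add: hk_L_0 ln_div)
  qed
  ultimately show ?thesis by (simp only:)
qed

section \<open>Bessel's equation and the identification with the power series\<close>

definition bes_sol :: "(complex \<Rightarrow> complex) \<Rightarrow> (complex \<Rightarrow> complex) \<Rightarrow> bool" where
  "bes_sol f f1 \<longleftrightarrow> (\<forall>x. 0 < Re x \<longrightarrow> (f has_field_derivative f1 x) (at x) \<and>
     (\<exists>f2. (f1 has_field_derivative f2) (at x) \<and> x * f2 + f1 x + x * f x = 0))"

text \<open>Abel's identity: in the derivative of x times the Wronskian the two equations cancel
  each other, and the right half-plane is convex.\<close>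

lemma bes_sol_wronskian:
  assumes f: "bes_sol f f1" and g: "bes_sol g g1"
  obtains c where "\<And>x. 0 < Re x \<Longrightarrow> x * (f x * g1 x - f1 x * g x) = c"
proof -
  define W where "W = (\<lambda>x. x * (f x * g1 x - f1 x * g x))"
  have d: "(W has_field_derivative 0) (at x within {z. 0 < Re z})" if x: "x \<in> {z. 0 < Re z}" for x
  proof -
    obtain f2 where f': "(f has_field_derivative f1 x) (at x)" "(f1 has_field_derivative f2) (at x)" "x * f2 + f1 x + x * f x = 0"
      using f x unfolding bes_sol_def by auto
    obtain g2 where g': "(g has_field_derivative g1 x) (at x)" "(g1 has_field_derivative g2) (at x)" "x * g2 + g1 x + x * g x = 0"
      using g x unfolding bes_sol_def by auto
    have "(W has_field_derivative (x * ((f x * g2 + f1 x * g1 x) - (f1 x * g1 x + f2 * g x)) + 1 * (f x * g1 x - f1 x * g x))) (at x)"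
      unfolding W_def by (rule derivative_eq_intros f' g' refl)+ (simp add: algebra_simps)
    moreover have "x * ((f x * g2 + f1 x * g1 x) - (f1 x * g1 x + f2 * g x)) + 1 * (f x * g1 x - f1 x * g x)
       = f x * (x * g2 + g1 x + x * g x) - g x * (x * f2 + f1 x + x * f x)"
      by (simp add: algebra_simps)
    ultimately have "(W has_field_derivative 0) (at x)" using f'(3) g'(3) by simp
    then show ?thesis by (rule has_field_derivative_at_within)
  qed
  have "\<exists>c. \<forall>x\<in>{z. 0 < Re z}. W x = c"
    by (rule has_field_derivative_zero_constant[OF convex_halfspace_Re_gt d])
  then show ?thesis using that by (auto simp: W_def)
qed

lemma bes_sol_diff: "bes_sol f f1 \<Longrightarrow> bes_sol g g1 \<Longrightarrow> bes_sol (\<lambda>x. f x - g x) (\<lambda>x. f1 x - g1 x)"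
proof (unfold bes_sol_def, intro allI impI)
  fix x :: complex assume x: "0 < Re x"
  assume "\<forall>x. 0 < Re x \<longrightarrow> (f has_field_derivative f1 x) (at x) \<and>
     (\<exists>f2. (f1 has_field_derivative f2) (at x) \<and> x * f2 + f1 x + x * f x = 0)"
  then obtain f2 where f': "(f has_field_derivative f1 x) (at x)" "(f1 has_field_derivative f2) (at x)" "x * f2 + f1 x + x * f x = 0"
    using x by auto
  assume "\<forall>x. 0 < Re x \<longrightarrow> (g has_field_derivative g1 x) (at x) \<and>
     (\<exists>g2. (g1 has_field_derivative g2) (at x) \<and> x * g2 + g1 x + x * g x = 0)"
  then obtain g2 where g': "(g has_field_derivative g1 x) (at x)" "(g1 has_field_derivative g2) (at x)" "x * g2 + g1 x + x * g x = 0"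
    using x by auto
  have "x * (f2 - g2) + (f1 x - g1 x) + x * (f x - g x) = (x * f2 + f1 x + x * f x) - (x * g2 + g1 x + x * g x)"
    by (simp add: algebra_simps)
  then show "((\<lambda>x. f x - g x) has_field_derivative f1 x - g1 x) (at x) \<and>
     (\<exists>f2. ((\<lambda>x. f1 x - g1 x) has_field_derivative f2) (at x) \<and> x * f2 + (f1 x - g1 x) + x * (f x - g x) = 0)"
    using f' g' by (intro conjI exI[of _ "f2 - g2"] DERIV_diff) auto
qed

lemma bes_sol_Phi: "bes_sol (hk_Phi 0) (hk_Phi 1)"
  unfolding bes_sol_def using hk_Phi_deriv hk_Phi_ode by metis

definition bes_j :: "complex \<Rightarrow> complex" where "bes_j x = bes_P 0 (x\<^sup>2 / 4)"
definition bes_j1 :: "complex \<Rightarrow> complex" where "bes_j1 x = bes_P 1 (x\<^sup>2 / 4) * (x / 2)"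
definition bes_q :: "complex \<Rightarrow> complex" where "bes_q x = bes_Q 0 (x\<^sup>2 / 4)"
definition bes_q1 :: "complex \<Rightarrow> complex" where "bes_q1 x = bes_Q 1 (x\<^sup>2 / 4) * (x / 2)"

lemma sq4_deriv: "((\<lambda>x::complex. x\<^sup>2 / 4) has_field_derivative (x / 2)) (at x)"
  by (auto intro!: derivative_eq_intros)

lemma bes_PQ_chain:
  "((\<lambda>x. bes_P n (x\<^sup>2 / 4)) has_field_derivative bes_P (Suc n) (x\<^sup>2 / 4) * (x / 2)) (at x)"
  "((\<lambda>x. bes_Q n (x\<^sup>2 / 4)) has_field_derivative bes_Q (Suc n) (x\<^sup>2 / 4) * (x / 2)) (at x)"
  by (rule DERIV_chain2[OF has_field_derivative_bes_P sq4_deriv] DERIV_chain2[OF has_field_derivative_bes_Q sq4_deriv])+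

lemma bes_j_deriv: "(bes_j has_field_derivative bes_j1 x) (at x)"
  unfolding bes_j_def[abs_def] bes_j1_def using bes_PQ_chain(1)[of 0 x] by simp

lemma bes_j1_deriv: "(bes_j1 has_field_derivative (bes_P 2 (x\<^sup>2 / 4) * (x\<^sup>2 / 4) + bes_P 1 (x\<^sup>2 / 4) / 2)) (at x)"
proof -
  have "((\<lambda>x. bes_P 1 (x\<^sup>2 / 4) * (x / 2)) has_field_derivative
     (bes_P 1 (x\<^sup>2 / 4) * (1 / 2) + bes_P 2 (x\<^sup>2 / 4) * (x / 2) * (x / 2))) (at x)"
    using bes_PQ_chain(1)[of 1 x] by (intro DERIV_mult') (auto intro!: derivative_eq_intros simp: numeral_2_eq_2)
  then show ?thesis
    unfolding bes_j1_def[abs_def] by (rule DERIV_cong) (simp add: power2_eq_square)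
qed

lemma bes_q_deriv: "(bes_q has_field_derivative bes_q1 x) (at x)"
  unfolding bes_q_def[abs_def] bes_q1_def using bes_PQ_chain(2)[of 0 x] by simp

lemma bes_q1_deriv: "(bes_q1 has_field_derivative (bes_Q 2 (x\<^sup>2 / 4) * (x\<^sup>2 / 4) + bes_Q 1 (x\<^sup>2 / 4) / 2)) (at x)"
proof -
  have "((\<lambda>x. bes_Q 1 (x\<^sup>2 / 4) * (x / 2)) has_field_derivative
     (bes_Q 1 (x\<^sup>2 / 4) * (1 / 2) + bes_Q 2 (x\<^sup>2 / 4) * (x / 2) * (x / 2))) (at x)"
    using bes_PQ_chain(2)[of 1 x] by (intro DERIV_mult') (auto intro!: derivative_eq_intros simp: numeral_2_eq_2)
  then show ?thesis
    unfolding bes_q1_def[abs_def] by (rule DERIV_cong) (simp add: power2_eq_square)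
qed

lemma bes_sol_j: "bes_sol bes_j bes_j1"
  unfolding bes_sol_def
proof (intro allI impI conjI exI)
  fix x :: complex
  show "(bes_j has_field_derivative bes_j1 x) (at x)" by (rule bes_j_deriv)
  show "(bes_j1 has_field_derivative (bes_P 2 (x\<^sup>2 / 4) * (x\<^sup>2 / 4) + bes_P 1 (x\<^sup>2 / 4) / 2)) (at x)" by (rule bes_j1_deriv)
  have "x * (bes_P 2 (x\<^sup>2 / 4) * (x\<^sup>2 / 4) + bes_P 1 (x\<^sup>2 / 4) / 2) + bes_j1 x + x * bes_j x
     = x * ((x\<^sup>2 / 4) * bes_P 2 (x\<^sup>2 / 4) + bes_P 1 (x\<^sup>2 / 4) + bes_P 0 (x\<^sup>2 / 4))"
    by (simp add: bes_j_def bes_j1_def field_simps)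
  then show "x * (bes_P 2 (x\<^sup>2 / 4) * (x\<^sup>2 / 4) + bes_P 1 (x\<^sup>2 / 4) / 2) + bes_j1 x + x * bes_j x = 0"
    by (simp only: bes_P_ode mult_zero_right)
qed

definition bes_l :: "complex \<Rightarrow> complex" where "bes_l x = Ln (x / 2) + euler_mascheroni"

text \<open>\<open>bes_B\<close> is \<open>\<pi>\<i>/2\<close> times the Hankel function.\<close>

definition bes_B :: "complex \<Rightarrow> complex" where
  "bes_B x = (\<i> * of_real (pi / 2) - bes_l x) * bes_j x + bes_q x"
definition bes_B1 :: "complex \<Rightarrow> complex" where
  "bes_B1 x = (\<i> * of_real (pi / 2) - bes_l x) * bes_j1 x - bes_j x / x + bes_q1 x"

lemma bes_l_deriv:
  assumes "0 < Re x" shows "(bes_l has_field_derivative 1 / x) (at x)"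
proof -
  have x: "x / 2 \<notin> \<real>\<^sub>\<le>\<^sub>0" "x \<noteq> 0" using assms by (auto simp: complex_nonpos_Reals_iff)
  show ?thesis
    unfolding bes_l_def[abs_def]
    using DERIV_add[OF DERIV_chain2[OF has_field_derivative_Ln[OF x(1)] DERIV_cdivide[OF DERIV_ident]] DERIV_const[of euler_mascheroni]]
    by (rule DERIV_cong) (use x in \<open>simp add: field_simps\<close>)
qed

text \<open>Bessel's operator applied to the product of the logarithm with \<open>bes_j\<close>
  leaves a term in \<open>bes_j1\<close>, because the derivative 1/x of the logarithm meets
  \<open>bes_j1\<close> twice. The inhomogeneity 2 \<open>bes_j1\<close> of the equation for
  \<open>bes_q\<close> cancels it.\<close>

lemma bes_sol_B: "bes_sol bes_B bes_B1"
  unfolding bes_sol_def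
proof (intro allI impI conjI exI)
  fix x :: complex assume x: "0 < Re x"
  then have nz: "x \<noteq> 0" by auto
  let ?c = "\<i> * of_real (pi / 2) - bes_l x"
  let ?j2 = "bes_P 2 (x\<^sup>2 / 4) * (x\<^sup>2 / 4) + bes_P 1 (x\<^sup>2 / 4) / 2"
  let ?q2 = "bes_Q 2 (x\<^sup>2 / 4) * (x\<^sup>2 / 4) + bes_Q 1 (x\<^sup>2 / 4) / 2"
  have c: "((\<lambda>x. \<i> * of_real (pi / 2) - bes_l x) has_field_derivative (- (1 / x))) (at x)"
    using DERIV_diff[OF DERIV_const bes_l_deriv[OF x]] by simp
  have "(bes_B has_field_derivative (?c * bes_j1 x + - (1 / x) * bes_j x + bes_q1 x)) (at x)"
    unfolding bes_B_def[abs_def] by (intro DERIV_add DERIV_mult' c bes_j_deriv bes_q_deriv)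
  then show "(bes_B has_field_derivative bes_B1 x) (at x)"
    by (simp add: bes_B1_def)
  have "(bes_B1 has_field_derivative (?c * ?j2 + - (1 / x) * bes_j1 x - (bes_j1 x * x - bes_j x * 1) / (x * x) + ?q2)) (at x)"
    unfolding bes_B1_def[abs_def]
    by (intro DERIV_add DERIV_diff DERIV_mult' DERIV_divide c bes_j_deriv bes_j1_deriv bes_q1_deriv DERIV_ident nz)
  moreover have "?c * ?j2 + - (1 / x) * bes_j1 x - (bes_j1 x * x - bes_j x * 1) / (x * x) + ?q2
     = ?c * ?j2 - 2 * bes_j1 x / x + bes_j x / (x * x) + ?q2"
    using nz by (simp add: field_simps)
  ultimately show "(bes_B1 has_field_derivative (?c * ?j2 - 2 * bes_j1 x / x + bes_j x / (x * x) + ?q2)) (at x)"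
    by (simp only:)
  have j: "x * ?j2 + bes_j1 x + x * bes_j x = 0"
  proof -
    have "x * ?j2 + bes_j1 x + x * bes_j x
      = x * ((x\<^sup>2 / 4) * bes_P 2 (x\<^sup>2 / 4) + bes_P 1 (x\<^sup>2 / 4) + bes_P 0 (x\<^sup>2 / 4))"
      by (simp add: bes_j_def bes_j1_def field_simps)
    then show ?thesis by (simp only: bes_P_ode mult_zero_right)
  qed
  have q: "x * ?q2 + bes_q1 x + x * bes_q x = 2 * bes_j1 x"
  proof -
    have "x * ?q2 + bes_q1 x + x * bes_q x
      = x * ((x\<^sup>2 / 4) * bes_Q 2 (x\<^sup>2 / 4) + bes_Q 1 (x\<^sup>2 / 4) + bes_Q 0 (x\<^sup>2 / 4))"
      by (simp add: bes_q_def bes_q1_def field_simps)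
    then show ?thesis by (simp only: bes_Q_ode bes_j1_def) simp
  qed
  have "x * (?c * ?j2 - 2 * bes_j1 x / x + bes_j x / (x * x) + ?q2) + bes_B1 x + x * bes_B x
     = ?c * (x * ?j2 + bes_j1 x + x * bes_j x) + (x * ?q2 + bes_q1 x + x * bes_q x) - 2 * bes_j1 x"
    using nz unfolding bes_B_def bes_B1_def by (simp add: field_simps)
  then show "x * (?c * ?j2 - 2 * bes_j1 x / x + bes_j x / (x * x) + ?q2) + bes_B1 x + x * bes_B x = 0"
    using j q by simp
qed

lemma bes_tendsto_0:
  shows "((\<lambda>r. bes_j (of_real r)) \<longlongrightarrow> 1) (at_right 0)"
    and "((\<lambda>r. bes_j1 (of_real r)) \<longlongrightarrow> 0) (at_right 0)"
    and "((\<lambda>r. of_real r * bes_B (of_real r)) \<longlongrightarrow> 0) (at_right 0)"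
    and "((\<lambda>r. of_real r * bes_B1 (of_real r)) \<longlongrightarrow> -1) (at_right 0)"
    and "((\<lambda>r. bes_B (of_real r) - (\<i> * of_real (pi / 2) - of_real (ln (r / 2) + euler_mascheroni))) \<longlongrightarrow> 0) (at_right 0)"
proof -
  have z: "((\<lambda>r. complex_of_real r) \<longlongrightarrow> 0) (at_right 0)"
    using tendsto_of_real[OF tendsto_ident_at, of 0 "{0<..}"] by simp
  have co: "isCont (bes_P n) w" "isCont (bes_Q n) w" for n w
    using has_field_derivative_bes_P has_field_derivative_bes_Q DERIV_isCont by blast+
  have z4: "((\<lambda>r. (complex_of_real r)\<^sup>2 / 4) \<longlongrightarrow> 0) (at_right 0)"
    using tendsto_divide[OF tendsto_power[OF z, of 2] tendsto_const, of 4] by simp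
  have tP: "((\<lambda>r. bes_P n ((of_real r)\<^sup>2 / 4)) \<longlongrightarrow> bes_P n 0) (at_right 0)"
   and tQ: "((\<lambda>r. bes_Q n ((of_real r)\<^sup>2 / 4)) \<longlongrightarrow> bes_Q n 0) (at_right 0)" for n
    using isCont_tendsto_compose[OF co(1) z4] isCont_tendsto_compose[OF co(2) z4] by auto
  show j: "((\<lambda>r. bes_j (of_real r)) \<longlongrightarrow> 1) (at_right 0)"
    using tP[of 0] by (simp add: bes_j_def bes_P_0)
  have r2: "((\<lambda>r. complex_of_real r / 2) \<longlongrightarrow> 0) (at_right 0)"
    using tendsto_divide[OF z tendsto_const, of 2] by simp
  show j1: "((\<lambda>r. bes_j1 (of_real r)) \<longlongrightarrow> 0) (at_right 0)"
    using tendsto_mult[OF tP[of 1] r2] by (simp add: bes_j1_def)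
  have q: "((\<lambda>r. bes_q (of_real r)) \<longlongrightarrow> 0) (at_right 0)"
    using tQ[of 0] by (simp add: bes_q_def bes_Q_0)
  have q1: "((\<lambda>r. bes_q1 (of_real r)) \<longlongrightarrow> 0) (at_right 0)"
    using tendsto_mult[OF tQ[of 1] r2] by (simp add: bes_q1_def)
  define c where "c = (\<lambda>r. \<i> * complex_of_real (pi / 2) - of_real (ln (r / 2) + euler_mascheroni))"
  have l: "bes_l (of_real r) = of_real (ln (r / 2) + euler_mascheroni)" if "0 < r" for r
    using that Ln_of_real[of "r / 2"] by (simp add: bes_l_def)
  have rc: "((\<lambda>r. of_real r * c r) \<longlongrightarrow> 0) (at_right 0)"
  proof -
    have "((\<lambda>r::real. r * (ln (r / 2) + euler_mascheroni)) \<longlongrightarrow> 0) (at_right 0)"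
      by real_asymp
    from tendsto_diff[OF tendsto_mult[OF z tendsto_const[of "\<i> * complex_of_real (pi / 2)"]] tendsto_of_real[OF this, where 'a = complex]]
    show ?thesis by (simp add: c_def algebra_simps)
  qed
  have ev: "eventually (\<lambda>r::real. 0 < r) (at_right 0)"
    by (simp add: eventually_at_right_less)
  have lim: "((\<lambda>r. (of_real r * c r) * bes_j (of_real r) + of_real r * bes_q (of_real r)) \<longlongrightarrow> 0 * 1 + 0 * 0) (at_right 0)"
    by (intro tendsto_intros rc j z q)
  moreover have "eventually (\<lambda>r. (of_real r * c r) * bes_j (of_real r) + of_real r * bes_q (of_real r) = of_real r * bes_B (of_real r)) (at_right 0)"
    using ev by eventually_elim (simp add: bes_B_def l c_def algebra_simps)
  ultimately show "((\<lambda>r. of_real r * bes_B (of_real r)) \<longlongrightarrow> 0) (at_right 0)"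
    using Lim_transform_eventually by fastforce
  have lim: "((\<lambda>r. (of_real r * c r) * bes_j1 (of_real r) - bes_j (of_real r) + of_real r * bes_q1 (of_real r)) \<longlongrightarrow> 0 * 0 - 1 + 0 * 0) (at_right 0)"
    by (intro tendsto_intros rc j j1 z q1)
  moreover have "eventually (\<lambda>r. (of_real r * c r) * bes_j1 (of_real r) - bes_j (of_real r) + of_real r * bes_q1 (of_real r) = of_real r * bes_B1 (of_real r)) (at_right 0)"
    using ev by eventually_elim (simp add: bes_B1_def l c_def algebra_simps)
  ultimately show "((\<lambda>r. of_real r * bes_B1 (of_real r)) \<longlongrightarrow> -1) (at_right 0)"
    using Lim_transform_eventually by fastforce
  have jd: "((\<lambda>r. (bes_j (of_real r) - 1) / of_real r) \<longlongrightarrow> 0) (at_right 0)"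
  proof -
    have "((\<lambda>h. (bes_j (0 + h) - bes_j 0) / h) \<longlongrightarrow> bes_j1 0) (at 0)"
      using bes_j_deriv[of 0] unfolding DERIV_def .
    then have *: "((\<lambda>h. (bes_j h - 1) / h) \<longlongrightarrow> 0) (at 0)"
      by (simp add: bes_j_def bes_j1_def bes_P_0)
    have "filterlim complex_of_real (at 0) (at_right 0)"
      using z by (auto simp: filterlim_at eventually_at_filter)
    from filterlim_compose[OF * this] show ?thesis .
  qed
  have lim: "((\<lambda>r. (of_real r * c r) * ((bes_j (of_real r) - 1) / of_real r) + bes_q (of_real r)) \<longlongrightarrow> 0 * 0 + 0) (at_right 0)"
    by (intro tendsto_intros rc jd q)
  moreover have "eventually (\<lambda>r. (of_real r * c r) * ((bes_j (of_real r) - 1) / of_real r) + bes_q (of_real r) = bes_B (of_real r) - c r) (at_right 0)"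
    using ev
  proof eventually_elim
    case (elim r)
    then have 1: "(of_real r * c r) * ((bes_j (of_real r) - 1) / of_real r) = c r * (bes_j (of_real r) - 1)"
      by simp
    have 2: "bes_B (of_real r) = c r * bes_j (of_real r) + bes_q (of_real r)"
      using elim by (simp add: bes_B_def l c_def)
    show ?case unfolding 1 2 by (simp add: algebra_simps)
  qed
  ultimately have "((\<lambda>r. bes_B (of_real r) - c r) \<longlongrightarrow> 0) (at_right 0)"
    using Lim_transform_eventually by fastforce
  then show "((\<lambda>r. bes_B (of_real r) - (\<i> * of_real (pi / 2) - of_real (ln (r / 2) + euler_mascheroni))) \<longlongrightarrow> 0) (at_right 0)"
    by (simp add: c_def)
qed

text \<open>The difference f solves Bessel's equation and tends to 0 at the origin. Its weighted
  Wronskian with \<open>bes_j\<close> is a constant, which has to vanish since f has no logarithm;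
  then the one with \<open>bes_B\<close> vanishes as well. As \<open>bes_j\<close> and
  \<open>bes_B\<close> have Wronskian constant -1, Cramer's rule gives f = 0.\<close>

lemma hk_Phi_eq_bes_B:
  assumes "0 < Re x"
  shows "hk_Phi 0 x = bes_B x"
proof -
  define f where "f = (\<lambda>x. hk_Phi 0 x - bes_B x)"
  define f1 where "f1 = (\<lambda>x. hk_Phi 1 x - bes_B1 x)"
  have sol: "bes_sol f f1"
    unfolding f_def f1_def by (intro bes_sol_diff bes_sol_Phi bes_sol_B)
  have ev: "eventually (\<lambda>r::real. 0 < r) (at_right 0)"
    by (simp add: eventually_at_right_less)
  have z: "((\<lambda>r. complex_of_real r) \<longlongrightarrow> 0) (at_right 0)"
    using tendsto_of_real[OF tendsto_ident_at, of 0 "{0<..}"] by simp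
  have f0: "((\<lambda>r. f (of_real r)) \<longlongrightarrow> 0) (at_right 0)"
  proof -
    define c where "c = (\<lambda>r. \<i> * complex_of_real (pi / 2) - of_real (ln (r / 2) + euler_mascheroni))"
    define e where "e = (\<lambda>r. exp (\<i> * complex_of_real r))"
    have d: "((\<lambda>r. exp (- (\<i> * complex_of_real r)) * hk_Phi 0 (of_real r) - c r) \<longlongrightarrow> 0) (at_right 0)"
    proof (rule Lim_null_comparison)
      show "\<forall>\<^sub>F r in at_right 0. norm (exp (- (\<i> * complex_of_real r)) * hk_Phi 0 (of_real r) - c r) \<le> 4 * pi * sqrt r"
        using ev by eventually_elim (simp only: c_def hk_Phi_near_0)
      show "((\<lambda>r. 4 * pi * sqrt r) \<longlongrightarrow> 0) (at_right 0)" by real_asymp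
    qed
    have el: "(e \<longlongrightarrow> 1) (at_right 0)"
      unfolding e_def using tendsto_exp[OF tendsto_mult[OF tendsto_const z, of \<i>]] by simp
    \<comment> \<open>The estimate near 0 concerns e^(-ir) times the function. Multiplying e^(ir)
      back is harmless: e^(ir) - 1 is of order r and beats the logarithm in
      \<open>c\<close>.\<close>
    have rc: "((\<lambda>r. (e r - 1) * c r) \<longlongrightarrow> 0) (at_right 0)"
    proof -
      have "((\<lambda>h. (exp (0 + h) - exp 0) / h) \<longlongrightarrow> exp 0) (at (0::complex))"
        using DERIV_exp[of 0] unfolding DERIV_def .
      then have *: "((\<lambda>h::complex. (exp h - 1) / h) \<longlongrightarrow> 1) (at 0)" by simp
      have "((\<lambda>r. \<i> * complex_of_real r) \<longlongrightarrow> 0) (at_right 0)"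
        using tendsto_mult[OF tendsto_const z, of \<i>] by simp
      then have "filterlim (\<lambda>r. \<i> * complex_of_real r) (at 0) (at_right 0)"
        using ev by (auto simp: filterlim_at elim: eventually_mono)
      from filterlim_compose[OF * this]
      have 1: "((\<lambda>r. (e r - 1) / (\<i> * of_real r)) \<longlongrightarrow> 1) (at_right 0)" by (simp add: e_def)
      have "((\<lambda>r::real. r * (ln (r / 2) + euler_mascheroni)) \<longlongrightarrow> 0) (at_right 0)"
        by real_asymp
      from tendsto_diff[OF tendsto_mult[OF z tendsto_const[of "\<i> * complex_of_real (pi / 2)"]] tendsto_of_real[OF this, where 'a = complex]]
      have 2: "((\<lambda>r. of_real r * c r) \<longlongrightarrow> 0) (at_right 0)" by (simp add: c_def algebra_simps)
      have lim: "((\<lambda>r. \<i> * ((e r - 1) / (\<i> * of_real r)) * (of_real r * c r)) \<longlongrightarrow> \<i> * 1 * 0) (at_right 0)"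
        by (intro tendsto_intros 1 2)
      moreover have "\<forall>\<^sub>F r in at_right 0. \<i> * ((e r - 1) / (\<i> * of_real r)) * (of_real r * c r) = (e r - 1) * c r"
        using ev by eventually_elim simp
      ultimately show ?thesis using Lim_transform_eventually by fastforce
    qed
    have B: "((\<lambda>r. bes_B (of_real r) - c r) \<longlongrightarrow> 0) (at_right 0)"
      using bes_tendsto_0(5) by (simp add: c_def)
    have "((\<lambda>r. e r * (exp (- (\<i> * complex_of_real r)) * hk_Phi 0 (of_real r) - c r) + (e r - 1) * c r
          - (bes_B (of_real r) - c r)) \<longlongrightarrow> 1 * 0 + 0 - 0) (at_right 0)"
      by (intro tendsto_intros d el rc B)
    moreover have "e r * (exp (- (\<i> * complex_of_real r)) * hk_Phi 0 (of_real r) - c r) + (e r - 1) * c r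
          - (bes_B (of_real r) - c r) = f (of_real r)" for r
    proof -
      have "e r * exp (- (\<i> * complex_of_real r)) = 1" by (simp add: e_def mult_exp_exp)
      then have "e r * (exp (- (\<i> * complex_of_real r)) * hk_Phi 0 (of_real r)) = hk_Phi 0 (of_real r)"
        by (metis mult.assoc mult_1)
      then show ?thesis by (simp add: f_def algebra_simps)
    qed
    ultimately show ?thesis by simp
  qed
  obtain c1 where c1: "\<And>x. 0 < Re x \<Longrightarrow> x * (f x * bes_j1 x - f1 x * bes_j x) = c1"
    using bes_sol_wronskian[OF sol bes_sol_j] by blast
  obtain c2 where c2: "\<And>x. 0 < Re x \<Longrightarrow> x * (f x * bes_B1 x - f1 x * bes_B x) = c2"
    using bes_sol_wronskian[OF sol bes_sol_B] by blast
  obtain c3 where c3: "\<And>x. 0 < Re x \<Longrightarrow> x * (bes_j x * bes_B1 x - bes_j1 x * bes_B x) = c3"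
    using bes_sol_wronskian[OF bes_sol_j bes_sol_B] by blast
  have jnz: "eventually (\<lambda>r. bes_j (of_real r) \<noteq> 0) (at_right 0)"
    using tendsto_imp_eventually_ne[OF bes_tendsto_0(1)] by simp
  have rf1: "((\<lambda>r. of_real r * f1 (of_real r)) \<longlongrightarrow> - c1) (at_right 0)"
  proof -
    have "((\<lambda>r. (of_real r * (f (of_real r) * bes_j1 (of_real r)) - c1) / bes_j (of_real r)) \<longlongrightarrow> (0 * (0 * 0) - c1) / 1) (at_right 0)"
      by (intro tendsto_intros z f0 bes_tendsto_0) auto
    moreover have "\<forall>\<^sub>F r in at_right 0. (of_real r * (f (of_real r) * bes_j1 (of_real r)) - c1) / bes_j (of_real r) = of_real r * f1 (of_real r)"
      using ev jnz
    proof eventually_elim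
      case (elim r)
      have "of_real r * (f (of_real r) * bes_j1 (of_real r)) - c1 = of_real r * f1 (of_real r) * bes_j (of_real r)"
        using c1[of "of_real r"] elim by (simp add: algebra_simps)
      then show ?case using elim by simp
    qed
    ultimately show ?thesis using Lim_transform_eventually by fastforce
  qed
  text \<open>If \<open>c1\<close> were nonzero then \<open>f\<close> would grow logarithmically at 0.\<close>
  have c1_small: "norm c1 * ln 2 \<le> e" if e: "0 < e" for e :: real
  proof -
    have "eventually (\<lambda>r. norm (of_real r * f1 (of_real r) + c1) < e) (at_right 0)"
      using tendstoD[OF rf1 e] by (simp add: dist_norm)
    then obtain d where d: "0 < d" "\<And>r. 0 < r \<Longrightarrow> r < d \<Longrightarrow> norm (of_real r * f1 (of_real r) + c1) < e"
      by (auto simp: eventually_at_right_field)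
    have le: "norm (f (of_real (2 * r)) - f (of_real r) + c1 * of_real (ln 2)) \<le> e" if r: "0 < r" "2 * r < d" for r
    proof -
      \<comment> \<open>Adding \<open>c1 * Ln x\<close> cancels the leading part -c1/r of
        \<open>f1\<close>, so F changes by at most e between r and 2r, while the logarithm alone
        changes by ln 2. Comparing these two points avoids integrating down to the origin.\<close>
      define F where "F = (\<lambda>x. f x + c1 * Ln x)"
      define S where "S = complex_of_real ` {r..2 * r}"
      have "norm (F (of_real (2 * r)) - F (of_real r)) \<le> (e / r) * norm (of_real (2 * r) - complex_of_real r)"
      proof (rule field_differentiable_bound[of S F "\<lambda>x. f1 x + c1 * inverse x"])
        show "convex S" unfolding S_def
          by (intro convex_linear_image) (auto intro!: bounded_linear.linear bounded_linear_of_real)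
        fix x assume "x \<in> S"
        then obtain t where t: "x = of_real t" "r \<le> t" "t \<le> 2 * r" by (auto simp: S_def)
        then have nn: "x \<notin> \<real>\<^sub>\<le>\<^sub>0" "0 < Re x" using r by (auto simp: complex_nonpos_Reals_iff)
        have "(f has_field_derivative f1 x) (at x)" using sol nn by (auto simp: bes_sol_def)
        then have "(F has_field_derivative f1 x + c1 * inverse x) (at x)"
          unfolding F_def by (intro DERIV_add DERIV_cmult has_field_derivative_Ln nn)
        then show "(F has_field_derivative f1 x + c1 * inverse x) (at x within S)"
          by (rule has_field_derivative_at_within)
        have "f1 x + c1 * inverse x = (of_real t * f1 (of_real t) + c1) / of_real t"
          using t r by (simp add: field_simps)
        then have "norm (f1 x + c1 * inverse x) = norm (of_real t * f1 (of_real t) + c1) / t"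
          using t r by (simp add: norm_divide)
        also have "\<dots> \<le> e / r"
          using d(2)[of t] t r e by (intro frac_le) auto
        finally show "norm (f1 x + c1 * inverse x) \<le> e / r" .
      qed (use r in \<open>auto simp: S_def simp del: of_real_mult\<close>)
      also have "\<dots> = e"
      proof -
        have "norm (of_real (2 * r) - complex_of_real r) = r"
          using r by (metis abs_of_pos add_diff_cancel_left' mult_2 norm_of_real of_real_diff)
        then show ?thesis using r by simp
      qed
      finally have "norm (F (of_real (2 * r)) - F (of_real r)) \<le> e" .
      moreover have "F (of_real (2 * r)) - F (of_real r) = f (of_real (2 * r)) - f (of_real r) + c1 * of_real (ln 2)"
      proof -
        have "Ln (of_real (2 * r)) = of_real (ln 2 + ln r)" "Ln (of_real r) = complex_of_real (ln r)"
          using r Ln_of_real[of "2 * r"] Ln_of_real[of r] ln_mult[of 2 r] by (simp_all del: of_real_mult of_real_add)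
        then show ?thesis by (simp add: F_def algebra_simps del: of_real_mult)
      qed
      ultimately show ?thesis by simp
    qed
    have t2: "filterlim (\<lambda>r::real. 2 * r) (at_right 0) (at_right 0)" by real_asymp
    have lim: "((\<lambda>r. norm (f (of_real (2 * r)) - f (of_real r) + c1 * of_real (ln 2))) \<longlongrightarrow> norm (0 - 0 + c1 * of_real (ln 2))) (at_right 0)"
      by (intro tendsto_intros f0 filterlim_compose[OF f0 t2])
    have "norm (0 - 0 + c1 * of_real (ln 2)) \<le> e"
    proof (rule tendsto_upperbound[OF lim])
      show "\<forall>\<^sub>F r in at_right 0. norm (f (of_real (2 * r)) - f (of_real r) + c1 * of_real (ln 2)) \<le> e"
        unfolding eventually_at_right[OF d(1)] using le d(1) by (intro exI[of _ "d/2"]) auto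
    qed simp
    then show ?thesis by (simp add: norm_mult)
  qed
  have c10: "c1 = 0"
  proof (rule ccontr)
    assume "c1 \<noteq> 0"
    then have "0 < norm c1 * ln 2" by simp
    then show False using c1_small[of "norm c1 * ln 2 / 2"] by simp
  qed
  have c20: "c2 = 0"
  proof -
    have "((\<lambda>r. f (of_real r) * (of_real r * bes_B1 (of_real r)) - f (of_real r) * (bes_j1 (of_real r) / bes_j (of_real r)) * (of_real r * bes_B (of_real r)))
       \<longlongrightarrow> 0 * (-1) - 0 * (0 / 1) * 0) (at_right 0)"
      by (intro tendsto_intros f0 bes_tendsto_0) auto
    moreover have "\<forall>\<^sub>F r in at_right 0. f (of_real r) * (of_real r * bes_B1 (of_real r)) - f (of_real r) * (bes_j1 (of_real r) / bes_j (of_real r)) * (of_real r * bes_B (of_real r)) = c2"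
      using ev jnz
    proof eventually_elim
      case (elim r)
      have "f1 (of_real r) = f (of_real r) * (bes_j1 (of_real r) / bes_j (of_real r))"
        using c1[of "of_real r"] elim c10 by (simp add: field_simps)
      then show ?case using c2[of "of_real r"] elim by (simp add: algebra_simps)
    qed
    ultimately have "((\<lambda>r::real. c2) \<longlongrightarrow> 0) (at_right 0)" using Lim_transform_eventually by fastforce
    then show ?thesis by (simp add: tendsto_const_iff)
  qed
  have c30: "c3 = -1"
  proof -
    have "((\<lambda>r. bes_j (of_real r) * (of_real r * bes_B1 (of_real r)) - bes_j1 (of_real r) * (of_real r * bes_B (of_real r)))
       \<longlongrightarrow> 1 * (-1) - 0 * 0) (at_right 0)"
      by (intro tendsto_intros bes_tendsto_0)
    moreover have "\<forall>\<^sub>F r in at_right 0. bes_j (of_real r) * (of_real r * bes_B1 (of_real r)) - bes_j1 (of_real r) * (of_real r * bes_B (of_real r)) = c3"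
      using ev by eventually_elim (use c3 in \<open>simp add: algebra_simps\<close>)
    ultimately have "((\<lambda>r::real. c3) \<longlongrightarrow> -1) (at_right 0)" using Lim_transform_eventually by fastforce
    then show ?thesis by (simp add: tendsto_const_iff)
  qed
  have "f x * c3 = f x * (x * (bes_j x * bes_B1 x - bes_j1 x * bes_B x))" using c3 assms by simp
  also have "\<dots> = bes_j x * (x * (f x * bes_B1 x - f1 x * bes_B x)) - bes_B x * (x * (f x * bes_j1 x - f1 x * bes_j x))"
    by (simp add: algebra_simps)
  also have "\<dots> = 0" unfolding c1[OF assms] c2[OF assms] c10 c20 by simp
  finally show ?thesis using c30 by (simp add: f_def)
qed

lemma bes_B_hankel:
  assumes "0 < r"
  shows "bes_B (of_real r) = \<i> * of_real (pi / 2) * hankel_H0 r"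
proof -
  have J: "bes_j (of_real r) = of_real (bessel_J0 r)"
    using bes_P_0(2)[of r] by (simp add: bes_j_def)
  define q where "q = (\<Sum>m. (-1) ^ m * harm m * (r\<^sup>2 / 4) ^ m / (fact m)\<^sup>2)"
  have Q: "bes_q (of_real r) = of_real q"
    using bes_Q_0(2)[of r] by (simp add: bes_q_def q_def)
  have l: "bes_l (of_real r) = of_real (ln (r / 2) + euler_mascheroni)"
    using assms Ln_of_real[of "r / 2"] by (simp add: bes_l_def)
  have Y: "pi / 2 * bessel_Y0 r = (ln (r / 2) + euler_mascheroni) * bessel_J0 r - q"
    unfolding bessel_Y0_def q_def[symmetric] by (simp add: field_simps)
  have H: "\<i> * of_real (pi / 2) * hankel_H0 r = \<i> * of_real (pi / 2 * bessel_J0 r) - of_real (pi / 2 * bessel_Y0 r)"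
    by (rule complex_eqI) (simp_all add: hankel_H0_def)
  show ?thesis unfolding H Y
    by (simp add: bes_B_def J Q l algebra_simps)
qed

text \<open>The fundamental solution as a function of the squared distance.\<close>

definition hlm_g :: "real \<Rightarrow> real \<Rightarrow> complex" where
  "hlm_g \<kappa> t = \<i> / 4 * hankel_H0 (\<kappa> * sqrt t)"

definition hlm_g1 :: "real \<Rightarrow> real \<Rightarrow> complex" where
  "hlm_g1 \<kappa> t = of_real (\<kappa> / (4 * pi * sqrt t)) * hk_Phi 1 (of_real (\<kappa> * sqrt t))"

lemma hlm_g_Phi:
  assumes "0 < \<kappa>" "0 < t"
  shows "hlm_g \<kappa> t = hk_Phi 0 (of_real (\<kappa> * sqrt t)) / of_real (2 * pi)"
proof -
  have eq: "hk_Phi 0 (of_real (\<kappa> * sqrt t)) = \<i> * of_real (pi / 2) * hankel_H0 (\<kappa> * sqrt t)"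
    using assms bes_B_hankel[of "\<kappa> * sqrt t"] hk_Phi_eq_bes_B[of "of_real (\<kappa> * sqrt t)"]
    by (simp del: of_real_mult)
  show ?thesis unfolding hlm_g_def eq by simp
qed

lemma hlm_g_deriv:
  assumes "0 < \<kappa>" "0 < t"
  shows "(hlm_g \<kappa> has_vector_derivative hlm_g1 \<kappa> t) (at t)"
proof -
  have s: "((\<lambda>t. of_real (\<kappa> * sqrt t)) has_vector_derivative complex_of_real (\<kappa> / (2 * sqrt t))) (at t)"
    by (rule has_vector_derivative_of_real) (use assms in \<open>auto intro!: derivative_eq_intros simp: field_simps\<close>)
  have "((hk_Phi 0 \<circ> (\<lambda>t. of_real (\<kappa> * sqrt t))) has_vector_derivative
     (complex_of_real (\<kappa> / (2 * sqrt t)) * hk_Phi 1 (of_real (\<kappa> * sqrt t)))) (at t)"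
    by (rule field_vector_diff_chain_at[OF s hk_Phi_deriv]) (use assms in simp)
  then have "((\<lambda>t. hk_Phi 0 (of_real (\<kappa> * sqrt t)) / of_real (2 * pi)) has_vector_derivative
     (complex_of_real (\<kappa> / (2 * sqrt t)) * hk_Phi 1 (of_real (\<kappa> * sqrt t)) / of_real (2 * pi))) (at t)"
    unfolding o_def by (rule has_vector_derivative_divide)
  then have "((\<lambda>t. hk_Phi 0 (of_real (\<kappa> * sqrt t)) / of_real (2 * pi)) has_vector_derivative hlm_g1 \<kappa> t) (at t)"
    by (simp add: hlm_g1_def field_simps)
  then show ?thesis
    by (rule has_vector_derivative_transform_within_open[of _ _ _ "{0<..}"]) (use assms hlm_g_Phi in auto)
qed

text \<open>For a function g of t = |y|^2 in the plane the Laplacian is 4 t g'' + 4 g', so the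
  identity is the Helmholtz equation away from the singularity.\<close>

lemma hlm_g1_deriv:
  assumes "0 < \<kappa>" "0 < t"
  obtains g2 where "(hlm_g1 \<kappa> has_vector_derivative g2) (at t)"
    "4 * of_real t * g2 + 4 * hlm_g1 \<kappa> t + (of_real \<kappa>)\<^sup>2 * hlm_g \<kappa> t = 0"
proof -
  define x where "x = complex_of_real (\<kappa> * sqrt t)"
  have rx: "0 < Re x" using assms by (simp add: x_def)
  obtain d2 where d2: "(hk_Phi 1 has_field_derivative d2) (at x)" "x * d2 + hk_Phi 1 x + x * hk_Phi 0 x = 0"
    using hk_Phi_ode[OF rx] by blast
  have s: "((\<lambda>t. of_real (\<kappa> * sqrt t)) has_vector_derivative complex_of_real (\<kappa> / (2 * sqrt t))) (at t)"
    by (rule has_vector_derivative_of_real) (use assms in \<open>auto intro!: derivative_eq_intros simp: field_simps\<close>)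
  have p: "((\<lambda>t. hk_Phi 1 (of_real (\<kappa> * sqrt t))) has_vector_derivative
     (complex_of_real (\<kappa> / (2 * sqrt t)) * d2)) (at t)"
    using field_vector_diff_chain_at[OF s d2(1)[unfolded x_def]] by (simp add: o_def)
  have "((\<lambda>t. \<kappa> / (4 * pi * sqrt t)) has_real_derivative (- \<kappa> / (8 * pi * t * sqrt t))) (at t)"
    using assms by (auto intro!: derivative_eq_intros simp: field_simps)
  from has_vector_derivative_mult[OF has_vector_derivative_of_real[OF this] p]
  have g2: "(hlm_g1 \<kappa> has_vector_derivative
     (of_real (\<kappa> / (4 * pi * sqrt t)) * (complex_of_real (\<kappa> / (2 * sqrt t)) * d2)
      + of_real (- \<kappa> / (8 * pi * t * sqrt t)) * hk_Phi 1 x)) (at t)" (is "(_ has_vector_derivative ?g2) _")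
    by (simp add: hlm_g1_def[abs_def] x_def)
  define w where "w = complex_of_real (sqrt t)"
  have w: "w \<noteq> 0" "complex_of_real t = w * w" using assms
    by (simp_all add: w_def flip: of_real_mult)
  have x': "x = of_real \<kappa> * w" by (simp add: x_def w_def)
  have pi0: "complex_of_real pi \<noteq> 0" by simp
  have "4 * of_real t * ?g2 + 4 * hlm_g1 \<kappa> t + (of_real \<kappa>)\<^sup>2 * hlm_g \<kappa> t
     = of_real \<kappa> / (2 * of_real pi * w) * (x * d2 + hk_Phi 1 x + x * hk_Phi 0 x)"
    unfolding hlm_g1_def hlm_g_Phi[OF assms] x_def[symmetric]
    using w pi0 by (simp add: x' w_def[symmetric] power2_eq_square field_simps)
  then have "4 * of_real t * ?g2 + 4 * hlm_g1 \<kappa> t + (of_real \<kappa>)\<^sup>2 * hlm_g \<kappa> t = 0"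
    using d2 by simp
  with g2 that show ?thesis by blast
qed

lemma hlm_g_bound:
  assumes "0 < \<kappa>" "0 < t"
  shows "norm (hlm_g \<kappa> t) \<le> 1 / sqrt (\<kappa> * sqrt t)"
proof -
  have "norm (hk_Phi 0 (of_real (\<kappa> * sqrt t))) \<le> pi / sqrt (\<kappa> * sqrt t)"
    by (rule hk_Phi_norm_le) (use assms in auto)
  then have "norm (hk_Phi 0 (of_real (\<kappa> * sqrt t))) / (2 * pi) \<le> (pi / sqrt (\<kappa> * sqrt t)) / (2 * pi)"
    by (rule divide_right_mono) simp
  moreover have "norm (hlm_g \<kappa> t) = norm (hk_Phi 0 (of_real (\<kappa> * sqrt t))) / (2 * pi)"
    by (simp only: hlm_g_Phi[OF assms] norm_divide norm_of_real) simp
  ultimately have "norm (hlm_g \<kappa> t) \<le> (pi / sqrt (\<kappa> * sqrt t)) / (2 * pi)" by simp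
  also have "\<dots> \<le> 1 / sqrt (\<kappa> * sqrt t)" using assms by (simp add: field_simps)
  finally show ?thesis .
qed

text \<open>The outgoing condition: \<open>\<partial>\<^sub>r G - i \<kappa> G = O(r\<^bsup>-3/2\<^esup>)\<close>.\<close>

lemma hlm_g_outgoing:
  assumes "0 < \<kappa>" "0 < t"
  shows "norm (of_real (2 * sqrt t) * hlm_g1 \<kappa> t - \<i> * of_real \<kappa> * hlm_g \<kappa> t) \<le> \<kappa> / (\<kappa> * sqrt t * sqrt (\<kappa> * sqrt t))"
proof -
  define x where "x = \<kappa> * sqrt t"
  have x: "0 < x" using assms by (simp add: x_def)
  have "of_real (2 * sqrt t) * hlm_g1 \<kappa> t - \<i> * of_real \<kappa> * hlm_g \<kappa> t
     = of_real (\<kappa> / (2 * pi)) * (hk_Phi 1 (of_real x) - \<i> * hk_Phi 0 (of_real x))"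
    using assms unfolding hlm_g_Phi[OF assms] hlm_g1_def x_def[symmetric] by (simp add: field_simps)
  then have "norm (of_real (2 * sqrt t) * hlm_g1 \<kappa> t - \<i> * of_real \<kappa> * hlm_g \<kappa> t)
     = (\<kappa> / (2 * pi)) * norm (hk_Phi 1 (of_real x) - \<i> * hk_Phi 0 (of_real x))"
    using assms by (simp only: norm_mult norm_of_real) simp
  also have "\<dots> \<le> (\<kappa> / (2 * pi)) * (2 * pi / (x * sqrt x))"
    using hk_Phi_norm_le(2)[OF x] assms by (intro mult_left_mono) auto
  also have "\<dots> = \<kappa> / (x * sqrt x)" by simp
  finally show ?thesis by (simp add: x_def)
qed

text \<open>The strength of the singularity: near 0 the kernel behaves like -(1/(4 pi)) ln t, that
  is -(1/(2 pi)) ln r. This normalisation is what makes it a fundamental solution.\<close>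

lemma hlm_g1_at_0:
  assumes "0 < \<kappa>"
  shows "((\<lambda>t. of_real t * hlm_g1 \<kappa> t) \<longlongrightarrow> - 1 / of_real (4 * pi)) (at_right 0)"
proof -
  have eq: "hk_Phi 1 x = bes_B1 x" if "0 < Re x" for x
  proof (rule DERIV_unique)
    show "(bes_B has_field_derivative bes_B1 x) (at x)"
      using bes_sol_B that by (simp add: bes_sol_def)
    show "(bes_B has_field_derivative hk_Phi 1 x) (at x)"
      by (rule has_field_derivative_transform_within_open[OF hk_Phi_deriv[OF that] open_halfspace_Re_gt[of 0]])
        (use that hk_Phi_eq_bes_B in auto)
  qed
  have t: "filterlim (\<lambda>t. \<kappa> * sqrt t) (at_right 0) (at_right 0)"
    using assms by real_asymp
  have "((\<lambda>t. of_real (\<kappa> * sqrt t) * bes_B1 (of_real (\<kappa> * sqrt t)) / of_real (4 * pi)) \<longlongrightarrow> -1 / of_real (4 * pi)) (at_right 0)"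
    by (intro tendsto_divide tendsto_const filterlim_compose[OF bes_tendsto_0(4) t]) auto
  moreover have "\<forall>\<^sub>F t in at_right 0. of_real (\<kappa> * sqrt t) * bes_B1 (of_real (\<kappa> * sqrt t)) / of_real (4 * pi) = of_real t * hlm_g1 \<kappa> t"
    using eventually_at_right_less[of 0]
  proof eventually_elim
    case (elim t)
    define w where "w = complex_of_real (sqrt t)"
    have w: "w \<noteq> 0" "complex_of_real t = w * w" using elim
      by (simp_all add: w_def flip: of_real_mult)
    have e: "hk_Phi 1 (of_real (\<kappa> * sqrt t)) = bes_B1 (of_real (\<kappa> * sqrt t))"
      by (rule eq) (use elim assms in simp)
    show ?case
      unfolding hlm_g1_def e using w by (simp add: w_def[symmetric] field_simps)
  qed
  ultimately show ?thesis using Lim_transform_eventually by fastforce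
qed

lemma helmholtz_G_hlm_g: "helmholtz_G \<kappa> X Y = hlm_g \<kappa> ((dist X Y)\<^sup>2)"
  by (simp add: helmholtz_G_def hlm_g_def)

section \<open>Green's identity in the plane\<close>

text \<open>The partial derivatives are carried along as explicit functions. Second derivatives of
  products then come out algebraically by applying the same rules to the components of the
  gradient.\<close>

definition c1 :: "(real^'n::finite \<Rightarrow> complex) \<Rightarrow> ('n \<Rightarrow> real^'n \<Rightarrow> complex) \<Rightarrow> bool" where
  "c1 f f' \<longleftrightarrow>
     (\<forall>x. (f has_derivative (\<lambda>v. \<Sum>j\<in>UNIV. of_real (v $ j) * f' j x)) (at x)) \<and>
     (\<forall>j. continuous_on UNIV (f' j))"

lemma c1_cont: "c1 f f' \<Longrightarrow> continuous_on A f"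
  unfolding c1_def
  by (meson continuous_at_imp_continuous_on has_derivative_continuous)

lemma c1_cont': "c1 f f' \<Longrightarrow> continuous_on A (f' j)"
  unfolding c1_def using continuous_on_subset by blast

lemma c1_const: "c1 (\<lambda>x. c) (\<lambda>j x. 0)"
  by (simp add: c1_def)

lemma c1_add:
  assumes "c1 f f'" "c1 g g'"
  shows "c1 (\<lambda>x. f x + g x) (\<lambda>j x. f' j x + g' j x)"
  using assms unfolding c1_def
  by (auto intro!: continuous_intros derivative_eq_intros simp: sum.distrib algebra_simps)

lemma c1_diff:
  assumes "c1 f f'" "c1 g g'"
  shows "c1 (\<lambda>x. f x - g x) (\<lambda>j x. f' j x - g' j x)"
  using assms unfolding c1_def
  by (auto intro!: continuous_intros derivative_eq_intros simp: sum_subtractf algebra_simps)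

lemma c1_mult:
  assumes "c1 f f'" "c1 g g'"
  shows "c1 (\<lambda>x. f x * g x) (\<lambda>j x. f' j x * g x + f x * g' j x)"
  unfolding c1_def
proof (intro conjI allI)
  fix x
  have "((\<lambda>x. f x * g x) has_derivative (\<lambda>v. f x * (\<Sum>j\<in>UNIV. of_real (v $ j) * g' j x) + (\<Sum>j\<in>UNIV. of_real (v $ j) * f' j x) * g x)) (at x)"
    using assms unfolding c1_def by (intro has_derivative_mult) auto
  then show "((\<lambda>x. f x * g x) has_derivative (\<lambda>v. \<Sum>j\<in>UNIV. of_real (v $ j) * (f' j x * g x + f x * g' j x))) (at x)"
    by (rule has_derivative_eq_rhs)
      (simp add: fun_eq_iff sum_distrib_left sum_distrib_right sum.distrib[symmetric] algebra_simps)
next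
  show "continuous_on UNIV (\<lambda>x. f' j x * g x + f x * g' j x)" for j
    by (intro continuous_intros c1_cont[OF assms(1)] c1_cont[OF assms(2)] c1_cont'[OF assms(1)] c1_cont'[OF assms(2)])
qed

lemma c1_cnj:
  assumes "c1 f f'"
  shows "c1 (\<lambda>x. cnj (f x)) (\<lambda>j x. cnj (f' j x))"
  unfolding c1_def
proof (intro conjI allI)
  fix x
  have "((\<lambda>x. cnj (f x)) has_derivative (\<lambda>v. cnj (\<Sum>j\<in>UNIV. of_real (v $ j) * f' j x))) (at x)"
    using assms unfolding c1_def by (intro bounded_linear.has_derivative[OF bounded_linear_cnj]) auto
  then show "((\<lambda>x. cnj (f x)) has_derivative (\<lambda>v. \<Sum>j\<in>UNIV. of_real (v $ j) * cnj (f' j x))) (at x)"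
    by (rule has_derivative_eq_rhs) (simp add: cnj_sum fun_eq_iff)
next
  show "continuous_on UNIV (\<lambda>x. cnj (f' j x))" for j
    by (intro continuous_intros c1_cont'[OF assms])
qed

lemma c1_compose:
  fixes p :: "real \<Rightarrow> complex" and h :: "real^'n::finite \<Rightarrow> real"
  assumes p: "\<And>x. (p has_vector_derivative p1 (h x)) (at (h x))" "continuous_on (range h) p1"
    and h: "\<And>x. (h has_derivative (\<lambda>v. \<Sum>j\<in>UNIV. v $ j * h' j x)) (at x)" "\<And>j. continuous_on UNIV (h' j)"
  shows "c1 (\<lambda>x. p (h x)) (\<lambda>j x. of_real (h' j x) * p1 (h x))"
  unfolding c1_def
proof (intro conjI allI)
  fix x
  have "((\<lambda>x. p (h x)) has_derivative (\<lambda>v. (\<Sum>j\<in>UNIV. v $ j * h' j x) *\<^sub>R p1 (h x))) (at x)"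
    using has_derivative_compose[OF h(1)[of x] p(1)[of x, unfolded has_vector_derivative_def]] by simp
  then show "((\<lambda>x. p (h x)) has_derivative (\<lambda>v. \<Sum>j\<in>UNIV. of_real (v $ j) * (of_real (h' j x) * p1 (h x)))) (at x)"
    by (rule has_derivative_eq_rhs)
      (simp add: fun_eq_iff scaleR_conv_of_real sum_distrib_right mult.assoc)
next
  fix j
  have "continuous_on UNIV h" using h(1)
    by (meson continuous_at_imp_continuous_on has_derivative_continuous)
  then show "continuous_on UNIV (\<lambda>x. of_real (h' j x) * p1 (h x))"
    by (intro continuous_intros h(2) continuous_on_compose2[OF p(2)]) auto
qed

lemma sqdist_deriv:
  fixes x0 :: "real^'n::finite"
  shows "((\<lambda>y. (norm (y - x0))\<^sup>2) has_derivative (\<lambda>v. \<Sum>j\<in>UNIV. v $ j * (2 * (y - x0) $ j))) (at y)"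
proof -
  have "((\<lambda>y. (y - x0) \<bullet> (y - x0)) has_derivative (\<lambda>v. (y - x0) \<bullet> v + v \<bullet> (y - x0))) (at y)"
    by (auto intro!: derivative_eq_intros)
  then show ?thesis
    unfolding power2_norm_eq_inner
    by (rule has_derivative_eq_rhs)
      (simp add: inner_vec_def fun_eq_iff sum.distrib[symmetric] algebra_simps)
qed

lemma c1_radial:
  fixes x0 :: "real^'n::finite"
  assumes "\<And>t. (p has_vector_derivative p1 t) (at t)" "continuous_on UNIV p1"
  shows "c1 (\<lambda>y. p ((norm (y - x0))\<^sup>2)) (\<lambda>j y. of_real (2 * (y - x0) $ j) * p1 ((norm (y - x0))\<^sup>2))"
  by (rule c1_compose[OF assms(1) continuous_on_subset[OF assms(2)] sqdist_deriv])
    (auto intro!: continuous_intros)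

lemma has_derivative_axis:
  fixes f :: "real^'n::finite \<Rightarrow> 'a::real_normed_vector"
  assumes "(f has_derivative f') (at x)"
  shows "((\<lambda>t. f (x + t *\<^sub>R axis j 1)) has_vector_derivative f' (axis j 1)) (at 0)" "pd j f x = f' (axis j 1)"
proof -
  have "((\<lambda>t::real. x + t *\<^sub>R axis j 1) has_derivative (\<lambda>t. t *\<^sub>R axis j 1)) (at 0)"
    by (auto intro!: derivative_eq_intros)
  moreover have "(f has_derivative f') (at (x + 0 *\<^sub>R axis j 1))" using assms by simp
  ultimately have "((\<lambda>t. f (x + t *\<^sub>R axis j 1)) has_derivative (\<lambda>t. f' (t *\<^sub>R axis j 1))) (at 0)"
    by (rule has_derivative_compose)
  moreover have "(\<lambda>t. f' (t *\<^sub>R axis j 1)) = (\<lambda>t. t *\<^sub>R f' (axis j 1))"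
    using assms by (simp add: has_derivative_def bounded_linear.linear linear_cmul)
  ultimately show "((\<lambda>t. f (x + t *\<^sub>R axis j 1)) has_vector_derivative f' (axis j 1)) (at 0)"
    by (simp add: has_vector_derivative_def)
  then show "pd j f x = f' (axis j 1)"
    unfolding pd_def by (rule vector_derivative_at)
qed

lemma differentiable_pd:
  fixes f :: "real^'n::finite \<Rightarrow> 'a::real_normed_vector"
  assumes "f differentiable (at x)"
  shows "(f has_derivative (\<lambda>v. \<Sum>j\<in>UNIV. (v $ j) *\<^sub>R pd j f x)) (at x)"
proof -
  obtain f' where f': "(f has_derivative f') (at x)" using assms by (auto simp: differentiable_def)
  have "f' v = (\<Sum>j\<in>UNIV. (v $ j) *\<^sub>R pd j f x)" for v
  proof -
    have lin: "linear f'" using f' by (simp add: has_derivative_def bounded_linear.linear)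
    have "v = (\<Sum>j\<in>UNIV. (v $ j) *\<^sub>R axis j 1)"
      by (simp add: vec_eq_iff axis_def if_distrib[of "\<lambda>x. _ * x"] sum.delta cong: if_cong)
    then have "f' v = (\<Sum>j\<in>UNIV. (v $ j) *\<^sub>R f' (axis j 1))"
      by (metis (no_types, lifting) lin linear_sum linear_cmul sum.cong)
    then show ?thesis by (simp add: has_derivative_axis(2)[OF f'])
  qed
  then have "f' = (\<lambda>v. \<Sum>j\<in>UNIV. (v $ j) *\<^sub>R pd j f x)" by auto
  with f' show ?thesis by simp
qed

lemma Ck_2_c1:
  assumes "Ck 2 (f :: real^'n::finite \<Rightarrow> complex)"
  shows "c1 f (\<lambda>j. pd j f)" "c1 (pd i f) (\<lambda>j. pd j (pd i f))"
proof -
  have d: "f differentiable (at x)" "pd i f differentiable (at x)" for x i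
    using assms[unfolded Ck_def, THEN conjunct1, THEN spec, of "[]"]
      assms[unfolded Ck_def, THEN conjunct1, THEN spec, of "[i]"]
    by (auto simp: differentiable_on_def)
  have c: "continuous_on UNIV (pd j f)" "continuous_on UNIV (pd j (pd i f))" for i j
    using assms[unfolded Ck_def, THEN conjunct2, THEN spec, of "[j]"]
      assms[unfolded Ck_def, THEN conjunct2, THEN spec, of "[j, i]"]
    by auto
  show "c1 f (\<lambda>j. pd j f)" "c1 (pd i f) (\<lambda>j. pd j (pd i f))"
    unfolding c1_def using differentiable_pd[OF d(1)] differentiable_pd[OF d(2)] c
    by (auto simp: scaleR_conv_of_real)
qed

section \<open>Integration by parts on the whole space\<close>

lemma lborel_integral_translate:
  fixes f :: "'a::euclidean_space \<Rightarrow> 'b::{banach, second_countable_topology}"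
  assumes "f \<in> borel_measurable borel"
  shows "(\<integral>x. f (a + x) \<partial>lborel) = (\<integral>x. f x \<partial>lborel)"
proof -
  have "(\<integral>x. f x \<partial>lborel) = (\<integral>x. f x \<partial>distr lborel borel ((+) a))"
    by (simp add: lborel_distr_plus)
  also have "\<dots> = (\<integral>x. f (a + x) \<partial>lborel)"
    using assms by (subst integral_distr) auto
  finally show ?thesis by simp
qed

lemma integrable_compact_support:
  fixes f :: "'a::euclidean_space \<Rightarrow> 'b::{banach, second_countable_topology}"
  assumes "continuous_on UNIV f" "\<And>x. R < norm x \<Longrightarrow> f x = 0"
  shows "integrable lborel f"
proof -
  have "integrable lborel (\<lambda>x. indicator (cball 0 R) x *\<^sub>R f x)"
    by (rule borel_integrable_compact) (auto intro: continuous_on_subset[OF assms(1)])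
  moreover have "(\<lambda>x. indicator (cball 0 R) x *\<^sub>R f x) = f"
    using assms(2) by (force simp: indicator_def)
  ultimately show ?thesis by simp
qed

text \<open>Translation invariance makes the integral of every difference quotient in direction j
  vanish; dominated convergence passes to the derivative. Neither iterated integrals nor boundaries
  occur.\<close>

lemma c1_integral_pd:
  fixes f :: "real^'n::finite \<Rightarrow> complex"
  assumes c: "c1 f f'" and supp: "\<And>x. R < norm x \<Longrightarrow> f x = 0"
  shows "(\<integral>x. f' j x \<partial>lborel) = 0"
proof -
  define e where "e = (axis j 1 :: real^'n)"
  have ne: "norm e = 1" by (simp add: e_def)
  have dir: "((\<lambda>t. f (x + t *\<^sub>R e)) has_vector_derivative f' j (x + t *\<^sub>R e)) (at t within A)" for x t A
  proof -
    have "((\<lambda>t::real. x + t *\<^sub>R e) has_derivative (\<lambda>t. t *\<^sub>R e)) (at t)"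
      by (auto intro!: derivative_eq_intros)
    moreover have "(f has_derivative (\<lambda>v. \<Sum>k\<in>UNIV. of_real (v $ k) * f' k (x + t *\<^sub>R e))) (at (x + t *\<^sub>R e))"
      using c by (simp add: c1_def)
    ultimately have "((\<lambda>t. f (x + t *\<^sub>R e)) has_derivative (\<lambda>s. \<Sum>k\<in>UNIV. of_real ((s *\<^sub>R e) $ k) * f' k (x + t *\<^sub>R e))) (at t)"
      by (rule has_derivative_compose)
    moreover have "(\<Sum>k\<in>UNIV. of_real ((s *\<^sub>R e) $ k) * f' k y) = s *\<^sub>R f' j y" for s :: real and y
    proof -
      have "(\<Sum>k\<in>UNIV. of_real ((s *\<^sub>R e) $ k) * f' k y) = (\<Sum>k\<in>UNIV. if k = j then of_real s * f' k y else 0)"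
        by (intro sum.cong) (auto simp: e_def axis_def)
      then show ?thesis by (simp add: scaleR_conv_of_real)
    qed
    ultimately have "((\<lambda>t. f (x + t *\<^sub>R e)) has_vector_derivative f' j (x + t *\<^sub>R e)) (at t)"
      by (simp add: has_vector_derivative_def)
    then show ?thesis by (rule has_vector_derivative_at_within)
  qed
  \<comment> \<open>The difference quotients vanish outside radius |R| + 1, and the mean value
    estimate looks at most one unit further, hence |R| + 2.\<close>
  have "bounded (f' j ` cball 0 (\<bar>R\<bar> + 2))"
    by (intro compact_imp_bounded compact_continuous_image c1_cont'[OF c]) auto
  then obtain B where B: "0 < B" "\<And>x. norm x \<le> \<bar>R\<bar> + 2 \<Longrightarrow> norm (f' j x) \<le> B"
    by (auto simp: bounded_pos)
  define D where "D = (\<lambda>n x. (f (x + (1 / (real n + 1)) *\<^sub>R e) - f x) * of_real (real n + 1))"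
  have ints: "integrable lborel f" by (rule integrable_compact_support[OF c1_cont[OF c] supp])
  have mf: "f \<in> borel_measurable borel" by (rule borel_measurable_continuous_onI[OF c1_cont[OF c]])
  have D0: "(\<integral>x. D n x \<partial>lborel) = 0" for n
  proof -
    have "integrable lborel (\<lambda>x. f ((1 / (real n + 1)) *\<^sub>R e + x))"
    proof (rule integrable_compact_support)
      show "continuous_on UNIV (\<lambda>x. f ((1 / (real n + 1)) *\<^sub>R e + x))"
        by (intro continuous_on_compose2[OF c1_cont[OF c, of UNIV]] continuous_intros) auto
      fix x :: "real^'n" assume "\<bar>R\<bar> + 1 < norm x"
      moreover have "norm x \<le> norm ((1 / (real n + 1)) *\<^sub>R e + x) + norm ((1 / (real n + 1)) *\<^sub>R e)"
        by (metis add.commute add_diff_cancel_left' norm_triangle_ineq4 add_diff_cancel_right')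
      moreover have "norm ((1 / (real n + 1)) *\<^sub>R e) \<le> 1" by (simp add: ne field_simps)
      ultimately show "f ((1 / (real n + 1)) *\<^sub>R e + x) = 0" by (intro supp) linarith
    qed
    moreover have "(\<integral>x. f ((1 / (real n + 1)) *\<^sub>R e + x) \<partial>lborel) = (\<integral>x. f x \<partial>lborel)"
      by (rule lborel_integral_translate[OF mf])
    ultimately show ?thesis
      using ints unfolding D_def by (subst add.commute[of _ "(1 / (real n + 1)) *\<^sub>R e"]) (simp add: Bochner_Integration.integral_diff)
  qed
  have "(\<lambda>n. \<integral>x. D n x \<partial>lborel) \<longlonglongrightarrow> (\<integral>x. f' j x \<partial>lborel)"
  proof (rule integral_dominated_convergence[where w = "\<lambda>x. B * indicator (cball 0 (\<bar>R\<bar> + 1)) x"])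
    show "f' j \<in> borel_measurable lborel"
      using borel_measurable_continuous_onI[OF c1_cont'[OF c]] by simp
    show "D n \<in> borel_measurable lborel" for n
      unfolding D_def by (intro borel_measurable_times borel_measurable_diff measurable_compose[OF _ mf] borel_measurable_add) auto
    show "integrable lborel (\<lambda>x. B * indicator (cball 0 (\<bar>R\<bar> + 1)) (x :: real^'n))"
      using emeasure_lborel_cball_finite[of "0 :: real^'n" "\<bar>R\<bar> + 1"]
      by (intro integrable_mult_right integrable_real_indicator) (auto simp: infinity_ennreal_def)
    show "AE x in lborel. (\<lambda>n. D n x) \<longlonglongrightarrow> f' j x"
    proof (intro AE_I2)
      fix x
      have "((\<lambda>h. norm (f (x + h *\<^sub>R e) - f (x + 0 *\<^sub>R e) - (h - 0) *\<^sub>R f' j (x + 0 *\<^sub>R e)) / norm (h - 0)) \<longlongrightarrow> 0) (at (0::real))"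
        using dir[of x 0 UNIV] unfolding has_vector_derivative_def has_derivative_iff_norm by blast
      moreover have "\<forall>\<^sub>F h in at (0::real). norm (f (x + h *\<^sub>R e) - f (x + 0 *\<^sub>R e) - (h - 0) *\<^sub>R f' j (x + 0 *\<^sub>R e)) / norm (h - 0)
          = norm ((1 / h) *\<^sub>R (f (x + h *\<^sub>R e) - f x) - f' j x)"
      proof (intro eventually_at_filter[THEN iffD2] always_eventually allI impI)
        fix h :: real assume "h \<noteq> 0"
        then have "(1 / h) *\<^sub>R (f (x + h *\<^sub>R e) - f x) - f' j x = (1 / h) *\<^sub>R (f (x + h *\<^sub>R e) - f x - h *\<^sub>R f' j x)"
          by (simp add: scaleR_diff_right)
        then show "norm (f (x + h *\<^sub>R e) - f (x + 0 *\<^sub>R e) - (h - 0) *\<^sub>R f' j (x + 0 *\<^sub>R e)) / norm (h - 0)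
          = norm ((1 / h) *\<^sub>R (f (x + h *\<^sub>R e) - f x) - f' j x)"
          by simp
      qed
      ultimately have "((\<lambda>h. norm ((1 / h) *\<^sub>R (f (x + h *\<^sub>R e) - f x) - f' j x)) \<longlongrightarrow> 0) (at (0::real))"
        by (rule Lim_transform_eventually)
      then have *: "((\<lambda>h. (1 / h) *\<^sub>R (f (x + h *\<^sub>R e) - f x)) \<longlongrightarrow> f' j x) (at 0)"
        unfolding tendsto_norm_zero_iff LIM_zero_iff .
      have "filterlim (\<lambda>n. 1 / (real n + 1)) (at 0) sequentially" by real_asymp
      from filterlim_compose[OF * this] show "(\<lambda>n. D n x) \<longlonglongrightarrow> f' j x"
        by (simp add: D_def scaleR_conv_of_real algebra_simps)
    qed
    show "AE x in lborel. norm (D n x) \<le> B * indicator (cball 0 (\<bar>R\<bar> + 1)) x" for n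
    proof (intro AE_I2)
      fix x
      define h where "h = 1 / (real n + 1)"
      have h: "0 < h" "h \<le> 1" by (auto simp: h_def)
      have tri: "norm (x + t *\<^sub>R e) \<le> norm x + t" "norm x - t \<le> norm (x + t *\<^sub>R e)" if "0 \<le> t" for t
        using norm_triangle_ineq[of x "t *\<^sub>R e"] norm_triangle_ineq2[of x "- (t *\<^sub>R e)"] that ne by auto
      show "norm (D n x) \<le> B * indicator (cball 0 (\<bar>R\<bar> + 1)) x"
      proof (cases "norm x \<le> \<bar>R\<bar> + 1")
        case True
        have "norm (f (x + h *\<^sub>R e) - f (x + 0 *\<^sub>R e)) \<le> B * norm (h - 0)"
        proof (rule differentiable_bound[of "{0..h}" _ "\<lambda>t s. s *\<^sub>R f' j (x + t *\<^sub>R e)"])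
          fix t assume t: "t \<in> {0..h}"
          show "((\<lambda>t. f (x + t *\<^sub>R e)) has_derivative (\<lambda>s. s *\<^sub>R f' j (x + t *\<^sub>R e))) (at t within {0..h})"
            using dir[of x t "{0..h}"] by (simp add: has_vector_derivative_def)
          have "norm (f' j (x + t *\<^sub>R e)) \<le> B"
            using tri[of t] t h True by (intro B) auto
          then show "onorm (\<lambda>s. s *\<^sub>R f' j (x + t *\<^sub>R e)) \<le> B"
            by (intro onorm_le) (simp add: mult.commute[of B] mult_left_mono)
        qed (use h in auto)
        then have "norm (D n x) \<le> (B * h) * (real n + 1)"
          using h by (simp add: D_def norm_mult h_def[symmetric] mult_right_mono del: of_real_add)
        also have "\<dots> = B" by (simp add: h_def)
        finally show ?thesis using True by simp
      next
        case False
        then have "f x = 0" "f (x + h *\<^sub>R e) = 0"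
          using tri(2)[of h] h by (auto intro!: supp)
        then show ?thesis using False by (simp add: D_def h_def)
      qed
    qed
  qed
  then show ?thesis using D0 by (simp add: LIMSEQ_const_iff)
qed

lemma c1_zero_open:
  fixes f :: "real^'n::finite \<Rightarrow> complex"
  assumes "c1 f f'" "open U" "\<And>x. x \<in> U \<Longrightarrow> f x = 0" "x \<in> U"
  shows "f' j x = 0"
proof -
  have "(f has_derivative (\<lambda>v. 0)) (at x)"
    by (rule has_derivative_transform_within_open[of "\<lambda>x. 0" _ x UNIV U]) (use assms in auto)
  moreover have "(f has_derivative (\<lambda>v. \<Sum>j\<in>UNIV. of_real (v $ j) * f' j x)) (at x)"
    using assms by (simp add: c1_def)
  ultimately have "(\<lambda>v. \<Sum>j\<in>UNIV. of_real (v $ j) * f' j x) = (\<lambda>v. 0)"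
    using has_derivative_unique by blast
  from fun_cong[OF this, of "axis j 1"] show ?thesis
    by (simp add: axis_def if_distrib[of "\<lambda>x. _ * x"] if_distrib[of "\<lambda>x. x * _"] if_distrib[of of_real] cong: if_cong)
qed

lemma c1_zero_outside:
  fixes f :: "real^'n::finite \<Rightarrow> complex"
  assumes "c1 f f'" "\<And>x. R < norm x \<Longrightarrow> f x = 0" "R < norm x"
  shows "f' j x = 0"
  by (rule c1_zero_open[OF assms(1), of "{x. R < norm x}"])
    (use assms in \<open>auto intro!: open_Collect_less continuous_intros\<close>)

text \<open>The field \<phi> (P grad u - u grad P) has compact support, so its divergence integrates
  to 0. Terms with grad \<phi> stand in for the surface integral of the classical identity.\<close>

lemma green_identity:
  fixes u P \<phi> :: "real^'n::finite \<Rightarrow> complex"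
  assumes u: "c1 u u1" "\<And>i. c1 (u1 i) (u2 i)" and P: "c1 P P1" "\<And>i. c1 (P1 i) (P2 i)"
    and \<phi>: "c1 \<phi> \<phi>1" "\<And>x. R < norm x \<Longrightarrow> \<phi> x = 0"
  shows "(\<integral>x. \<phi> x * (P x * (\<Sum>j\<in>UNIV. u2 j j x) - u x * (\<Sum>j\<in>UNIV. P2 j j x)) \<partial>lborel)
     = - (\<integral>x. (\<Sum>j\<in>UNIV. \<phi>1 j x * (P x * u1 j x - u x * P1 j x)) \<partial>lborel)"
proof -
  have \<phi>1: "\<phi>1 j x = 0" if "R < norm x" for j x
    by (rule c1_zero_outside[OF \<phi> that])
  define A where "A = (\<lambda>j x. \<phi>1 j x * (P x * u1 j x - u x * P1 j x))"
  define B where "B = (\<lambda>j x. \<phi> x * (P x * u2 j j x - u x * P2 j j x))"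
  note cont = c1_cont[OF u(1)] c1_cont[OF u(2)] c1_cont'[OF u(2)] c1_cont[OF P(1)] c1_cont[OF P(2)] c1_cont'[OF P(2)]
    c1_cont[OF \<phi>(1)] c1_cont'[OF \<phi>(1)]
  have iA: "integrable lborel (A j)" for j
    by (rule integrable_compact_support[of _ R]) (auto simp: A_def \<phi>1 intro!: continuous_intros cont)
  have iB: "integrable lborel (B j)" for j
    by (rule integrable_compact_support[of _ R]) (auto simp: B_def \<phi> intro!: continuous_intros cont)
  have AB: "(\<integral>x. A j x \<partial>lborel) + (\<integral>x. B j x \<partial>lborel) = 0" for j
  proof -
    have "c1 (\<lambda>x. \<phi> x * (P x * u1 j x - u x * P1 j x))
      (\<lambda>k x. \<phi>1 k x * (P x * u1 j x - u x * P1 j x) + \<phi> x * ((P1 k x * u1 j x + P x * u2 j k x) - (u1 k x * P1 j x + u x * P2 j k x)))"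
      by (intro c1_mult c1_diff u P \<phi>)
    then have "(\<integral>x. \<phi>1 j x * (P x * u1 j x - u x * P1 j x) + \<phi> x * ((P1 j x * u1 j x + P x * u2 j j x) - (u1 j x * P1 j x + u x * P2 j j x)) \<partial>lborel) = 0"
      by (rule c1_integral_pd[of _ _ R]) (simp add: \<phi>)
    moreover have "(\<lambda>x. \<phi>1 j x * (P x * u1 j x - u x * P1 j x) + \<phi> x * ((P1 j x * u1 j x + P x * u2 j j x) - (u1 j x * P1 j x + u x * P2 j j x))) = (\<lambda>x. A j x + B j x)"
      by (simp add: A_def B_def fun_eq_iff algebra_simps)
    ultimately show ?thesis
      using Bochner_Integration.integral_add[OF iA iB] by simp
  qed
  have "(\<integral>x. \<phi> x * (P x * (\<Sum>j\<in>UNIV. u2 j j x) - u x * (\<Sum>j\<in>UNIV. P2 j j x)) \<partial>lborel) = (\<integral>x. (\<Sum>j\<in>UNIV. B j x) \<partial>lborel)"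
    by (simp add: B_def sum_distrib_left right_diff_distrib sum_subtractf)
  also have "\<dots> = (\<Sum>j\<in>UNIV. \<integral>x. B j x \<partial>lborel)"
    by (rule Bochner_Integration.integral_sum) (rule iB)
  also have "\<dots> = (\<Sum>j\<in>UNIV. - (\<integral>x. A j x \<partial>lborel))"
    using AB by (intro sum.cong refl) (simp add: eq_neg_iff_add_eq_0 add.commute)
  also have "\<dots> = - (\<integral>x. (\<Sum>j\<in>UNIV. A j x) \<partial>lborel)"
    by (simp add: Bochner_Integration.integral_sum[OF iA] sum_negf)
  finally show ?thesis by (simp add: A_def)
qed

section \<open>Radial integrals in the plane\<close>

text \<open>The image of planar Lebesgue measure under the squared distance from a point is \<open>\<pi>\<close> times
  Lebesgue measure on the half-line; this replaces polar coordinates.\<close>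

lemma distr_sqdist:
  fixes x :: "real^2"
  shows "distr lborel borel (\<lambda>y. - (norm (y - x))\<^sup>2) = density lborel (\<lambda>t. ennreal pi * indicator {..0} t)"
    (is "?\<mu> = ?\<nu>")
\<comment> \<open>The squared distance enters with a minus sign because this criterion compares
  measures on half-lines \<open>{a<..}\<close>, whose preimages are then discs of finite
  area.\<close>
proof (rule measure_eqI_lessThan)
  show "sets ?\<mu> = sets borel" "sets ?\<nu> = sets borel" by auto
  have eq: "emeasure ?\<mu> {a<..} = ennreal (pi * max 0 (- a))" "emeasure ?\<nu> {a<..} = ennreal (pi * max 0 (- a))" for a
  proof -
    have "(\<lambda>y. - (norm (y - x))\<^sup>2) -` {a<..} = ball x (sqrt (max 0 (- a)))"
    proof (intro set_eqI)
      fix y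
      have "(norm (y - x))\<^sup>2 < - a \<longleftrightarrow> norm (y - x) < sqrt (max 0 (- a))"
      proof -
        have "norm (y - x) < sqrt (max 0 (- a)) \<longleftrightarrow> sqrt ((norm (y - x))\<^sup>2) < sqrt (max 0 (- a))" by simp
        also have "\<dots> \<longleftrightarrow> (norm (y - x))\<^sup>2 < max 0 (- a)" by (rule real_sqrt_less_iff)
        also have "\<dots> \<longleftrightarrow> (norm (y - x))\<^sup>2 < - a"
          using zero_le_power2[of "norm (y - x)"] by (simp only: less_max_iff_disj) linarith
        finally show ?thesis by simp
      qed
      then show "y \<in> (\<lambda>y. - (norm (y - x))\<^sup>2) -` {a<..} \<longleftrightarrow> y \<in> ball x (sqrt (max 0 (- a)))"
        by (simp add: dist_norm norm_minus_commute less_minus_iff)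
    qed
    then have "emeasure ?\<mu> {a<..} = emeasure lborel (ball x (sqrt (max 0 (- a))))"
      by (subst emeasure_distr) auto
    also have "\<dots> = ennreal (unit_ball_vol (real 2) * sqrt (max 0 (- a)) ^ 2)"
      by (subst emeasure_ball) auto
    also have "\<dots> = ennreal (pi * max 0 (- a))" by (simp add: unit_ball_vol_2)
    finally show "emeasure ?\<mu> {a<..} = ennreal (pi * max 0 (- a))" .
    have "emeasure ?\<nu> {a<..} = (\<integral>\<^sup>+t. ennreal pi * indicator {..0} t * indicator {a<..} t \<partial>lborel)"
      by (subst emeasure_density) auto
    also have "\<dots> = (\<integral>\<^sup>+t. ennreal pi * indicator {a<..0} t \<partial>lborel)"
      by (intro nn_integral_cong) (auto simp: indicator_def)
    also have "\<dots> = ennreal pi * emeasure lborel {a<..0}"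
      by (simp add: nn_integral_cmult)
    also have "\<dots> = ennreal (pi * max 0 (- a))"
      by (cases "a \<le> 0") (auto simp: ennreal_mult''[symmetric] max_def)
    finally show "emeasure ?\<nu> {a<..} = ennreal (pi * max 0 (- a))" .
  qed
  show "emeasure ?\<mu> {a<..} < \<infinity>" for a unfolding eq by simp
  show "emeasure ?\<mu> {a<..} = emeasure ?\<nu> {a<..}" for a unfolding eq by simp
qed

lemma nn_integral_radial:
  fixes x :: "real^2"
  assumes [measurable]: "f \<in> borel_measurable borel"
  shows "(\<integral>\<^sup>+y. f ((norm (y - x))\<^sup>2) \<partial>lborel) = ennreal pi * (\<integral>\<^sup>+t. indicator {0..} t * f t \<partial>lborel)"
proof -
  have "(\<integral>\<^sup>+y. f ((norm (y - x))\<^sup>2) \<partial>lborel) = (\<integral>\<^sup>+s. f (- s) \<partial>distr lborel borel (\<lambda>y. - (norm (y - x))\<^sup>2))"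
    by (subst nn_integral_distr) auto
  also have "\<dots> = (\<integral>\<^sup>+s. ennreal pi * indicator {..0} s * f (- s) \<partial>lborel)"
    unfolding distr_sqdist by (subst nn_integral_density) auto
  also have "\<dots> = (\<integral>\<^sup>+s. ennreal pi * (indicator {..0} s * f (- s)) \<partial>lborel)"
    by (simp add: mult.assoc)
  also have "\<dots> = ennreal pi * (\<integral>\<^sup>+s. indicator {..0} s * f (- s) \<partial>lborel)"
    by (rule nn_integral_cmult) measurable
  also have "(\<integral>\<^sup>+s. indicator {..0} s * f (- s) \<partial>lborel) = (\<integral>\<^sup>+t. indicator {0..} t * f t \<partial>lborel)"
    by (subst nn_integral_real_affine[of _ "-1" 0]) (auto intro!: nn_integral_cong simp: indicator_def)
  finally show ?thesis .
qed

lemma integral_radial: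
  fixes x :: "real^2" and f :: "real \<Rightarrow> complex"
  assumes [measurable]: "f \<in> borel_measurable borel"
  shows "(\<integral>y. f ((norm (y - x))\<^sup>2) \<partial>lborel) = of_real pi * (\<integral>t. indicator {0..} t *\<^sub>R f t \<partial>lborel)"
proof -
  have "(\<integral>y. f ((norm (y - x))\<^sup>2) \<partial>lborel) = (\<integral>s. f (- s) \<partial>distr lborel borel (\<lambda>y. - (norm (y - x))\<^sup>2))"
    by (subst integral_distr) auto
  also have "density lborel (\<lambda>t. ennreal pi * indicator {..0} t) = density lborel (\<lambda>t::real. ennreal (pi * indicator {..0} t))"
    by (intro density_cong) (auto simp: indicator_def)
  then have "(\<integral>s. f (- s) \<partial>distr lborel borel (\<lambda>y. - (norm (y - x))\<^sup>2)) = (\<integral>s. (pi * indicator {..0} s) *\<^sub>R f (- s) \<partial>lborel)"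
    unfolding distr_sqdist by (simp only:) (subst integral_density, auto)
  also have "\<dots> = (\<integral>s. of_real pi * (indicator {..0} s *\<^sub>R f (- s)) \<partial>lborel)"
    by (simp add: scaleR_conv_of_real mult.assoc)
  also have "\<dots> = of_real pi * (\<integral>s. indicator {..0} s *\<^sub>R f (- s) \<partial>lborel)"
    by (rule integral_mult_right_zero)
  also have "(\<integral>s. indicator {..0} s *\<^sub>R f (- s) \<partial>lborel) = (\<integral>t. indicator {0..} t *\<^sub>R f t \<partial>lborel)"
    by (subst lborel_integral_real_affine[of "-1" _ 0]) (auto intro!: Bochner_Integration.integral_cong simp: indicator_def)
  finally show ?thesis .
qed

lemma nn_integral_inverse_sqrt:
  assumes "0 \<le> T"
  shows "(\<integral>\<^sup>+t. indicator {0..T} t * ennreal (1 / sqrt t) \<partial>lborel) = ennreal (2 * sqrt T)"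
proof -
  have "((\<lambda>t. t powr (-1/2)) has_integral (T powr (-1/2 + 1) / (-1/2 + 1))) {0..T}"
    by (rule has_integral_powr_from_0) (use assms in auto)
  then have "((\<lambda>t. 1 / sqrt t) has_integral (2 * sqrt T)) {0..T}"
    by (rule has_integral_eq_rhs[OF has_integral_eq[rotated]])
      (use assms in \<open>auto simp: powr_minus powr_half_sqrt inverse_eq_divide\<close>)
  from nn_integral_has_integral_lborel[OF _ _ this[unfolded has_integral_restrict_UNIV[of "{0..T}", symmetric]]]
  have "(\<integral>\<^sup>+t. ennreal (if t \<in> {0..T} then 1 / sqrt t else 0) \<partial>lborel) = ennreal (2 * sqrt T)"
    by auto
  then show ?thesis
    by (auto intro!: nn_integral_cong simp: indicator_def elim!: trans[rotated])
qed

lemma nn_integral_inverse_norm: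
  fixes x :: "real^2"
  assumes "0 \<le> R"
  shows "(\<integral>\<^sup>+y. indicator (cball x R) y * ennreal (1 / norm (y - x)) \<partial>lborel) = ennreal (2 * pi * R)"
proof -
  have "(\<integral>\<^sup>+y. indicator (cball x R) y * ennreal (1 / norm (y - x)) \<partial>lborel)
     = (\<integral>\<^sup>+y. (\<lambda>t. indicator {0..R\<^sup>2} t * ennreal (1 / sqrt t)) ((norm (y - x))\<^sup>2) \<partial>lborel)"
  proof (intro nn_integral_cong)
    fix y
    have "y \<in> cball x R \<longleftrightarrow> (norm (y - x))\<^sup>2 \<in> {0..R\<^sup>2}"
      using assms by (simp add: dist_norm norm_minus_commute abs_le_square_iff[symmetric])
    then show "indicator (cball x R) y * ennreal (1 / norm (y - x)) = (\<lambda>t. indicator {0..R\<^sup>2} t * ennreal (1 / sqrt t)) ((norm (y - x))\<^sup>2)"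
      by (simp add: indicator_def)
  qed
  also have "\<dots> = ennreal pi * (\<integral>\<^sup>+t. indicator {0..} t * (indicator {0..R\<^sup>2} t * ennreal (1 / sqrt t)) \<partial>lborel)"
    by (rule nn_integral_radial) measurable
  also have "(\<integral>\<^sup>+t. indicator {0..} t * (indicator {0..R\<^sup>2} t * ennreal (1 / sqrt t)) \<partial>lborel)
     = (\<integral>\<^sup>+t. indicator {0..R\<^sup>2} t * ennreal (1 / sqrt t) \<partial>lborel)"
    by (intro nn_integral_cong) (auto simp: indicator_def)
  also have "\<dots> = ennreal (2 * sqrt (R\<^sup>2))" by (rule nn_integral_inverse_sqrt) simp
  finally show ?thesis using assms by (simp add: ennreal_mult[symmetric] algebra_simps)
qed

section \<open>The kernel with its singularity smoothed out\<close>

lemma has_vector_derivative_if_less: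
  fixes f g :: "real \<Rightarrow> complex"
  assumes "\<And>t. e \<le> t \<Longrightarrow> (f has_vector_derivative f1 t) (at t)"
    and "\<And>t. t \<le> e \<Longrightarrow> (g has_vector_derivative g1 t) (at t)"
    and "f e = g e" "f1 e = g1 e"
  shows "((\<lambda>t. if t < e then g t else f t) has_vector_derivative (if t < e then g1 t else f1 t)) (at t)"
proof -
  have "((\<lambda>t. if t \<in> {..<e} then g t else f t) has_vector_derivative (if t \<in> {..<e} then g1 t else f1 t)) (at t within UNIV)"
  proof (rule has_vector_derivative_If_within_closures[where T = "{e..}"])
    have cl: "closure {..<e} = {..e}" by simp
    show "t \<in> {..<e} \<union> {e..}" "UNIV = {..<e} \<union> {e..}" by auto
    show "(g has_vector_derivative g1 t) (at t within {..<e} \<union> (closure {..<e} \<inter> closure {e..}))"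
      if "t \<in> {..<e} \<union> (closure {..<e} \<inter> closure {e..})"
      by (rule has_vector_derivative_at_within[OF assms(2)]) (use that in \<open>auto simp: cl\<close>)
    show "(f has_vector_derivative f1 t) (at t within {e..} \<union> (closure {..<e} \<inter> closure {e..}))"
      if "t \<in> {e..} \<union> (closure {..<e} \<inter> closure {e..})"
      by (rule has_vector_derivative_at_within[OF assms(1)]) (use that in \<open>auto simp: cl\<close>)
    show "g t = f t" if "t \<in> closure {..<e}" "t \<in> closure {e..}"
      using that assms(3) by (auto simp: cl dest!: order_antisym)
    show "g1 t = f1 t" if "t \<in> closure {..<e}" "t \<in> closure {e..}"
      using that assms(4) by (auto simp: cl dest!: order_antisym)
  qed
  then show ?thesis by simp
qed

text \<open>The second derivative as prescribed by the Helmholtz equation 4 t g'' + 4 g' +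
  \<kappa>^2 g = 0; in this form its continuity and its size near 0 follow from those of g and
  g'.\<close>

definition hlm_g2 :: "real \<Rightarrow> real \<Rightarrow> complex" where
  "hlm_g2 \<kappa> t = - (4 * hlm_g1 \<kappa> t + (of_real \<kappa>)\<^sup>2 * hlm_g \<kappa> t) / (4 * of_real t)"

lemma hlm_g1_deriv':
  assumes "0 < \<kappa>" "0 < t"
  shows "(hlm_g1 \<kappa> has_vector_derivative hlm_g2 \<kappa> t) (at t)"
proof -
  obtain g2 where g2: "(hlm_g1 \<kappa> has_vector_derivative g2) (at t)"
    "4 * of_real t * g2 + 4 * hlm_g1 \<kappa> t + (of_real \<kappa>)\<^sup>2 * hlm_g \<kappa> t = 0"
    using hlm_g1_deriv[OF assms] by blast
  have "4 * of_real t * g2 = - (4 * hlm_g1 \<kappa> t + (of_real \<kappa>)\<^sup>2 * hlm_g \<kappa> t)"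
    using g2(2) by (simp only: eq_neg_iff_add_eq_0 add.assoc)
  then have "g2 = hlm_g2 \<kappa> t"
    using assms unfolding hlm_g2_def by (simp add: nonzero_eq_divide_eq mult.commute)
  with g2(1) show ?thesis by simp
qed

text \<open>The arithmetic-geometric mean inequality turns the bound by the root of 1/(\<kappa> |y -
  x|) into a bound by 1 + 1/|y - x|, a weight whose integrals over discs are elementary.\<close>

lemma hlm_g_bound2:
  assumes "0 < \<kappa>" "0 < t"
  shows "norm (hlm_g \<kappa> t) \<le> (1 + 1 / \<kappa>) * (1 + 1 / sqrt t)"
proof -
  have "1 / sqrt (\<kappa> * sqrt t) = sqrt ((1 / \<kappa>) * (1 / sqrt t))"
    using assms by (simp add: real_sqrt_divide real_sqrt_mult)
  also have "\<dots> \<le> (1 / \<kappa> + 1 / sqrt t) / 2"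
    by (rule arith_geo_mean_sqrt) (use assms in auto)
  also have "\<dots> \<le> (1 + 1 / \<kappa>) * (1 + 1 / sqrt t)"
  proof -
    have "(p + q) / 2 \<le> (1 + p) * (1 + q)" if "0 \<le> p" "0 \<le> q" for p q :: real
      using that mult_nonneg_nonneg[OF that] by (simp add: algebra_simps)
    from this[of "1 / \<kappa>" "1 / sqrt t"] show ?thesis using assms by simp
  qed
  finally show ?thesis using hlm_g_bound[OF assms] by linarith
qed

lemma continuous_on_hlm:
  assumes "0 < \<kappa>"
  shows "continuous_on {0<..} (hlm_g \<kappa>)" "continuous_on {0<..} (hlm_g1 \<kappa>)" "continuous_on {0<..} (hlm_g2 \<kappa>)"
proof -
  show a: "continuous_on {0<..} (hlm_g \<kappa>)" "continuous_on {0<..} (hlm_g1 \<kappa>)"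
    using hlm_g_deriv[OF assms] hlm_g1_deriv'[OF assms]
    by (auto intro!: continuous_at_imp_continuous_on dest!: has_vector_derivative_continuous)
  show "continuous_on {0<..} (hlm_g2 \<kappa>)"
    unfolding hlm_g2_def by (intro continuous_intros a) auto
qed

text \<open>The singularity is removed by continuing \<open>hlm_g\<close> to \<open>t < e\<close> by its Taylor polynomial of
  degree two at \<open>e\<close>, which keeps the function twice continuously differentiable.\<close>

definition hlm_p :: "real \<Rightarrow> real \<Rightarrow> real \<Rightarrow> complex" where
  "hlm_p \<kappa> e t = (if t < e then hlm_g \<kappa> e + of_real (t - e) * hlm_g1 \<kappa> e + of_real ((t - e)\<^sup>2 / 2) * hlm_g2 \<kappa> e else hlm_g \<kappa> t)"

definition hlm_p1 :: "real \<Rightarrow> real \<Rightarrow> real \<Rightarrow> complex" where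
  "hlm_p1 \<kappa> e t = (if t < e then hlm_g1 \<kappa> e + of_real (t - e) * hlm_g2 \<kappa> e else hlm_g1 \<kappa> t)"

definition hlm_p2 :: "real \<Rightarrow> real \<Rightarrow> real \<Rightarrow> complex" where
  "hlm_p2 \<kappa> e t = (if t < e then hlm_g2 \<kappa> e else hlm_g2 \<kappa> t)"

lemma hlm_p_deriv:
  assumes "0 < \<kappa>" "0 < e"
  shows "(hlm_p \<kappa> e has_vector_derivative hlm_p1 \<kappa> e t) (at t)"
    and "(hlm_p1 \<kappa> e has_vector_derivative hlm_p2 \<kappa> e t) (at t)"
    and "continuous_on UNIV (hlm_p2 \<kappa> e)"
proof -
  have lin: "((\<lambda>t. complex_of_real (t - e)) has_vector_derivative of_real 1) (at t)" for t
    by (rule has_vector_derivative_of_real) (auto intro!: derivative_eq_intros)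
  have quad: "((\<lambda>t. complex_of_real ((t - e)\<^sup>2 / 2)) has_vector_derivative of_real (t - e)) (at t)" for t
    by (rule has_vector_derivative_of_real) (auto intro!: derivative_eq_intros)
  show "(hlm_p \<kappa> e has_vector_derivative hlm_p1 \<kappa> e t) (at t)"
    unfolding hlm_p_def hlm_p1_def
  proof (rule has_vector_derivative_if_less)
    fix t
    show "(hlm_g \<kappa> has_vector_derivative hlm_g1 \<kappa> t) (at t)" if "e \<le> t"
      using that assms by (intro hlm_g_deriv) auto
    have "((\<lambda>t. hlm_g \<kappa> e + of_real (t - e) * hlm_g1 \<kappa> e + of_real ((t - e)\<^sup>2 / 2) * hlm_g2 \<kappa> e) has_vector_derivative
        0 + of_real 1 * hlm_g1 \<kappa> e + of_real (t - e) * hlm_g2 \<kappa> e) (at t)"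
      by (intro has_vector_derivative_add has_vector_derivative_const has_vector_derivative_mult_left lin quad)
    then show "((\<lambda>t. hlm_g \<kappa> e + of_real (t - e) * hlm_g1 \<kappa> e + of_real ((t - e)\<^sup>2 / 2) * hlm_g2 \<kappa> e) has_vector_derivative
        hlm_g1 \<kappa> e + of_real (t - e) * hlm_g2 \<kappa> e) (at t)" by simp
  qed auto
  show "(hlm_p1 \<kappa> e has_vector_derivative hlm_p2 \<kappa> e t) (at t)"
    unfolding hlm_p1_def hlm_p2_def
  proof (rule has_vector_derivative_if_less)
    fix t
    show "(hlm_g1 \<kappa> has_vector_derivative hlm_g2 \<kappa> t) (at t)" if "e \<le> t"
      using that assms by (intro hlm_g1_deriv') auto
    have "((\<lambda>t. hlm_g1 \<kappa> e + of_real (t - e) * hlm_g2 \<kappa> e) has_vector_derivative 0 + of_real 1 * hlm_g2 \<kappa> e) (at t)"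
      by (intro has_vector_derivative_add has_vector_derivative_const has_vector_derivative_mult_left lin)
    then show "((\<lambda>t. hlm_g1 \<kappa> e + of_real (t - e) * hlm_g2 \<kappa> e) has_vector_derivative hlm_g2 \<kappa> e) (at t)" by simp
  qed auto
  have "continuous_on UNIV (\<lambda>t. hlm_g2 \<kappa> (max e t))"
    by (rule continuous_on_compose2[OF continuous_on_hlm(3)[OF assms(1)]]) (use assms in \<open>auto intro!: continuous_intros\<close>)
  moreover have "hlm_p2 \<kappa> e = (\<lambda>t. hlm_g2 \<kappa> (max e t))" by (auto simp: hlm_p2_def max_def)
  ultimately show "continuous_on UNIV (hlm_p2 \<kappa> e)" by simp
qed

text \<open>The operator \<open>\<Delta> + \<kappa>\<^sup>2\<close> applied to the smoothed kernel,
  written in the squared distance t. It vanishes for t >= e and approximates minus the point mass as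
  e tends to 0.\<close>

definition hlm_M :: "real \<Rightarrow> real \<Rightarrow> real \<Rightarrow> complex" where
  "hlm_M \<kappa> e t = 4 * of_real t * hlm_p2 \<kappa> e t + 4 * hlm_p1 \<kappa> e t + (of_real \<kappa>)\<^sup>2 * hlm_p \<kappa> e t"

lemma hlm_M_0:
  assumes "0 < e" "e \<le> t"
  shows "hlm_M \<kappa> e t = 0"
  using assms by (simp add: hlm_M_def hlm_p_def hlm_p1_def hlm_p2_def hlm_g2_def field_simps)

lemma c1_hlm_P:
  fixes x :: "real^2"
  assumes "0 < \<kappa>" "0 < e"
  defines "P \<equiv> \<lambda>y. hlm_p \<kappa> e ((norm (y - x))\<^sup>2)"
    and "P1 \<equiv> \<lambda>j y. of_real (2 * (y - x) $ j) * hlm_p1 \<kappa> e ((norm (y - x))\<^sup>2)"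
  obtains P2 where "c1 P P1" "\<And>j. c1 (P1 j) (P2 j)"
    "\<And>y. (\<Sum>j\<in>UNIV. P2 j j y) + (of_real \<kappa>)\<^sup>2 * P y = hlm_M \<kappa> e ((norm (y - x))\<^sup>2)"
proof -
  note d = hlm_p_deriv[OF assms(1,2)]
  have cp1: "continuous_on UNIV (hlm_p1 \<kappa> e)"
    using d(2) by (meson continuous_at_imp_continuous_on has_vector_derivative_continuous)
  have 1: "c1 P P1"
    unfolding P_def P1_def by (rule c1_radial[OF d(1) cp1])
  have co: "c1 (\<lambda>y. of_real (2 * (y - x) $ j)) (\<lambda>k y. of_real (if k = j then 2 else 0))" for j
  proof -
    have h: "((\<lambda>y. 2 * (y - x) $ j) has_derivative (\<lambda>v. \<Sum>k\<in>UNIV. v $ k * (if k = j then 2 else 0))) (at y)" for y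
    proof -
      have "((\<lambda>y. 2 * (y - x) $ j) has_derivative (\<lambda>v. 2 * (v $ j))) (at y)"
        by (auto intro!: derivative_eq_intros bounded_linear.has_derivative[OF bounded_linear_vec_nth])
      then show ?thesis
        by (rule has_derivative_eq_rhs) (simp add: if_distrib[of "\<lambda>x. _ * x"] fun_eq_iff cong: if_cong)
    qed
    have "((\<lambda>y. complex_of_real (2 * (y - x) $ j)) has_derivative
       (\<lambda>v. \<Sum>k\<in>UNIV. of_real (v $ k) * of_real (if k = j then 2 else 0))) (at y)" for y
      using has_derivative_of_real[OF h[of y], where 'a = complex] by (simp only: of_real_sum of_real_mult)
    then show ?thesis
      unfolding c1_def by auto
  qed
  define P2 where "P2 = (\<lambda>j k y. complex_of_real (if k = j then 2 else 0) * hlm_p1 \<kappa> e ((norm (y - x))\<^sup>2)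
     + of_real (2 * (y - x) $ j) * (of_real (2 * (y - x) $ k) * hlm_p2 \<kappa> e ((norm (y - x))\<^sup>2)))"
  have 2: "c1 (P1 j) (P2 j)" for j
    unfolding P1_def P2_def by (intro c1_mult co c1_radial[OF d(2,3)])
  have 3: "(\<Sum>j\<in>UNIV. P2 j j y) + (of_real \<kappa>)\<^sup>2 * P y = hlm_M \<kappa> e ((norm (y - x))\<^sup>2)" for y
  proof -
    have n: "(norm (y - x))\<^sup>2 = ((y - x) $ 1)\<^sup>2 + ((y - x) $ 2)\<^sup>2"
      unfolding power2_norm_eq_inner by (simp add: inner_vec_def sum_2 power2_eq_square)
    show ?thesis
      unfolding hlm_M_def P2_def P_def
      by (subst (4) n) (simp add: sum_2 algebra_simps power2_eq_square)
  qed
  show ?thesis by (rule that[OF 1 2 3])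
qed

section \<open>Representation formulas\<close>

lemma norm_integral_ball_le:
  fixes x :: "real^2" and f :: "real^2 \<Rightarrow> complex"
  assumes "0 \<le> s" "0 \<le> c" "\<And>y. norm (f y) \<le> c * indicator (ball x s) y"
  shows "norm (\<integral>y. f y \<partial>lborel) \<le> c * (pi * s\<^sup>2)"
proof -
  have fin: "emeasure lborel (ball x s) < \<infinity>" by (rule emeasure_lborel_ball_finite)
  have "norm (\<integral>y. f y \<partial>lborel) \<le> (\<integral>y. norm (f y) \<partial>lborel)"
    by (rule integral_norm_bound)
  also have "\<dots> \<le> (\<integral>y. c * indicator (ball x s) y \<partial>lborel)"
    by (rule integral_mono') (use assms fin in \<open>auto simp: infinity_ennreal_def intro!: integrable_mult_right integrable_real_indicator\<close>)
  also have "\<dots> = c * measure lborel (ball x s)" by simp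
  also have "measure lborel (ball x s) = pi * s\<^sup>2"
    using circle_area[OF assms(1), of x] by simp
  finally show ?thesis .
qed

lemma integrable_weight:
  fixes x :: "real^2"
  shows "integrable lborel (\<lambda>y. K * (1 + 1 / norm (y - x)) * indicator (cball 0 R) y)"
proof -
  define S where "S = R + norm x"
  have sub: "cball 0 R \<subseteq> cball x S"
  proof
    fix y :: "real^2" assume "y \<in> cball 0 R"
    then show "y \<in> cball x S"
      using norm_triangle_ineq4[of x y] by (simp add: S_def dist_norm)
  qed
  have fin: "emeasure lborel (cball 0 R :: (real^2) set) < \<infinity>" by (rule emeasure_lborel_cball_finite)
  have "(\<integral>\<^sup>+y. ennreal (1 / norm (y - x) * indicator (cball 0 R) y) \<partial>lborel)
     \<le> (\<integral>\<^sup>+y. indicator (cball x (max 0 S)) y * ennreal (1 / norm (y - x)) \<partial>lborel)"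
    using sub by (intro nn_integral_mono) (auto simp: indicator_def max_def intro: order_trans[OF zero_le_dist])
  also have "\<dots> = ennreal (2 * pi * max 0 S)" by (rule nn_integral_inverse_norm) simp
  finally have "(\<integral>\<^sup>+y. ennreal (1 / norm (y - x) * indicator (cball 0 R) y) \<partial>lborel) < \<infinity>"
    by (rule le_less_trans) simp
  moreover have [measurable]: "cball (0 :: real^2) R \<in> sets borel" by simp
  have "(\<lambda>y. 1 / norm (y - x) * indicator (cball 0 R) y) \<in> borel_measurable lborel" by measurable
  ultimately have "integrable lborel (\<lambda>y. 1 / norm (y - x) * indicator (cball 0 R) y)"
    by (intro integrableI_nonneg) auto
  moreover have "integrable lborel (\<lambda>y. indicator (cball 0 R :: (real^2) set) y :: real)"
    using fin by (intro integrable_real_indicator) (auto simp: infinity_ennreal_def)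
  ultimately have "integrable lborel (\<lambda>y. K * (indicator (cball 0 R) y + 1 / norm (y - x) * indicator (cball 0 R) y))"
    by (intro integrable_mult_right Bochner_Integration.integrable_add)
  then show ?thesis by (simp add: algebra_simps)
qed

lemma borel_measurable_hlm_g:
  assumes k: "0 < \<kappa>" and f: "f \<in> borel_measurable M" "\<And>y. 0 \<le> f y"
  shows "(\<lambda>y. hlm_g \<kappa> (f y)) \<in> borel_measurable M"
proof -
  define h where "h = (\<lambda>t. indicator {0<..} t *\<^sub>R hlm_g \<kappa> t + indicator {0} t *\<^sub>R hlm_g \<kappa> 0)"
  have "h \<in> borel_measurable borel"
    unfolding h_def
    by (intro borel_measurable_add borel_measurable_continuous_on_indicator continuous_on_hlm k) auto
  then have "(\<lambda>y. h (f y)) \<in> borel_measurable M" by (rule measurable_compose[OF f(1)])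
  moreover have "h (f y) = hlm_g \<kappa> (f y)" for y
    using f(2)[of y] by (auto simp: h_def indicator_def)
  ultimately show ?thesis by simp
qed

text \<open>Uniformity in \<open>e\<close> is the point, since it provides a single majorant for
  dominated convergence. As t g'(t) stays bounded near 0, the equation bounds t^2 g''(t); hence the
  linear and quadratic Taylor terms at \<open>e\<close> are bounded on [0, e], while |g(e)| is
  controlled by the weight at e, which is below the weight at t < e.\<close>

lemma hlm_p_estimates:
  assumes k: "0 < \<kappa>"
  obtains r C where "0 < r" "r \<le> 1" "0 \<le> C"
    "\<And>e. 0 < e \<Longrightarrow> e < r \<Longrightarrow> norm (of_real (e\<^sup>2) * hlm_g2 \<kappa> e) \<le> C"
    "\<And>e t. 0 < e \<Longrightarrow> e < r \<Longrightarrow> 0 < t \<Longrightarrow> norm (hlm_p \<kappa> e t) \<le> C * (1 + 1 / sqrt t)"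
proof -
  have "\<forall>\<^sub>F t in at_right 0. dist (of_real t * hlm_g1 \<kappa> t) (- 1 / of_real (4 * pi)) < 1/2"
    using tendstoD[OF hlm_g1_at_0[OF k], of "1/2"] by simp
  then obtain r0 where r0: "0 < r0" "\<And>t. 0 < t \<Longrightarrow> t < r0 \<Longrightarrow> dist (of_real t * hlm_g1 \<kappa> t) (- 1 / of_real (4 * pi)) < 1/2"
    by (auto simp: eventually_at_right_field)
  have g1: "norm (of_real t * hlm_g1 \<kappa> t) \<le> 1" if "0 < t" "t < r0" for t
  proof -
    have "norm (- 1 / complex_of_real (4 * pi)) \<le> 1/2"
      using pi_gt3 by (simp add: norm_divide norm_mult field_simps)
    then show ?thesis
      using r0(2)[OF that] norm_triangle_ineq[of "of_real t * hlm_g1 \<kappa> t - (- 1 / of_real (4 * pi))" "- 1 / of_real (4 * pi)"]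
      by (simp add: dist_norm)
  qed
  define A where "A = 1 + 1 / \<kappa>"
  have A: "0 \<le> A" using k by (simp add: A_def)
  define B where "B = 1 + \<kappa>\<^sup>2 * A"
  have B: "0 \<le> B" using A by (simp add: B_def)
  define r where "r = min r0 1"
  have g2: "norm (of_real (e\<^sup>2) * hlm_g2 \<kappa> e) \<le> B" if "0 < e" "e < r" for e
  proof -
    have "of_real (e\<^sup>2) * hlm_g2 \<kappa> e = - (of_real e * hlm_g1 \<kappa> e) - of_real (\<kappa>\<^sup>2 * e / 4) * hlm_g \<kappa> e"
      using that by (simp add: hlm_g2_def field_simps power2_eq_square)
    then have "norm (of_real (e\<^sup>2) * hlm_g2 \<kappa> e) \<le> norm (- (of_real e * hlm_g1 \<kappa> e)) + norm (of_real (\<kappa>\<^sup>2 * e / 4) * hlm_g \<kappa> e)"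
      by (metis norm_triangle_ineq4)
    also have "norm (- (of_real e * hlm_g1 \<kappa> e)) \<le> 1" using g1 that by (simp add: r_def)
    also have "norm (of_real (\<kappa>\<^sup>2 * e / 4) * hlm_g \<kappa> e) = (\<kappa>\<^sup>2 * e / 4) * norm (hlm_g \<kappa> e)"
      using that k by (simp only: norm_mult norm_of_real) simp
    also have "\<dots> \<le> (\<kappa>\<^sup>2 * e / 4) * (A * (1 + 1 / sqrt e))"
      using hlm_g_bound2[OF k that(1)] that by (intro mult_left_mono) (auto simp: A_def)
    also have "\<dots> = \<kappa>\<^sup>2 * A * (e * (1 + 1 / sqrt e) / 4)" by simp
    also have "\<dots> \<le> \<kappa>\<^sup>2 * A * 1"
    proof (rule mult_left_mono)
      have se: "e * (1 / sqrt e) = sqrt e" using that by (simp add: real_div_sqrt)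
      have "sqrt e \<le> 1" "e \<le> 1" using that by (auto simp: r_def)
      then have "(e + sqrt e) / 4 \<le> 1" by argo
      moreover have "e * (1 + 1 / sqrt e) = e + sqrt e" by (simp only: distrib_left se mult_1_right)
      ultimately show "e * (1 + 1 / sqrt e) / 4 \<le> 1" by (simp only:)
    qed (use A in simp)
    finally show ?thesis by (simp add: B_def)
  qed
  define C where "C = A + 1 + B"
  have p: "norm (hlm_p \<kappa> e t) \<le> C * (1 + 1 / sqrt t)" if e: "0 < e" "e < r" and t: "0 < t" for e t
  proof (cases "t < e")
    case False
    then have "norm (hlm_p \<kappa> e t) = norm (hlm_g \<kappa> t)" by (simp add: hlm_p_def)
    also have "\<dots> \<le> A * (1 + 1 / sqrt t)" using hlm_g_bound2[OF k t] by (simp add: A_def)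
    also have "\<dots> \<le> C * (1 + 1 / sqrt t)"
      using B t by (intro mult_right_mono) (auto simp: C_def)
    finally show ?thesis .
  next
    case True
    have "norm (of_real (t - e) * hlm_g1 \<kappa> e) \<le> norm (of_real e * hlm_g1 \<kappa> e)"
      unfolding norm_mult norm_of_real using True t by (intro mult_right_mono) auto
    also have "\<dots> \<le> 1" using g1 e by (simp add: r_def)
    finally have 1: "norm (of_real (t - e) * hlm_g1 \<kappa> e) \<le> 1" .
    have sq: "(t - e)\<^sup>2 \<le> e\<^sup>2"
      using True t by (intro abs_le_square_iff[THEN iffD1]) auto
    have "(t - e)\<^sup>2 / 2 \<le> e\<^sup>2" using sq zero_le_power2[of e] by linarith
    then have "norm (of_real ((t - e)\<^sup>2 / 2) * hlm_g2 \<kappa> e) \<le> norm (of_real (e\<^sup>2) * hlm_g2 \<kappa> e)"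
      unfolding norm_mult norm_of_real by (intro mult_right_mono) auto
    also have "\<dots> \<le> B" by (rule g2[OF e])
    finally have 2: "norm (of_real ((t - e)\<^sup>2 / 2) * hlm_g2 \<kappa> e) \<le> B" .
    have "norm (hlm_g \<kappa> e) \<le> A * (1 + 1 / sqrt e)" using hlm_g_bound2[OF k e(1)] by (simp add: A_def)
    also have "\<dots> \<le> A * (1 + 1 / sqrt t)"
      using True t A by (intro mult_left_mono add_left_mono frac_le) auto
    finally have 3: "norm (hlm_g \<kappa> e) \<le> A * (1 + 1 / sqrt t)" .
    have "norm (hlm_p \<kappa> e t) \<le> norm (hlm_g \<kappa> e) + norm (of_real (t - e) * hlm_g1 \<kappa> e) + norm (of_real ((t - e)\<^sup>2 / 2) * hlm_g2 \<kappa> e)"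
      using True unfolding hlm_p_def by (simp only: if_True) (meson norm_triangle_mono norm_triangle_ineq order_refl)
    also have "\<dots> \<le> A * (1 + 1 / sqrt t) + 1 + B" using 1 2 3 by linarith
    also have "\<dots> \<le> A * (1 + 1 / sqrt t) + (1 + B) * (1 + 1 / sqrt t)"
    proof -
      have "(1 + B) * 1 \<le> (1 + B) * (1 + 1 / sqrt t)" using B t by (intro mult_left_mono) auto
      then show ?thesis by simp
    qed
    also have "\<dots> = C * (1 + 1 / sqrt t)" by (simp add: C_def algebra_simps)
    finally show ?thesis .
  qed
  show ?thesis
  proof (rule that[of r C])
    show "norm (of_real (e\<^sup>2) * hlm_g2 \<kappa> e) \<le> C" if "0 < e" "e < r" for e
      using g2[OF that] A by (simp add: C_def)
  qed (use r0 p A B in \<open>auto simp: r_def C_def\<close>)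
qed

text \<open>\<open>hlm_M\<close> lives on the disc |y - x|^2 < e. Its part L from the Laplacian is
  of size 1/e and has integral 4 pi e g'(e), which tends to -1: an approximate identity. The
  remaining part, \<kappa>^2 times the smoothed kernel, is dominated by an integrable weight on a
  shrinking disc and contributes nothing in the limit.\<close>

lemma hlm_M_tendsto:
  fixes F :: "real^2 \<Rightarrow> complex"
  assumes k: "0 < \<kappa>" and F: "continuous_on UNIV F" "\<And>y. R < norm y \<Longrightarrow> F y = 0"
    and e: "e \<longlonglongrightarrow> 0" "\<And>n. 0 < e n"
  shows "(\<lambda>n. \<integral>y. F y * hlm_M \<kappa> (e n) ((norm (y - x))\<^sup>2) \<partial>lborel) \<longlonglongrightarrow> - F x"
proof -
  obtain r C where rC: "0 < r" "r \<le> 1" "0 \<le> C"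
    "\<And>e. 0 < e \<Longrightarrow> e < r \<Longrightarrow> norm (of_real (e\<^sup>2) * hlm_g2 \<kappa> e) \<le> C"
    "\<And>e t. 0 < e \<Longrightarrow> e < r \<Longrightarrow> 0 < t \<Longrightarrow> norm (hlm_p \<kappa> e t) \<le> C * (1 + 1 / sqrt t)"
    using hlm_p_estimates[OF k] by blast
  have e_right: "filterlim e (at_right 0) sequentially"
  proof -
    have "e n \<noteq> 0" for n using e(2)[of n] by simp
    then show ?thesis using e by (simp add: filterlim_at)
  qed
  define a where "a = (\<lambda>e. of_real e * hlm_g1 \<kappa> e)"
  have a_lim: "(\<lambda>n. a (e n)) \<longlonglongrightarrow> - 1 / of_real (4 * pi)"
    unfolding a_def by (rule filterlim_compose[OF hlm_g1_at_0[OF k] e_right])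
  \<comment> \<open>For t < e the Laplacian 4 t p'' + 4 p' of the quadratic Taylor polynomial p is 4
    t g''(e) + 4 (g'(e) + (t - e) g''(e)).\<close>
  define L where "L = (\<lambda>e t. if t < e then of_real (8 * t - 4 * e) * hlm_g2 \<kappa> e + 4 * hlm_g1 \<kappa> e else 0)"
  define q where "q = (\<lambda>e t. if t < e then (of_real \<kappa>)\<^sup>2 * hlm_p \<kappa> e t else 0)"
  have M: "hlm_M \<kappa> e t = L e t + q e t" if "0 < e" for e t
    using that hlm_M_0[of e t \<kappa>]
    by (cases "t < e") (auto simp: L_def q_def hlm_M_def hlm_p1_def hlm_p2_def algebra_simps)
  have mL: "L e \<in> borel_measurable borel" for e
    unfolding L_def by measurable
  text \<open>The total mass of the regularised delta function.\<close>
  have L_int: "(\<integral>y. L e ((norm (y - x))\<^sup>2) \<partial>lborel) = of_real (4 * pi) * a e" if "0 < e" for e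
  proof -
    have "((\<lambda>t. of_real (8 * t - 4 * e) * hlm_g2 \<kappa> e + 4 * hlm_g1 \<kappa> e) has_integral
      (of_real (4 * e\<^sup>2 - 4 * e * e) * hlm_g2 \<kappa> e + of_real e * (4 * hlm_g1 \<kappa> e)
       - (of_real (4 * 0\<^sup>2 - 4 * e * 0) * hlm_g2 \<kappa> e + of_real 0 * (4 * hlm_g1 \<kappa> e)))) {0..e}"
    proof (rule fundamental_theorem_of_calculus)
      fix t :: real
      have 1: "((\<lambda>t. complex_of_real (4 * t\<^sup>2 - 4 * e * t)) has_vector_derivative of_real (8 * t - 4 * e)) (at t within {0..e})"
        by (rule has_vector_derivative_of_real) (auto intro!: derivative_eq_intros)
      have 2: "((\<lambda>t. complex_of_real t) has_vector_derivative of_real 1) (at t within {0..e})"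
        by (rule has_vector_derivative_of_real) (auto intro!: derivative_eq_intros)
      have "((\<lambda>t. of_real (4 * t\<^sup>2 - 4 * e * t) * hlm_g2 \<kappa> e + of_real t * (4 * hlm_g1 \<kappa> e)) has_vector_derivative
        (of_real (8 * t - 4 * e) * hlm_g2 \<kappa> e + of_real 1 * (4 * hlm_g1 \<kappa> e))) (at t within {0..e})"
        by (intro has_vector_derivative_add has_vector_derivative_mult_left 1 2)
      then show "((\<lambda>t. of_real (4 * t\<^sup>2 - 4 * e * t) * hlm_g2 \<kappa> e + of_real t * (4 * hlm_g1 \<kappa> e)) has_vector_derivative
        (of_real (8 * t - 4 * e) * hlm_g2 \<kappa> e + 4 * hlm_g1 \<kappa> e)) (at t within {0..e})" by simp
    qed (use that in simp)
    then have I: "((\<lambda>t. of_real (8 * t - 4 * e) * hlm_g2 \<kappa> e + 4 * hlm_g1 \<kappa> e) has_integral (4 * a e)) {0..e}"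
      by (simp add: a_def power2_eq_square mult_ac)
    have si: "set_integrable lborel {0..e} (\<lambda>t. of_real (8 * t - 4 * e) * hlm_g2 \<kappa> e + 4 * hlm_g1 \<kappa> e)"
      unfolding set_integrable_def by (rule borel_integrable_compact) (auto intro!: continuous_intros)
    have "(\<integral>t. indicator {0..} t *\<^sub>R L e t \<partial>lborel) = (LINT t:{0..e}|lborel. of_real (8 * t - 4 * e) * hlm_g2 \<kappa> e + 4 * hlm_g1 \<kappa> e)"
      unfolding set_lebesgue_integral_def
    proof (rule integral_cong_AE)
      show "AE t in lborel. indicator {0..} t *\<^sub>R L e t = indicator {0..e} t *\<^sub>R (of_real (8 * t - 4 * e) * hlm_g2 \<kappa> e + 4 * hlm_g1 \<kappa> e)"
        using AE_lborel_singleton[of e] by eventually_elim (auto simp: L_def indicator_def)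
    qed (use mL in measurable)
    also have "\<dots> = 4 * a e"
      using set_borel_integral_eq_integral(2)[OF si] integral_unique[OF I] by simp
    finally show ?thesis
      unfolding integral_radial[OF mL] by simp
  qed
  have "bounded (F ` cball 0 \<bar>R\<bar>)"
    by (intro compact_imp_bounded compact_continuous_image continuous_on_subset[OF F(1)]) auto
  then obtain K where K0: "0 < K" "\<And>y. y \<in> cball 0 \<bar>R\<bar> \<Longrightarrow> norm (F y) \<le> K"
    by (auto simp: bounded_pos)
  have K: "norm (F y) \<le> K" for y
    using K0 F(2)[of y] by (cases "norm y \<le> \<bar>R\<bar>") auto
  define D where "D = (\<lambda>n. (\<integral>y. F y * hlm_M \<kappa> (e n) ((norm (y - x))\<^sup>2) \<partial>lborel) - F x * (of_real (4 * pi) * a (e n)))"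
  define c0 where "c0 = pi * (8 * C + 2)"
  have "\<forall>\<^sub>F n in sequentially. e n < r" using order_tendstoD(2)[OF e(1), of r] rC by simp
  have D0: "D \<longlonglongrightarrow> 0"
  proof (rule tendstoI)
    fix \<epsilon> :: real assume \<epsilon>: "0 < \<epsilon>"
    \<comment> \<open>On the disc of area pi b the function L is at most (12 C + 4)/b, so an
      oscillation of F below this \<eta> costs less than \<epsilon>/2; the other half pays for the
      zeroth order part.\<close>
    define \<eta> where "\<eta> = \<epsilon> / (2 * (pi * (12 * C + 4) + 1))"
    have den: "0 < pi * (12 * C + 4) + 1" using rC by (simp add: add_nonneg_pos)
    have \<eta>: "0 < \<eta>" using \<epsilon> den by (simp add: \<eta>_def)
    have "isCont F x" using F(1) by (simp add: continuous_on_eq_continuous_at)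
    then obtain d where d: "0 < d" "\<And>y. dist y x < d \<Longrightarrow> dist (F y) (F x) < \<eta>"
      using \<eta> unfolding continuous_at_eps_delta by blast
    have ev1: "\<forall>\<^sub>F n in sequentially. e n < min r (d\<^sup>2)"
      using order_tendstoD(2)[OF e(1), of "min r (d\<^sup>2)"] rC d by simp
    have "(\<lambda>n. K * \<kappa>\<^sup>2 * (C * pi) * (e n + 2 * sqrt (e n))) \<longlonglongrightarrow> K * \<kappa>\<^sup>2 * (C * pi) * (0 + 2 * sqrt 0)"
      by (intro tendsto_intros e(1))
    then have ev2: "\<forall>\<^sub>F n in sequentially. K * \<kappa>\<^sup>2 * (C * pi) * (e n + 2 * sqrt (e n)) < \<epsilon> / 2"
      by (rule order_tendstoD) (use \<epsilon> in simp)
    have ev3: "\<forall>\<^sub>F n in sequentially. norm (a (e n)) < 1"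
    proof (rule order_tendstoD(2)[OF tendsto_norm[OF a_lim]])
      show "norm (- 1 / complex_of_real (4 * pi)) < 1"
        using pi_gt3 by (simp add: norm_divide norm_mult field_simps)
    qed
    show "\<forall>\<^sub>F n in sequentially. dist (D n) 0 < \<epsilon>"
      using ev1 ev2 ev3
    proof eventually_elim
      case (elim n)
      define b where "b = e n"
      have b: "0 < b" "b < r" "b < d\<^sup>2" using elim e(2) by (auto simp: b_def)
      have ball: "(norm (y - x))\<^sup>2 < b \<longleftrightarrow> y \<in> ball x (sqrt b)" for y
      proof -
        have "y \<in> ball x (sqrt b) \<longleftrightarrow> sqrt ((norm (y - x))\<^sup>2) < sqrt b" by (simp add: dist_norm norm_minus_commute)
        also have "\<dots> \<longleftrightarrow> (norm (y - x))\<^sup>2 < b" by (rule real_sqrt_less_iff)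
        finally show ?thesis by simp
      qed
      have Lb: "norm (L b t) \<le> (12 * C + 4) / b" if "0 \<le> t" for t
      proof (cases "t < b")
        case True
        have "norm (of_real (8 * t - 4 * b) * hlm_g2 \<kappa> b) = \<bar>8 * t - 4 * b\<bar> * norm (hlm_g2 \<kappa> b)"
          by (simp only: norm_mult norm_of_real)
        also have "\<dots> \<le> (12 * b) * norm (hlm_g2 \<kappa> b)"
          using True that by (intro mult_right_mono) auto
        also have "\<dots> = 12 * (norm (of_real (b\<^sup>2) * hlm_g2 \<kappa> b)) / b"
          using b by (simp add: norm_mult norm_power power2_eq_square)
        also have "\<dots> \<le> 12 * C / b"
          using rC(4)[OF b(1,2)] b by (intro divide_right_mono mult_left_mono) auto
        finally have 1: "norm (of_real (8 * t - 4 * b) * hlm_g2 \<kappa> b) \<le> 12 * C / b" .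
        have "norm (4 * hlm_g1 \<kappa> b) = 4 * norm (a b) / b"
          using b by (simp add: a_def norm_mult)
        also have "\<dots> \<le> 4 / b" using elim(3) b by (intro divide_right_mono) (auto simp: b_def)
        finally have 2: "norm (4 * hlm_g1 \<kappa> b) \<le> 4 / b" .
        have "norm (L b t) \<le> norm (of_real (8 * t - 4 * b) * hlm_g2 \<kappa> b) + norm (4 * hlm_g1 \<kappa> b)"
          using True unfolding L_def by (simp only: if_True norm_triangle_ineq)
        also have "\<dots> \<le> (12 * C + 4) / b" using 1 2 by (simp add: add_divide_distrib)
        finally show ?thesis .
      qed (use rC b in \<open>simp add: L_def\<close>)
      define f1 where "f1 = (\<lambda>y. (F y - F x) * L b ((norm (y - x))\<^sup>2))"
      define f2 where "f2 = (\<lambda>y. F y * q b ((norm (y - x))\<^sup>2))"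
      define f3 where "f3 = (\<lambda>y. L b ((norm (y - x))\<^sup>2))"
      have mF: "F \<in> borel_measurable borel" by (rule borel_measurable_continuous_onI[OF F(1)])
      have bnd: "f1 y = 0" "f2 y = 0" "f3 y = 0" if "y \<notin> ball x (sqrt b)" for y
        using that ball[of y] by (auto simp: f1_def f2_def f3_def L_def q_def)
      have fin: "integrable lborel (\<lambda>y. c * indicator (ball x (sqrt b)) y)" for c :: real
        using emeasure_lborel_ball_finite[of x "sqrt b"]
        by (auto simp: infinity_ennreal_def intro!: integrable_mult_right integrable_real_indicator)
      have n1: "norm (f1 y) \<le> \<eta> * ((12 * C + 4) / b) * indicator (ball x (sqrt b)) y" for y
      proof (cases "y \<in> ball x (sqrt b)")
        case True
        then have "dist y x < sqrt b" by (simp add: dist_commute)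
        also have "\<dots> < d" using b d(1) by (metis real_sqrt_less_iff real_sqrt_abs abs_of_pos)
        finally have "norm (F y - F x) \<le> \<eta>" using d(2)[of y] by (simp add: dist_norm)
        then have "norm (F y - F x) * norm (L b ((norm (y - x))\<^sup>2)) \<le> \<eta> * ((12 * C + 4) / b)"
          using Lb[of "(norm (y - x))\<^sup>2"] \<eta> by (intro mult_mono) auto
        then show ?thesis using True by (simp add: f1_def norm_mult)
      qed (simp add: bnd)
      have n3: "norm (f3 y) \<le> ((12 * C + 4) / b) * indicator (ball x (sqrt b)) y" for y
        using Lb[of "(norm (y - x))\<^sup>2"] bnd(3)[of y] by (cases "y \<in> ball x (sqrt b)") (auto simp: f3_def)
      have mp: "(\<lambda>y. q b ((norm (y - x))\<^sup>2)) \<in> borel_measurable borel"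
      proof -
        have "continuous_on UNIV (hlm_p \<kappa> b)"
          using hlm_p_deriv(1)[OF k b(1)] by (meson continuous_at_imp_continuous_on has_vector_derivative_continuous)
        then have [measurable]: "hlm_p \<kappa> b \<in> borel_measurable borel" by (rule borel_measurable_continuous_onI)
        show ?thesis unfolding q_def by measurable
      qed
      have i1: "integrable lborel f1"
      proof (rule Bochner_Integration.integrable_bound[OF fin[of "\<eta> * ((12 * C + 4) / b)"]])
        show "f1 \<in> borel_measurable lborel"
          unfolding f1_def using mF by (auto intro!: borel_measurable_times borel_measurable_diff measurable_compose[OF _ mL])
        show "AE y in lborel. norm (f1 y) \<le> norm (\<eta> * ((12 * C + 4) / b) * indicator (ball x (sqrt b)) y)"
          by (intro AE_I2) (simp only: real_norm_def order_trans[OF n1 abs_ge_self])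
      qed
      have i3: "integrable lborel f3"
      proof (rule Bochner_Integration.integrable_bound[OF fin[of "(12 * C + 4) / b"]])
        show "f3 \<in> borel_measurable lborel"
          unfolding f3_def by (auto intro!: measurable_compose[OF _ mL])
        show "AE y in lborel. norm (f3 y) \<le> norm ((12 * C + 4) / b * indicator (ball x (sqrt b)) y)"
          by (intro AE_I2) (simp only: real_norm_def order_trans[OF n3 abs_ge_self])
      qed
      have qb: "norm (f2 y) \<le> (K * \<kappa>\<^sup>2 * C) * ((1 + 1 / norm (y - x)) * indicator (ball x (sqrt b)) y)" if "y \<noteq> x" for y
      proof (cases "y \<in> ball x (sqrt b)")
        case True
        then have "norm (f2 y) = norm (F y) * (\<kappa>\<^sup>2 * norm (hlm_p \<kappa> b ((norm (y - x))\<^sup>2)))"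
          using ball[of y] by (simp add: f2_def q_def norm_mult norm_power)
        also have "\<dots> \<le> K * (\<kappa>\<^sup>2 * (C * (1 + 1 / sqrt ((norm (y - x))\<^sup>2))))"
          using rC(5)[OF b(1,2), of "(norm (y - x))\<^sup>2"] that K[of y] K0(1)
          by (intro mult_mono mult_nonneg_nonneg) auto
        finally show ?thesis using True by (simp add: mult_ac)
      qed (simp add: bnd)
      have w: "integrable lborel (\<lambda>y. (1 + 1 / norm (y - x)) * indicator (ball x (sqrt b)) y)"
        and wi: "(\<integral>y. (1 + 1 / norm (y - x)) * indicator (ball x (sqrt b)) y \<partial>lborel) \<le> pi * (b + 2 * sqrt b)"
      proof -
        have [measurable]: "ball x (sqrt b) \<in> sets borel" "cball x (sqrt b) \<in> sets borel" by auto
        have m: "(indicator (ball x (sqrt b)) :: _ \<Rightarrow> ennreal) \<in> borel_measurable borel"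
           "(\<lambda>y. indicator (cball x (sqrt b)) y * ennreal (1 / norm (y - x))) \<in> borel_measurable borel"
           "(\<lambda>y. (1 + 1 / norm (y - x)) * indicator (ball x (sqrt b)) y) \<in> borel_measurable borel"
          by measurable
        have "(\<integral>\<^sup>+y. ennreal ((1 + 1 / norm (y - x)) * indicator (ball x (sqrt b)) y) \<partial>lborel)
          \<le> (\<integral>\<^sup>+y. indicator (ball x (sqrt b)) y + indicator (cball x (sqrt b)) y * ennreal (1 / norm (y - x)) \<partial>lborel)"
          by (intro nn_integral_mono) (auto simp: indicator_def)
        also have "\<dots> = emeasure lborel (ball x (sqrt b)) + ennreal (2 * pi * sqrt b)"
          using nn_integral_inverse_norm[of "sqrt b" x] b m by (subst nn_integral_add) auto
        also have "emeasure lborel (ball x (sqrt b)) = ennreal (pi * b)"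
          using b by (subst emeasure_ball) (auto simp: unit_ball_vol_2)
        also have "ennreal (pi * b) + ennreal (2 * pi * sqrt b) = ennreal (pi * (b + 2 * sqrt b))"
          using b by (subst ennreal_plus[symmetric]) (auto simp: algebra_simps)
        finally have le: "(\<integral>\<^sup>+y. ennreal ((1 + 1 / norm (y - x)) * indicator (ball x (sqrt b)) y) \<partial>lborel) \<le> ennreal (pi * (b + 2 * sqrt b))" .
        show w: "integrable lborel (\<lambda>y. (1 + 1 / norm (y - x)) * indicator (ball x (sqrt b)) y)"
          by (rule integrableI_nonneg) (use le_less_trans[OF le] m in auto)
        show "(\<integral>y. (1 + 1 / norm (y - x)) * indicator (ball x (sqrt b)) y \<partial>lborel) \<le> pi * (b + 2 * sqrt b)"
          by (rule integral_real_bounded) (use le b in auto)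
      qed
      have ae: "AE y in lborel. norm (f2 y) \<le> (K * \<kappa>\<^sup>2 * C) * ((1 + 1 / norm (y - x)) * indicator (ball x (sqrt b)) y)"
        using AE_lborel_singleton[of x] by eventually_elim (rule qb)
      have i2: "integrable lborel f2"
      proof (rule Bochner_Integration.integrable_bound[OF integrable_mult_right[OF w, of "K * \<kappa>\<^sup>2 * C"]])
        show "f2 \<in> borel_measurable lborel" unfolding f2_def using mF mp by simp
        show "AE y in lborel. norm (f2 y) \<le> norm ((K * \<kappa>\<^sup>2 * C) * ((1 + 1 / norm (y - x)) * indicator (ball x (sqrt b)) y))"
          using ae by eventually_elim (simp only: real_norm_def abs_ge_self order_trans[OF _ abs_ge_self])
      qed
      have F2: "norm (\<integral>y. f2 y \<partial>lborel) \<le> K * \<kappa>\<^sup>2 * (C * pi) * (b + 2 * sqrt b)"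
      proof -
        have "norm (\<integral>y. f2 y \<partial>lborel) \<le> (\<integral>y. norm (f2 y) \<partial>lborel)" by (rule integral_norm_bound)
        also have "\<dots> \<le> (\<integral>y. (K * \<kappa>\<^sup>2 * C) * ((1 + 1 / norm (y - x)) * indicator (ball x (sqrt b)) y) \<partial>lborel)"
          by (rule integral_mono_AE[OF integrable_norm[OF i2] integrable_mult_right[OF w] ae])
        also have "\<dots> = (K * \<kappa>\<^sup>2 * C) * (\<integral>y. (1 + 1 / norm (y - x)) * indicator (ball x (sqrt b)) y \<partial>lborel)"
          by (rule integral_mult_right_zero)
        also have "\<dots> \<le> (K * \<kappa>\<^sup>2 * C) * (pi * (b + 2 * sqrt b))"
          using wi K0(1) rC(3) by (intro mult_left_mono) auto
        finally show ?thesis by (simp add: mult_ac)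
      qed
      have F1: "norm (\<integral>y. f1 y \<partial>lborel) \<le> \<eta> * (pi * (12 * C + 4))"
      proof -
        have "norm (\<integral>y. f1 y \<partial>lborel) \<le> \<eta> * ((12 * C + 4) / b) * (pi * (sqrt b)\<^sup>2)"
          by (rule norm_integral_ball_le[OF _ _ n1]) (use b \<eta> rC in auto)
        also have "\<dots> = \<eta> * (pi * (12 * C + 4))" using b by simp
        finally show ?thesis .
      qed
      have "(\<integral>y. F y * hlm_M \<kappa> b ((norm (y - x))\<^sup>2) \<partial>lborel) = (\<integral>y. f1 y + f2 y + F x * f3 y \<partial>lborel)"
        by (simp add: M[OF b(1)] f1_def f2_def f3_def algebra_simps)
      also have "\<dots> = (\<integral>y. f1 y \<partial>lborel) + (\<integral>y. f2 y \<partial>lborel) + F x * (\<integral>y. f3 y \<partial>lborel)"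
        using i1 i2 i3 by simp
      also have "(\<integral>y. f3 y \<partial>lborel) = of_real (4 * pi) * a b"
        unfolding f3_def by (rule L_int[OF b(1)])
      finally have "D n = (\<integral>y. f1 y \<partial>lborel) + (\<integral>y. f2 y \<partial>lborel)"
        by (simp add: D_def b_def)
      then have "norm (D n) \<le> norm (\<integral>y. f1 y \<partial>lborel) + norm (\<integral>y. f2 y \<partial>lborel)"
        by (simp only: norm_triangle_ineq)
      also have "\<dots> \<le> \<eta> * (pi * (12 * C + 4)) + K * \<kappa>\<^sup>2 * (C * pi) * (b + 2 * sqrt b)"
        by (rule add_mono[OF F1 F2])
      also have "\<eta> * (pi * (12 * C + 4)) \<le> \<epsilon> / 2"
      proof -
        have "\<eta> * (pi * (12 * C + 4)) \<le> \<eta> * (pi * (12 * C + 4) + 1)" using \<eta> by (intro mult_left_mono) auto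
        also have "\<dots> = \<epsilon> / 2"
        proof -
          have "\<epsilon> / (2 * Z) * Z = \<epsilon> / 2" if "0 < Z" for Z :: real using that by simp
          from this[OF den] show ?thesis unfolding \<eta>_def .
        qed
        finally show ?thesis .
      qed
      finally show "dist (D n) 0 < \<epsilon>" using elim(2) by (simp add: b_def)
    qed
  qed
  have "(\<lambda>n. D n + F x * (of_real (4 * pi) * a (e n))) \<longlonglongrightarrow> 0 + F x * (of_real (4 * pi) * (- 1 / of_real (4 * pi)))"
    by (intro tendsto_intros D0 a_lim)
  then show ?thesis by (simp add: D_def)
qed

text \<open>Green's identity holds for the smoothed kernel. Letting the smoothing radius shrink,
  \<open>hlm_M\<close> turns into evaluation at \<open>x\<close>, while the terms with the gradient
  of \<phi> do not change at all: \<phi> is flat near \<open>x\<close>, and beyond that the kernel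
  has not been modified.\<close>

lemma green_representation:
  fixes x :: "real^2"
  assumes k: "0 < \<kappa>"
    and u: "c1 u u1" "\<And>i. c1 (u1 i) (u2 i)"
    and \<phi>: "c1 \<phi> \<phi>1" "\<And>y. R < norm y \<Longrightarrow> \<phi> y = 0"
    and plateau: "0 < r0" "\<And>y j. norm (y - x) < r0 \<Longrightarrow> \<phi>1 j y = 0"
  shows "(\<integral>y. \<phi> y * hlm_g \<kappa> ((norm (y - x))\<^sup>2) * ((\<Sum>j\<in>UNIV. u2 j j y) + (of_real \<kappa>)\<^sup>2 * u y) \<partial>lborel)
    = - (\<phi> x * u x) - (\<integral>y. (\<Sum>j\<in>UNIV. \<phi>1 j y * (hlm_g \<kappa> ((norm (y - x))\<^sup>2) * u1 j y
         - u y * (of_real (2 * (y - x) $ j) * hlm_g1 \<kappa> ((norm (y - x))\<^sup>2)))) \<partial>lborel)"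
proof -
  obtain r C where rC: "0 < r" "r \<le> 1" "0 \<le> C"
    "\<And>e t. 0 < e \<Longrightarrow> e < r \<Longrightarrow> 0 < t \<Longrightarrow> norm (hlm_p \<kappa> e t) \<le> C * (1 + 1 / sqrt t)"
    using hlm_p_estimates[OF k] by metis
  \<comment> \<open>The bound r0^2 keeps the smoothed disc inside the plateau of \<phi>; the bound r
    makes the uniform kernel estimate available.\<close>
  define m where "m = min r (r0\<^sup>2)"
  have m0: "0 < m" using rC plateau by (simp add: m_def)
  define e where "e = (\<lambda>n. m / (real n + 2))"
  have e: "0 < e n" "e n < m" for n
    using m0 by (auto simp: e_def divide_less_eq)
  have e0: "e \<longlonglongrightarrow> 0" unfolding e_def by real_asymp
  define N where "N = (\<lambda>y. (norm (y - x))\<^sup>2)"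
  define Lu where "Lu = (\<lambda>y. (\<Sum>j\<in>UNIV. u2 j j y) + (of_real \<kappa>)\<^sup>2 * u y)"
  define bd where "bd = (\<integral>y. (\<Sum>j\<in>UNIV. \<phi>1 j y * (hlm_g \<kappa> (N y) * u1 j y
         - u y * (of_real (2 * (y - x) $ j) * hlm_g1 \<kappa> (N y)))) \<partial>lborel)"
  note cont = c1_cont[OF u(1)] c1_cont[OF u(2)] c1_cont'[OF u(2)] c1_cont[OF \<phi>(1)] c1_cont'[OF \<phi>(1)]
  have cN: "continuous_on A N" for A unfolding N_def by (intro continuous_intros)
  have cLu: "continuous_on UNIV (\<lambda>y. \<phi> y * Lu y)"
    unfolding Lu_def by (intro continuous_intros cont)
  have cp: "continuous_on UNIV (hlm_p \<kappa> (e n))" "continuous_on UNIV (hlm_p1 \<kappa> (e n))" for n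
    using hlm_p_deriv(1,2)[OF k e(1)] by (meson continuous_at_imp_continuous_on has_vector_derivative_continuous)+
  have cM: "continuous_on UNIV (hlm_M \<kappa> (e n))" for n
    unfolding hlm_M_def by (intro continuous_intros cp hlm_p_deriv(3)[OF k e(1)])
  have main: "(\<integral>y. (\<phi> y * Lu y) * hlm_p \<kappa> (e n) (N y) \<partial>lborel) - (\<integral>y. (\<phi> y * u y) * hlm_M \<kappa> (e n) (N y) \<partial>lborel) = - bd" for n
  proof -
    define P where "P = (\<lambda>y. hlm_p \<kappa> (e n) ((norm (y - x))\<^sup>2))"
    define P1 where "P1 = (\<lambda>j y. of_real (2 * (y - x) $ j) * hlm_p1 \<kappa> (e n) ((norm (y - x))\<^sup>2))"
    obtain P2 where P2: "c1 P P1" "\<And>j. c1 (P1 j) (P2 j)"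
      "\<And>y. (\<Sum>j\<in>UNIV. P2 j j y) + (of_real \<kappa>)\<^sup>2 * P y = hlm_M \<kappa> (e n) ((norm (y - x))\<^sup>2)"
      using c1_hlm_P[OF k e(1)[of n], of x] unfolding P_def P1_def by blast
    have "(\<integral>y. \<phi> y * (P y * (\<Sum>j\<in>UNIV. u2 j j y) - u y * (\<Sum>j\<in>UNIV. P2 j j y)) \<partial>lborel)
       = - (\<integral>y. (\<Sum>j\<in>UNIV. \<phi>1 j y * (P y * u1 j y - u y * P1 j y)) \<partial>lborel)"
      by (rule green_identity[OF u P2(1,2) \<phi>])
    moreover have "(\<lambda>y. (\<Sum>j\<in>UNIV. \<phi>1 j y * (P y * u1 j y - u y * P1 j y)))
       = (\<lambda>y. (\<Sum>j\<in>UNIV. \<phi>1 j y * (hlm_g \<kappa> (N y) * u1 j y - u y * (of_real (2 * (y - x) $ j) * hlm_g1 \<kappa> (N y)))))"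
    proof
      fix y
      show "(\<Sum>j\<in>UNIV. \<phi>1 j y * (P y * u1 j y - u y * P1 j y))
       = (\<Sum>j\<in>UNIV. \<phi>1 j y * (hlm_g \<kappa> (N y) * u1 j y - u y * (of_real (2 * (y - x) $ j) * hlm_g1 \<kappa> (N y))))"
      proof (cases "norm (y - x) < r0")
        case False
        then have "r0\<^sup>2 \<le> (norm (y - x))\<^sup>2" using plateau(1) by (intro power_mono) auto
        then have "\<not> (norm (y - x))\<^sup>2 < e n" using e(2)[of n] by (simp add: m_def)
        then show ?thesis by (simp add: P_def P1_def N_def hlm_p_def hlm_p1_def)
      qed (simp add: plateau(2))
    qed
    moreover have "(\<lambda>y. \<phi> y * (P y * (\<Sum>j\<in>UNIV. u2 j j y) - u y * (\<Sum>j\<in>UNIV. P2 j j y)))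
      = (\<lambda>y. (\<phi> y * Lu y) * hlm_p \<kappa> (e n) (N y) - (\<phi> y * u y) * hlm_M \<kappa> (e n) (N y))"
    proof
      fix y
      have eq: "(\<Sum>j\<in>UNIV. P2 j j y) = hlm_M \<kappa> (e n) (N y) - (of_real \<kappa>)\<^sup>2 * P y"
        using P2(3)[of y] by (simp add: N_def algebra_simps)
      show "\<phi> y * (P y * (\<Sum>j\<in>UNIV. u2 j j y) - u y * (\<Sum>j\<in>UNIV. P2 j j y))
        = (\<phi> y * Lu y) * hlm_p \<kappa> (e n) (N y) - (\<phi> y * u y) * hlm_M \<kappa> (e n) (N y)"
        unfolding eq by (simp add: Lu_def P_def N_def algebra_simps)
    qed
    moreover have "integrable lborel (\<lambda>y. (\<phi> y * Lu y) * hlm_p \<kappa> (e n) (N y))"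
      by (rule integrable_compact_support[of _ R])
        (auto simp: \<phi>(2) intro!: continuous_intros cLu cN continuous_on_compose2[OF cp(1)])
    moreover have "integrable lborel (\<lambda>y. (\<phi> y * u y) * hlm_M \<kappa> (e n) (N y))"
      by (rule integrable_compact_support[of _ R])
        (auto simp: \<phi>(2) intro!: continuous_intros cont cN continuous_on_compose2[OF cM])
    ultimately show ?thesis unfolding bd_def by simp
  qed
  have M_lim: "(\<lambda>n. \<integral>y. (\<phi> y * u y) * hlm_M \<kappa> (e n) (N y) \<partial>lborel) \<longlonglongrightarrow> - (\<phi> x * u x)"
    unfolding N_def
    by (rule hlm_M_tendsto[OF k _ _ e0 e(1), of _ R]) (auto simp: \<phi>(2) intro!: continuous_intros cont)
  have "bounded ((\<lambda>y. \<phi> y * Lu y) ` cball 0 R)"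
    by (intro compact_imp_bounded compact_continuous_image continuous_on_subset[OF cLu]) auto
  then obtain K where K: "0 < K" "\<And>y. y \<in> cball 0 R \<Longrightarrow> norm (\<phi> y * Lu y) \<le> K"
    by (auto simp: bounded_pos)
  have P_lim: "(\<lambda>n. \<integral>y. (\<phi> y * Lu y) * hlm_p \<kappa> (e n) (N y) \<partial>lborel) \<longlonglongrightarrow> (\<integral>y. (\<phi> y * Lu y) * hlm_g \<kappa> (N y) \<partial>lborel)"
  proof (rule integral_dominated_convergence)
    have mF: "(\<lambda>y. \<phi> y * Lu y) \<in> borel_measurable lborel"
      using borel_measurable_continuous_onI[OF cLu] by simp
    have mN: "N \<in> borel_measurable lborel"
      using borel_measurable_continuous_onI[OF cN] by simp
    show "(\<lambda>y. (\<phi> y * Lu y) * hlm_g \<kappa> (N y)) \<in> borel_measurable lborel"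
      by (intro borel_measurable_times mF borel_measurable_hlm_g[OF k mN]) (simp add: N_def)
    show "(\<lambda>y. (\<phi> y * Lu y) * hlm_p \<kappa> (e n) (N y)) \<in> borel_measurable lborel" for n
      by (intro borel_measurable_times mF measurable_compose[OF mN] borel_measurable_continuous_onI cp)
    show "integrable lborel (\<lambda>y. (K * C) * (1 + 1 / norm (y - x)) * indicator (cball 0 R) y)"
      by (rule integrable_weight)
    show "AE y in lborel. (\<lambda>n. (\<phi> y * Lu y) * hlm_p \<kappa> (e n) (N y)) \<longlonglongrightarrow> (\<phi> y * Lu y) * hlm_g \<kappa> (N y)"
      using AE_lborel_singleton[of x]
    proof eventually_elim
      case (elim y)
      then have "0 < N y" by (simp add: N_def)
      then have "\<forall>\<^sub>F n in sequentially. e n < N y" using order_tendstoD(2)[OF e0] by blast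
      then have "\<forall>\<^sub>F n in sequentially. (\<phi> y * Lu y) * hlm_p \<kappa> (e n) (N y) = (\<phi> y * Lu y) * hlm_g \<kappa> (N y)"
        by eventually_elim (simp add: hlm_p_def)
      then show ?case by (rule tendsto_eventually)
    qed
    show "AE y in lborel. norm ((\<phi> y * Lu y) * hlm_p \<kappa> (e n) (N y)) \<le> (K * C) * (1 + 1 / norm (y - x)) * indicator (cball 0 R) y" for n
      using AE_lborel_singleton[of x]
    proof eventually_elim
      case (elim y)
      show ?case
      proof (cases "y \<in> cball 0 R")
        case True
        have "norm (hlm_p \<kappa> (e n) (N y)) \<le> C * (1 + 1 / sqrt (N y))"
          by (rule rC(4)) (use elim e[of n] in \<open>auto simp: N_def m_def\<close>)
        then have "norm (\<phi> y * Lu y) * norm (hlm_p \<kappa> (e n) (N y)) \<le> K * (C * (1 + 1 / norm (y - x)))"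
          using K True by (intro mult_mono) (auto simp: N_def)
        then show ?thesis using True by (simp only: norm_mult indicator_simps mult_1_right mult.assoc)
      qed (use \<phi>(2) in simp)
    qed
  qed
  have "(\<lambda>n. - bd) \<longlonglongrightarrow> (\<integral>y. (\<phi> y * Lu y) * hlm_g \<kappa> (N y) \<partial>lborel) - (- (\<phi> x * u x))"
    using tendsto_diff[OF P_lim M_lim] by (simp only: main)
  then have bd: "- bd = (\<integral>y. (\<phi> y * Lu y) * hlm_g \<kappa> (N y) \<partial>lborel) + \<phi> x * u x"
    by (simp add: LIMSEQ_const_iff)
  have "(\<integral>y. (\<phi> y * Lu y) * hlm_g \<kappa> (N y) \<partial>lborel)
      = - (\<phi> x * u x) + ((\<integral>y. (\<phi> y * Lu y) * hlm_g \<kappa> (N y) \<partial>lborel) + \<phi> x * u x)"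
    by simp
  also have "\<dots> = - (\<phi> x * u x) - bd" unfolding bd[symmetric] by simp
  finally have "(\<integral>y. (\<phi> y * Lu y) * hlm_g \<kappa> (N y) \<partial>lborel) = - (\<phi> x * u x) - bd" .
  then show ?thesis by (simp add: bd_def Lu_def N_def mult_ac)
qed

section \<open>Cutoff functions\<close>

definition chiw :: "real \<Rightarrow> real" where
  "chiw t = 6 * max 0 ((t - 1) * (2 - t))"

text \<open>The cubic step from 1 to 0 on [1, 2]; with s = t - 1 its derivative is -6 s (1 - s),
  that is \<open>- chiw t\<close>. One continuous derivative is enough for Green's identity, and the
  fixed sign of \<open>chiw\<close> lets it serve as a weight.\<close>

definition chi :: "real \<Rightarrow> complex" where
  "chi t = (if t < 1 then 1 else if t < 2 then of_real (1 - 3 * (t - 1)\<^sup>2 + 2 * (t - 1) ^ 3) else 0)"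

lemma chi_deriv: "(chi has_vector_derivative - of_real (chiw t)) (at t)"
proof -
  have 1: "((\<lambda>t. complex_of_real (1 - 3 * (t - 1)\<^sup>2 + 2 * (t - 1) ^ 3)) has_vector_derivative
     of_real (- 6 * ((t - 1) * (2 - t)))) (at t)" for t :: real
    by (rule has_vector_derivative_of_real)
      (auto intro!: derivative_eq_intros simp: power2_eq_square algebra_simps)
  have 2: "((\<lambda>t. if t < 2 then complex_of_real (1 - 3 * (t - 1)\<^sup>2 + 2 * (t - 1) ^ 3) else 0) has_vector_derivative
     (if t < 2 then of_real (- 6 * ((t - 1) * (2 - t))) else 0)) (at t)" for t
    by (rule has_vector_derivative_if_less) (use 1 in auto)
  have 3: "(chi has_vector_derivative
     (if t < 1 then 0 else (if t < 2 then of_real (- 6 * ((t - 1) * (2 - t))) else 0))) (at t)"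
    unfolding chi_def[abs_def] by (rule has_vector_derivative_if_less) (use 2 in auto)
  have "(t - 1) * (2 - t) \<le> 0" if "t < 1 \<or> 2 \<le> t"
    using that by (cases "t < 1") (simp_all add: mult_nonpos_nonneg mult_nonneg_nonpos)
  moreover have "0 \<le> (t - 1) * (2 - t)" if "1 \<le> t" "t < 2" using that by simp
  ultimately have "(if t < 1 then 0 else (if t < 2 then complex_of_real (- 6 * ((t - 1) * (2 - t))) else 0)) = - of_real (chiw t)"
    unfolding chiw_def by (cases "t < 1"; cases "t < 2") (auto simp: max_def)
  with 3 show ?thesis by simp
qed

lemma chiw_bounds: "0 \<le> chiw t" "chiw t \<le> 2"
proof -
  show "0 \<le> chiw t" by (simp add: chiw_def)
  have "(t - 1) * (2 - t) = 1/4 - (t - 3/2)\<^sup>2" by (simp add: power2_eq_square algebra_simps)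
  then have "(t - 1) * (2 - t) \<le> 1/4" by simp
  then show "chiw t \<le> 2" by (simp add: chiw_def)
qed

lemma chiw_0: "t < 1 \<or> 2 < t \<Longrightarrow> chiw t = 0"
  unfolding chiw_def by (auto simp: max_def mult_nonpos_nonneg mult_nonneg_nonpos dest: order_antisym)

lemma continuous_on_chiw: "continuous_on A chiw"
  unfolding chiw_def by (intro continuous_intros)

text \<open>A function of the squared norm has a gradient along \<open>y\<close>. The boundary terms
  of Green's identity thus become averages of radial derivatives over an annulus, in the form in
  which the radiation condition applies.\<close>

definition cutoff :: "real \<Rightarrow> real^2 \<Rightarrow> complex" where
  "cutoff R y = chi ((norm y)\<^sup>2 / R\<^sup>2)"

definition cutoff1 :: "real \<Rightarrow> 2 \<Rightarrow> real^2 \<Rightarrow> complex" where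
  "cutoff1 R j y = of_real (- 2 * y $ j / R\<^sup>2 * chiw ((norm y)\<^sup>2 / R\<^sup>2))"

lemma c1_cutoff: "c1 (cutoff R) (cutoff1 R)" if "0 < R"
proof -
  have p: "((\<lambda>t. chi (t / R\<^sup>2)) has_vector_derivative of_real (- chiw (t / R\<^sup>2) / R\<^sup>2)) (at t)" for t
  proof -
    have "((\<lambda>t. t / R\<^sup>2) has_vector_derivative 1 / R\<^sup>2) (at t)"
      by (rule has_vector_derivative_divide[OF has_vector_derivative_id])
    from vector_diff_chain_at[OF this chi_deriv] show ?thesis
      by (simp add: o_def scaleR_conv_of_real)
  qed
  have "c1 (\<lambda>y. chi ((norm (y - 0))\<^sup>2 / R\<^sup>2)) (\<lambda>j y. of_real (2 * (y - 0) $ j) * of_real (- chiw ((norm (y - 0))\<^sup>2 / R\<^sup>2) / R\<^sup>2))"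
    by (rule c1_radial[OF p]) (intro continuous_intros continuous_on_compose2[OF continuous_on_chiw[of UNIV]]; simp add: that less_imp_neq[THEN not_sym])
  then show ?thesis by (simp add: cutoff_def[abs_def] cutoff1_def[abs_def])
qed

lemma cutoff_inside: "cutoff R y = 1" "cutoff1 R j y = 0" if "norm y < R"
proof -
  have "(norm y)\<^sup>2 < R\<^sup>2" using that by (intro power_strict_mono) auto
  moreover have "0 < R" using that norm_ge_zero[of y] by linarith
  ultimately have "(norm y)\<^sup>2 / R\<^sup>2 < 1" by simp
  then show "cutoff R y = 1" "cutoff1 R j y = 0" by (auto simp: cutoff_def cutoff1_def chi_def chiw_0)
qed

lemma cutoff_outside: "cutoff R y = 0" if "2 * R < norm y" "0 < R"
proof -
  have "(2 * R)\<^sup>2 < (norm y)\<^sup>2" using that by (intro power_strict_mono) auto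
  then have "4 * R\<^sup>2 < (norm y)\<^sup>2" by (simp add: power_mult_distrib)
  then have "2 * R\<^sup>2 < (norm y)\<^sup>2" using zero_le_power2[of R] by linarith
  then have "2 < (norm y)\<^sup>2 / R\<^sup>2" using that by (simp add: less_divide_eq)
  then show ?thesis by (simp add: cutoff_def chi_def)
qed

lemma cutoff_annulus: "R \<le> norm y \<and> norm y \<le> 2 * R" if "chiw ((norm y)\<^sup>2 / R\<^sup>2) \<noteq> 0" "0 < R"
proof (rule ccontr)
  assume "\<not> (R \<le> norm y \<and> norm y \<le> 2 * R)"
  then consider "norm y < R" | "2 * R < norm y" by linarith
  then have "(norm y)\<^sup>2 / R\<^sup>2 < 1 \<or> 2 < (norm y)\<^sup>2 / R\<^sup>2"
  proof cases
    case 1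
    then have "(norm y)\<^sup>2 < R\<^sup>2" by (intro power_strict_mono) auto
    then show ?thesis using that by simp
  next
    case 2
    then have "(2 * R)\<^sup>2 < (norm y)\<^sup>2" using that by (intro power_strict_mono) auto
    then have "4 * R\<^sup>2 < (norm y)\<^sup>2" by (simp add: power_mult_distrib)
    then have "2 * R\<^sup>2 < (norm y)\<^sup>2" using zero_le_power2[of R] by linarith
    then show ?thesis using that by (simp add: less_divide_eq)
  qed
  then show False using chiw_0 that by blast
qed

text \<open>The cutoff equals 1 on the support of \<open>u\<close> and on the unit disc about
  \<open>x\<close>, so it disappears from the volume term and its gradient meets only zeros of
  \<open>u\<close> and of its derivatives.\<close>

lemma fundamental_solution:
  fixes x :: "real^2"
  assumes k: "0 < \<kappa>" and u: "c1 u u1" "\<And>i. c1 (u1 i) (u2 i)" "\<And>y. R < norm y \<Longrightarrow> u y = 0"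
  shows "(\<integral>y. hlm_g \<kappa> ((norm (y - x))\<^sup>2) * ((\<Sum>j\<in>UNIV. u2 j j y) + (of_real \<kappa>)\<^sup>2 * u y) \<partial>lborel) = - u x"
proof -
  define S where "S = \<bar>R\<bar> + norm x + 1"
  have S: "0 < S" by (simp add: S_def add_nonneg_pos)
  have u1: "u1 j y = 0" if "R < norm y" for j y by (rule c1_zero_outside[OF u(1,3) that])
  have u2: "u2 i j y = 0" if "R < norm y" for i j y by (rule c1_zero_outside[OF u(2) u1 that])
  have "(\<integral>y. cutoff S y * hlm_g \<kappa> ((norm (y - x))\<^sup>2) * ((\<Sum>j\<in>UNIV. u2 j j y) + (of_real \<kappa>)\<^sup>2 * u y) \<partial>lborel)
    = - (cutoff S x * u x) - (\<integral>y. (\<Sum>j\<in>UNIV. cutoff1 S j y * (hlm_g \<kappa> ((norm (y - x))\<^sup>2) * u1 j y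
         - u y * (of_real (2 * (y - x) $ j) * hlm_g1 \<kappa> ((norm (y - x))\<^sup>2)))) \<partial>lborel)"
  proof (rule green_representation[OF k u(1,2) c1_cutoff[OF S] _ zero_less_one])
    show "cutoff S y = 0" if "2 * S < norm y" for y by (rule cutoff_outside[OF that S])
    show "cutoff1 S j y = 0" if "norm (y - x) < 1" for y j
      by (rule cutoff_inside(2)) (use that norm_triangle_ineq[of "y - x" x] in \<open>simp add: S_def\<close>)
  qed
  moreover have "cutoff S x = 1" by (rule cutoff_inside(1)) (simp add: S_def)
  moreover have "(\<lambda>y. cutoff S y * hlm_g \<kappa> ((norm (y - x))\<^sup>2) * ((\<Sum>j\<in>UNIV. u2 j j y) + (of_real \<kappa>)\<^sup>2 * u y))
     = (\<lambda>y. hlm_g \<kappa> ((norm (y - x))\<^sup>2) * ((\<Sum>j\<in>UNIV. u2 j j y) + (of_real \<kappa>)\<^sup>2 * u y))"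
  proof
    fix y
    show "cutoff S y * hlm_g \<kappa> ((norm (y - x))\<^sup>2) * ((\<Sum>j\<in>UNIV. u2 j j y) + (of_real \<kappa>)\<^sup>2 * u y)
     = hlm_g \<kappa> ((norm (y - x))\<^sup>2) * ((\<Sum>j\<in>UNIV. u2 j j y) + (of_real \<kappa>)\<^sup>2 * u y)"
    proof (cases "norm y < S")
      case False
      then have "R < norm y" using norm_ge_zero[of x] abs_ge_self[of R] unfolding S_def by linarith
      then show ?thesis using u2 u(3) by simp
    qed (simp add: cutoff_inside)
  qed
  moreover have "(\<lambda>y. (\<Sum>j\<in>UNIV. cutoff1 S j y * (hlm_g \<kappa> ((norm (y - x))\<^sup>2) * u1 j y
         - u y * (of_real (2 * (y - x) $ j) * hlm_g1 \<kappa> ((norm (y - x))\<^sup>2))))) = (\<lambda>y. 0)"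
  proof
    fix y
    show "(\<Sum>j\<in>UNIV. cutoff1 S j y * (hlm_g \<kappa> ((norm (y - x))\<^sup>2) * u1 j y
         - u y * (of_real (2 * (y - x) $ j) * hlm_g1 \<kappa> ((norm (y - x))\<^sup>2)))) = 0"
    proof (cases "norm y < S")
      case False
      then have "R < norm y" using norm_ge_zero[of x] abs_ge_self[of R] unfolding S_def by linarith
      then show ?thesis using u1 u(3) by simp
    qed (simp add: cutoff_inside)
  qed
  ultimately show ?thesis by simp
qed

section \<open>Radiating fields\<close>

lemma hlm_radiation_estimate:
  fixes x :: "real^2"
  assumes k: "0 < \<kappa>"
  obtains C where "0 < C"
    "\<And>y. 2 * norm x + 1 \<le> norm y \<Longrightarrow> norm (hlm_g \<kappa> ((norm (y - x))\<^sup>2)) \<le> C / sqrt (norm y)"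
    "\<And>y. 2 * norm x + 1 \<le> norm y \<Longrightarrow>
       norm (of_real (2 * (y \<bullet> (y - x))) * hlm_g1 \<kappa> ((norm (y - x))\<^sup>2) - \<i> * of_real (\<kappa> * norm y) * hlm_g \<kappa> ((norm (y - x))\<^sup>2))
       \<le> C / sqrt (norm y)"
proof -
  define C1 where "C1 = sqrt (2 / \<kappa>)"
  define C where "C = C1 + 2 * C1 + \<kappa> * (2 * norm x) * C1"
  have C1: "0 < C1" using k by (simp add: C1_def)
  have g: "norm (hlm_g \<kappa> ((norm (y - x))\<^sup>2)) \<le> C1 / sqrt (norm y)" and ge: "norm y / 2 \<le> norm (y - x)" "0 < norm y"
    if "2 * norm x + 1 \<le> norm y" for y
  proof -
    show y0: "0 < norm y" using that norm_ge_zero[of x] by linarith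
    show d: "norm y / 2 \<le> norm (y - x)"
      using that norm_triangle_ineq2[of y x] by linarith
    then have "norm (hlm_g \<kappa> ((norm (y - x))\<^sup>2)) \<le> 1 / sqrt (\<kappa> * sqrt ((norm (y - x))\<^sup>2))"
      using y0 by (intro hlm_g_bound[OF k]) auto
    also have "\<dots> \<le> 1 / sqrt (\<kappa> * (norm y / 2))"
    proof -
      have "0 < norm (y - x)" using d y0 by linarith
      then show ?thesis
        using d y0 k by (intro divide_left_mono real_sqrt_le_mono mult_left_mono mult_pos_pos) auto
    qed
    also have "\<dots> = C1 / sqrt (norm y)"
      using k y0 by (simp add: C1_def real_sqrt_divide real_sqrt_mult)
    finally show "norm (hlm_g \<kappa> ((norm (y - x))\<^sup>2)) \<le> C1 / sqrt (norm y)" .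
  qed
  have S2: "norm (of_real (2 * (y \<bullet> (y - x))) * hlm_g1 \<kappa> ((norm (y - x))\<^sup>2) - \<i> * of_real (\<kappa> * norm y) * hlm_g \<kappa> ((norm (y - x))\<^sup>2))
       \<le> C / sqrt (norm y)" if y: "2 * norm x + 1 \<le> norm y" for y
  proof -
    define d where "d = norm (y - x)"
    define c where "c = y \<bullet> (y - x) / d"
    have d: "0 < d" "norm y / 2 \<le> d" using ge[OF y] by (auto simp: d_def)
    have cs: "\<bar>c\<bar> \<le> norm y"
      using Cauchy_Schwarz_ineq2[of y "y - x"] d by (simp add: c_def d_def abs_div_pos[symmetric] divide_le_eq abs_divide)
    \<comment> \<open>The kernel is radial about \<open>x\<close>, the cutoff about the origin. Here
      c is the component of \<open>y\<close> along y - x, and it differs from |y - x|, as |y - x|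
      does from |y|, by at most |x|; the outgoing condition therefore survives the change of
      centre.\<close>
    have cn: "\<bar>c - norm y\<bar> \<le> 2 * norm x"
    proof -
      have "c - d = x \<bullet> (y - x) / d"
      proof -
        have "y \<bullet> (y - x) = x \<bullet> (y - x) + d\<^sup>2"
          by (simp add: d_def power2_norm_eq_inner inner_diff_left inner_diff_right)
        then show ?thesis using d by (simp add: c_def field_simps power2_eq_square)
      qed
      moreover have "\<bar>x \<bullet> (y - x) / d\<bar> \<le> norm x"
        using Cauchy_Schwarz_ineq2[of x "y - x"] d by (simp add: d_def divide_le_eq abs_divide)
      moreover have "\<bar>d - norm y\<bar> \<le> norm x"
        unfolding d_def using norm_triangle_ineq3[of "y - x" y] by simp
      ultimately show ?thesis by linarith
    qed
    \<comment> \<open>The radial derivative about \<open>x\<close>, scaled by c, carries the gain of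
      the outgoing estimate; replacing c by |y| costs a bounded multiple of the kernel
      itself.\<close>
    have "of_real (2 * (y \<bullet> (y - x))) * hlm_g1 \<kappa> (d\<^sup>2) - \<i> * of_real (\<kappa> * norm y) * hlm_g \<kappa> (d\<^sup>2)
       = of_real c * (of_real (2 * sqrt (d\<^sup>2)) * hlm_g1 \<kappa> (d\<^sup>2) - \<i> * of_real \<kappa> * hlm_g \<kappa> (d\<^sup>2))
         + \<i> * of_real (\<kappa> * (c - norm y)) * hlm_g \<kappa> (d\<^sup>2)"
    proof -
      have cd: "2 * (y \<bullet> (y - x)) = c * (2 * d)" and sd: "sqrt (d\<^sup>2) = d" using d by (simp_all add: c_def)
      show ?thesis unfolding cd sd by (simp add: algebra_simps)
    qed
    then have "norm (of_real (2 * (y \<bullet> (y - x))) * hlm_g1 \<kappa> (d\<^sup>2) - \<i> * of_real (\<kappa> * norm y) * hlm_g \<kappa> (d\<^sup>2))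
      \<le> norm (of_real c * (of_real (2 * sqrt (d\<^sup>2)) * hlm_g1 \<kappa> (d\<^sup>2) - \<i> * of_real \<kappa> * hlm_g \<kappa> (d\<^sup>2)))
         + norm (\<i> * of_real (\<kappa> * (c - norm y)) * hlm_g \<kappa> (d\<^sup>2))"
      by (simp only: norm_triangle_ineq)
    also have "norm (of_real c * (of_real (2 * sqrt (d\<^sup>2)) * hlm_g1 \<kappa> (d\<^sup>2) - \<i> * of_real \<kappa> * hlm_g \<kappa> (d\<^sup>2)))
       \<le> norm y * (\<kappa> / (\<kappa> * d * sqrt (\<kappa> * d)))"
    proof -
      have "norm (of_real (2 * sqrt (d\<^sup>2)) * hlm_g1 \<kappa> (d\<^sup>2) - \<i> * of_real \<kappa> * hlm_g \<kappa> (d\<^sup>2)) \<le> \<kappa> / (\<kappa> * sqrt (d\<^sup>2) * sqrt (\<kappa> * sqrt (d\<^sup>2)))"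
        by (rule hlm_g_outgoing[OF k]) (use d in simp)
      moreover have "sqrt (d\<^sup>2) = d" using d by simp
      ultimately show ?thesis
        unfolding norm_mult norm_of_real using cs by (intro mult_mono) auto
    qed
    also have "\<dots> \<le> norm y * (1 / ((norm y / 2) * sqrt (\<kappa> * (norm y / 2))))"
    proof -
      have "\<kappa> / (\<kappa> * d * sqrt (\<kappa> * d)) = 1 / (d * sqrt (\<kappa> * d))" using k by simp
      also have "\<dots> \<le> 1 / ((norm y / 2) * sqrt (\<kappa> * (norm y / 2)))"
      proof (rule frac_le)
        show "0 < norm y / 2 * sqrt (\<kappa> * (norm y / 2))"
          using ge(2)[OF y] k by (intro mult_pos_pos) auto
        have "sqrt (\<kappa> * (norm y / 2)) \<le> sqrt (\<kappa> * d)"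
          using d k by (intro real_sqrt_le_mono mult_left_mono) auto
        then show "norm y / 2 * sqrt (\<kappa> * (norm y / 2)) \<le> d * sqrt (\<kappa> * d)"
          using d(2) less_imp_le[OF d(1)] k by (intro mult_mono) auto
      qed auto
      finally show ?thesis by (intro mult_left_mono) auto
    qed
    also have "\<dots> = 2 * C1 / sqrt (norm y)"
      using k ge[OF y] by (simp add: C1_def real_sqrt_divide real_sqrt_mult)
    also have "norm (\<i> * of_real (\<kappa> * (c - norm y)) * hlm_g \<kappa> (d\<^sup>2)) \<le> \<kappa> * (2 * norm x) * (C1 / sqrt (norm y))"
    proof -
      have "norm (\<i> * of_real (\<kappa> * (c - norm y)) * hlm_g \<kappa> (d\<^sup>2)) = \<kappa> * \<bar>c - norm y\<bar> * norm (hlm_g \<kappa> (d\<^sup>2))"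
        using k by (simp only: norm_mult norm_ii norm_of_real abs_mult abs_of_pos mult_1_left)
      also have "\<dots> \<le> \<kappa> * (2 * norm x) * (C1 / sqrt (norm y))"
        using g[OF y] cn k by (intro mult_mono mult_nonneg_nonneg) (auto simp: d_def)
      finally show ?thesis .
    qed
    finally have "norm (of_real (2 * (y \<bullet> (y - x))) * hlm_g1 \<kappa> (d\<^sup>2) - \<i> * of_real (\<kappa> * norm y) * hlm_g \<kappa> (d\<^sup>2))
      \<le> (2 * C1 + \<kappa> * (2 * norm x) * C1) / sqrt (norm y)"
      by (simp add: add_divide_distrib)
    also have "\<dots> \<le> C / sqrt (norm y)"
      using C1 by (intro divide_right_mono) (auto simp: C_def)
    finally show ?thesis by (simp add: d_def)
  qed
  show ?thesis
  proof (rule that[of C])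
    show "0 < C" using C1 k by (simp add: C_def add_pos_nonneg)
    show "norm (hlm_g \<kappa> ((norm (y - x))\<^sup>2)) \<le> C / sqrt (norm y)" if "2 * norm x + 1 \<le> norm y" for y
      by (rule order_trans[OF g[OF that]]) (use C1 k in \<open>auto simp: C_def intro!: divide_right_mono\<close>)
  qed (rule S2)
qed

text \<open>The constant is crude: \<open>chiw\<close> is at most 2 and the support lies in a disc
  of radius 3 R, of area 9 pi R^2. Only the order R^2 matters.\<close>

lemma annulus_weight:
  assumes "0 < R"
  shows "integrable lborel (\<lambda>y::real^2. chiw ((norm y)\<^sup>2 / R\<^sup>2))"
    and "(\<integral>y. chiw ((norm (y::real^2))\<^sup>2 / R\<^sup>2) \<partial>lborel) \<le> 18 * pi * R\<^sup>2"
proof -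
  have c: "continuous_on UNIV (\<lambda>y::real^2. chiw ((norm y)\<^sup>2 / R\<^sup>2))"
    using assms by (intro continuous_on_compose2[OF continuous_on_chiw[of UNIV]] continuous_intros) auto
  have z: "chiw ((norm y)\<^sup>2 / R\<^sup>2) = 0" if "2 * R < norm y" for y :: "real^2"
    using cutoff_annulus[of y R] that assms by force
  show i: "integrable lborel (\<lambda>y::real^2. chiw ((norm y)\<^sup>2 / R\<^sup>2))"
    by (rule integrable_compact_support[OF c z])
  have fin: "emeasure lborel (ball (0::real^2) (3 * R)) < \<infinity>" by (rule emeasure_lborel_ball_finite)
  have "(\<integral>y. chiw ((norm (y::real^2))\<^sup>2 / R\<^sup>2) \<partial>lborel) \<le> (\<integral>y. 2 * indicator (ball (0::real^2) (3 * R)) y \<partial>lborel)"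
  proof (rule integral_mono)
    show "integrable lborel (\<lambda>y. 2 * indicator (ball (0::real^2) (3 * R)) y :: real)"
      using fin by (intro integrable_mult_right integrable_real_indicator) (auto simp: infinity_ennreal_def)
    show "chiw ((norm y)\<^sup>2 / R\<^sup>2) \<le> 2 * indicator (ball (0::real^2) (3 * R)) y" for y
      using chiw_bounds(2) z[of y] assms by (cases "norm y < 3 * R") auto
  qed (rule i)
  also have "\<dots> = 2 * measure lborel (ball (0::real^2) (3 * R))" by simp
  also have "measure lborel (ball (0::real^2) (3 * R)) = (3 * R)\<^sup>2 * pi"
    using circle_area[of "3 * R" 0] assms by simp
  finally show "(\<integral>y. chiw ((norm (y::real^2))\<^sup>2 / R\<^sup>2) \<partial>lborel) \<le> 18 * pi * R\<^sup>2"
    by (simp add: power_mult_distrib algebra_simps)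
qed

text \<open>Rellich's argument: the imaginary part of Green's identity for \<open>u\<close> and its conjugate does not
  depend on the cutoff radius, and the radiation condition turns it into a bound for the mean of \<open>|u|\<^sup>2\<close>.\<close>

lemma rellich_bound:
  fixes u :: "real^2 \<Rightarrow> complex"
  assumes k: "0 < \<kappa>" and u: "c1 u u1" "\<And>i. c1 (u1 i) (u2 i)"
    and supp: "\<And>y. R0 < norm y \<Longrightarrow> (\<Sum>j\<in>UNIV. u2 j j y) + (of_real \<kappa>)\<^sup>2 * u y = 0"
    and rad: "\<And>y. R1 \<le> norm y \<Longrightarrow>
       norm ((\<Sum>j\<in>UNIV. of_real (y $ j) * u1 j y) - \<i> * of_real (\<kappa> * norm y) * u y) \<le> sqrt (norm y)"
  obtains C where "\<And>R. R0 < R \<Longrightarrow> R1 < R \<Longrightarrow> 0 < R \<Longrightarrow>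
     (\<integral>y. chiw ((norm y)\<^sup>2 / R\<^sup>2) * (norm (u y))\<^sup>2 \<partial>lborel) \<le> C * R"
proof -
  define f where "f = (\<lambda>y. (\<Sum>j\<in>UNIV. u2 j j y) + (of_real \<kappa>)\<^sup>2 * u y)"
  define c0 where "c0 = (\<integral>y. cnj (u y) * f y - u y * cnj (f y) \<partial>lborel)"
  note cu = c1_cont[OF u(1)] c1_cont[OF u(2)] c1_cont'[OF u(2)]
  have est: "(\<integral>y. chiw ((norm y)\<^sup>2 / R\<^sup>2) * (norm (u y))\<^sup>2 \<partial>lborel) \<le> (2 / \<kappa>) * (norm c0 + (9 * pi) / \<kappa>) * R"
    if R: "R0 < R" "R1 < R" "0 < R" for R
  proof -
    define w where "w = (\<lambda>y::real^2. chiw ((norm y)\<^sup>2 / R\<^sup>2))"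
    have w: "0 \<le> w y" "w y \<noteq> 0 \<Longrightarrow> R \<le> norm y \<and> norm y \<le> 2 * R" for y
      using chiw_bounds(1) cutoff_annulus[of y R] R by (auto simp: w_def)
    have cw: "continuous_on UNIV w"
      unfolding w_def using R by (intro continuous_on_compose2[OF continuous_on_chiw[of UNIV]] continuous_intros) auto
    have w0: "w y = 0" if "2 * R < norm y" for y using w(2)[of y] that by force
    define D where "D = (\<lambda>y. \<Sum>j\<in>UNIV. of_real (y $ j) * u1 j y)"
    have cD: "continuous_on UNIV D"
      unfolding D_def by (intro continuous_intros continuous_on_component cu)
    have "(\<integral>y. cutoff R y * (cnj (u y) * (\<Sum>j\<in>UNIV. u2 j j y) - u y * (\<Sum>j\<in>UNIV. cnj (u2 j j y))) \<partial>lborel)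
      = - (\<integral>y. (\<Sum>j\<in>UNIV. cutoff1 R j y * (cnj (u y) * u1 j y - u y * cnj (u1 j y))) \<partial>lborel)"
      by (rule green_identity[OF u c1_cnj[OF u(1)] c1_cnj[OF u(2)] c1_cutoff[OF R(3)] cutoff_outside[OF _ R(3)]])
    \<comment> \<open>Where the cutoff differs from 1, the homogeneous equation makes the integrand
      vanish. Dropping the cutoff shows that the flux \<open>c0\<close> is the same for every
      R.\<close>
    moreover have "(\<lambda>y. cutoff R y * (cnj (u y) * (\<Sum>j\<in>UNIV. u2 j j y) - u y * (\<Sum>j\<in>UNIV. cnj (u2 j j y))))
      = (\<lambda>y. cnj (u y) * f y - u y * cnj (f y))"
    proof
      fix y
      have "cnj (u y) * (\<Sum>j\<in>UNIV. u2 j j y) - u y * (\<Sum>j\<in>UNIV. cnj (u2 j j y)) = cnj (u y) * f y - u y * cnj (f y)"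
        by (simp add: f_def cnj_sum algebra_simps)
      moreover have "cutoff R y = 1 \<or> f y = 0"
        using cutoff_inside(1)[of y R] supp[of y] R(1) by (cases "norm y < R") (auto simp: f_def)
      ultimately show "cutoff R y * (cnj (u y) * (\<Sum>j\<in>UNIV. u2 j j y) - u y * (\<Sum>j\<in>UNIV. cnj (u2 j j y)))
        = cnj (u y) * f y - u y * cnj (f y)" by auto
    qed
    moreover have "(\<lambda>y. (\<Sum>j\<in>UNIV. cutoff1 R j y * (cnj (u y) * u1 j y - u y * cnj (u1 j y))))
      = (\<lambda>y. - (of_real (4 / R\<^sup>2) * (\<i> * of_real (w y * Im (cnj (u y) * D y)))))"
    proof
      fix y
      have cut: "cutoff1 R j y = of_real (- 2 / R\<^sup>2 * w y) * of_real (y $ j)" for j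
        by (simp add: cutoff1_def w_def)
      have "(\<Sum>j\<in>UNIV. cutoff1 R j y * (cnj (u y) * u1 j y - u y * cnj (u1 j y)))
        = of_real (- 2 / R\<^sup>2 * w y) * (cnj (u y) * D y - cnj (cnj (u y) * D y))"
        unfolding D_def cut by (simp only: sum_2 complex_cnj_mult complex_cnj_add complex_cnj_cnj complex_cnj_complex_of_real)
          (simp only: algebra_simps)
      also have "cnj (u y) * D y - cnj (cnj (u y) * D y) = 2 * \<i> * of_real (Im (cnj (u y) * D y))"
        by (rule complex_eqI) auto
      finally show "(\<Sum>j\<in>UNIV. cutoff1 R j y * (cnj (u y) * u1 j y - u y * cnj (u1 j y)))
        = - (of_real (4 / R\<^sup>2) * (\<i> * of_real (w y * Im (cnj (u y) * D y))))" by simp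
    qed
    ultimately have c0: "c0 = (\<integral>y. of_real (4 / R\<^sup>2) * (\<i> * of_real (w y * Im (cnj (u y) * D y))) \<partial>lborel)"
      unfolding c0_def by simp
    have iI: "integrable lborel (\<lambda>y. w y * Im (cnj (u y) * D y))"
      by (rule integrable_compact_support[of _ "2 * R"])
        (auto simp: w0 intro!: continuous_intros cw cu cD simp del: times_complex.sel)
    have "c0 = of_real (4 / R\<^sup>2) * (\<i> * of_real (\<integral>y. w y * Im (cnj (u y) * D y) \<partial>lborel))"
      unfolding c0 by (simp only: integral_mult_right_zero integral_complex_of_real)
    then have "norm c0 = (4 / R\<^sup>2) * \<bar>\<integral>y. w y * Im (cnj (u y) * D y) \<partial>lborel\<bar>"
      by (simp only: norm_mult norm_of_real norm_ii) simp
    then have I1: "(\<integral>y. w y * Im (cnj (u y) * D y) \<partial>lborel) \<le> norm c0 * R\<^sup>2 / 4"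
      using R by (simp add: field_simps)
    have i2: "integrable lborel (\<lambda>y. w y * (norm (u y))\<^sup>2)"
      by (rule integrable_compact_support[of _ "2 * R"]) (auto simp: w0 intro!: continuous_intros cw cu)
    have iw: "integrable lborel w" "(\<integral>y. w y \<partial>lborel) \<le> 18 * pi * R\<^sup>2"
      using annulus_weight[OF R(3)] by (auto simp: w_def)
    \<comment> \<open>Up to an error of size sqrt r the radiation condition replaces
      \<open>D y\<close> by i \<kappa> r u, which gives the imaginary part the sign of \<kappa> r
      |u|^2. Young's inequality hides the error term in half of this, at the price of the constant
      1/(2 \<kappa>).\<close>
    have pw: "\<kappa> * R / 2 * (w y * (norm (u y))\<^sup>2) - (1 / (2 * \<kappa>)) * w y \<le> w y * Im (cnj (u y) * D y)" for y
    proof (cases "w y = 0")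
      case False
      then have y: "R \<le> norm y" using w(2) by auto
      define S where "S = D y - \<i> * of_real (\<kappa> * norm y) * u y"
      define r where "r = norm y"
      have r: "0 < r" "R \<le> r" using y R by (auto simp: r_def)
      have S: "norm S \<le> sqrt r" using rad[of y] y R by (simp add: S_def D_def r_def)
      have "cnj (u y) * D y = cnj (u y) * S + \<i> * of_real (\<kappa> * r) * (u y * cnj (u y))"
        by (simp add: S_def r_def algebra_simps)
      also have "u y * cnj (u y) = of_real ((norm (u y))\<^sup>2)" by (simp only: complex_norm_square)
      finally have "Im (cnj (u y) * D y) = Im (cnj (u y) * S) + \<kappa> * r * (norm (u y))\<^sup>2" by simp
      moreover have "\<bar>Im (cnj (u y) * S)\<bar> \<le> norm (u y) * sqrt r"
      proof -
        have "\<bar>Im (cnj (u y) * S)\<bar> \<le> norm (cnj (u y) * S)" by (rule abs_Im_le_cmod)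
        also have "\<dots> = norm (u y) * norm S" by (simp add: norm_mult)
        also have "\<dots> \<le> norm (u y) * sqrt r" using S by (intro mult_left_mono) auto
        finally show ?thesis .
      qed
      moreover have "norm (u y) * sqrt r \<le> \<kappa> * r / 2 * (norm (u y))\<^sup>2 + 1 / (2 * \<kappa>)"
      proof -
        have "0 \<le> (\<kappa> * sqrt r * norm (u y) - 1)\<^sup>2" by simp
        also have "\<dots> = (\<kappa> * sqrt r * norm (u y))\<^sup>2 + 1 - 2 * (\<kappa> * sqrt r * norm (u y))"
          by (simp add: power2_diff)
        also have "(\<kappa> * sqrt r * norm (u y))\<^sup>2 = \<kappa>\<^sup>2 * r * (norm (u y))\<^sup>2"
          using r by (simp add: power_mult_distrib)
        finally have "2 * \<kappa> * (norm (u y) * sqrt r) \<le> \<kappa>\<^sup>2 * r * (norm (u y))\<^sup>2 + 1"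
          by (simp add: mult_ac)
        then show ?thesis using k r by (simp add: field_simps power2_eq_square)
      qed
      ultimately have "\<kappa> * r / 2 * (norm (u y))\<^sup>2 - 1 / (2 * \<kappa>) \<le> Im (cnj (u y) * D y)"
        by (simp only: abs_le_iff) argo
      moreover have "\<kappa> * R / 2 * (norm (u y))\<^sup>2 \<le> \<kappa> * r / 2 * (norm (u y))\<^sup>2"
        using r k by (intro mult_right_mono divide_right_mono mult_left_mono) auto
      ultimately have "\<kappa> * R / 2 * (norm (u y))\<^sup>2 - 1 / (2 * \<kappa>) \<le> Im (cnj (u y) * D y)" by linarith
      then have "w y * (\<kappa> * R / 2 * (norm (u y))\<^sup>2 - 1 / (2 * \<kappa>)) \<le> w y * Im (cnj (u y) * D y)"
        using w(1) by (rule mult_left_mono)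
      then show ?thesis by (simp add: algebra_simps)
    qed simp
    have "(\<integral>y. \<kappa> * R / 2 * (w y * (norm (u y))\<^sup>2) - (1 / (2 * \<kappa>)) * w y \<partial>lborel) \<le> (\<integral>y. w y * Im (cnj (u y) * D y) \<partial>lborel)"
      by (rule integral_mono[OF _ iI pw]) (intro Bochner_Integration.integrable_diff integrable_mult_right i2 iw)
    also have "(\<integral>y. \<kappa> * R / 2 * (w y * (norm (u y))\<^sup>2) - (1 / (2 * \<kappa>)) * w y \<partial>lborel)
       = \<kappa> * R / 2 * (\<integral>y. w y * (norm (u y))\<^sup>2 \<partial>lborel) - (1 / (2 * \<kappa>)) * (\<integral>y. w y \<partial>lborel)"
      using i2 iw by (subst Bochner_Integration.integral_diff) auto
    finally have "\<kappa> * R / 2 * (\<integral>y. w y * (norm (u y))\<^sup>2 \<partial>lborel) \<le> norm c0 * R\<^sup>2 / 4 + (1 / (2 * \<kappa>)) * (\<integral>y. w y \<partial>lborel)"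
      using I1 by linarith
    also have "\<dots> \<le> norm c0 * R\<^sup>2 / 4 + (1 / (2 * \<kappa>)) * (18 * pi * R\<^sup>2)"
      using iw k by (intro add_left_mono mult_left_mono) auto
    also have "\<dots> \<le> (norm c0 + 9 * pi / \<kappa>) * R\<^sup>2"
    proof -
      have "norm c0 * R\<^sup>2 / 4 \<le> norm c0 * R\<^sup>2" by simp
      then show ?thesis using k by (simp add: algebra_simps)
    qed
    also have "\<dots> = \<kappa> * R / 2 * ((2 / \<kappa>) * (norm c0 + 9 * pi / \<kappa>) * R)"
      using k by (simp add: power2_eq_square)
    finally have "(\<integral>y. w y * (norm (u y))\<^sup>2 \<partial>lborel) \<le> (2 / \<kappa>) * (norm c0 + 9 * pi / \<kappa>) * R"
      using k R by (subst (asm) mult_le_cancel_left_pos) auto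
    then show ?thesis by (simp add: w_def)
  qed
  show ?thesis by (rule that) (rule est)
qed

text \<open>The difference of the two sides equals an average over the annulus of the flux between
  \<open>u\<close> and the kernel, for every R. Both radiate, so the leading parts of the flux
  cancel. The rest is small because of the little-o radiation condition for \<open>u\<close>, the
  extra decay of the kernel, and the bound of order R on the weighted integral of |u|^2.\<close>

theorem radiating_representation:
  fixes u :: "real^2 \<Rightarrow> complex"
  assumes k: "0 < \<kappa>" and u: "c1 u u1" "\<And>i. c1 (u1 i) (u2 i)"
    and supp: "\<And>y. R0 < norm y \<Longrightarrow> (\<Sum>j\<in>UNIV. u2 j j y) + (of_real \<kappa>)\<^sup>2 * u y = 0"
    and rad: "\<And>\<eta>. 0 < \<eta> \<Longrightarrow> \<exists>R1. \<forall>y. R1 \<le> norm y \<longrightarrow>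
       norm ((\<Sum>j\<in>UNIV. of_real (y $ j) * u1 j y) - \<i> * of_real (\<kappa> * norm y) * u y) \<le> \<eta> * sqrt (norm y)"
  shows "u x = - (\<integral>y. hlm_g \<kappa> ((norm (y - x))\<^sup>2) * ((\<Sum>j\<in>UNIV. u2 j j y) + (of_real \<kappa>)\<^sup>2 * u y) \<partial>lborel)"
proof -
  define f where "f = (\<lambda>y. (\<Sum>j\<in>UNIV. u2 j j y) + (of_real \<kappa>)\<^sup>2 * u y)"
  define G where "G = (\<lambda>y. hlm_g \<kappa> ((norm (y - x))\<^sup>2))"
  define V where "V = u x + (\<integral>y. G y * f y \<partial>lborel)"
  note cu = c1_cont[OF u(1)] c1_cont[OF u(2)] c1_cont'[OF u(2)]
  obtain C1 where C1: "0 < C1"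
    "\<And>y. 2 * norm x + 1 \<le> norm y \<Longrightarrow> norm (G y) \<le> C1 / sqrt (norm y)"
    "\<And>y. 2 * norm x + 1 \<le> norm y \<Longrightarrow>
       norm (of_real (2 * (y \<bullet> (y - x))) * hlm_g1 \<kappa> ((norm (y - x))\<^sup>2) - \<i> * of_real (\<kappa> * norm y) * G y)
       \<le> C1 / sqrt (norm y)"
    using hlm_radiation_estimate[OF k, of x] unfolding G_def by blast
  obtain R1 where R1: "\<And>y. R1 \<le> norm y \<Longrightarrow>
       norm ((\<Sum>j\<in>UNIV. of_real (y $ j) * u1 j y) - \<i> * of_real (\<kappa> * norm y) * u y) \<le> sqrt (norm y)"
    using rad[of 1] by auto
  obtain C2 where C2: "\<And>R. R0 < R \<Longrightarrow> R1 < R \<Longrightarrow> 0 < R \<Longrightarrow>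
     (\<integral>y. chiw ((norm y)\<^sup>2 / R\<^sup>2) * (norm (u y))\<^sup>2 \<partial>lborel) \<le> C2 * R"
    using rellich_bound[OF k u supp R1] by blast
  \<comment> \<open>The number 72 is the product of the prefactor 2/R^2, the pointwise error 2 C1
    \<eta> and the mass 18 pi R^2 of the weight. The constant \<open>C2\<close> is fixed beforehand
    by the radiation condition with error 1, so R can grow while \<eta> stays fixed.\<close>
  have est: "norm V \<le> 72 * pi * C1 * \<eta> + (C1 * (C2 + 18 * pi)) / R"
    if \<eta>: "0 < \<eta>" and R2: "\<And>y. R2 \<le> norm y \<Longrightarrow>
       norm ((\<Sum>j\<in>UNIV. of_real (y $ j) * u1 j y) - \<i> * of_real (\<kappa> * norm y) * u y) \<le> \<eta> * sqrt (norm y)"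
      and R: "R0 < R" "R1 < R" "R2 < R" "2 * norm x + 1 < R" for \<eta> R2 R
  proof -
    have R0: "0 < R" using R(4) norm_ge_zero[of x] by linarith
    define w where "w = (\<lambda>y::real^2. chiw ((norm y)\<^sup>2 / R\<^sup>2))"
    have w: "0 \<le> w y" "w y \<noteq> 0 \<Longrightarrow> R \<le> norm y \<and> norm y \<le> 2 * R" for y
      using chiw_bounds(1) cutoff_annulus[of y R] R0 by (auto simp: w_def)
    have cw: "continuous_on UNIV w"
      unfolding w_def using R0 by (intro continuous_on_compose2[OF continuous_on_chiw[of UNIV]] continuous_intros) auto
    have w0: "w y = 0" if "2 * R < norm y" for y using w(2)[of y] that by force
    define D where "D = (\<lambda>y. \<Sum>j\<in>UNIV. of_real (y $ j) * u1 j y)"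
    define g1 where "g1 = (\<lambda>y. hlm_g1 \<kappa> ((norm (y - x))\<^sup>2))"
    have "(\<integral>y. cutoff R y * G y * f y \<partial>lborel)
      = - (cutoff R x * u x) - (\<integral>y. (\<Sum>j\<in>UNIV. cutoff1 R j y * (G y * u1 j y - u y * (of_real (2 * (y - x) $ j) * g1 y))) \<partial>lborel)"
      unfolding G_def f_def g1_def
    proof (rule green_representation[OF k u c1_cutoff[OF R0] _ zero_less_one])
      show "cutoff R y = 0" if "2 * R < norm y" for y by (rule cutoff_outside[OF that R0])
      show "cutoff1 R j y = 0" if "norm (y - x) < 1" for y j
        by (rule cutoff_inside(2)) (use that norm_triangle_ineq[of "y - x" x] norm_ge_zero[of x] R(4) in \<open>simp; linarith\<close>)
    qed
    moreover have "cutoff R x = 1"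
      by (rule cutoff_inside(1)) (use norm_ge_zero[of x] R(4) in linarith)
    moreover have "(\<lambda>y. cutoff R y * G y * f y) = (\<lambda>y. G y * f y)"
    proof
      fix y show "cutoff R y * G y * f y = G y * f y"
        using cutoff_inside(1)[of y R] supp[of y] R(1) by (cases "norm y < R") (auto simp: f_def)
    qed
    moreover have "(\<lambda>y. (\<Sum>j\<in>UNIV. cutoff1 R j y * (G y * u1 j y - u y * (of_real (2 * (y - x) $ j) * g1 y))))
      = (\<lambda>y. of_real (- 2 / R\<^sup>2) * (of_real (w y) * (G y * D y - u y * (of_real (2 * (y \<bullet> (y - x))) * g1 y))))"
    proof
      fix y
      have cut: "cutoff1 R j y = of_real (- 2 / R\<^sup>2) * (of_real (w y) * of_real (y $ j))" for j
        by (simp add: cutoff1_def w_def)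
      have inn: "2 * (y \<bullet> (y - x)) = y $ 1 * (2 * (y - x) $ 1) + y $ 2 * (2 * (y - x) $ 2)"
        by (simp add: inner_vec_def sum_2 algebra_simps)
      show "(\<Sum>j\<in>UNIV. cutoff1 R j y * (G y * u1 j y - u y * (of_real (2 * (y - x) $ j) * g1 y)))
        = of_real (- 2 / R\<^sup>2) * (of_real (w y) * (G y * D y - u y * (of_real (2 * (y \<bullet> (y - x))) * g1 y)))"
        unfolding D_def cut inn sum_2 of_real_add of_real_mult[of "y $ _"] by (simp only: algebra_simps)
    qed
    ultimately have "(\<integral>y. G y * f y \<partial>lborel) = - u x
      - (\<integral>y. of_real (- 2 / R\<^sup>2) * (of_real (w y) * (G y * D y - u y * (of_real (2 * (y \<bullet> (y - x))) * g1 y))) \<partial>lborel)"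
      by simp
    then have V: "V = of_real (2 / R\<^sup>2) * (\<integral>y. of_real (w y) * (G y * D y - u y * (of_real (2 * (y \<bullet> (y - x))) * g1 y)) \<partial>lborel)"
      unfolding V_def by (simp only: integral_mult_right_zero) simp
    have iw: "integrable lborel w" "(\<integral>y. w y \<partial>lborel) \<le> 18 * pi * R\<^sup>2"
      using annulus_weight[OF R0] by (auto simp: w_def)
    have i2: "integrable lborel (\<lambda>y. w y * (norm (u y))\<^sup>2)"
      by (rule integrable_compact_support[of _ "2 * R"]) (auto simp: w0 intro!: continuous_intros cw cu)
    have pw: "norm (of_real (w y) * (G y * D y - u y * (of_real (2 * (y \<bullet> (y - x))) * g1 y)))
       \<le> (2 * C1 * \<eta> + C1 / (2 * R)) * w y + (C1 / 2) * (w y * (norm (u y))\<^sup>2)" for y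
    proof (cases "w y = 0")
      case False
      then have y: "R \<le> norm y" "norm y \<le> 2 * R" using w(2) by auto
      define S where "S = D y - \<i> * of_real (\<kappa> * norm y) * u y"
      define S2 where "S2 = of_real (2 * (y \<bullet> (y - x))) * g1 y - \<i> * of_real (\<kappa> * norm y) * G y"
      define r where "r = norm y"
      have r: "0 < r" "R \<le> r" using y R0 by (auto simp: r_def)
      have S: "norm S \<le> \<eta> * sqrt r" using R2[of y] y R by (simp add: S_def D_def r_def)
      have S2: "norm S2 \<le> C1 / sqrt r" using C1(3)[of y] y R by (simp add: S2_def g1_def r_def)
      have Gy: "norm (G y) \<le> C1 / sqrt r" using C1(2)[of y] y R by (simp add: r_def)
      \<comment> \<open>Both radial derivatives equal i \<kappa> |y| times the function plus a
        remainder; the products with i \<kappa> |y| agree and drop out.\<close>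
      have "G y * D y - u y * (of_real (2 * (y \<bullet> (y - x))) * g1 y) = G y * S - u y * S2"
        by (simp add: S_def S2_def algebra_simps)
      then have "norm (G y * D y - u y * (of_real (2 * (y \<bullet> (y - x))) * g1 y)) \<le> norm (G y) * norm S + norm (u y) * norm S2"
        by (metis norm_mult norm_triangle_ineq4)
      also have "norm (G y) * norm S \<le> (C1 / sqrt r) * (\<eta> * sqrt r)"
        using Gy S by (intro mult_mono) (use C1 r in auto)
      also have "(C1 / sqrt r) * (\<eta> * sqrt r) = C1 * \<eta>" using r by simp
      also have "norm (u y) * norm S2 \<le> norm (u y) * (C1 / sqrt r)" using S2 by (intro mult_left_mono) auto
      also have "norm (u y) * (C1 / sqrt r) = C1 * (norm (u y) * (1 / sqrt r))" by simp
      also have "norm (u y) * (1 / sqrt r) \<le> ((norm (u y))\<^sup>2 + (1 / sqrt r)\<^sup>2) / 2"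
        using sum_squares_bound[of "norm (u y)" "1 / sqrt r"] by (simp add: mult.commute)
      also have "(1 / sqrt r)\<^sup>2 = 1 / r" using r by (simp add: power_divide)
      also have "1 / r \<le> 1 / R" using r R0 by (simp add: frac_le)
      finally have "norm (G y * D y - u y * (of_real (2 * (y \<bullet> (y - x))) * g1 y)) \<le> C1 * \<eta> + C1 * (((norm (u y))\<^sup>2 + 1 / R) / 2)"
        using C1(1) by simp
      also have "\<dots> \<le> (2 * C1 * \<eta> + C1 / (2 * R)) + (C1 / 2) * (norm (u y))\<^sup>2"
        using C1(1) \<eta> by (simp add: field_simps add_increasing)
      finally have "w y * norm (G y * D y - u y * (of_real (2 * (y \<bullet> (y - x))) * g1 y))
        \<le> w y * ((2 * C1 * \<eta> + C1 / (2 * R)) + (C1 / 2) * (norm (u y))\<^sup>2)"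
        using w(1) by (rule mult_left_mono)
      then show ?thesis
        using w(1)[of y] by (simp only: norm_mult norm_of_real abs_of_nonneg) (simp add: algebra_simps)
    qed simp
    have C2': "(\<integral>y. w y * (norm (u y))\<^sup>2 \<partial>lborel) \<le> C2 * R"
      using C2[OF R(1,2) R0] by (simp add: w_def)
    have "norm (\<integral>y. of_real (w y) * (G y * D y - u y * (of_real (2 * (y \<bullet> (y - x))) * g1 y)) \<partial>lborel)
      \<le> (\<integral>y. norm (of_real (w y) * (G y * D y - u y * (of_real (2 * (y \<bullet> (y - x))) * g1 y))) \<partial>lborel)"
      by (rule integral_norm_bound)
    also have "\<dots> \<le> (\<integral>y. (2 * C1 * \<eta> + C1 / (2 * R)) * w y + (C1 / 2) * (w y * (norm (u y))\<^sup>2) \<partial>lborel)"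
    proof (rule integral_mono')
      show "integrable lborel (\<lambda>y. (2 * C1 * \<eta> + C1 / (2 * R)) * w y + (C1 / 2) * (w y * (norm (u y))\<^sup>2))"
        by (intro Bochner_Integration.integrable_add integrable_mult_right iw i2)
      show "0 \<le> (2 * C1 * \<eta> + C1 / (2 * R)) * w y + (C1 / 2) * (w y * (norm (u y))\<^sup>2)" for y
        using C1(1) \<eta> w(1)[of y] R0 by (intro add_nonneg_nonneg mult_nonneg_nonneg) auto
    qed (rule pw)
    also have "\<dots> = (2 * C1 * \<eta> + C1 / (2 * R)) * (\<integral>y. w y \<partial>lborel) + (C1 / 2) * (\<integral>y. w y * (norm (u y))\<^sup>2 \<partial>lborel)"
      using iw i2 by (subst Bochner_Integration.integral_add) auto
    also have "\<dots> \<le> (2 * C1 * \<eta> + C1 / (2 * R)) * (18 * pi * R\<^sup>2) + (C1 / 2) * (C2 * R)"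
      using iw C2' C1(1) \<eta> R0 by (intro add_mono mult_left_mono) auto
    finally have "norm V \<le> (2 / R\<^sup>2) * ((2 * C1 * \<eta> + C1 / (2 * R)) * (18 * pi * R\<^sup>2) + (C1 / 2) * (C2 * R))"
      unfolding V norm_mult norm_of_real by (intro mult_mono) auto
    also have "\<dots> = 72 * pi * C1 * \<eta> + (C1 * (C2 + 18 * pi)) / R"
      using R0 by (simp add: field_simps power2_eq_square)
    finally show ?thesis .
  qed
  have "norm V \<le> 0"
  proof (rule field_le_epsilon)
    fix \<epsilon> :: real assume \<epsilon>: "0 < \<epsilon>"
    define \<eta> where "\<eta> = \<epsilon> / (72 * pi * C1)"
    have \<eta>: "0 < \<eta>" using \<epsilon> C1 by (simp add: \<eta>_def)
    obtain R2 where R2: "\<And>y. R2 \<le> norm y \<Longrightarrow>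
       norm ((\<Sum>j\<in>UNIV. of_real (y $ j) * u1 j y) - \<i> * of_real (\<kappa> * norm y) * u y) \<le> \<eta> * sqrt (norm y)"
      using rad[OF \<eta>] by blast
    have "((\<lambda>R. 72 * pi * C1 * \<eta> + (C1 * (C2 + 18 * pi)) / R) \<longlongrightarrow> 72 * pi * C1 * \<eta>) at_top"
      by real_asymp
    moreover have "\<forall>\<^sub>F R in at_top. norm V \<le> 72 * pi * C1 * \<eta> + (C1 * (C2 + 18 * pi)) / R"
      using eventually_gt_at_top[of "max (max R0 R1) (max R2 (2 * norm x + 1))"]
      by eventually_elim (use est[OF \<eta> R2] in auto)
    ultimately have "norm V \<le> 72 * pi * C1 * \<eta>"
      by (intro tendsto_lowerbound) auto
    then show "norm V \<le> 0 + \<epsilon>" using C1 by (simp add: \<eta>_def)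
  qed
  then have "u x + (\<integral>y. G y * f y \<partial>lborel) = 0" by (simp add: V_def)
  then show ?thesis by (simp add: G_def f_def eq_neg_iff_add_eq_0)
qed

section \<open>Smooth bump functions and the Sobolev norm\<close>

text \<open>Flat functions p(1/t) e^(-1/t), indexed by polynomials since the family is closed under
  differentiation: with y = 1/t, the derivative acts on p as y^2 (p - p').\<close>

definition flat_exp :: "real poly \<Rightarrow> real \<Rightarrow> real" where
  "flat_exp p t = (if 0 < t then poly p (1 / t) * exp (- 1 / t) else 0)"

lemma poly_times_exp_tendsto_0: "((\<lambda>y. poly p y * exp (- y)) \<longlongrightarrow> 0) at_top" for p :: "real poly"
proof -
  have "((\<lambda>y. \<Sum>i\<le>degree p. coeff p i * (y ^ i / exp y)) \<longlongrightarrow> (\<Sum>i\<le>degree p. coeff p i * 0)) at_top"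
    by (intro tendsto_intros tendsto_power_div_exp_0)
  then show ?thesis
    by (simp add: poly_altdef sum_divide_distrib exp_minus divide_inverse[symmetric])
qed

lemma flat_exp_deriv:
  "(flat_exp p has_real_derivative flat_exp (monom 1 2 * (p - pderiv p)) t) (at t)"
proof (cases t "0 :: real" rule: linorder_cases)
  case less
  have "((\<lambda>t. 0) has_real_derivative 0) (at t)" by simp
  then have "(flat_exp p has_real_derivative 0) (at t)"
    by (rule has_field_derivative_transform_within_open[of _ _ _ "{..<0}"]) (use less in \<open>auto simp: flat_exp_def\<close>)
  then show ?thesis using less by (simp add: flat_exp_def)
next
  case greater
  have "((\<lambda>t. poly p (1 / t) * exp (- 1 / t)) has_real_derivative
     (poly (pderiv p) (1 / t) * (- 1 / t\<^sup>2)) * exp (- 1 / t) + poly p (1 / t) * (exp (- 1 / t) * (1 / t\<^sup>2))) (at t)"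
  proof -
    have i: "((\<lambda>t. 1 / t) has_real_derivative - 1 / t\<^sup>2) (at t)" "((\<lambda>t. - 1 / t) has_real_derivative 1 / t\<^sup>2) (at t)"
      using greater by (auto intro!: derivative_eq_intros simp: power2_eq_square)
    show ?thesis
      using DERIV_mult'[OF DERIV_chain2[OF poly_DERIV i(1)] DERIV_chain2[OF DERIV_exp i(2)]]
      by (rule DERIV_cong) simp
  qed
  then have "(flat_exp p has_real_derivative
     (poly (pderiv p) (1 / t) * (- 1 / t\<^sup>2)) * exp (- 1 / t) + poly p (1 / t) * (exp (- 1 / t) * (1 / t\<^sup>2))) (at t)"
    by (rule has_field_derivative_transform_within_open[of _ _ _ "{0<..}"]) (use greater in \<open>auto simp: flat_exp_def\<close>)
  then show ?thesis
    by (rule DERIV_cong) (use greater in \<open>simp add: flat_exp_def poly_monom power_divide algebra_simps\<close>)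
next
  case equal
  have r: "((\<lambda>h. flat_exp p h / h) \<longlongrightarrow> 0) (at_right 0)"
  proof -
    have "filterlim (\<lambda>h::real. 1 / h) at_top (at_right 0)" by real_asymp
    from filterlim_compose[OF poly_times_exp_tendsto_0[of "monom 1 1 * p"] this]
    have "((\<lambda>h. poly (monom 1 1 * p) (1 / h) * exp (- (1 / h))) \<longlongrightarrow> 0) (at_right 0)" .
    then show ?thesis
      by (rule Lim_transform_eventually)
        (use eventually_at_right_less[of "0::real"] in \<open>eventually_elim, simp add: flat_exp_def poly_monom\<close>)
  qed
  have l: "((\<lambda>h. flat_exp p h / h) \<longlongrightarrow> 0) (at_left 0)"
    by (rule Lim_transform_eventually[OF tendsto_const])
      (auto simp: eventually_at_filter flat_exp_def)
  have "((\<lambda>h. flat_exp p h / h) \<longlongrightarrow> 0) (at 0)"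
    using filterlim_split_at[OF l r] .
  then show ?thesis using equal by (simp add: DERIV_def flat_exp_def)
qed

context
  fixes X0 :: "real^'n::finite" and r :: real
begin

text \<open>Contains a bump function and is closed under partial derivatives.\<close>

inductive bump_class :: "(real^'n \<Rightarrow> real) \<Rightarrow> bool" where
  base: "bump_class (\<lambda>X. flat_exp p (r\<^sup>2 - (norm (X - X0))\<^sup>2))"
| scale: "bump_class f \<Longrightarrow> bump_class (\<lambda>X. c * f X)"
| coord: "bump_class f \<Longrightarrow> bump_class (\<lambda>X. (X - X0) $ j * f X)"
| add: "bump_class f \<Longrightarrow> bump_class g \<Longrightarrow> bump_class (\<lambda>X. f X + g X)"

lemma bump_class_deriv:
  "bump_class f \<Longrightarrow> \<exists>f'. (\<forall>j. bump_class (f' j)) \<and> (\<forall>X. (f has_derivative (\<lambda>v. \<Sum>j\<in>UNIV. v $ j * f' j X)) (at X))"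
proof (induction rule: bump_class.induct)
  case (base p)
  define q where "q = monom 1 2 * (p - pderiv p)"
  define f' where "f' = (\<lambda>j X. (X - X0) $ j * ((- 2) * flat_exp q (r\<^sup>2 - (norm (X - X0))\<^sup>2)))"
  have "((\<lambda>X. flat_exp p (r\<^sup>2 - (norm (X - X0))\<^sup>2)) has_derivative (\<lambda>v. \<Sum>j\<in>UNIV. v $ j * f' j X)) (at X)" for X
  proof -
    have "((\<lambda>X. r\<^sup>2 - (norm (X - X0))\<^sup>2) has_derivative (\<lambda>v. 0 - (\<Sum>j\<in>UNIV. v $ j * (2 * (X - X0) $ j)))) (at X)"
      by (intro has_derivative_diff has_derivative_const sqdist_deriv)
    from has_derivative_compose[OF this flat_exp_deriv[unfolded has_field_derivative_def]]
    show ?thesis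
      by (rule has_derivative_eq_rhs)
        (simp add: f'_def q_def fun_eq_iff sum_distrib_right sum_negf mult_ac del: vector_minus_component)
  qed
  moreover have "bump_class (f' j)" for j
    unfolding f'_def by (intro bump_class.intros)
  ultimately show ?case by blast
next
  case (scale f c)
  then obtain f' where f': "\<And>j. bump_class (f' j)" "\<And>X. (f has_derivative (\<lambda>v. \<Sum>j\<in>UNIV. v $ j * f' j X)) (at X)" by blast
  have "((\<lambda>X. c * f X) has_derivative (\<lambda>v. \<Sum>j\<in>UNIV. v $ j * (c * f' j X))) (at X)" for X
    using has_derivative_mult_right[OF f'(2)[of X], of c]
    by (rule has_derivative_eq_rhs) (simp add: fun_eq_iff sum_distrib_left mult_ac)
  then show ?case using bump_class.scale[OF f'(1)] by (intro exI[of _ "\<lambda>j X. c * f' j X"]) auto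
next
  case (coord f k)
  then obtain f' where f': "\<And>j. bump_class (f' j)" "\<And>X. (f has_derivative (\<lambda>v. \<Sum>j\<in>UNIV. v $ j * f' j X)) (at X)" by blast
  define h where "h = (\<lambda>j X. (X - X0) $ k * f' j X + (if j = k then 1 else 0) * f X)"
  have "((\<lambda>X. (X - X0) $ k * f X) has_derivative (\<lambda>v. \<Sum>j\<in>UNIV. v $ j * h j X)) (at X)" for X
  proof -
    have "((\<lambda>X. (X - X0) $ k) has_derivative (\<lambda>v. v $ k)) (at X)"
      by (auto intro!: derivative_eq_intros bounded_linear.has_derivative[OF bounded_linear_vec_nth])
    from has_derivative_mult[OF this f'(2)[of X]] show ?thesis
    proof (rule has_derivative_eq_rhs, intro ext)
      fix v :: "real^'n"
      have "(\<Sum>j\<in>UNIV. v $ j * h j X) = (\<Sum>j\<in>UNIV. (X - X0) $ k * (v $ j * f' j X)) + (\<Sum>j\<in>UNIV. if j = k then v $ j * f X else 0)"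
        unfolding sum.distrib[symmetric] h_def by (intro sum.cong) (auto simp: algebra_simps)
      then show "(X - X0) $ k * (\<Sum>j\<in>UNIV. v $ j * f' j X) + v $ k * f X = (\<Sum>j\<in>UNIV. v $ j * h j X)"
        by (simp add: sum_distrib_left)
    qed
  qed
  moreover have "bump_class (h j)" for j
    unfolding h_def by (intro bump_class.add bump_class.coord bump_class.scale f'(1) coord.hyps)
  ultimately show ?case by blast
next
  case (add f g)
  then obtain f' g' where f': "\<And>j. bump_class (f' j)" "\<And>X. (f has_derivative (\<lambda>v. \<Sum>j\<in>UNIV. v $ j * f' j X)) (at X)"
    and g': "\<And>j. bump_class (g' j)" "\<And>X. (g has_derivative (\<lambda>v. \<Sum>j\<in>UNIV. v $ j * g' j X)) (at X)" by blast
  have "((\<lambda>X. f X + g X) has_derivative (\<lambda>v. \<Sum>j\<in>UNIV. v $ j * (f' j X + g' j X))) (at X)" for X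
    using has_derivative_add[OF f'(2)[of X] g'(2)[of X]]
    by (rule has_derivative_eq_rhs) (simp add: fun_eq_iff sum.distrib algebra_simps)
  then show ?case using bump_class.add[OF f'(1) g'(1)] by (intro exI[of _ "\<lambda>j X. f' j X + g' j X"]) auto
qed

lemma bump_class_pds: "bump_class f \<Longrightarrow> bump_class (pds js f)"
proof (induction js)
  case (Cons j js)
  then have "bump_class (pds js f)" by simp
  then obtain f' where f': "\<And>j. bump_class (f' j)" "\<And>X. (pds js f has_derivative (\<lambda>v. \<Sum>j\<in>UNIV. v $ j * f' j X)) (at X)"
    using bump_class_deriv by blast
  have "pd j (pds js f) X = f' j X" for X
    unfolding has_derivative_axis(2)[OF f'(2)]
    by (simp add: axis_def if_distrib[of "\<lambda>x. x * _"] cong: if_cong)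
  then have "pds (j # js) f = f' j" by auto
  then show ?case using f'(1) by simp
qed simp

lemma smooth_bump_class: "bump_class f \<Longrightarrow> smooth f"
proof -
  have d: "g differentiable (at X)" if g: "bump_class g" for g X
    using bump_class_deriv[OF g] by (auto simp: differentiable_def)
  have "g differentiable_on UNIV" "continuous_on UNIV g" if g: "bump_class g" for g
    using d[OF g] by (auto simp: differentiable_on_def continuous_on_eq_continuous_within intro!: differentiable_imp_continuous_within)
  then show "bump_class f \<Longrightarrow> smooth f"
    unfolding smooth_def Ck_def using bump_class_pds by blast
qed

end

definition bump :: "real^'n::finite \<Rightarrow> real \<Rightarrow> real^'n \<Rightarrow> real" where
  "bump X0 r X = flat_exp 1 (r\<^sup>2 - (norm (X - X0))\<^sup>2)"

lemma bump_props:
  assumes "0 < r"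
  shows "smooth (bump X0 r)" "0 \<le> bump X0 r X" "bump X0 r X \<noteq> 0 \<longleftrightarrow> X \<in> ball X0 r" "support (bump X0 r) = cball X0 r"
proof -
  show "smooth (bump X0 r)" unfolding bump_def[abs_def] by (intro smooth_bump_class[of X0 r] bump_class.base)
  show "0 \<le> bump X0 r X" by (simp add: bump_def flat_exp_def)
  have iff: "bump X0 r X \<noteq> 0 \<longleftrightarrow> X \<in> ball X0 r" for X
  proof -
    have "(norm (X - X0))\<^sup>2 < r\<^sup>2 \<longleftrightarrow> norm (X - X0) < r"
      using assms by (metis norm_ge_zero less_imp_le power2_less_imp_less power_strict_mono zero_less_numeral)
    then show ?thesis by (simp add: bump_def flat_exp_def dist_norm norm_minus_commute)
  qed
  show "bump X0 r X \<noteq> 0 \<longleftrightarrow> X \<in> ball X0 r" by (rule iff)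
  have "{X. bump X0 r X \<noteq> 0} = ball X0 r" by (simp only: iff Collect_mem_eq)
  then show "support (bump X0 r) = cball X0 r" using assms by (simp only: support_def closure_ball)
qed

section \<open>Positivity of the Sobolev norm\<close>

lemma integral_lebesgue_on_lborel:
  fixes G :: "'a::euclidean_space \<Rightarrow> 'b::{banach, second_countable_topology}"
  assumes "D \<in> sets lebesgue" "G \<in> borel_measurable borel" "\<And>X. X \<notin> D \<Longrightarrow> G X = 0"
  shows "(LINT X|lebesgue_on D. G X) = (\<integral>X. G X \<partial>lborel)"
proof -
  have "(LINT X|lebesgue_on D. G X) = (LINT X|lebesgue. indicator D X *\<^sub>R G X)"
    using assms(1) by (subst integral_restrict_space) auto
  also have "(\<lambda>X. indicator D X *\<^sub>R G X) = G"
    using assms(3) by (auto simp: fun_eq_iff indicator_def)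
  also have "(LINT X|lebesgue. G X) = (\<integral>X. G X \<partial>lborel)"
    using assms(2) by (intro integral_completion) simp
  finally show ?thesis .
qed

text \<open>The order-zero term of the norm is that of a choice v among the weak derivatives of
  order zero, not literally that of f. Tested against a bump function concentrated where f is close
  to a nonzero value, v has the same nonzero integral as f, so it cannot vanish almost
  everywhere.\<close>

lemma H2_norm_pos:
  fixes f :: "real^2 \<Rightarrow> complex"
  assumes D: "open D" and f: "continuous_on UNIV f" "L2 D f" and X0: "X0 \<in> D" "f X0 \<noteq> 0"
  shows "0 < H2_norm D f"
proof -
  define z where "z = f X0"
  have z: "0 < norm z" using X0 by (simp add: z_def)
  obtain e where e: "0 < e" "cball X0 e \<subseteq> D" using D X0 by (meson open_contains_cball)
  have "isCont f X0" using f(1) by (simp add: continuous_on_eq_continuous_at)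
  then obtain d where d: "0 < d" "\<And>X. dist X X0 < d \<Longrightarrow> dist (f X) z < norm z / 2"
    using z unfolding continuous_at_eps_delta z_def by (meson half_gt_zero)
  define r where "r = min e d"
  have r: "0 < r" "cball X0 r \<subseteq> D" using e d by (auto simp: r_def)
  define \<phi> where "\<phi> = bump X0 r"
  note \<phi> = bump_props[OF r(1), of X0, folded \<phi>_def]
  have tf: "test_function D \<phi>" using \<phi> r by (simp add: test_function_def)
  have c\<phi>: "continuous_on UNIV \<phi>"
    using \<phi>(1) unfolding smooth_def Ck_def by (metis le0 list.size(3) pds.simps(1))
  have D_m: "D \<in> sets lebesgue" using D by (simp add: borel_open)
  have vb: "Re (cnj z * f X) \<ge> (norm z)\<^sup>2 / 2" if "X \<in> ball X0 r" for X
  proof -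
    have "dist X X0 < d" using that by (simp add: r_def dist_commute)
    then have "norm (f X - z) \<le> norm z / 2" using d(2)[of X] by (simp add: dist_norm)
    then have "norm (cnj z * (f X - z)) \<le> norm z * (norm z / 2)"
      unfolding norm_mult complex_mod_cnj by (rule mult_left_mono) simp
    then have "\<bar>Re (cnj z * (f X - z))\<bar> \<le> (norm z)\<^sup>2 / 2"
      using abs_Re_le_cmod[of "cnj z * (f X - z)"] by (simp add: power2_eq_square)
    moreover have "Re (cnj z * f X) = Re (cnj z * (f X - z)) + (norm z)\<^sup>2"
      unfolding cmod_power2 by (simp add: power2_eq_square algebra_simps)
    ultimately show ?thesis by linarith
  qed
  define F where "F = (\<lambda>X. \<phi> X *\<^sub>R f X)"
  have cF: "continuous_on UNIV F" unfolding F_def by (intro continuous_intros c\<phi> f)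
  have F0: "F X = 0" "\<phi> X = 0" if "X \<notin> ball X0 r" for X using \<phi>(3)[of X] that by (auto simp: F_def)
  have out: "X \<notin> ball X0 r" if "norm X0 + r < norm X" for X
    using that norm_triangle_ineq2[of X X0] by (auto simp: dist_norm norm_minus_commute)
  have iF: "integrable lborel F"
    by (rule integrable_compact_support[OF cF F0(1)[OF out]])
  have i\<phi>: "integrable lborel \<phi>"
    by (rule integrable_compact_support[OF c\<phi> F0(2)[OF out]])
  have onD: "(LINT X|lebesgue_on D. F X) = (\<integral>X. F X \<partial>lborel)"
  proof (rule integral_lebesgue_on_lborel[OF D_m borel_measurable_continuous_onI[OF cF]])
    show "F X = 0" if "X \<notin> D" for X
    proof (rule F0(1))
      show "X \<notin> ball X0 r" using that r(2) ball_subset_cball[of X0 r] by blast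
    qed
  qed
  have pos: "0 < Re (cnj z * (\<integral>X. F X \<partial>lborel))"
  proof -
    have "0 < (\<integral>X. \<phi> X \<partial>lborel)"
    proof -
      have "(\<integral>X. \<phi> X \<partial>lborel) \<noteq> 0"
      proof
        assume "(\<integral>X. \<phi> X \<partial>lborel) = 0"
        then have "AE X in lborel. \<phi> X = 0"
          by (rule integral_nonneg_eq_0_iff_AE[OF i\<phi> AE_I2[OF \<phi>(2)], THEN iffD1])
        then have "AE X in lborel. X \<notin> ball X0 r"
          by (rule eventually_mono) (simp only: \<phi>(3)[symmetric] not_not)
        then have "ball X0 r \<in> null_sets lborel"
          by (subst AE_iff_null_sets) auto
        then have "negligible (ball X0 r)"
          by (simp add: negligible_iff_null_sets null_sets_completionI)
        then show False using r(1) open_not_negligible[of "ball X0 r"] by simp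
      qed
      moreover have "0 \<le> (\<integral>X. \<phi> X \<partial>lborel)" by (rule integral_nonneg_AE[OF AE_I2[OF \<phi>(2)]])
      ultimately show ?thesis by simp
    qed
    then have "0 < (norm z)\<^sup>2 / 2 * (\<integral>X. \<phi> X \<partial>lborel)" using z by simp
    also have "\<dots> = (\<integral>X. (norm z)\<^sup>2 / 2 * \<phi> X \<partial>lborel)" by simp
    also have "\<dots> \<le> (\<integral>X. Re (cnj z * F X) \<partial>lborel)"
    proof (rule integral_mono)
      show "integrable lborel (\<lambda>X. Re (cnj z * F X))" using iF by (intro integrable_Re integrable_mult_right)
      show "(norm z)\<^sup>2 / 2 * \<phi> X \<le> Re (cnj z * F X)" for X
      proof (cases "X \<in> ball X0 r")
        case True
        have "Re (cnj z * F X) = \<phi> X * Re (cnj z * f X)" by (simp add: F_def algebra_simps)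
        then show ?thesis using mult_left_mono[OF vb[OF True] \<phi>(2)[of X]] by (simp add: mult.commute)
      qed (simp add: F0)
    qed (use i\<phi> in simp)
    also have "\<dots> = Re (\<integral>X. cnj z * F X \<partial>lborel)" using iF by (intro integral_Re integrable_mult_right)
    also have "(\<integral>X. cnj z * F X \<partial>lborel) = cnj z * (\<integral>X. F X \<partial>lborel)" by (rule integral_mult_right_zero)
    finally show ?thesis .
  qed
  define v where "v = (SOME v. weak_pds D [] f v)"
  have "weak_pds D [] f f" using f by (simp add: weak_pds_def)
  then have v: "weak_pds D [] f v" unfolding v_def by (rule someI[of "weak_pds D [] f" f])
  have eq: "(LINT X|lebesgue_on D. F X) = (LINT X|lebesgue_on D. \<phi> X *\<^sub>R v X)"
    using v tf by (simp add: weak_pds_def F_def)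
  have v_pos: "0 < (L2_norm D v)\<^sup>2"
  proof (rule ccontr)
    assume "\<not> 0 < (L2_norm D v)\<^sup>2"
    then have "L2_norm D v = 0" by simp
    then have "(LINT X|lebesgue_on D. (norm (v X))\<^sup>2) = 0" by (simp add: L2_norm_def)
    moreover have "integrable (lebesgue_on D) (\<lambda>X. (norm (v X))\<^sup>2)" using v by (simp add: weak_pds_def L2_def)
    ultimately have "AE X in lebesgue_on D. (norm (v X))\<^sup>2 = 0"
      using integral_nonneg_eq_0_iff_AE[of "lebesgue_on D" "\<lambda>X. (norm (v X))\<^sup>2"] by simp
    then have "(LINT X|lebesgue_on D. \<phi> X *\<^sub>R v X) = 0"
      by (intro integral_eq_zero_AE) (auto elim: eventually_mono)
    then have "(\<integral>X. F X \<partial>lborel) = 0"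
      using eq onD by simp
    then show False using pos by simp
  qed
  have "(L2_norm D (SOME v. weak_pds D [] f v))\<^sup>2 \<le> (\<Sum>js\<in>{[], [1], [2], [1, 1], [1, 2], [2, 2]}. (L2_norm D (SOME v. weak_pds D js f v))\<^sup>2)"
    by (rule member_le_sum) auto
  then have "0 < (\<Sum>js\<in>{[], [1], [2], [1, 1], [1, 2], [2, 2]}. (L2_norm D (SOME v. weak_pds D js f v))\<^sup>2)"
    using v_pos unfolding v_def by (rule less_le_trans[rotated])
  then show ?thesis unfolding H2_norm_def by (rule real_sqrt_gt_zero)
qed

section \<open>The dispersion relation\<close>

context
  fixes \<omega> g \<mu> :: real
  assumes pos: "0 < \<omega>" "0 < g" and \<mu>: "\<mu> = \<omega>\<^sup>2 / g"
begin

lemma mu_pos: "0 < \<mu>" using pos by (simp add: \<mu>)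

lemma dispersion_iff: "\<omega>\<^sup>2 = g * \<kappa> * tanh (\<kappa> * d) \<longleftrightarrow> \<kappa> * tanh (\<kappa> * d) = \<mu>"
  using pos by (auto simp: \<mu> field_simps)

lemma tanh_ge_half: "1/2 \<le> tanh z" if "1 \<le> z" for z :: real
proof -
  have "2 \<le> exp (1::real)" using exp_ge_add_one_self[of 1] by simp
  then have "exp (- 1) \<le> (1/2 :: real)" by (simp add: exp_minus field_simps)
  moreover have "exp (- z) \<le> exp (- 1)" using that by simp
  ultimately have "exp (- z) \<le> (1/2 :: real)" by linarith
  then have "exp (- z) * exp (- z) \<le> 1/2 * (1/2 :: real)" by (intro mult_mono) auto
  moreover have "exp (- z) * exp (- z) = exp (- 2 * z)" by (simp add: mult_exp_exp)
  ultimately have "exp (- 2 * z) \<le> 1/4" by simp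
  then show ?thesis
    unfolding tanh_real_altdef by (simp add: le_divide_eq add_pos_pos)
qed

lemma dispersion_strict_mono:
  fixes a b d :: real
  assumes "0 < d" "0 < a" "a < b"
  shows "a * tanh (a * d) < b * tanh (b * d)"
proof -
  have "tanh (a * d) < tanh (b * d)" using assms by simp
  moreover have "0 < tanh (a * d)" using assms by simp
  ultimately show ?thesis using assms by (intro mult_strict_mono) auto
qed

lemma dispersion_ex:
  assumes "0 < d"
  shows "\<exists>!\<kappa>. 0 < \<kappa> \<and> \<omega>\<^sup>2 = g * \<kappa> * tanh (\<kappa> * d)"
proof -
  \<comment> \<open>The first entry makes tanh (b d) at least 1/2 and the second then lifts b tanh
    (b d) to \<mu>, giving the upper end for the intermediate value theorem.\<close>
  define b where "b = max (1 / d) (2 * \<mu>)"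
  have b: "0 < b" "1 \<le> b * d" "2 * \<mu> \<le> b" using assms mu_pos
    by (auto simp: b_def max_def field_simps)
  have "\<exists>x\<ge>0. x \<le> b \<and> x * tanh (x * d) = \<mu>"
  proof (rule IVT)
    show "0 * tanh (0 * d) \<le> \<mu>" using mu_pos by simp
    have "\<mu> = (2 * \<mu>) * (1/2)" by simp
    also have "\<dots> \<le> b * tanh (b * d)" using b tanh_ge_half[OF b(2)] mu_pos by (intro mult_mono) auto
    finally show "\<mu> \<le> b * tanh (b * d)" .
    show "\<forall>x. 0 \<le> x \<and> x \<le> b \<longrightarrow> isCont (\<lambda>x. x * tanh (x * d)) x"
      by (intro allI impI continuous_intros) (simp add: cosh_real_nonzero)
  qed (use b in auto)
  then obtain x where x: "0 \<le> x" "x * tanh (x * d) = \<mu>" by blast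
  then have "0 < x" using mu_pos by (cases "x = 0") auto
  show ?thesis
  proof (rule ex1I[of _ x])
    show "0 < x \<and> \<omega>\<^sup>2 = g * x * tanh (x * d)" using \<open>0 < x\<close> x by (simp add: dispersion_iff)
    fix y assume "0 < y \<and> \<omega>\<^sup>2 = g * y * tanh (y * d)"
    then have y: "0 < y" "y * tanh (y * d) = \<mu>" by (auto simp: dispersion_iff)
    show "y = x"
      using dispersion_strict_mono[OF assms \<open>0 < x\<close>, of y] dispersion_strict_mono[OF assms y(1), of x] x y
      by (cases x y rule: linorder_cases) auto
  qed
qed

section \<open>The local wavenumber as a function of the depth\<close>

definition wnum :: "real \<Rightarrow> real" where "wnum = wavenumber \<omega> g"

lemma wnum_eq:
  assumes "0 < d"
  shows "0 < wnum d" "wnum d * tanh (wnum d * d) = \<mu>"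
  using theI'[OF dispersion_ex[OF assms]] by (auto simp: wnum_def wavenumber_def dispersion_iff)

lemma wnum_unique: "0 < d \<Longrightarrow> 0 < \<kappa> \<Longrightarrow> \<kappa> * tanh (\<kappa> * d) = \<mu> \<Longrightarrow> wnum d = \<kappa>"
  unfolding wnum_def wavenumber_def
  by (rule the1_equality[OF dispersion_ex]) (auto simp: dispersion_iff)

lemma wnum_gt:
  assumes "0 < d" shows "\<mu> < wnum d"
proof -
  have "wnum d * tanh (wnum d * d) < wnum d * 1"
    using wnum_eq(1)[OF assms] tanh_real_lt_1 by (intro mult_strict_left_mono) auto
  then show ?thesis using wnum_eq[OF assms] by simp
qed

text \<open>Either the product is below 1, or tanh is at least 1/2 and the wavenumber is at most 2
  \<mu>. The wavenumber itself is unbounded as d tends to 0; in terms of the product, the mild-slope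
  condition bounds the gradient of d by a multiple of 1 + d.\<close>

lemma wnum_mult_le:
  assumes "0 < d" shows "wnum d * d \<le> 1 + 2 * \<mu> * d"
proof (cases "1 \<le> wnum d * d")
  case True
  have "wnum d * (1/2) \<le> wnum d * tanh (wnum d * d)"
    using tanh_ge_half[OF True] wnum_eq[OF assms] by (intro mult_left_mono) auto
  then have "wnum d \<le> 2 * \<mu>" using wnum_eq[OF assms] by simp
  then have "wnum d * d \<le> 2 * \<mu> * d" using assms by (intro mult_right_mono) auto
  then show ?thesis by simp
qed (use assms mu_pos in \<open>simp add: add_increasing2\<close>)

text \<open>The inverse of \<open>wnum\<close> on wavenumbers above \<mu>. It is explicit, so the
  regularity of \<open>wnum\<close> is derived from it, and it is the untruncated branch of the
  depth function.\<close>

definition depth_of :: "real \<Rightarrow> real" where "depth_of \<kappa> = artanh (\<mu> / \<kappa>) / \<kappa>"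

lemma depth_of_wnum:
  assumes "0 < d" shows "depth_of (wnum d) = d"
proof -
  have "tanh (wnum d * d) = \<mu> / wnum d" using wnum_eq[OF assms] by (simp add: field_simps)
  then have "artanh (\<mu> / wnum d) = wnum d * d" by (metis artanh_tanh_real)
  then show ?thesis using wnum_eq[OF assms] by (simp add: depth_of_def)
qed

lemma artanh_pos: "0 < artanh x" if "0 < x" "x < 1" for x :: real
proof -
  have "1 < (1 + x) / (1 - x)" using that by (simp add: field_simps)
  then show ?thesis by (simp add: artanh_def)
qed

lemma tanh_artanh: "tanh (artanh x) = x" if "\<bar>x\<bar> < 1" for x :: real
proof -
  have p: "0 < 1 - x" "0 < 1 + x" using that by auto
  have "exp (- 2 * artanh x) = inverse ((1 + x) / (1 - x))"
    using p by (simp add: artanh_def exp_minus)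
  also have "\<dots> = (1 - x) / (1 + x)" by simp
  finally have e: "exp (- 2 * artanh x) = (1 - x) / (1 + x)" .
  show ?thesis
    unfolding tanh_real_altdef e using p by (simp add: field_simps)
qed

lemma wnum_depth_of:
  assumes "\<mu> < \<kappa>" shows "0 < depth_of \<kappa>" "wnum (depth_of \<kappa>) = \<kappa>"
proof -
  have k: "0 < \<kappa>" "\<mu> / \<kappa> < 1" "0 < \<mu> / \<kappa>" using assms mu_pos by auto
  show p: "0 < depth_of \<kappa>" using artanh_pos[OF k(3,2)] k by (simp add: depth_of_def)
  have "tanh (\<kappa> * depth_of \<kappa>) = \<mu> / \<kappa>" using k abs_of_pos[OF k(3)] tanh_artanh[of "\<mu> / \<kappa>"] by (simp add: depth_of_def)
  then show "wnum (depth_of \<kappa>) = \<kappa>" using k by (intro wnum_unique p) auto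
qed

lemma depth_of_deriv:
  assumes "\<mu> < \<kappa>"
  shows "(depth_of has_real_derivative (- artanh (\<mu> / \<kappa>) / \<kappa>\<^sup>2 - \<mu> / (\<kappa> * (\<kappa>\<^sup>2 - \<mu>\<^sup>2)))) (at \<kappa>)"
proof -
  have k: "0 < \<kappa>" "\<mu> / \<kappa> < 1" "0 < \<mu> / \<kappa>" using assms mu_pos by auto
  have sq: "\<mu>\<^sup>2 < \<kappa>\<^sup>2" using assms mu_pos by (intro power_strict_mono) auto
  have 1: "((\<lambda>\<kappa>. \<mu> / \<kappa>) has_real_derivative (- \<mu> / \<kappa>\<^sup>2)) (at \<kappa>)"
    using k by (auto intro!: derivative_eq_intros simp: power2_eq_square)
  have "((\<lambda>\<kappa>. artanh (\<mu> / \<kappa>)) has_real_derivative (1 / (1 - (\<mu> / \<kappa>)\<^sup>2) * (- \<mu> / \<kappa>\<^sup>2))) (at \<kappa>)"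
    by (rule DERIV_chain2[OF _ 1]) (use k mu_pos assms in \<open>auto intro!: artanh_real_has_field_derivative\<close>)
  from DERIV_divide[OF this DERIV_ident]
  have "((\<lambda>\<kappa>. artanh (\<mu> / \<kappa>) / \<kappa>) has_real_derivative ((1 / (1 - (\<mu> / \<kappa>)\<^sup>2) * (- \<mu> / \<kappa>\<^sup>2)) * \<kappa> - artanh (\<mu> / \<kappa>) * 1) / (\<kappa> * \<kappa>)) (at \<kappa>)"
    using k by simp
  moreover have "((1 / (1 - (\<mu> / \<kappa>)\<^sup>2) * (- \<mu> / \<kappa>\<^sup>2)) * \<kappa> - artanh (\<mu> / \<kappa>) * 1) / (\<kappa> * \<kappa>)
     = - artanh (\<mu> / \<kappa>) / \<kappa>\<^sup>2 - \<mu> / (\<kappa> * (\<kappa>\<^sup>2 - \<mu>\<^sup>2))"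
  proof -
    have "1 / (1 - (\<mu> / \<kappa>)\<^sup>2) = \<kappa>\<^sup>2 / (\<kappa>\<^sup>2 - \<mu>\<^sup>2)"
      using k sq by (simp add: power_divide field_simps)
    then show ?thesis using k sq by (simp add: power2_eq_square diff_divide_distrib)
  qed
  ultimately show ?thesis by (simp add: depth_of_def[abs_def])
qed

lemma isCont_wnum:
  assumes "0 < d" shows "isCont wnum d"
proof -
  have "isCont wnum (depth_of (wnum d))"
  proof (rule isCont_inverse_function2[where f = depth_of and x = "wnum d" and a = "(\<mu> + wnum d) / 2" and b = "wnum d + 1"])
    show "wnum (depth_of z) = z" if "(\<mu> + wnum d) / 2 \<le> z" "z \<le> wnum d + 1" for z
      using that wnum_gt[OF assms] by (intro wnum_depth_of) auto
    show "isCont depth_of z" if "(\<mu> + wnum d) / 2 \<le> z" "z \<le> wnum d + 1" for z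
      by (rule DERIV_isCont[OF depth_of_deriv]) (use that wnum_gt[OF assms] in auto)
  qed (use wnum_gt[OF assms] in auto)
  then show ?thesis by (simp add: depth_of_wnum[OF assms])
qed

text \<open>The reciprocal of the derivative of \<open>depth_of\<close>, with the inverse hyperbolic
  tangent eliminated through artanh (\<mu>/k) = d k. What remains is a rational expression in d and
  \<open>wnum d\<close>, ready to be differentiated once more.\<close>

definition wnum1 :: "real \<Rightarrow> real" where
  "wnum1 d = - (wnum d * ((wnum d)\<^sup>2 - \<mu>\<^sup>2)) / (d * ((wnum d)\<^sup>2 - \<mu>\<^sup>2) + \<mu>)"

lemma wnum_sq_gt: "0 < d \<Longrightarrow> \<mu>\<^sup>2 < (wnum d)\<^sup>2"
  using wnum_gt mu_pos by (intro power_strict_mono) auto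

lemma wnum_den_pos: "0 < d \<Longrightarrow> 0 < d * ((wnum d)\<^sup>2 - \<mu>\<^sup>2) + \<mu>"
  using wnum_sq_gt[of d] mu_pos by (intro add_pos_pos mult_pos_pos) auto

lemma wnum_deriv:
  assumes "0 < d" shows "(wnum has_real_derivative wnum1 d) (at d)"
proof -
  define k where "k = wnum d"
  have k: "0 < k" "\<mu>\<^sup>2 < k\<^sup>2" "0 < d * (k\<^sup>2 - \<mu>\<^sup>2) + \<mu>" using wnum_eq wnum_sq_gt wnum_den_pos assms by (auto simp: k_def)
  have art: "artanh (\<mu> / k) = d * k" using depth_of_wnum[OF assms] k by (simp add: depth_of_def k_def[symmetric] field_simps)
  define D where "D = - artanh (\<mu> / k) / k\<^sup>2 - \<mu> / (k * (k\<^sup>2 - \<mu>\<^sup>2))"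
  have D: "D = - (d * (k\<^sup>2 - \<mu>\<^sup>2) + \<mu>) / (k * (k\<^sup>2 - \<mu>\<^sup>2))"
  proof -
    define z where "z = k\<^sup>2 - \<mu>\<^sup>2"
    have "0 < z" using k by (simp add: z_def)
    then show ?thesis unfolding D_def art z_def[symmetric] using k(1) by (simp add: field_simps power2_eq_square)
  qed
  have nz: "D \<noteq> 0" using k by (simp add: D)
  have "(wnum has_real_derivative inverse D) (at d)"
  proof (rule DERIV_inverse_function[where f = depth_of and a = 0 and b = "d + 1"])
    show "(depth_of has_real_derivative D) (at (wnum d))"
      unfolding D_def k_def by (rule depth_of_deriv[OF wnum_gt[OF assms]])
    show "depth_of (wnum y) = y" if "0 < y" "y < d + 1" for y by (rule depth_of_wnum[OF that(1)])
  qed (use assms nz isCont_wnum in auto)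
  moreover have "inverse D = wnum1 d"
    unfolding D wnum1_def k_def[symmetric] by (metis inverse_divide minus_divide_left minus_divide_right)
  ultimately show ?thesis by simp
qed

definition wnum2 :: "real \<Rightarrow> real" where
  "wnum2 d = ((- (wnum1 d * ((wnum d)\<^sup>2 - \<mu>\<^sup>2) + 2 * wnum d * wnum1 d * wnum d)) * (d * ((wnum d)\<^sup>2 - \<mu>\<^sup>2) + \<mu>)
     - (- (wnum d * ((wnum d)\<^sup>2 - \<mu>\<^sup>2))) * (((wnum d)\<^sup>2 - \<mu>\<^sup>2) + d * (2 * wnum d * wnum1 d)))
     / ((d * ((wnum d)\<^sup>2 - \<mu>\<^sup>2) + \<mu>) * (d * ((wnum d)\<^sup>2 - \<mu>\<^sup>2) + \<mu>))"

lemma wnum1_deriv: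
  assumes "0 < d" shows "(wnum1 has_real_derivative wnum2 d) (at d)"
proof -
  have a: "((\<lambda>d. (wnum d)\<^sup>2 - \<mu>\<^sup>2) has_real_derivative 2 * wnum d * wnum1 d) (at d)"
    by (auto intro!: derivative_eq_intros wnum_deriv[OF assms])
  have n: "((\<lambda>d. - (wnum d * ((wnum d)\<^sup>2 - \<mu>\<^sup>2))) has_real_derivative - (wnum1 d * ((wnum d)\<^sup>2 - \<mu>\<^sup>2) + 2 * wnum d * wnum1 d * wnum d)) (at d)"
    by (rule DERIV_minus[OF DERIV_mult[OF wnum_deriv[OF assms] a]])
  have "((\<lambda>d. d * ((wnum d)\<^sup>2 - \<mu>\<^sup>2) + \<mu>) has_real_derivative (1 * ((wnum d)\<^sup>2 - \<mu>\<^sup>2) + 2 * wnum d * wnum1 d * d) + 0) (at d)"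
    by (rule DERIV_add[OF DERIV_mult[OF DERIV_ident a] DERIV_const])
  then have m: "((\<lambda>d. d * ((wnum d)\<^sup>2 - \<mu>\<^sup>2) + \<mu>) has_real_derivative ((wnum d)\<^sup>2 - \<mu>\<^sup>2) + d * (2 * wnum d * wnum1 d)) (at d)"
    by (rule DERIV_cong) simp
  show ?thesis
    unfolding wnum1_def[abs_def] using DERIV_divide[OF n m] wnum_den_pos[OF assms]
    by (simp only: wnum2_def wnum1_def less_imp_neq[THEN not_sym] not_False_eq_True simp_thms)
qed

lemma continuous_on_wnum: "continuous_on {0<..} wnum" "continuous_on {0<..} wnum1" "continuous_on {0<..} wnum2"
proof -
  show c: "continuous_on {0<..} wnum" "continuous_on {0<..} wnum1"
    using DERIV_isCont[OF wnum_deriv] DERIV_isCont[OF wnum1_deriv] by (auto intro!: continuous_at_imp_continuous_on)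
  show "continuous_on {0<..} wnum2"
  proof -
    have "d * ((wnum d)\<^sup>2 - \<mu>\<^sup>2) + \<mu> \<noteq> 0" if "d \<in> {0<..}" for d
      using wnum_den_pos[of d] that by auto
    then show ?thesis unfolding wnum2_def by (intro continuous_intros c) auto
  qed
qed

section \<open>The contrast as a function of the topography\<close>

definition wq :: "real \<Rightarrow> real \<Rightarrow> real \<Rightarrow> real" where
  "wq ki H0 t = 1 - (wnum (H0 - t))\<^sup>2 / ki\<^sup>2"

lemma wq_0: "0 < H0 \<Longrightarrow> 0 < ki \<Longrightarrow> ki * tanh (ki * H0) = \<mu> \<Longrightarrow> wq ki H0 0 = 0"
  using wnum_unique[of H0 ki] by (simp add: wq_def)

lemma wq_c2:
  fixes h :: "real^2 \<Rightarrow> real"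
  assumes h: "Ck 2 h" "\<And>X. h X < H0" and ki: "0 < ki"
  obtains q1 q2 where "c1 (\<lambda>X. of_real (wq ki H0 (h X))) q1" "\<And>i. c1 (q1 i) (q2 i)"
proof -
  define Q1 where "Q1 = (\<lambda>t. 2 * wnum (H0 - t) * wnum1 (H0 - t) / ki\<^sup>2)"
  define Q2 where "Q2 = (\<lambda>t. - 2 * (wnum1 (H0 - t) * wnum1 (H0 - t) + wnum (H0 - t) * wnum2 (H0 - t)) / ki\<^sup>2)"
  have sub: "((\<lambda>t. H0 - t) has_real_derivative - 1) (at t)" for t
    by (auto intro!: derivative_eq_intros)
  have dwnum: "((\<lambda>t. wnum (H0 - t)) has_real_derivative - wnum1 (H0 - t)) (at t)"
    and dwnum1: "((\<lambda>t. wnum1 (H0 - t)) has_real_derivative - wnum2 (H0 - t)) (at t)" if "t < H0" for t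
    using DERIV_chain2[OF wnum_deriv sub, of t] DERIV_chain2[OF wnum1_deriv sub, of t] that by auto
  have d1: "((\<lambda>t. complex_of_real (wq ki H0 t)) has_vector_derivative of_real (Q1 t)) (at t)" if "t < H0" for t
  proof (rule has_vector_derivative_of_real)
    show "(wq ki H0 has_real_derivative Q1 t) (at t)"
      unfolding wq_def[abs_def] Q1_def
      by (rule DERIV_cong[OF DERIV_diff[OF DERIV_const DERIV_cdivide[OF DERIV_power[OF dwnum[OF that], of 2]]]]) simp
  qed
  have d2: "((\<lambda>t. complex_of_real (Q1 t)) has_vector_derivative of_real (Q2 t)) (at t)" if "t < H0" for t
  proof (rule has_vector_derivative_of_real)
    show "(Q1 has_real_derivative Q2 t) (at t)"
      unfolding Q1_def[abs_def] Q2_def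
      by (rule DERIV_cong[OF DERIV_cdivide[OF DERIV_mult[OF DERIV_cmult[OF dwnum[OF that], of 2] dwnum1[OF that]]]]) (simp add: algebra_simps)
  qed
  have r: "range h \<subseteq> {..<H0}" using h(2) by auto
  have cont: "continuous_on (range h) (\<lambda>t. complex_of_real (Q1 t))" "continuous_on (range h) (\<lambda>t. complex_of_real (Q2 t))"
    unfolding Q1_def Q2_def using r ki
    by (auto intro!: continuous_intros continuous_on_compose2[OF continuous_on_wnum(1)]
        continuous_on_compose2[OF continuous_on_wnum(2)] continuous_on_compose2[OF continuous_on_wnum(3)])
  have hd: "h differentiable (at x)" "pd i h differentiable (at x)" for x i
    using h(1)[unfolded Ck_def, THEN conjunct1, THEN spec, of "[]"]
      h(1)[unfolded Ck_def, THEN conjunct1, THEN spec, of "[i]"]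
    by (auto simp: differentiable_on_def)
  have hc: "continuous_on UNIV (pd j h)" "continuous_on UNIV (pd j (pd i h))" for i j
    using h(1)[unfolded Ck_def, THEN conjunct2, THEN spec, of "[j]"]
      h(1)[unfolded Ck_def, THEN conjunct2, THEN spec, of "[j, i]"]
    by auto
  have hder: "(h has_derivative (\<lambda>v. \<Sum>j\<in>UNIV. v $ j * pd j h x)) (at x)"
    and hder2: "(pd i h has_derivative (\<lambda>v. \<Sum>j\<in>UNIV. v $ j * pd j (pd i h) x)) (at x)" for x i
    using differentiable_pd[OF hd(1)] differentiable_pd[OF hd(2)] by auto
  have 1: "c1 (\<lambda>X. of_real (wq ki H0 (h X))) (\<lambda>j X. of_real (pd j h X) * of_real (Q1 (h X)))"
    by (rule c1_compose[OF d1[OF h(2)] cont(1) hder hc(1)])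
  have 2: "c1 (\<lambda>X. complex_of_real (Q1 (h X))) (\<lambda>j X. of_real (pd j h X) * of_real (Q2 (h X)))"
    by (rule c1_compose[OF d2[OF h(2)] cont(2) hder hc(1)])
  have 3: "c1 (\<lambda>X. complex_of_real (pd i h X)) (\<lambda>j X. of_real (pd j (pd i h) X) * 1)" for i
  proof (rule c1_compose[OF _ _ hder2 hc(2)])
    have "((\<lambda>t. complex_of_real t) has_vector_derivative of_real 1) (at (pd i h x))" for x
      by (rule has_vector_derivative_of_real[OF DERIV_ident])
    then show "(complex_of_real has_vector_derivative 1) (at (pd i h x))" for x by simp
  qed auto
  show ?thesis by (rule that[OF 1 c1_mult[OF 3 2]])
qed

text \<open>From any point a segment of fixed length leads out of \<open>\<Omega>\<close>, where the
  depth is \<open>H0\<close>. Along it ln (1 + d) has slope at most \<delta>0 (1 + 2 \<mu>), so it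
  stays close to ln (1 + H0), and the contrast is a continuous function of it that vanishes there.
  The shift by 1 is essential: the gradient of ln d is only bounded by \<delta>0 k, and k is not
  bounded uniformly over all \<open>h\<close>.\<close>

lemma mild_topography_q_small:
  assumes H0: "0 < H0" and ki: "0 < ki" "ki * tanh (ki * H0) = \<mu>" and \<Omega>: "bounded \<Omega>" and \<eta>: "0 < \<eta>"
  obtains \<delta>max where "0 < \<delta>max"
    "\<And>\<delta>0 h X. 0 < \<delta>0 \<Longrightarrow> \<delta>0 \<le> \<delta>max \<Longrightarrow> mild_topography \<omega> g H0 \<Omega> \<delta>0 h \<Longrightarrow> \<bar>wq ki H0 (h X)\<bar> < \<eta>"
proof -
  obtain \<rho> where \<rho>: "0 < \<rho>" "\<And>X. X \<in> \<Omega> \<Longrightarrow> norm X \<le> \<rho>" using \<Omega> by (auto simp: bounded_pos)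
  \<comment> \<open>A step longer than the diameter of the disc containing \<open>\<Omega>\<close>
    leaves that disc from any starting point in it.\<close>
  define L where "L = 2 * \<rho> + 1"
  have L: "0 < L" using \<rho> by (simp add: L_def)
  define F where "F = (\<lambda>l. 1 - (wnum (exp l - 1))\<^sup>2 / ki\<^sup>2)"
  define l0 where "l0 = ln (1 + H0)"
  have el0: "exp l0 - 1 = H0" using H0 by (simp add: l0_def)
  have KH: "wnum H0 = ki" by (rule wnum_unique[OF H0 ki])
  have "isCont F l0"
    unfolding F_def
    by (intro continuous_intros isCont_o2[OF _ isCont_wnum]) (use el0 H0 ki in auto)
  moreover have "F l0 = 0" using ki by (simp add: F_def el0 KH)
  ultimately obtain c where c: "0 < c" "\<And>l. \<bar>l - l0\<bar> < c \<Longrightarrow> \<bar>F l\<bar> < \<eta>"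
    using \<eta> unfolding continuous_at_eps_delta by (auto simp: dist_real_def)
  \<comment> \<open>Chosen so that the variation of ln (1 + d) along the segment is at most c/2,
    hence strictly below the tolerance c.\<close>
  define \<delta>max where "\<delta>max = c / (2 * L * (1 + 2 * \<mu>))"
  have m: "0 < 1 + 2 * \<mu>" using mu_pos by simp
  show ?thesis
  proof (rule that[of \<delta>max])
    show "0 < \<delta>max" using c L m by (simp add: \<delta>max_def)
    fix \<delta>0 h X assume \<delta>: "0 < \<delta>0" "\<delta>0 \<le> \<delta>max" and "mild_topography \<omega> g H0 \<Omega> \<delta>0 h"
    then have h: "Ck 2 h" "support h \<subseteq> \<Omega>" "\<And>X. 0 < H0 - h X"
      "\<And>X. norm (grad (\<lambda>Z. H0 - h Z) X) / (H0 - h X) \<le> \<delta>0 * wnum (H0 - h X)"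
      by (auto simp: mild_topography_def wnum_def)
    define d where "d = (\<lambda>X. H0 - h X)"
    have d0: "0 < d X" for X using h(3) by (simp add: d_def)
    have out: "h Y = 0" if "Y \<notin> \<Omega>" for Y
      using h(2) that closure_subset[of "{X. h X \<noteq> 0}"] by (auto simp: support_def)
    show "\<bar>wq ki H0 (h X)\<bar> < \<eta>"
    proof (cases "X \<in> \<Omega>")
      case False
      then show ?thesis using out[OF False] KH ki \<eta> by (simp add: wq_def)
    next
      case True
      define v where "v = L *\<^sub>R (axis 1 1 :: real^2)"
      have nv: "norm v = L" using L by (simp add: v_def)
      have "\<rho> < norm (X + v)"
        using norm_triangle_ineq2[of v "- X"] \<rho>(2)[OF True] \<rho>(1) nv by (simp add: L_def add.commute)
      then have Y: "X + v \<notin> \<Omega>" using \<rho>(2) by force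
      have hd: "h differentiable (at x)" for x
        using h(1)[unfolded Ck_def, THEN conjunct1, THEN spec, of "[]"] by (auto simp: differentiable_on_def)
      have dd: "d differentiable (at x)" for x unfolding d_def by (intro derivative_intros hd)
      have dder: "(d has_derivative (\<lambda>w. w \<bullet> grad d x)) (at x)" for x
        using differentiable_pd[OF dd[of x]] by (simp add: grad_def inner_vec_def)
      define \<psi> where "\<psi> = (\<lambda>t::real. ln (1 + d (X + t *\<^sub>R v)))"
      have \<psi>': "(\<psi> has_derivative (\<lambda>s. s * ((v \<bullet> grad d (X + t *\<^sub>R v)) / (1 + d (X + t *\<^sub>R v))))) (at t within {0..1})" for t
      proof -
        have "((\<lambda>t::real. X + t *\<^sub>R v) has_derivative (\<lambda>s. s *\<^sub>R v)) (at t within {0..1})"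
          by (auto intro!: derivative_eq_intros)
        from has_derivative_compose[OF this dder]
        have "((\<lambda>t. d (X + t *\<^sub>R v)) has_derivative (\<lambda>s. (s *\<^sub>R v) \<bullet> grad d (X + t *\<^sub>R v))) (at t within {0..1})" .
        then show ?thesis unfolding \<psi>_def
          using d0[of "X + t *\<^sub>R v"] by (auto intro!: derivative_eq_intros simp: field_simps)
      qed
      have "norm (\<psi> 1 - \<psi> 0) \<le> (L * \<delta>0 * (1 + 2 * \<mu>)) * norm (1 - 0 :: real)"
      proof (rule differentiable_bound[OF _ \<psi>'])
        fix t :: real
        define x where "x = X + t *\<^sub>R v"
        have "norm (grad d x) \<le> \<delta>0 * wnum (d x) * d x"
          using h(4)[of x] d0[of x] by (simp add: d_def divide_le_eq)
        also have "\<dots> = \<delta>0 * (wnum (d x) * d x)" by simp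
        also have "\<dots> \<le> \<delta>0 * (1 + 2 * \<mu> * d x)"
          using wnum_mult_le[OF d0] \<delta> by (intro mult_left_mono) auto
        also have "\<dots> \<le> \<delta>0 * ((1 + 2 * \<mu>) * (1 + d x))"
          using \<delta> d0[of x] mu_pos by (intro mult_left_mono) (auto simp: algebra_simps)
        finally have gr: "norm (grad d x) \<le> \<delta>0 * ((1 + 2 * \<mu>) * (1 + d x))" .
        have "\<bar>v \<bullet> grad d x\<bar> \<le> L * (\<delta>0 * ((1 + 2 * \<mu>) * (1 + d x)))"
          using Cauchy_Schwarz_ineq2[of v "grad d x"] gr L
          by (smt (verit) mult_left_mono nv)
        then have "\<bar>(v \<bullet> grad d x) / (1 + d x)\<bar> \<le> L * \<delta>0 * (1 + 2 * \<mu>)"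
          using d0[of x] by (simp add: abs_divide divide_le_eq mult_ac)
        then have "norm (s * ((v \<bullet> grad d x) / (1 + d x))) \<le> (L * \<delta>0 * (1 + 2 * \<mu>)) * norm s" for s
          using mult_left_mono[of "\<bar>(v \<bullet> grad d x) / (1 + d x)\<bar>" "L * \<delta>0 * (1 + 2 * \<mu>)" "\<bar>s\<bar>"]
          by (simp only: real_norm_def abs_mult) (simp add: mult.commute)
        then show "onorm (\<lambda>s. s * ((v \<bullet> grad d (X + t *\<^sub>R v)) / (1 + d (X + t *\<^sub>R v)))) \<le> L * \<delta>0 * (1 + 2 * \<mu>)"
          unfolding x_def by (intro onorm_le) auto
      qed auto
      also have "(L * \<delta>0 * (1 + 2 * \<mu>)) * norm (1 - 0 :: real) < c"
      proof -
        have "L * \<delta>0 * (1 + 2 * \<mu>) \<le> L * \<delta>max * (1 + 2 * \<mu>)" using \<delta> L m by (intro mult_right_mono mult_left_mono) auto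
        also have "\<dots> = c / 2"
        proof -
          have "A * (c / (2 * A * B)) * B = c / 2" if "0 < A" "0 < B" for A B :: real using that by simp
          from this[OF L m] show ?thesis by (simp only: \<delta>max_def)
        qed
        finally show ?thesis using c by simp
      qed
      finally have "\<bar>\<psi> 1 - \<psi> 0\<bar> < c" by simp
      moreover have "\<psi> 1 = l0" using out[OF Y] by (simp add: \<psi>_def d_def l0_def)
      ultimately have "\<bar>F (\<psi> 0)\<bar> < \<eta>" by (intro c(2)) (simp add: abs_minus_commute)
      moreover have "exp (\<psi> 0) - 1 = d X" using d0[of X] by (simp add: \<psi>_def)
      ultimately show ?thesis by (simp add: F_def wq_def d_def)
    qed
  qed
qed

section \<open>The truncated depth function\<close>

lemma artanh_le: "artanh x \<le> x / (1 - x)" if "0 < x" "x < 1" for x :: real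
proof -
  have "artanh x = ln ((1 + x) / (1 - x)) / 2" by (simp add: artanh_def)
  also have "\<dots> \<le> ((1 + x) / (1 - x) - 1) / 2"
    using that by (intro divide_right_mono ln_le_minus_one) auto
  also have "\<dots> = x / (1 - x)" using that by (simp add: field_simps)
  finally show ?thesis .
qed

lemma artanh_div_bounds:
  assumes "0 < \<alpha>" "\<mu> + \<alpha> \<le> \<kappa>"
  shows "0 \<le> artanh (\<mu> / \<kappa>)" "artanh (\<mu> / \<kappa>) \<le> \<mu> / \<alpha>"
proof -
  have k: "0 < \<mu> / \<kappa>" "\<mu> / \<kappa> < 1" "0 < \<kappa>" "0 < \<kappa> - \<mu>" using assms mu_pos by auto
  show "0 \<le> artanh (\<mu> / \<kappa>)" using artanh_pos[OF k(1,2)] by simp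
  have "artanh (\<mu> / \<kappa>) \<le> (\<mu> / \<kappa>) / (1 - \<mu> / \<kappa>)" by (rule artanh_le[OF k(1,2)])
  also have "\<dots> = \<mu> / (\<kappa> - \<mu>)" using k by (simp add: field_simps)
  also have "\<dots> \<le> \<mu> / \<alpha>" using assms mu_pos by (intro divide_left_mono) auto
  finally show "artanh (\<mu> / \<kappa>) \<le> \<mu> / \<alpha>" .
qed

lemma trunc_depth_eq: "trunc_depth \<mu> \<alpha> k = depth_of (max k (\<mu> + \<alpha>))"
  by (auto simp: trunc_depth_def depth_of_def max_def)

lemma trunc_depth_bounds:
  assumes "0 < \<alpha>"
  shows "0 \<le> trunc_depth \<mu> \<alpha> k" "trunc_depth \<mu> \<alpha> k \<le> \<mu> / (\<alpha> * (\<alpha> + \<mu>))"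
proof -
  define \<kappa> where "\<kappa> = max k (\<mu> + \<alpha>)"
  have \<kappa>: "\<mu> + \<alpha> \<le> \<kappa>" "0 < \<kappa>" using assms mu_pos by (auto simp: \<kappa>_def)
  note b = artanh_div_bounds[OF assms \<kappa>(1)]
  show "0 \<le> trunc_depth \<mu> \<alpha> k" using b \<kappa> by (simp add: trunc_depth_eq depth_of_def \<kappa>_def)
  have "artanh (\<mu> / \<kappa>) / \<kappa> \<le> (\<mu> / \<alpha>) / (\<alpha> + \<mu>)"
    using b \<kappa> assms mu_pos by (intro frac_le) auto
  then show "trunc_depth \<mu> \<alpha> k \<le> \<mu> / (\<alpha> * (\<alpha> + \<mu>))" by (simp add: trunc_depth_eq depth_of_def \<kappa>_def)
qed

text \<open>Truncation is clamping the argument at \<mu> + \<alpha>, which does not increase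
  distances. Above that value each of the two terms in the derivative of \<open>depth_of\<close> is
  at most 1/(\<alpha> (\<alpha> + \<mu>)) in size.\<close>

lemma trunc_depth_lipschitz:
  assumes \<alpha>: "0 < \<alpha>"
  shows "\<bar>trunc_depth \<mu> \<alpha> a - trunc_depth \<mu> \<alpha> b\<bar> \<le> 2 / (\<alpha> * (\<alpha> + \<mu>)) * \<bar>a - b\<bar>"
proof -
  have "norm (depth_of (max a (\<mu> + \<alpha>)) - depth_of (max b (\<mu> + \<alpha>))) \<le> 2 / (\<alpha> * (\<alpha> + \<mu>)) * norm (max a (\<mu> + \<alpha>) - max b (\<mu> + \<alpha>))"
  proof (rule field_differentiable_bound[of "{\<mu> + \<alpha>..}" depth_of "\<lambda>\<kappa>. - artanh (\<mu> / \<kappa>) / \<kappa>\<^sup>2 - \<mu> / (\<kappa> * (\<kappa>\<^sup>2 - \<mu>\<^sup>2))"])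
    fix \<kappa> assume "\<kappa> \<in> {\<mu> + \<alpha>..}"
    then have k: "\<mu> + \<alpha> \<le> \<kappa>" "\<mu> < \<kappa>" "0 < \<kappa>" using \<alpha> mu_pos by auto
    show "(depth_of has_real_derivative - artanh (\<mu> / \<kappa>) / \<kappa>\<^sup>2 - \<mu> / (\<kappa> * (\<kappa>\<^sup>2 - \<mu>\<^sup>2))) (at \<kappa> within {\<mu> + \<alpha>..})"
      by (rule has_field_derivative_at_within[OF depth_of_deriv[OF k(2)]])
    have "artanh (\<mu> / \<kappa>) / \<kappa>\<^sup>2 \<le> (\<mu> / \<alpha>) / (\<mu> * (\<alpha> + \<mu>))"
    proof (rule frac_le)
      show "\<mu> * (\<alpha> + \<mu>) \<le> \<kappa>\<^sup>2" unfolding power2_eq_square using k mu_pos \<alpha> by (intro mult_mono) auto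
    qed (use artanh_div_bounds[OF \<alpha> k(1)] mu_pos \<alpha> in auto)
    then have 1: "artanh (\<mu> / \<kappa>) / \<kappa>\<^sup>2 \<le> 1 / (\<alpha> * (\<alpha> + \<mu>))" using mu_pos by simp
    have "\<mu> * (\<alpha> * (\<alpha> + \<mu>)) \<le> \<kappa> * ((\<kappa> - \<mu>) * (\<kappa> + \<mu>))"
      using k mu_pos \<alpha> by (intro mult_mono) auto
    then have "\<mu> * (\<alpha> * (\<alpha> + \<mu>)) \<le> \<kappa> * (\<kappa>\<^sup>2 - \<mu>\<^sup>2)" by (simp add: power2_eq_square algebra_simps)
    moreover have "0 < \<mu> * (\<alpha> * (\<alpha> + \<mu>))" using mu_pos \<alpha> by simp
    ultimately have "\<mu> / (\<kappa> * (\<kappa>\<^sup>2 - \<mu>\<^sup>2)) \<le> \<mu> / (\<mu> * (\<alpha> * (\<alpha> + \<mu>)))"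
      using mu_pos by (intro divide_left_mono) auto
    then have 2: "\<mu> / (\<kappa> * (\<kappa>\<^sup>2 - \<mu>\<^sup>2)) \<le> 1 / (\<alpha> * (\<alpha> + \<mu>))" using mu_pos by simp
    have 3: "0 \<le> artanh (\<mu> / \<kappa>) / \<kappa>\<^sup>2" using artanh_div_bounds[OF \<alpha> k(1)] by simp
    have 4: "0 \<le> \<mu> / (\<kappa> * (\<kappa>\<^sup>2 - \<mu>\<^sup>2))"
      using mu_pos k power_strict_mono[of \<mu> \<kappa> 2] by simp
    have "\<bar>- A - B\<bar> \<le> 2 * C" if "A \<le> C" "B \<le> C" "0 \<le> A" "0 \<le> B" for A B C :: real using that by simp
    from this[OF 1 2 3 4]
    show "norm (- artanh (\<mu> / \<kappa>) / \<kappa>\<^sup>2 - \<mu> / (\<kappa> * (\<kappa>\<^sup>2 - \<mu>\<^sup>2))) \<le> 2 / (\<alpha> * (\<alpha> + \<mu>))" by simp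
  qed auto
  also have "\<dots> \<le> 2 / (\<alpha> * (\<alpha> + \<mu>)) * \<bar>a - b\<bar>"
    using \<alpha> mu_pos by (intro mult_left_mono) (auto simp: max_def)
  finally show ?thesis by (simp add: trunc_depth_eq)
qed

end

section \<open>The volume potential and Tikhonov regularization\<close>

text \<open>The unit disc about x contributes at most 2 pi, and outside it the integrand is at most
  1. The bound does not see where x lies.\<close>

lemma nn_integral_inverse_dist_le:
  fixes x :: "real^2"
  assumes [measurable]: "S \<in> sets borel"
  shows "(\<integral>\<^sup>+y. indicator S y * ennreal (1 / norm (y - x)) \<partial>lborel) \<le> ennreal (2 * pi) + emeasure lborel S"
proof -
  have [measurable]: "cball x 1 \<in> sets borel" by simp
  have "(\<integral>\<^sup>+y. indicator S y * ennreal (1 / norm (y - x)) \<partial>lborel)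
    \<le> (\<integral>\<^sup>+y. indicator (cball x 1) y * ennreal (1 / norm (y - x)) + indicator S y \<partial>lborel)"
  proof (rule nn_integral_mono)
    fix y
    show "indicator S y * ennreal (1 / norm (y - x)) \<le> indicator (cball x 1) y * ennreal (1 / norm (y - x)) + indicator S y"
    proof (cases "y \<in> cball x 1")
      case False
      then have "1 \<le> norm (y - x)" by (simp add: dist_norm norm_minus_commute)
      then have "1 / norm (y - x) \<le> 1" by (simp add: divide_le_eq_1)
      then have "ennreal (1 / norm (y - x)) \<le> 1" by (metis ennreal_1 ennreal_leI)
      then show ?thesis using False by (simp add: indicator_def)
    qed (simp add: indicator_def)
  qed
  also have "\<dots> = (\<integral>\<^sup>+y. indicator (cball x 1) y * ennreal (1 / norm (y - x)) \<partial>lborel) + (\<integral>\<^sup>+y. indicator S y \<partial>lborel)"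
    by (rule nn_integral_add) measurable
  also have "\<dots> = ennreal (2 * pi) + emeasure lborel S"
    using nn_integral_inverse_norm[of 1 x] by simp
  finally show ?thesis .
qed

lemma nn_integral_lebesgue_on_borel:
  fixes f :: "real^2 \<Rightarrow> ennreal"
  assumes "D \<in> sets borel" "f \<in> borel_measurable borel"
  shows "(\<integral>\<^sup>+y. f y \<partial>lebesgue_on D) = (\<integral>\<^sup>+y. indicator D y * f y \<partial>lborel)"
proof -
  have "(\<integral>\<^sup>+y. f y \<partial>lebesgue_on D) = (\<integral>\<^sup>+y. f y * indicator D y \<partial>lebesgue)"
    using assms by (subst nn_integral_restrict_space) auto
  also have "\<dots> = (\<integral>\<^sup>+y. f y * indicator D y \<partial>lborel)"
    by (rule nn_integral_completion)
  finally show ?thesis by (simp add: mult.commute)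
qed

section \<open>Square integrable functions\<close>

lemma L2_diff: "L2 D f \<Longrightarrow> L2 D h \<Longrightarrow> L2 D (\<lambda>x. f x - h x)" for f h :: "'a::euclidean_space \<Rightarrow> complex"
proof -
  assume f: "L2 D f" and h: "L2 D h"
  have "integrable (lebesgue_on D) (\<lambda>x. (norm (f x - h x))\<^sup>2)"
  proof (rule Bochner_Integration.integrable_bound)
    show "integrable (lebesgue_on D) (\<lambda>x. 2 * (norm (f x))\<^sup>2 + 2 * (norm (h x))\<^sup>2)"
      using f h unfolding L2_def by (intro Bochner_Integration.integrable_add integrable_mult_right) auto
    show "(\<lambda>x. (norm (f x - h x))\<^sup>2) \<in> borel_measurable (lebesgue_on D)"
      using f h unfolding L2_def by (intro borel_measurable_power borel_measurable_norm borel_measurable_diff) auto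
    have "(norm (f x - h x))\<^sup>2 \<le> 2 * (norm (f x))\<^sup>2 + 2 * (norm (h x))\<^sup>2" for x
    proof -
      have "(norm (f x - h x))\<^sup>2 \<le> (norm (f x) + norm (h x))\<^sup>2"
        by (intro power_mono norm_triangle_ineq4) auto
      also have "\<dots> \<le> 2 * (norm (f x))\<^sup>2 + 2 * (norm (h x))\<^sup>2"
        using sum_squares_bound[of "norm (f x)" "norm (h x)"] by (simp add: power2_sum)
      finally show ?thesis .
    qed
    then show "AE x in lebesgue_on D. norm ((norm (f x - h x))\<^sup>2) \<le> norm (2 * (norm (f x))\<^sup>2 + 2 * (norm (h x))\<^sup>2)"
      by (intro AE_I2) (simp add: abs_of_nonneg)
  qed
  then show ?thesis using f h unfolding L2_def by auto
qed

lemma L2_norm_sq: "(L2_norm D f)\<^sup>2 = (LINT x|lebesgue_on D. (norm (f x))\<^sup>2)"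
  unfolding L2_norm_def by (rule real_sqrt_pow2) (rule integral_nonneg_AE, simp)

lemma L2_mult_left: "L2 D f \<Longrightarrow> L2 D (\<lambda>x. c * f x)" for f :: "'a::euclidean_space \<Rightarrow> complex"
  unfolding L2_def by (auto simp: norm_mult power_mult_distrib)

text \<open>The pointwise arithmetic-geometric mean bound takes the place of Cauchy-Schwarz; it
  serves to bound potentials uniformly in the point, where the sharp product form is
  irrelevant.\<close>

lemma L2_integrable_mult:
  fixes f h :: "'a::euclidean_space \<Rightarrow> complex"
  assumes f: "L2 D f" and h: "L2 D h"
  shows "integrable (lebesgue_on D) (\<lambda>x. f x * h x)"
    and "(LINT x|lebesgue_on D. norm (f x * h x)) \<le> ((L2_norm D f)\<^sup>2 + (L2_norm D h)\<^sup>2) / 2"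
proof -
  have i: "integrable (lebesgue_on D) (\<lambda>x. ((norm (f x))\<^sup>2 + (norm (h x))\<^sup>2) / 2)"
    using f h unfolding L2_def by auto
  have le: "norm (f x * h x) \<le> ((norm (f x))\<^sup>2 + (norm (h x))\<^sup>2) / 2" for x
    using sum_squares_bound[of "norm (f x)" "norm (h x)"] by (simp add: norm_mult)
  show im: "integrable (lebesgue_on D) (\<lambda>x. f x * h x)"
  proof (rule Bochner_Integration.integrable_bound[OF i])
    show "(\<lambda>x. f x * h x) \<in> borel_measurable (lebesgue_on D)"
      using f h unfolding L2_def by auto
    show "AE x in lebesgue_on D. norm (f x * h x) \<le> norm (((norm (f x))\<^sup>2 + (norm (h x))\<^sup>2) / 2)"
      using le by (intro AE_I2) (simp add: abs_of_nonneg)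
  qed
  have "(LINT x|lebesgue_on D. norm (f x * h x)) \<le> (LINT x|lebesgue_on D. ((norm (f x))\<^sup>2 + (norm (h x))\<^sup>2) / 2)"
    by (rule integral_mono[OF integrable_norm[OF im] i le])
  also have "\<dots> = ((L2_norm D f)\<^sup>2 + (L2_norm D h)\<^sup>2) / 2"
    unfolding L2_norm_sq using f h by (simp add: L2_def)
  finally show "(LINT x|lebesgue_on D. norm (f x * h x)) \<le> ((L2_norm D f)\<^sup>2 + (L2_norm D h)\<^sup>2) / 2" .
qed

lemma measurable_lebesgue_on: "f \<in> borel_measurable borel \<Longrightarrow> f \<in> borel_measurable (lebesgue_on D)"
  for f :: "'a::euclidean_space \<Rightarrow> 'b::topological_space"
  by (intro measurable_restrict_space1 measurable_completion) simp

lemma L2_bounded: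
  fixes f :: "'a::euclidean_space \<Rightarrow> 'b::euclidean_space"
  assumes "D \<in> lmeasurable" "f \<in> borel_measurable (lebesgue_on D)" "\<And>x. x \<in> D \<Longrightarrow> norm (f x) \<le> B"
  shows "L2 D f"
proof -
  interpret finite_measure "lebesgue_on D" by (rule finite_measure_lebesgue_on[OF assms(1)])
  have "integrable (lebesgue_on D) (\<lambda>x. (norm (f x))\<^sup>2)"
  proof (rule integrable_const_bound[of _ "B\<^sup>2"])
    show "AE x in lebesgue_on D. norm ((norm (f x))\<^sup>2) \<le> B\<^sup>2"
      using assms(3) by (intro AE_I2) (auto intro!: power_mono)
  qed (use assms(2) in auto)
  then show ?thesis using assms(2) by (simp add: L2_def)
qed

section \<open>The volume potential on a bounded open set\<close>

context
  fixes D :: "(real^2) set" and \<kappa> :: real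
  assumes D: "open D" "bounded D" and k: "0 < \<kappa>"
begin

lemma D_lm: "D \<in> lmeasurable" using D by (rule lmeasurable_open[rotated])

lemma D_borel: "D \<in> sets borel" using D by (simp add: borel_open)

lemma helmholtz_G_eq: "helmholtz_G \<kappa> X Y = hlm_g \<kappa> ((norm (Y - X))\<^sup>2)"
  by (simp add: helmholtz_G_hlm_g dist_norm norm_minus_commute)

lemma helmholtz_G_sym: "helmholtz_G \<kappa> X Y = helmholtz_G \<kappa> Y X"
  by (simp add: helmholtz_G_eq norm_minus_commute)

lemma helmholtz_G_measurable:
  "(\<lambda>Y. helmholtz_G \<kappa> X Y) \<in> borel_measurable borel"
  "(\<lambda>(X, Y). helmholtz_G \<kappa> X Y) \<in> borel_measurable (lebesgue_on D \<Otimes>\<^sub>M lebesgue_on D)"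
proof -
  show "(\<lambda>Y. helmholtz_G \<kappa> X Y) \<in> borel_measurable borel"
    unfolding helmholtz_G_eq by (intro borel_measurable_hlm_g k) auto
  have id: "(\<lambda>x. x) \<in> measurable (lebesgue_on D) borel" by (rule measurable_lebesgue_on) simp
  have "fst \<in> measurable (lebesgue_on D \<Otimes>\<^sub>M lebesgue_on D) borel" "snd \<in> measurable (lebesgue_on D \<Otimes>\<^sub>M lebesgue_on D) borel"
    using measurable_compose[OF measurable_fst id] measurable_compose[OF measurable_snd id] by auto
  then have "(\<lambda>p. hlm_g \<kappa> ((norm (snd p - fst p))\<^sup>2)) \<in> borel_measurable (lebesgue_on D \<Otimes>\<^sub>M lebesgue_on D)"
    by (intro borel_measurable_hlm_g k borel_measurable_power borel_measurable_norm borel_measurable_diff) auto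
  then show "(\<lambda>(X, Y). helmholtz_G \<kappa> X Y) \<in> borel_measurable (lebesgue_on D \<Otimes>\<^sub>M lebesgue_on D)"
    by (simp add: helmholtz_G_eq case_prod_beta)
qed

text \<open>The kernel grows at most like the root of 1/(\<kappa> |Y - X|), so its square has a
  singularity that is integrable in the plane, with a bound independent of X. This makes the
  potential of a square integrable function bounded.\<close>

lemma helmholtz_G_L2:
  "L2 D (helmholtz_G \<kappa> X)" "(L2_norm D (helmholtz_G \<kappa> X))\<^sup>2 \<le> (1 / \<kappa>) * (2 * pi + measure lborel D)"
proof -
  have [measurable]: "D \<in> sets borel" by (rule D_borel)
  have m: "helmholtz_G \<kappa> X \<in> borel_measurable (lebesgue_on D)"
    by (rule measurable_lebesgue_on[OF helmholtz_G_measurable(1)])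
  have fin: "emeasure lborel D < \<infinity>" using D(2) by (rule emeasure_bounded_finite)
  have "(\<integral>\<^sup>+Y. ennreal ((norm (helmholtz_G \<kappa> X Y))\<^sup>2) \<partial>lebesgue_on D)
     = (\<integral>\<^sup>+Y. indicator D Y * ennreal ((norm (helmholtz_G \<kappa> X Y))\<^sup>2) \<partial>lborel)"
    by (rule nn_integral_lebesgue_on_borel[OF D_borel]) (use helmholtz_G_measurable(1) in measurable)
  also have "\<dots> \<le> (\<integral>\<^sup>+Y. ennreal (1 / \<kappa>) * (indicator D Y * ennreal (1 / norm (Y - X))) \<partial>lborel)"
  proof (rule nn_integral_mono_AE)
    show "AE Y in lborel. indicator D Y * ennreal ((norm (helmholtz_G \<kappa> X Y))\<^sup>2) \<le> ennreal (1 / \<kappa>) * (indicator D Y * ennreal (1 / norm (Y - X)))"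
      using AE_lborel_singleton[of X]
    proof eventually_elim
      case (elim Y)
      then have "norm (helmholtz_G \<kappa> X Y) \<le> 1 / sqrt (\<kappa> * sqrt ((norm (Y - X))\<^sup>2))"
        unfolding helmholtz_G_eq by (intro hlm_g_bound[OF k]) simp
      then have "(norm (helmholtz_G \<kappa> X Y))\<^sup>2 \<le> (1 / sqrt (\<kappa> * norm (Y - X)))\<^sup>2"
        by (intro power_mono) auto
      also have "\<dots> = (1 / \<kappa>) * (1 / norm (Y - X))" using k by (simp add: power_divide)
      finally have "ennreal ((norm (helmholtz_G \<kappa> X Y))\<^sup>2) \<le> ennreal (1 / \<kappa>) * ennreal (1 / norm (Y - X))"
        using k by (subst ennreal_mult[symmetric]) (auto intro: ennreal_leI)
      then show ?case by (auto simp: indicator_def)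
    qed
  qed
  also have "\<dots> = ennreal (1 / \<kappa>) * (\<integral>\<^sup>+Y. indicator D Y * ennreal (1 / norm (Y - X)) \<partial>lborel)"
    by (rule nn_integral_cmult) measurable
  also have "\<dots> \<le> ennreal (1 / \<kappa>) * (ennreal (2 * pi) + emeasure lborel D)"
    by (intro mult_left_mono nn_integral_inverse_dist_le D_borel) auto
  also have "emeasure lborel D = ennreal (measure lborel D)"
    using fin by (intro emeasure_eq_ennreal_measure) auto
  also have "ennreal (1 / \<kappa>) * (ennreal (2 * pi) + ennreal (measure lborel D)) = ennreal ((1 / \<kappa>) * (2 * pi + measure lborel D))"
  proof -
    have "ennreal (2 * pi) + ennreal (measure lborel D) = ennreal (2 * pi + measure lborel D)"
      by (rule ennreal_plus[symmetric]) auto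
    moreover have "ennreal (1 / \<kappa>) * ennreal (2 * pi + measure lborel D) = ennreal ((1 / \<kappa>) * (2 * pi + measure lborel D))"
      using k by (intro ennreal_mult[symmetric]) auto
    ultimately show ?thesis by (simp only:)
  qed
  finally have le: "(\<integral>\<^sup>+Y. ennreal ((norm (helmholtz_G \<kappa> X Y))\<^sup>2) \<partial>lebesgue_on D) \<le> ennreal ((1 / \<kappa>) * (2 * pi + measure lborel D))" .
  have "integrable (lebesgue_on D) (\<lambda>Y. (norm (helmholtz_G \<kappa> X Y))\<^sup>2)"
    by (rule integrableI_nonneg) (use m le_less_trans[OF le] in auto)
  then show "L2 D (helmholtz_G \<kappa> X)" using m by (simp add: L2_def)
  show "(L2_norm D (helmholtz_G \<kappa> X))\<^sup>2 \<le> (1 / \<kappa>) * (2 * pi + measure lborel D)"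
    unfolding L2_norm_sq by (rule integral_real_bounded[OF _ le]) (use k in simp)
qed

lemma helmholtz_K_bound:
  assumes v: "L2 D v"
  shows "norm (helmholtz_K D \<kappa> v X) \<le> ((1 / \<kappa>) * (2 * pi + measure lborel D) + (L2_norm D v)\<^sup>2) / 2"
proof -
  have "norm (helmholtz_K D \<kappa> v X) \<le> (LINT Y|lebesgue_on D. norm (helmholtz_G \<kappa> X Y * v Y))"
    unfolding helmholtz_K_def by (rule integral_norm_bound)
  also have "\<dots> \<le> ((L2_norm D (helmholtz_G \<kappa> X))\<^sup>2 + (L2_norm D v)\<^sup>2) / 2"
    by (rule L2_integrable_mult(2)[OF helmholtz_G_L2(1) v])
  also have "\<dots> \<le> ((1 / \<kappa>) * (2 * pi + measure lborel D) + (L2_norm D v)\<^sup>2) / 2"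
    by (intro divide_right_mono add_right_mono helmholtz_G_L2(2)) simp
  finally show ?thesis .
qed

lemma helmholtz_Gv_measurable:
  assumes v: "L2 D v"
  shows "(\<lambda>(X, Y). helmholtz_G \<kappa> X Y * v Y) \<in> borel_measurable (lebesgue_on D \<Otimes>\<^sub>M lebesgue_on D)"
proof -
  have "v \<in> borel_measurable (lebesgue_on D)" using v by (simp add: L2_def)
  then have "(\<lambda>p. v (snd p)) \<in> borel_measurable (lebesgue_on D \<Otimes>\<^sub>M lebesgue_on D)"
    by (rule measurable_compose[OF measurable_snd])
  then show ?thesis using helmholtz_G_measurable(2) by (simp add: case_prod_beta)
qed

lemma helmholtz_K_L2:
  assumes v: "L2 D v"
  shows "L2 D (helmholtz_K D \<kappa> v)"
proof (rule L2_bounded[OF D_lm _ helmholtz_K_bound[OF v]])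
  interpret finite_measure "lebesgue_on D" by (rule finite_measure_lebesgue_on[OF D_lm])
  show "helmholtz_K D \<kappa> v \<in> borel_measurable (lebesgue_on D)"
    unfolding helmholtz_K_def[abs_def]
    using borel_measurable_lebesgue_integral[OF helmholtz_Gv_measurable[OF v]] by simp
qed

lemma helmholtz_K_diff:
  assumes "L2 D v" "L2 D w"
  shows "helmholtz_K D \<kappa> (\<lambda>Y. v Y - w Y) X = helmholtz_K D \<kappa> v X - helmholtz_K D \<kappa> w X"
  unfolding helmholtz_K_def
  using L2_integrable_mult(1)[OF helmholtz_G_L2(1)[of X] assms(1)] L2_integrable_mult(1)[OF helmholtz_G_L2(1)[of X] assms(2)]
  by (subst Bochner_Integration.integral_diff[symmetric]) (auto simp: algebra_simps)

text \<open>The kernel is symmetric but not Hermitian, so Fubini yields this bilinear identity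
  without conjugates. The Hilbert space adjoint is K conjugated from both sides; this is why the
  source condition below is imposed on the conjugate of f. Boundedness of \<open>w\<close> provides
  integrability on the product.\<close>

lemma helmholtz_K_adjoint:
  assumes v: "L2 D v" and w: "w \<in> borel_measurable (lebesgue_on D)" "\<And>X. X \<in> D \<Longrightarrow> norm (w X) \<le> B"
  shows "(LINT X|lebesgue_on D. w X * helmholtz_K D \<kappa> v X) = (LINT Y|lebesgue_on D. helmholtz_K D \<kappa> w Y * v Y)"
proof -
  interpret finite_measure "lebesgue_on D" by (rule finite_measure_lebesgue_on[OF D_lm])
  interpret P: pair_sigma_finite "lebesgue_on D" "lebesgue_on D" ..
  define F where "F = (\<lambda>X Y. w X * (helmholtz_G \<kappa> X Y * v Y))"
  have mF: "case_prod F \<in> borel_measurable (lebesgue_on D \<Otimes>\<^sub>M lebesgue_on D)"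
  proof -
    have "(\<lambda>p. w (fst p)) \<in> borel_measurable (lebesgue_on D \<Otimes>\<^sub>M lebesgue_on D)"
      by (rule measurable_compose[OF measurable_fst w(1)])
    then show ?thesis using helmholtz_Gv_measurable[OF v] by (simp add: F_def case_prod_beta)
  qed
  have iX: "integrable (lebesgue_on D) (F X)" for X
    unfolding F_def by (intro integrable_mult_right L2_integrable_mult(1)[OF helmholtz_G_L2(1) v])
  define C where "C = ((1 / \<kappa>) * (2 * pi + measure lborel D) + (L2_norm D v)\<^sup>2) / 2"
  have "integrable (lebesgue_on D \<Otimes>\<^sub>M lebesgue_on D) (case_prod F)"
  proof (rule P.Fubini_integrable[OF mF])
    show "AE X in lebesgue_on D. integrable (lebesgue_on D) (\<lambda>Y. case_prod F (X, Y))" using iX by simp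
    show "integrable (lebesgue_on D) (\<lambda>X. LINT Y|lebesgue_on D. norm (case_prod F (X, Y)))"
    proof (rule integrable_const_bound[of _ "B * C"])
      show "(\<lambda>X. LINT Y|lebesgue_on D. norm (case_prod F (X, Y))) \<in> borel_measurable (lebesgue_on D)"
        by (rule borel_measurable_lebesgue_integral) (use mF in \<open>simp add: case_prod_beta\<close>)
      show "AE X in lebesgue_on D. norm (LINT Y|lebesgue_on D. norm (case_prod F (X, Y))) \<le> B * C"
      proof (intro AE_I2)
        fix X assume "X \<in> space (lebesgue_on D)"
        then have X: "X \<in> D" by simp
        have "(LINT Y|lebesgue_on D. norm (case_prod F (X, Y))) = norm (w X) * (LINT Y|lebesgue_on D. norm (helmholtz_G \<kappa> X Y * v Y))"
          by (simp add: F_def norm_mult)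
        also have "(LINT Y|lebesgue_on D. norm (helmholtz_G \<kappa> X Y * v Y)) \<le> ((L2_norm D (helmholtz_G \<kappa> X))\<^sup>2 + (L2_norm D v)\<^sup>2) / 2"
          by (rule L2_integrable_mult(2)[OF helmholtz_G_L2(1) v])
        also have "\<dots> \<le> C"
          unfolding C_def by (intro divide_right_mono add_right_mono helmholtz_G_L2(2)) simp
        finally have "(LINT Y|lebesgue_on D. norm (case_prod F (X, Y))) \<le> norm (w X) * C"
          by (simp add: mult_left_mono)
        also have "\<dots> \<le> B * C" using w(2)[OF X] k by (intro mult_right_mono) (auto simp: C_def)
        finally show "norm (LINT Y|lebesgue_on D. norm (case_prod F (X, Y))) \<le> B * C" by simp
      qed
    qed
  qed
  then have "(LINT Y|lebesgue_on D. LINT X|lebesgue_on D. F X Y) = (LINT X|lebesgue_on D. LINT Y|lebesgue_on D. F X Y)"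
    by (rule P.Fubini_integral)
  moreover have "(LINT Y|lebesgue_on D. F X Y) = w X * helmholtz_K D \<kappa> v X" for X
    by (simp add: F_def helmholtz_K_def)
  moreover have "(LINT X|lebesgue_on D. F X Y) = helmholtz_K D \<kappa> w Y * v Y" for Y
  proof -
    have "(LINT X|lebesgue_on D. F X Y) = (LINT X|lebesgue_on D. (helmholtz_G \<kappa> Y X * w X) * v Y)"
      by (intro Bochner_Integration.integral_cong refl) (simp add: F_def helmholtz_G_sym[of _ Y])
    then show ?thesis by (simp add: helmholtz_K_def)
  qed
  ultimately show ?thesis by simp
qed

text \<open>Under the source condition \<open>f = K\<^sup>* w\<close>, comparing the Tikhonov functional at the minimiser
  and at \<open>f\<close> gives the classical convergence rate.\<close>

lemma tikhonov_rate:
  assumes f: "L2 D f" and w: "w \<in> borel_measurable (lebesgue_on D)" "\<And>X. X \<in> D \<Longrightarrow> norm (w X) \<le> B"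
    and source: "\<And>Y. Y \<in> D \<Longrightarrow> cnj (f Y) = helmholtz_K D \<kappa> w Y"
    and b: "L2 D b" and lam: "0 < lam"
    and u: "tikhonov D \<kappa> b lam u"
  shows "L2 D u"
    "lam * (L2_norm D (\<lambda>X. f X - u X))\<^sup>2 \<le> 2 * (L2_norm D (\<lambda>X. b X - of_real (\<kappa>\<^sup>2) * helmholtz_K D \<kappa> f X))\<^sup>2
        + 2 * (lam / \<kappa>\<^sup>2)\<^sup>2 * (L2_norm D w)\<^sup>2"
proof -
  show uL: "L2 D u" using u by (simp add: tikhonov_def is_arg_min_def)
  have min: "(L2_norm D (\<lambda>X. b X - of_real (\<kappa>\<^sup>2) * helmholtz_K D \<kappa> u X))\<^sup>2 + lam * (L2_norm D u)\<^sup>2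
     \<le> (L2_norm D (\<lambda>X. b X - of_real (\<kappa>\<^sup>2) * helmholtz_K D \<kappa> f X))\<^sup>2 + lam * (L2_norm D f)\<^sup>2"
    using u f unfolding tikhonov_def is_arg_min_linorder by blast
  define e where "e = (\<lambda>X. b X - of_real (\<kappa>\<^sup>2) * helmholtz_K D \<kappa> f X)"
  define r where "r = (\<lambda>X. b X - of_real (\<kappa>\<^sup>2) * helmholtz_K D \<kappa> u X)"
  define z where "z = (\<lambda>X. f X - u X)"
  have wL: "L2 D w" by (rule L2_bounded[OF D_lm w])
  have eL: "L2 D e" and rL: "L2 D r" and zL: "L2 D z"
    unfolding e_def r_def z_def by (intro L2_diff L2_mult_left helmholtz_K_L2 b f uL)+
  have fz: "integrable (lebesgue_on D) (\<lambda>X. cnj (f X) * z X)"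
  proof -
    have "L2 D (\<lambda>X. cnj (f X))"
      using f borel_measurable_continuous_on[OF _ , of cnj f "lebesgue_on D"] unfolding L2_def by (auto intro!: continuous_intros)
    then show ?thesis by (rule L2_integrable_mult(1)[OF _ zL])
  qed
  \<comment> \<open>The square of u = f - z is expanded so that the penalty difference in the
    minimality inequality becomes the squared error plus a term linear in z.\<close>
  have sq: "(L2_norm D u)\<^sup>2 = (L2_norm D f)\<^sup>2 - 2 * Re (LINT X|lebesgue_on D. cnj (f X) * z X) + (L2_norm D z)\<^sup>2"
  proof -
    have "(norm (u X))\<^sup>2 = (norm (f X))\<^sup>2 - 2 * Re (cnj (f X) * z X) + (norm (z X))\<^sup>2" for X
      unfolding z_def cmod_power2 by (simp add: power2_eq_square algebra_simps)
    then have "(L2_norm D u)\<^sup>2 = (LINT X|lebesgue_on D. (norm (f X))\<^sup>2 - 2 * Re (cnj (f X) * z X) + (norm (z X))\<^sup>2)"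
      by (simp add: L2_norm_sq)
    also have "\<dots> = (L2_norm D f)\<^sup>2 - 2 * (LINT X|lebesgue_on D. Re (cnj (f X) * z X)) + (L2_norm D z)\<^sup>2"
    proof -
      have "(LINT X|M. A X - 2 * B X + C X) = (LINT X|M. A X) - 2 * (LINT X|M. B X) + (LINT X|M. C X)"
        if "integrable M A" "integrable M B" "integrable M C" for M and A B C :: "real^2 \<Rightarrow> real"
        using that by simp
      from this[OF _ integrable_Re[OF fz]] show ?thesis
        using f zL unfolding L2_norm_sq L2_def by blast
    qed
    also have "(LINT X|lebesgue_on D. Re (cnj (f X) * z X)) = Re (LINT X|lebesgue_on D. cnj (f X) * z X)"
      by (rule integral_Re[OF fz])
    finally show ?thesis .
  qed
  have "(LINT X|lebesgue_on D. cnj (f X) * z X) = (LINT X|lebesgue_on D. helmholtz_K D \<kappa> w X * z X)"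
    by (intro Bochner_Integration.integral_cong refl) (simp add: source)
  also have "\<dots> = (LINT X|lebesgue_on D. w X * helmholtz_K D \<kappa> z X)"
    by (rule helmholtz_K_adjoint[OF zL w, symmetric])
  \<comment> \<open>The vector \<kappa>^2 K z is the difference r - e of the residuals at the
    minimiser and at f, which makes the linear term visible to the data misfit.\<close>
  also have "\<dots> = (LINT X|lebesgue_on D. of_real (1 / \<kappa>\<^sup>2) * (w X * r X - w X * e X))"
  proof -
    have "w X * helmholtz_K D \<kappa> z X = of_real (1 / \<kappa>\<^sup>2) * (w X * r X - w X * e X)" for X
      using k unfolding z_def helmholtz_K_diff[OF f uL] r_def e_def by (simp add: field_simps)
    then show ?thesis by simp
  qed
  finally have fzw: "(LINT X|lebesgue_on D. cnj (f X) * z X) = (LINT X|lebesgue_on D. of_real (1 / \<kappa>\<^sup>2) * (w X * r X - w X * e X))" .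
  have iw: "integrable (lebesgue_on D) (\<lambda>X. of_real (1 / \<kappa>\<^sup>2) * (w X * r X - w X * e X))"
    by (intro integrable_mult_right Bochner_Integration.integrable_diff L2_integrable_mult(1) wL rL eL)
  have "2 * lam * Re (LINT X|lebesgue_on D. cnj (f X) * z X) = (LINT X|lebesgue_on D. 2 * lam * Re (of_real (1 / \<kappa>\<^sup>2) * (w X * r X - w X * e X)))"
    unfolding fzw integral_Re[OF iw, symmetric] by (rule integral_mult_right_zero[symmetric])
  \<comment> \<open>Young's inequality, weighted so that the residual r appears with coefficient 1:
    it then cancels against the misfit at the minimiser, about which nothing else is known.\<close>
  also have "\<dots> \<le> (LINT X|lebesgue_on D. (norm (r X))\<^sup>2 + (norm (e X))\<^sup>2 + 2 * (lam / \<kappa>\<^sup>2)\<^sup>2 * (norm (w X))\<^sup>2)"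
  proof (rule integral_mono)
    show "integrable (lebesgue_on D) (\<lambda>X. 2 * lam * Re (of_real (1 / \<kappa>\<^sup>2) * (w X * r X - w X * e X)))"
      by (intro integrable_mult_right integrable_Re iw)
    show "integrable (lebesgue_on D) (\<lambda>X. (norm (r X))\<^sup>2 + (norm (e X))\<^sup>2 + 2 * (lam / \<kappa>\<^sup>2)\<^sup>2 * (norm (w X))\<^sup>2)"
      using rL eL wL unfolding L2_def by auto
    fix X
    define m where "m = lam / \<kappa>\<^sup>2"
    have m: "0 \<le> m" using lam by (simp add: m_def)
    have "2 * lam * Re (of_real (1 / \<kappa>\<^sup>2) * (w X * r X - w X * e X)) = 2 * m * Re (w X * r X - w X * e X)"
    proof -
      have "Re (of_real c * z) = c * Re z" for c z by simp
      then show ?thesis by (simp only: m_def) simp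
    qed
    also have "\<dots> \<le> 2 * m * (norm (w X) * norm (r X) + norm (w X) * norm (e X))"
    proof (rule mult_left_mono)
      have "Re (w X * r X - w X * e X) \<le> norm (w X * r X - w X * e X)" by (rule complex_Re_le_cmod)
      also have "\<dots> \<le> norm (w X * r X) + norm (w X * e X)" by (rule norm_triangle_ineq4)
      finally show "Re (w X * r X - w X * e X) \<le> norm (w X) * norm (r X) + norm (w X) * norm (e X)" by (simp add: norm_mult)
    qed (use m in simp)
    also have "\<dots> \<le> (norm (r X))\<^sup>2 + (norm (e X))\<^sup>2 + 2 * m\<^sup>2 * (norm (w X))\<^sup>2"
      using sum_squares_bound[of "m * norm (w X)" "norm (r X)"] sum_squares_bound[of "m * norm (w X)" "norm (e X)"]
      by (simp add: power_mult_distrib algebra_simps)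
    finally show "2 * lam * Re (of_real (1 / \<kappa>\<^sup>2) * (w X * r X - w X * e X)) \<le> (norm (r X))\<^sup>2 + (norm (e X))\<^sup>2 + 2 * (lam / \<kappa>\<^sup>2)\<^sup>2 * (norm (w X))\<^sup>2"
      by (simp add: m_def)
  qed
  also have "\<dots> = (L2_norm D r)\<^sup>2 + (L2_norm D e)\<^sup>2 + 2 * (lam / \<kappa>\<^sup>2)\<^sup>2 * (L2_norm D w)\<^sup>2"
    using rL eL wL unfolding L2_norm_sq L2_def by simp
  finally have cross: "2 * lam * Re (LINT X|lebesgue_on D. cnj (f X) * z X)
     \<le> (L2_norm D r)\<^sup>2 + (L2_norm D e)\<^sup>2 + 2 * (lam / \<kappa>\<^sup>2)\<^sup>2 * (L2_norm D w)\<^sup>2" .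
  have "(L2_norm D r)\<^sup>2 + lam * (L2_norm D u)\<^sup>2 \<le> (L2_norm D e)\<^sup>2 + lam * (L2_norm D f)\<^sup>2"
    using min by (simp only: r_def e_def)
  then have "lam * (L2_norm D z)\<^sup>2 \<le> 2 * (L2_norm D e)\<^sup>2 + 2 * (lam / \<kappa>\<^sup>2)\<^sup>2 * (L2_norm D w)\<^sup>2"
    using cross unfolding sq by (simp add: algebra_simps)
  then show "lam * (L2_norm D (\<lambda>X. f X - u X))\<^sup>2 \<le> 2 * (L2_norm D (\<lambda>X. b X - of_real (\<kappa>\<^sup>2) * helmholtz_K D \<kappa> f X))\<^sup>2
        + 2 * (lam / \<kappa>\<^sup>2)\<^sup>2 * (L2_norm D w)\<^sup>2"
    by (simp only: z_def e_def)
qed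

end

section \<open>The scattered field\<close>

lemma c1_incoming_wave:
  obtains w2 where "c1 (incoming_wave a kvec) (\<lambda>j X. of_real (kvec $ j) * (\<i> * incoming_wave a kvec X))"
    "\<And>i. c1 (\<lambda>X. of_real (kvec $ i) * (\<i> * incoming_wave a kvec X)) (w2 i)"
    "\<And>X. (\<Sum>j\<in>UNIV. w2 j j X) + (of_real (norm kvec))\<^sup>2 * incoming_wave a kvec X = 0"
proof -
  have p: "((\<lambda>t. of_real a * exp (\<i> * of_real t)) has_vector_derivative \<i> * (of_real a * exp (\<i> * of_real t))) (at t)" for t :: real
  proof -
    have "((\<lambda>z. of_real a * exp (\<i> * z)) has_field_derivative \<i> * (of_real a * exp (\<i> * of_real t))) (at (of_real t))"
      by (auto intro!: derivative_eq_intros)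
    from has_vector_derivative_real_field[OF this] show ?thesis by simp
  qed
  have h: "((\<lambda>X. kvec \<bullet> X) has_derivative (\<lambda>v. \<Sum>j\<in>UNIV. v $ j * kvec $ j)) (at X)" for X
  proof -
    have "((\<lambda>X. kvec \<bullet> X) has_derivative (\<lambda>v. kvec \<bullet> v)) (at X)"
      by (auto intro!: derivative_eq_intros)
    then show ?thesis by (simp add: inner_vec_def mult.commute)
  qed
  have 1: "c1 (incoming_wave a kvec) (\<lambda>j X. of_real (kvec $ j) * (\<i> * incoming_wave a kvec X))"
    unfolding incoming_wave_def by (rule c1_compose[OF p _ h]) (intro continuous_intros)+
  define w2 where "w2 = (\<lambda>i j X. of_real (kvec $ i) * (\<i> * (of_real (kvec $ j) * (\<i> * incoming_wave a kvec X))))"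
  have 2: "c1 (\<lambda>X. of_real (kvec $ i) * (\<i> * incoming_wave a kvec X)) (w2 i)" for i
  proof -
    have "c1 (\<lambda>X. (of_real (kvec $ i) * \<i>) * incoming_wave a kvec X)
      (\<lambda>j X. 0 * incoming_wave a kvec X + (of_real (kvec $ i) * \<i>) * (of_real (kvec $ j) * (\<i> * incoming_wave a kvec X)))"
      by (rule c1_mult[OF c1_const 1])
    then show ?thesis by (simp add: w2_def mult.assoc)
  qed
  have 3: "(\<Sum>j\<in>UNIV. w2 j j X) + (of_real (norm kvec))\<^sup>2 * incoming_wave a kvec X = 0" for X
  proof -
    have "(complex_of_real (norm kvec))\<^sup>2 = of_real (kvec \<bullet> kvec)"
      by (simp only: of_real_power[symmetric] power2_norm_eq_inner)
    then show ?thesis by (simp add: w2_def inner_vec_def sum_2 algebra_simps)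
  qed
  show ?thesis by (rule that[OF 1 2 3])
qed

lemma radial_deriv_c1:
  assumes "c1 u u1"
  shows "radial_deriv u X = (\<Sum>j\<in>UNIV. of_real ((X /\<^sub>R norm X) $ j) * u1 j X)"
proof -
  define e where "e = X /\<^sub>R norm X"
  have "((\<lambda>t::real. X + t *\<^sub>R e) has_derivative (\<lambda>t. t *\<^sub>R e)) (at 0)"
    by (auto intro!: derivative_eq_intros)
  moreover have "(u has_derivative (\<lambda>v. \<Sum>j\<in>UNIV. of_real (v $ j) * u1 j X)) (at (X + 0 *\<^sub>R e))"
    using assms by (simp add: c1_def)
  ultimately have "((\<lambda>t. u (X + t *\<^sub>R e)) has_derivative (\<lambda>t. \<Sum>j\<in>UNIV. of_real ((t *\<^sub>R e) $ j) * u1 j X)) (at 0)"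
    by (rule has_derivative_compose)
  moreover have "(\<lambda>t. \<Sum>j\<in>UNIV. of_real ((t *\<^sub>R e) $ j) * u1 j X) = (\<lambda>t. t *\<^sub>R (\<Sum>j\<in>UNIV. of_real (e $ j) * u1 j X))"
    by (simp only: fun_eq_iff vector_scaleR_component real_scaleR_def of_real_mult scaleR_sum_right scaleR_conv_of_real[where 'a=complex] mult.assoc) (simp add: sum_distrib_left)
  ultimately have "((\<lambda>t. u (X + t *\<^sub>R e)) has_vector_derivative (\<Sum>j\<in>UNIV. of_real (e $ j) * u1 j X)) (at 0)"
    by (simp add: has_vector_derivative_def)
  then show ?thesis unfolding radial_deriv_def e_def by (rule vector_derivative_at)
qed

text \<open>Multiplying the radiation condition by |y|, split as sqrt |y| times sqrt |y|, turns the
  radial derivative into y . grad u, the quantity that the gradient of the cutoff produces.\<close>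

lemma sommerfeld_c1:
  assumes u: "c1 u u1" and s: "sommerfeld \<kappa> u" and \<eta>: "0 < \<eta>"
  shows "\<exists>R1. \<forall>y. R1 \<le> norm y \<longrightarrow>
     norm ((\<Sum>j\<in>UNIV. of_real (y $ j) * u1 j y) - \<i> * of_real (\<kappa> * norm y) * u y) \<le> \<eta> * sqrt (norm y)"
proof -
  have "\<forall>\<^sub>F X in at_infinity. norm (of_real (sqrt (norm X)) * (radial_deriv u X - \<i> * of_real \<kappa> * u X)) < \<eta>"
    using tendstoD[OF s[unfolded sommerfeld_def] \<eta>] by (simp add: dist_norm)
  then obtain b where b: "\<And>X. b \<le> norm X \<Longrightarrow> norm (of_real (sqrt (norm X)) * (radial_deriv u X - \<i> * of_real \<kappa> * u X)) < \<eta>"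
    by (auto simp: eventually_at_infinity)
  show ?thesis
  proof (intro exI[of _ "max b 1"] allI impI)
    fix y :: "real^2" assume y: "max b 1 \<le> norm y"
    then have y0: "0 < norm y" by linarith
    have "of_real (norm y) * radial_deriv u y = (\<Sum>j\<in>UNIV. of_real (y $ j) * u1 j y)"
      unfolding radial_deriv_c1[OF u] sum_distrib_left
    proof (intro sum.cong refl)
      fix j
      have "norm y * (y /\<^sub>R norm y) $ j = y $ j" using y0 by simp
      then show "of_real (norm y) * (of_real ((y /\<^sub>R norm y) $ j) * u1 j y) = of_real (y $ j) * u1 j y"
        by (metis mult.assoc of_real_mult)
    qed
    then have "(\<Sum>j\<in>UNIV. of_real (y $ j) * u1 j y) - \<i> * of_real (\<kappa> * norm y) * u y
      = of_real (norm y) * (radial_deriv u y - \<i> * of_real \<kappa> * u y)"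
      by (simp add: algebra_simps)
    also have "\<dots> = of_real (sqrt (norm y)) * (of_real (sqrt (norm y)) * (radial_deriv u y - \<i> * of_real \<kappa> * u y))"
      using y0 by (simp add: mult.assoc[symmetric] flip: of_real_mult)
    finally have "norm ((\<Sum>j\<in>UNIV. of_real (y $ j) * u1 j y) - \<i> * of_real (\<kappa> * norm y) * u y)
      = sqrt (norm y) * norm (of_real (sqrt (norm y)) * (radial_deriv u y - \<i> * of_real \<kappa> * u y))"
      by (simp only: norm_mult[of "of_real (sqrt (norm y))"] norm_of_real) simp
    also have "\<dots> \<le> sqrt (norm y) * \<eta>"
      using b[of y] y by (intro mult_left_mono) auto
    finally show "norm ((\<Sum>j\<in>UNIV. of_real (y $ j) * u1 j y) - \<i> * of_real (\<kappa> * norm y) * u y) \<le> \<eta> * sqrt (norm y)"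
      by (simp add: mult.commute)
  qed
qed

text \<open>The kernel is dominated by 1 + 1/|y - x|. The area of S is counted twice, once for the
  constant and once for the part of 1/|y - x| outside the unit disc about x.\<close>

lemma potential_bound:
  fixes f :: "real^2 \<Rightarrow> complex"
  assumes k: "0 < \<kappa>" and S: "S \<in> sets borel" "emeasure lborel S < \<infinity>"
    and f: "f \<in> borel_measurable borel" "\<And>y. norm (f y) \<le> B * indicator S y" and B: "0 \<le> B"
  shows "norm (\<integral>y. hlm_g \<kappa> ((norm (y - x))\<^sup>2) * f y \<partial>lborel) \<le> B * ((1 + 1 / \<kappa>) * (2 * pi + 2 * measure lborel S))"
proof -
  note [measurable] = S(1)
  have "norm (\<integral>y. hlm_g \<kappa> ((norm (y - x))\<^sup>2) * f y \<partial>lborel) \<le> (\<integral>y. norm (hlm_g \<kappa> ((norm (y - x))\<^sup>2) * f y) \<partial>lborel)"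
    by (rule integral_norm_bound)
  also have "\<dots> \<le> B * ((1 + 1 / \<kappa>) * (2 * pi + 2 * measure lborel S))"
  proof (rule integral_real_bounded)
    show "0 \<le> B * ((1 + 1 / \<kappa>) * (2 * pi + 2 * measure lborel S))" using B k by simp
    have "(\<integral>\<^sup>+y. ennreal (norm (hlm_g \<kappa> ((norm (y - x))\<^sup>2) * f y)) \<partial>lborel)
      \<le> (\<integral>\<^sup>+y. ennreal (B * (1 + 1 / \<kappa>)) * (indicator S y + indicator S y * ennreal (1 / norm (y - x))) \<partial>lborel)"
    proof (rule nn_integral_mono_AE)
      show "AE y in lborel. ennreal (norm (hlm_g \<kappa> ((norm (y - x))\<^sup>2) * f y))
         \<le> ennreal (B * (1 + 1 / \<kappa>)) * (indicator S y + indicator S y * ennreal (1 / norm (y - x)))"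
        using AE_lborel_singleton[of x]
      proof eventually_elim
        case (elim y)
        show ?case
        proof (cases "y \<in> S")
          case True
          have "norm (hlm_g \<kappa> ((norm (y - x))\<^sup>2)) \<le> (1 + 1 / \<kappa>) * (1 + 1 / sqrt ((norm (y - x))\<^sup>2))"
            using elim by (intro hlm_g_bound2[OF k]) simp
          then have "norm (hlm_g \<kappa> ((norm (y - x))\<^sup>2)) * norm (f y) \<le> ((1 + 1 / \<kappa>) * (1 + 1 / norm (y - x))) * B"
            using f(2)[of y] True B k by (intro mult_mono) auto
          then have "ennreal (norm (hlm_g \<kappa> ((norm (y - x))\<^sup>2) * f y)) \<le> ennreal ((B * (1 + 1 / \<kappa>)) * (1 + 1 / norm (y - x)))"
            by (intro ennreal_leI) (simp add: norm_mult mult_ac)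
          also have "\<dots> = ennreal (B * (1 + 1 / \<kappa>)) * ennreal (1 + 1 / norm (y - x))"
            using B k by (intro ennreal_mult) auto
          also have "ennreal (1 + 1 / norm (y - x)) = 1 + ennreal (1 / norm (y - x))"
            by (subst ennreal_plus) auto
          finally show ?thesis using True by simp
        next
          case False
          then have "f y = 0" using f(2)[of y] by simp
          then show ?thesis by simp
        qed
      qed
    qed
    also have "\<dots> = ennreal (B * (1 + 1 / \<kappa>)) * ((\<integral>\<^sup>+y. indicator S y \<partial>lborel) + (\<integral>\<^sup>+y. indicator S y * ennreal (1 / norm (y - x)) \<partial>lborel))"
      by (subst nn_integral_cmult, measurable) (subst nn_integral_add, auto)
    also have "\<dots> \<le> ennreal (B * (1 + 1 / \<kappa>)) * (emeasure lborel S + (ennreal (2 * pi) + emeasure lborel S))"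
      using S(1) by (intro mult_left_mono add_mono nn_integral_inverse_dist_le) auto
    also have "emeasure lborel S = ennreal (measure lborel S)"
      using S(2) by (intro emeasure_eq_ennreal_measure) auto
    also have "ennreal (measure lborel S) + (ennreal (2 * pi) + ennreal (measure lborel S)) = ennreal (2 * pi + 2 * measure lborel S)"
    proof -
      have "ennreal (2 * pi) + ennreal (measure lborel S) = ennreal (2 * pi + measure lborel S)"
        by (rule ennreal_plus[symmetric]) auto
      moreover have "ennreal (measure lborel S) + ennreal (2 * pi + measure lborel S) = ennreal (measure lborel S + (2 * pi + measure lborel S))"
        by (rule ennreal_plus[symmetric]) auto
      ultimately show ?thesis by (simp add: algebra_simps)
    qed
    also have "ennreal (B * (1 + 1 / \<kappa>)) * ennreal (2 * pi + 2 * measure lborel S) = ennreal (B * (1 + 1 / \<kappa>) * (2 * pi + 2 * measure lborel S))"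
      using B k by (intro ennreal_mult[symmetric]) auto
    finally show "(\<integral>\<^sup>+y. ennreal (norm (hlm_g \<kappa> ((norm (y - x))\<^sup>2) * f y)) \<partial>lborel) \<le> ennreal (B * ((1 + 1 / \<kappa>) * (2 * pi + 2 * measure lborel S)))"
      by (simp add: mult.assoc)
  qed
  finally show ?thesis .
qed

section \<open>From the Tikhonov error to the depth error\<close>

lemma L2_norm_mono:
  fixes f :: "'a::euclidean_space \<Rightarrow> 'b::euclidean_space" and F :: "'a \<Rightarrow> real"
  assumes S: "S \<in> sets lebesgue" "S \<subseteq> D" and D: "D \<in> sets lebesgue"
    and f: "f \<in> borel_measurable (lebesgue_on D)"
    and F: "integrable (lebesgue_on D) F" "\<And>x. x \<in> D \<Longrightarrow> (norm (f x))\<^sup>2 \<le> F x"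
  shows "L2 S f" "(L2_norm S f)\<^sup>2 \<le> (LINT x|lebesgue_on D. F x)"
proof -
  have fD: "integrable (lebesgue_on D) (\<lambda>x. (norm (f x))\<^sup>2)"
  proof (rule Bochner_Integration.integrable_bound[OF F(1)])
    show "AE x in lebesgue_on D. norm ((norm (f x))\<^sup>2) \<le> norm (F x)"
      using F(2) by (intro AE_I2) (force intro: order_trans)
  qed (use f in auto)
  have iD: "integrable lebesgue (\<lambda>x. indicator D x *\<^sub>R (norm (f x))\<^sup>2)"
    using fD D by (subst (asm) integrable_restrict_space) auto
  have iS: "integrable lebesgue (\<lambda>x. indicator S x *\<^sub>R (indicator D x *\<^sub>R (norm (f x))\<^sup>2))"
    by (rule integrable_mult_indicator[OF S(1) iD])
  have eq: "(\<lambda>x. indicator S x *\<^sub>R (indicator D x *\<^sub>R (norm (f x))\<^sup>2)) = (\<lambda>x. indicator S x *\<^sub>R (norm (f x))\<^sup>2)"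
    using S(2) by (auto simp: fun_eq_iff indicator_def)
  have iS': "integrable (lebesgue_on S) (\<lambda>x. (norm (f x))\<^sup>2)"
    using iS unfolding eq using S(1) by (subst integrable_restrict_space) auto
  moreover have "f \<in> borel_measurable (lebesgue_on S)"
    using f S(2) by (rule measurable_restrict_mono)
  ultimately show "L2 S f" by (simp add: L2_def)
  have "(L2_norm S f)\<^sup>2 = (LINT x|lebesgue. indicator S x *\<^sub>R (norm (f x))\<^sup>2)"
    unfolding L2_norm_sq using S(1) by (subst integral_restrict_space) auto
  also have "\<dots> \<le> (LINT x|lebesgue. indicator D x *\<^sub>R (norm (f x))\<^sup>2)"
    using S(2) iS iD unfolding eq by (intro integral_mono) (auto simp: indicator_def)
  also have "\<dots> = (LINT x|lebesgue_on D. (norm (f x))\<^sup>2)"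
    using D by (subst integral_restrict_space) auto
  also have "\<dots> \<le> (LINT x|lebesgue_on D. F x)"
    by (rule integral_mono[OF fD F(1)]) (use F(2) in auto)
  finally show "(L2_norm S f)\<^sup>2 \<le> (LINT x|lebesgue_on D. F x)" .
qed

text \<open>Since \<open>1 - q\<close> is bounded below, \<open>q \<mapsto> \<surd>|1 - q|\<close> is Lipschitz where it is used.\<close>

lemma wavenumber_error:
  fixes M \<eta> \<epsilon> u :: complex and q \<kappa> ki a :: real
  assumes ki: "0 < ki" and kap: "0 < \<kappa>" and q: "q = 1 - \<kappa>\<^sup>2 / ki\<^sup>2" "\<bar>q\<bar> \<le> 1/3" and a: "0 < a"
    and M: "M = \<eta> + \<epsilon>" "a / 4 \<le> norm M"
  shows "\<bar>ki * sqrt (norm (1 - u / M)) - \<kappa>\<bar> \<le> 8 * ki / a * (norm (of_real q * \<eta> - u) + norm \<epsilon>)"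
proof -
  define p where "p = sqrt (norm (1 - u / M))"
  define r where "r = \<kappa> / ki"
  have r0: "0 < r" using ki kap by (simp add: r_def)
  have r2: "r\<^sup>2 = 1 - q" using q by (simp add: r_def power_divide)
  \<comment> \<open>Since |q| is at most 1/3, r^2 = 1 - q is at least 2/3.\<close>
  have rh: "1/2 \<le> r"
  proof (rule power2_le_imp_le)
    show "(1/2)\<^sup>2 \<le> r\<^sup>2" using r2 q(2) by (simp add: power2_eq_square abs_le_iff)
  qed (use r0 in simp)
  have p0: "0 \<le> p" by (simp add: p_def)
  have p2: "p\<^sup>2 = norm (1 - u / M)" by (simp add: p_def)
  have M0: "M \<noteq> 0" using M(2) a by auto
  \<comment> \<open>The difference of the roots is the difference of the squares divided by p + r >=
    1/2; together with |M| >= a/4 this is the origin of 8/a.\<close>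
  have "\<bar>p - r\<bar> * (1/2) \<le> \<bar>p - r\<bar> * (p + r)"
    using p0 rh by (intro mult_left_mono) auto
  also have "\<dots> = \<bar>p\<^sup>2 - r\<^sup>2\<bar>"
  proof -
    have "p\<^sup>2 - r\<^sup>2 = (p - r) * (p + r)" by (simp add: power2_eq_square algebra_simps)
    then show ?thesis using p0 r0 by (simp add: abs_mult)
  qed
  also have "\<dots> \<le> norm (of_real q - u / M)"
  proof -
    have "\<bar>norm (1 - u / M) - norm (1 - complex_of_real q)\<bar> \<le> norm ((1 - u / M) - (1 - of_real q))"
      by (rule norm_triangle_ineq3)
    moreover have "norm (1 - complex_of_real q) = 1 - q"
    proof -
      have "1 - complex_of_real q = of_real (1 - q)" by simp
      then show ?thesis using q(2) by (simp only: norm_of_real)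
    qed
    ultimately show ?thesis unfolding p2 r2 by simp
  qed
  \<comment> \<open>Division is by the noisy field, so the noise enters a second time through q
    \<epsilon>.\<close>
  also have "of_real q - u / M = ((of_real q * \<eta> - u) + of_real q * \<epsilon>) / M"
    using M0 by (simp add: M(1) field_simps)
  also have "norm \<dots> = norm ((of_real q * \<eta> - u) + of_real q * \<epsilon>) / norm M" by (rule norm_divide)
  also have "\<dots> \<le> (norm (of_real q * \<eta> - u) + norm \<epsilon>) / (a / 4)"
  proof (rule frac_le)
    have "norm ((of_real q * \<eta> - u) + of_real q * \<epsilon>) \<le> norm (of_real q * \<eta> - u) + \<bar>q\<bar> * norm \<epsilon>"
      using norm_triangle_ineq[of "of_real q * \<eta> - u" "of_real q * \<epsilon>"] by (simp add: norm_mult)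
    also have "\<bar>q\<bar> * norm \<epsilon> \<le> 1 * norm \<epsilon>" using q(2) by (intro mult_right_mono) auto
    finally show "norm ((of_real q * \<eta> - u) + of_real q * \<epsilon>) \<le> norm (of_real q * \<eta> - u) + norm \<epsilon>" by simp
  qed (use M a in auto)
  finally have pr: "\<bar>p - r\<bar> \<le> 8 / a * (norm (of_real q * \<eta> - u) + norm \<epsilon>)" by simp
  have "\<bar>ki * p - \<kappa>\<bar> = ki * \<bar>p - r\<bar>"
  proof -
    have "ki * p - \<kappa> = ki * (p - r)" using ki by (simp add: r_def algebra_simps)
    then show ?thesis using ki by (simp add: abs_mult)
  qed
  also have "\<dots> \<le> ki * (8 / a * (norm (of_real q * \<eta> - u) + norm \<epsilon>))"
    using pr ki by (intro mult_left_mono) auto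
  finally show ?thesis by (simp add: p_def algebra_simps)
qed

text \<open>An a priori bound in place of a Neumann series. Let S be the maximum of |\<eta>| on
  \<open>\<Omega>\<close>. The potential of q \<eta> bounds the scattered field by S/3 everywhere;
  at the maximiser this reads S <= a + S/3, so S <= 3a/2, and therefore |\<eta>| >= a - S/3 >= a/2
  everywhere.\<close>

lemma small_contrast_field:
  fixes q k :: "real^2 \<Rightarrow> real" and \<eta> :: "real^2 \<Rightarrow> complex"
  assumes ki: "ki = norm kvec" "0 < ki" and a: "0 < a"
    and \<Omega>: "compact \<Omega>" "\<Omega> \<noteq> {}"
    and q: "continuous_on UNIV q" "\<And>X. X \<notin> \<Omega> \<Longrightarrow> q X = 0" "\<And>X. \<bar>q X\<bar> \<le> c"
    and k: "\<And>X. (k X)\<^sup>2 = ki\<^sup>2 * (1 - q X)"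
    and c: "c * (3 * ki\<^sup>2 * ((1 + 1 / ki) * (2 * pi + 2 * measure lborel \<Omega>))) \<le> 1"
    and \<eta>: "total_field k ki (incoming_wave a kvec) \<eta>"
  shows "a / 2 \<le> norm (\<eta> X)"
    "incoming_wave a kvec X - \<eta> X = of_real (ki\<^sup>2) * (\<integral>Y. hlm_g ki ((norm (Y - X))\<^sup>2) * (of_real (q Y) * \<eta> Y) \<partial>lborel)"
proof -
  obtain w2 where w: "c1 (incoming_wave a kvec) (\<lambda>j X. of_real (kvec $ j) * (\<i> * incoming_wave a kvec X))"
    "\<And>i. c1 (\<lambda>X. of_real (kvec $ i) * (\<i> * incoming_wave a kvec X)) (w2 i)"
    "\<And>X. (\<Sum>j\<in>UNIV. w2 j j X) + (of_real (norm kvec))\<^sup>2 * incoming_wave a kvec X = 0"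
    by (rule c1_incoming_wave[of a kvec]) (rule that)
  have C2: "Ck 2 \<eta>" and pde: "\<And>X. laplacian \<eta> X + of_real ((k X)\<^sup>2) * \<eta> X = 0"
    and rad: "sommerfeld ki (\<lambda>X. \<eta> X - incoming_wave a kvec X)"
    using \<eta> by (auto simp: total_field_def)
  note c\<eta> = Ck_2_c1[OF C2]
  define \<eta>s where "\<eta>s = (\<lambda>X. \<eta> X - incoming_wave a kvec X)"
  define f where "f = (\<lambda>Y. of_real (q Y) * \<eta> Y)"
  have cs: "c1 \<eta>s (\<lambda>j X. pd j \<eta> X - of_real (kvec $ j) * (\<i> * incoming_wave a kvec X))"
    "\<And>i. c1 (\<lambda>X. pd i \<eta> X - of_real (kvec $ i) * (\<i> * incoming_wave a kvec X)) (\<lambda>j X. pd j (pd i \<eta>) X - w2 i j X)"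
    unfolding \<eta>s_def by (rule c1_diff[OF c\<eta>(1) w(1)], rule c1_diff[OF c\<eta>(2) w(2)])
  have rhs: "(\<Sum>j\<in>UNIV. pd j (pd j \<eta>) X - w2 j j X) + (of_real ki)\<^sup>2 * \<eta>s X = of_real (ki\<^sup>2) * f X" for X
  proof -
    have 1: "(\<Sum>j\<in>UNIV. pd j (pd j \<eta>) X) = - (of_real ((k X)\<^sup>2) * \<eta> X)"
      using pde[of X] by (simp add: laplacian_def eq_neg_iff_add_eq_0)
    have 2: "(\<Sum>j\<in>UNIV. w2 j j X) = - ((of_real ki)\<^sup>2 * incoming_wave a kvec X)"
      using w(3)[of X] by (simp add: ki(1) eq_neg_iff_add_eq_0)
    show ?thesis
      unfolding sum_subtractf 1 2 k \<eta>s_def f_def by (simp add: algebra_simps)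
  qed
  have f0: "f X = 0" if "X \<notin> \<Omega>" for X using q(2)[OF that] by (simp add: f_def)
  obtain R where R: "\<And>X. X \<in> \<Omega> \<Longrightarrow> norm X \<le> R" using compact_imp_bounded[OF \<Omega>(1)] by (auto simp: bounded_pos)
  have rep: "\<eta>s X = - (\<integral>Y. hlm_g ki ((norm (Y - X))\<^sup>2) * (of_real (ki\<^sup>2) * f Y) \<partial>lborel)" for X
    unfolding rhs[symmetric]
  proof (rule radiating_representation[OF ki(2) cs])
    show "(\<Sum>j\<in>UNIV. pd j (pd j \<eta>) Y - w2 j j Y) + (of_real ki)\<^sup>2 * \<eta>s Y = 0" if "R < norm Y" for Y
      unfolding rhs using f0[of Y] R[of Y] that by force
  qed (rule sommerfeld_c1[OF cs(1) rad[folded \<eta>s_def]])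
  have rep': "\<eta>s X = - (of_real (ki\<^sup>2) * (\<integral>Y. hlm_g ki ((norm (Y - X))\<^sup>2) * f Y \<partial>lborel))" for X
    unfolding rep by (subst integral_mult_right_zero[symmetric]) (simp only: mult.left_commute)
  show "incoming_wave a kvec X - \<eta> X = of_real (ki\<^sup>2) * (\<integral>Y. hlm_g ki ((norm (Y - X))\<^sup>2) * (of_real (q Y) * \<eta> Y) \<partial>lborel)"
    using rep'[of X] by (simp add: \<eta>s_def f_def algebra_simps)
  have cont: "continuous_on UNIV \<eta>" by (rule c1_cont[OF c\<eta>(1)])
  obtain Xm where Xm: "Xm \<in> \<Omega>" "\<And>Y. Y \<in> \<Omega> \<Longrightarrow> norm (\<eta> Y) \<le> norm (\<eta> Xm)"
    using continuous_attains_sup[OF \<Omega>, of "\<lambda>X. norm (\<eta> X)"] continuous_on_subset[OF cont] by (auto intro: continuous_on_norm)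
  define S where "S = norm (\<eta> Xm)"
  have c0: "0 \<le> c" using q(3)[of 0] by linarith
  have S0: "0 \<le> S" by (simp add: S_def)
  have fb: "norm (f Y) \<le> c * S * indicator \<Omega> Y" for Y
  proof (cases "Y \<in> \<Omega>")
    case True
    have "norm (f Y) = \<bar>q Y\<bar> * norm (\<eta> Y)" by (simp add: f_def norm_mult)
    also have "\<dots> \<le> c * S" unfolding S_def using q(3) Xm(2)[OF True] c0 by (intro mult_mono) auto
    finally show ?thesis using True by simp
  qed (simp add: f0)
  have fm: "f \<in> borel_measurable borel"
    unfolding f_def by (intro borel_measurable_continuous_onI continuous_intros q(1) cont)
  have \<eta>s: "norm (\<eta>s X) \<le> S / 3" for X
  proof -
    have "norm (\<eta>s X) = ki\<^sup>2 * norm (\<integral>Y. hlm_g ki ((norm (Y - X))\<^sup>2) * f Y \<partial>lborel)"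
      unfolding rep' norm_minus_cancel norm_mult norm_of_real by simp
    also have "\<dots> \<le> ki\<^sup>2 * (c * S * ((1 + 1 / ki) * (2 * pi + 2 * measure lborel \<Omega>)))"
    proof (intro mult_left_mono potential_bound[OF ki(2)])
      show "emeasure lborel \<Omega> < \<infinity>" by (rule emeasure_bounded_finite[OF compact_imp_bounded[OF \<Omega>(1)]])
      show "\<Omega> \<in> sets borel" by (rule borel_compact[OF \<Omega>(1)])
    qed (use fm fb c0 S0 in auto)
    also have "\<dots> = (c * (3 * ki\<^sup>2 * ((1 + 1 / ki) * (2 * pi + 2 * measure lborel \<Omega>)))) * (S / 3)"
      by (simp add: mult_ac)
    also have "\<dots> \<le> 1 * (S / 3)" by (rule mult_right_mono[OF c]) (simp add: S_def)
    finally show ?thesis by simp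
  qed
  have inc: "norm (incoming_wave a kvec X) = a" for X
    using a by (simp add: incoming_wave_def norm_mult)
  have tri: "\<bar>norm (\<eta> X) - a\<bar> \<le> S / 3" for X
    using norm_triangle_ineq3[of "\<eta> X" "incoming_wave a kvec X"] \<eta>s[of X] unfolding inc by (simp add: \<eta>s_def)
  show "a / 2 \<le> norm (\<eta> X)"
    using tri[of X] tri[of Xm] unfolding S_def[symmetric] by linarith
qed

text \<open>The function w is minus the Helmholtz operator applied to the conjugate of f, and the
  fundamental solution undoes that operator. Representing the conjugate of f by K w is the same as f
  lying in the range of the adjoint of K.\<close>

lemma source_condition:
  assumes k: "0 < \<kappa>" and f: "c1 f f1" "\<And>i. c1 (f1 i) (f2 i)" "\<And>X. X \<notin> \<Omega> \<Longrightarrow> f X = 0"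
    and D: "open D" "bounded D" and \<Omega>: "compact \<Omega>" "\<Omega> \<subseteq> D"
  obtains w B where "w \<in> borel_measurable (lebesgue_on D)" "\<And>X. X \<in> D \<Longrightarrow> norm (w X) \<le> B"
    "\<And>Y. cnj (f Y) = helmholtz_K D \<kappa> w Y"
proof -
  define w where "w = (\<lambda>X. - ((\<Sum>j\<in>UNIV. cnj (f2 j j X)) + (of_real \<kappa>)\<^sup>2 * cnj (f X)))"
  have cw: "continuous_on UNIV w"
    unfolding w_def by (intro continuous_intros c1_cont[OF f(1)] c1_cont'[OF f(2)])
  have op: "open (- \<Omega>)" using compact_imp_closed[OF \<Omega>(1)] by auto
  \<comment> \<open>The complement of \<open>\<Omega>\<close> is open, so the vanishing of f there
    is inherited by all its derivatives. Hence integrating over D loses nothing of the integral over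
    the plane.\<close>
  have w0: "w X = 0" if "X \<notin> \<Omega>" for X
  proof -
    have f1: "f1 j Y = 0" if "Y \<notin> \<Omega>" for j Y
      by (rule c1_zero_open[OF f(1) op]) (use f(3) that in auto)
    have "f2 i j X = 0" for i j
      by (rule c1_zero_open[OF f(2) op]) (use f1 that in auto)
    then show ?thesis using f(3)[OF that] by (simp add: w_def)
  qed
  have "compact (w ` \<Omega>)" by (rule compact_continuous_image[OF continuous_on_subset[OF cw] \<Omega>(1)]) auto
  then obtain B where B: "0 < B" "\<And>X. X \<in> \<Omega> \<Longrightarrow> norm (w X) \<le> B"
    using compact_imp_bounded[of "w ` \<Omega>"] by (auto simp: bounded_pos)
  have wB: "norm (w X) \<le> B" for X
    using B w0[of X] by (cases "X \<in> \<Omega>") auto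
  obtain R where R: "\<And>X. X \<in> \<Omega> \<Longrightarrow> norm X \<le> R" using compact_imp_bounded[OF \<Omega>(1)] by (auto simp: bounded_pos)
  have src: "cnj (f Y) = helmholtz_K D \<kappa> w Y" for Y
  proof -
    have "(\<integral>X. hlm_g \<kappa> ((norm (X - Y))\<^sup>2) * ((\<Sum>j\<in>UNIV. cnj (f2 j j X)) + (of_real \<kappa>)\<^sup>2 * cnj (f X)) \<partial>lborel) = - cnj (f Y)"
    proof (rule fundamental_solution[OF k c1_cnj[OF f(1)] c1_cnj[OF f(2)]])
      show "cnj (f X) = 0" if "R < norm X" for X using R[of X] f(3)[of X] that by force
    qed
    then have 1: "(\<integral>X. hlm_g \<kappa> ((norm (X - Y))\<^sup>2) * w X \<partial>lborel) = cnj (f Y)"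
      by (simp only: w_def mult_minus_right Bochner_Integration.integral_minus minus_minus)
    have "helmholtz_K D \<kappa> w Y = (\<integral>X. helmholtz_G \<kappa> Y X * w X \<partial>lborel)"
      unfolding helmholtz_K_def
    proof (rule integral_lebesgue_on_lborel)
      show "D \<in> sets lebesgue" using D by (simp add: borel_open)
      show "(\<lambda>X. helmholtz_G \<kappa> Y X * w X) \<in> borel_measurable borel"
        by (intro borel_measurable_times helmholtz_G_measurable(1)[OF D k] borel_measurable_continuous_onI cw)
      show "helmholtz_G \<kappa> Y X * w X = 0" if "X \<notin> D" for X
        using w0[of X] that \<Omega>(2) by auto
    qed
    then show ?thesis unfolding helmholtz_G_eq[OF D k] 1 by simp
  qed
  show ?thesis
    by (rule that[OF measurable_lebesgue_on[OF borel_measurable_continuous_onI[OF cw]] wB src])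
qed

text \<open>Where |\<epsilon>| < a/4 the measured field is at least a/4 in size and the Lipschitz
  bounds apply; elsewhere the trivial bound m T is paid for by 16 |\<epsilon>|^2/a^2 >= 1. Both
  cases give one pointwise bound by |z|^2 and |\<epsilon>|^2, which is then integrated over
  D.\<close>

lemma reconstruction_estimate:
  fixes td :: "real \<Rightarrow> real" and q k :: "real^2 \<Rightarrow> real" and \<eta> \<epsilon> u M :: "real^2 \<Rightarrow> complex"
  assumes ki: "0 < ki" and a: "0 < a" and T: "0 < T" and m: "0 < m"
    and td: "\<And>x y. \<bar>td x - td y\<bar> \<le> 2 * T * \<bar>x - y\<bar>" "\<And>x. 0 \<le> td x" "\<And>x. td x \<le> m * T"
    and D: "open D" "bounded D" and S: "S \<in> sets lebesgue" "S \<subseteq> D"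
    and \<eta>: "continuous_on UNIV \<eta>" "\<And>X. a / 2 \<le> norm (\<eta> X)"
    and k: "continuous_on UNIV k" "\<And>X. 0 < k X" and q: "\<And>X. q X = 1 - (k X)\<^sup>2 / ki\<^sup>2" "\<And>X. \<bar>q X\<bar> \<le> 1 / 3"
    and eL: "L2 D \<epsilon>" and uL: "L2 D u" and fL: "L2 D (\<lambda>X. of_real (q X) * \<eta> X)" and M: "M = (\<lambda>X. \<eta> X + \<epsilon> X)"
    and rate: "(L2_norm D (\<lambda>X. of_real (q X) * \<eta> X - u X))\<^sup>2 \<le> c * L2_norm D \<epsilon>" and c: "0 \<le> c"
  shows "L2 S (\<lambda>X. td (rec_wavenumber ki M u X) - td (k X))"
    "(L2_norm S (\<lambda>X. td (rec_wavenumber ki M u X) - td (k X)))\<^sup>2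
       \<le> T\<^sup>2 * (512 * ki\<^sup>2 / a\<^sup>2 * c + (512 * ki\<^sup>2 / a\<^sup>2 + 16 * m\<^sup>2 / a\<^sup>2) + m\<^sup>2 * measure lebesgue D) * L2_norm D \<epsilon>"
proof -
  define dd where "dd = (\<lambda>X. td (rec_wavenumber ki M u X) - td (k X))"
  define \<delta> where "\<delta> = L2_norm D \<epsilon>"
  define z where "z = (\<lambda>X. of_real (q X) * \<eta> X - u X)"
  \<comment> \<open>The constant is 2 (2 * 8)^2: the Lipschitz factor 2 T, the wavenumber factor 8
    ki/a, and (x + y)^2 <= 2 x^2 + 2 y^2. The additional term in B is the price of the points with
    large noise.\<close>
  define A where "A = 512 * ki\<^sup>2 / a\<^sup>2"
  define B where "B = A + 16 * m\<^sup>2 / a\<^sup>2"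
  have zL: "L2 D z" unfolding z_def by (rule L2_diff[OF fL uL])
  have AB: "0 \<le> A" "0 \<le> B" by (auto simp: A_def B_def)
  have \<delta>0: "0 \<le> \<delta>" by (simp add: \<delta>_def L2_norm_def)
  have Dm: "D \<in> sets lebesgue" using D by (simp add: borel_open)
  have Dlm: "D \<in> lmeasurable" using D by (rule lmeasurable_open[rotated])
  have tdc: "continuous_on UNIV td"
  proof -
    have "(2 * T)-lipschitz_on UNIV td"
      using td(1) T by (intro lipschitz_onI) (auto simp: dist_real_def)
    then show ?thesis by (rule lipschitz_on_continuous_on)
  qed
  have ddm: "dd \<in> borel_measurable (lebesgue_on D)"
  proof -
    have [measurable]: "u \<in> borel_measurable (lebesgue_on D)" "\<epsilon> \<in> borel_measurable (lebesgue_on D)"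
      using uL eL by (auto simp: L2_def)
    have [measurable]: "\<eta> \<in> borel_measurable (lebesgue_on D)" "k \<in> borel_measurable (lebesgue_on D)"
      by (intro measurable_lebesgue_on borel_measurable_continuous_onI \<eta> k)+
    have [measurable]: "td \<in> borel_measurable borel" by (rule borel_measurable_continuous_onI[OF tdc])
    show ?thesis unfolding dd_def rec_wavenumber_def M by measurable
  qed
  have triv: "(dd X)\<^sup>2 \<le> m\<^sup>2 * T\<^sup>2" for X
  proof -
    have "\<bar>dd X\<bar> \<le> m * T" unfolding dd_def
      using td(2)[of "rec_wavenumber ki M u X"] td(3)[of "rec_wavenumber ki M u X"] td(2)[of "k X"] td(3)[of "k X"] by linarith
    then have "\<bar>dd X\<bar>\<^sup>2 \<le> (m * T)\<^sup>2" by (rule power_mono) simp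
    then show ?thesis by (simp add: power_mult_distrib)
  qed
  have pw: "(dd X)\<^sup>2 \<le> T\<^sup>2 * (A * (norm (z X))\<^sup>2 + B * (norm (\<epsilon> X))\<^sup>2)" for X
  proof (cases "a / 4 \<le> norm (\<epsilon> X)")
    case True
    then have "a\<^sup>2 / 16 \<le> (norm (\<epsilon> X))\<^sup>2"
      using power_mono[OF True, of 2] a by (simp add: power_divide)
    then have "1 \<le> 16 / a\<^sup>2 * (norm (\<epsilon> X))\<^sup>2" using a by (simp add: field_simps)
    then have "m\<^sup>2 * T\<^sup>2 * 1 \<le> m\<^sup>2 * T\<^sup>2 * (16 / a\<^sup>2 * (norm (\<epsilon> X))\<^sup>2)" by (intro mult_left_mono) auto
    also have "\<dots> = T\<^sup>2 * (16 * m\<^sup>2 / a\<^sup>2 * (norm (\<epsilon> X))\<^sup>2)" by simp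
    also have "\<dots> \<le> T\<^sup>2 * (A * (norm (z X))\<^sup>2 + B * (norm (\<epsilon> X))\<^sup>2)"
    proof (intro mult_left_mono)
      have "0 \<le> A * (norm (z X))\<^sup>2 + A * (norm (\<epsilon> X))\<^sup>2" using AB by simp
      then show "16 * m\<^sup>2 / a\<^sup>2 * (norm (\<epsilon> X))\<^sup>2 \<le> A * (norm (z X))\<^sup>2 + B * (norm (\<epsilon> X))\<^sup>2"
        unfolding B_def distrib_right by linarith
    qed simp
    finally show ?thesis using triv[of X] by simp
  next
    case False
    have "a / 4 \<le> norm (M X)"
      using \<eta>(2)[of X] False norm_diff_ineq[of "\<eta> X" "\<epsilon> X"] by (simp add: M)
    then have "\<bar>rec_wavenumber ki M u X - k X\<bar> \<le> 8 * ki / a * (norm (z X) + norm (\<epsilon> X))"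
      unfolding rec_wavenumber_def z_def by (intro wavenumber_error[OF ki k(2) q a]) (auto simp: M)
    then have "2 * T * \<bar>rec_wavenumber ki M u X - k X\<bar> \<le> 2 * T * (8 * ki / a * (norm (z X) + norm (\<epsilon> X)))"
      using T by (intro mult_left_mono) auto
    then have "\<bar>dd X\<bar> \<le> 2 * T * (8 * ki / a * (norm (z X) + norm (\<epsilon> X)))"
      unfolding dd_def using td(1) by (rule order_trans[rotated])
    then have "\<bar>dd X\<bar>\<^sup>2 \<le> (2 * T * (8 * ki / a * (norm (z X) + norm (\<epsilon> X))))\<^sup>2"
      by (rule power_mono) simp
    also have "\<dots> = T\<^sup>2 * (256 * ki\<^sup>2 / a\<^sup>2 * (norm (z X) + norm (\<epsilon> X))\<^sup>2)"
      by (simp add: power_mult_distrib power_divide)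
    also have "\<dots> \<le> T\<^sup>2 * (256 * ki\<^sup>2 / a\<^sup>2 * (2 * (norm (z X))\<^sup>2 + 2 * (norm (\<epsilon> X))\<^sup>2))"
      using sum_squares_bound[of "norm (z X)" "norm (\<epsilon> X)"]
      by (intro mult_left_mono) (auto simp: power2_sum)
    also have "\<dots> = T\<^sup>2 * (A * (norm (z X))\<^sup>2 + A * (norm (\<epsilon> X))\<^sup>2)"
      by (simp add: A_def distrib_left)
    also have "\<dots> \<le> T\<^sup>2 * (A * (norm (z X))\<^sup>2 + B * (norm (\<epsilon> X))\<^sup>2)"
      by (intro mult_left_mono add_left_mono mult_right_mono) (auto simp: B_def)
    finally show ?thesis by simp
  qed
  have iF: "integrable (lebesgue_on D) (\<lambda>X. T\<^sup>2 * (A * (norm (z X))\<^sup>2 + B * (norm (\<epsilon> X))\<^sup>2))"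
    using zL eL unfolding L2_def by auto
  note L = L2_norm_mono[OF S Dm ddm iF, unfolded real_norm_def power2_abs, OF pw]
  show "L2 S (\<lambda>X. td (rec_wavenumber ki M u X) - td (k X))"
    using L(1) by (simp add: dd_def)
  have "(L2_norm S dd)\<^sup>2 \<le> T\<^sup>2 * (A * c + B + m\<^sup>2 * measure lebesgue D) * \<delta>"
  \<comment> \<open>The noise contributes \<delta>^2, which is dominated by \<delta> only in this
    case. For \<delta> > 1 the trivial bound m T on all of D is already good enough and explains the
    term with the area of D.\<close>
  proof (cases "\<delta> \<le> 1")
    case True
    have "(L2_norm S dd)\<^sup>2 \<le> T\<^sup>2 * (A * (L2_norm D z)\<^sup>2 + B * \<delta>\<^sup>2)"
      using L(2) zL eL unfolding L2_norm_sq \<delta>_def L2_def by simp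
    also have "\<dots> \<le> T\<^sup>2 * (A * (c * \<delta>) + B * (1 * \<delta>) + m\<^sup>2 * measure lebesgue D * \<delta>)"
    proof (intro mult_left_mono)
      have "A * (L2_norm D z)\<^sup>2 \<le> A * (c * \<delta>)"
        using rate AB by (intro mult_left_mono) (auto simp: z_def \<delta>_def)
      moreover have "B * \<delta>\<^sup>2 \<le> B * (1 * \<delta>)"
        unfolding power2_eq_square using True AB \<delta>0 by (intro mult_left_mono mult_right_mono) auto
      moreover have "0 \<le> m\<^sup>2 * measure lebesgue D * \<delta>" using \<delta>0 by simp
      ultimately show "A * (L2_norm D z)\<^sup>2 + B * \<delta>\<^sup>2 \<le> A * (c * \<delta>) + B * (1 * \<delta>) + m\<^sup>2 * measure lebesgue D * \<delta>" by linarith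
    qed simp
    finally show ?thesis by (simp add: algebra_simps)
  next
    case False
    have fin: "finite_measure (lebesgue_on D)" using Dlm by (rule finite_measure_lebesgue_on)
    have ic: "integrable (lebesgue_on D) (\<lambda>X. m\<^sup>2 * T\<^sup>2)" using finite_measure.integrable_const[OF fin] .
    have "(L2_norm S dd)\<^sup>2 \<le> (LINT X|lebesgue_on D. m\<^sup>2 * T\<^sup>2)"
      by (rule L2_norm_mono(2)[OF S Dm ddm ic]) (use triv in simp)
    also have "\<dots> = T\<^sup>2 * (m\<^sup>2 * measure lebesgue D) * 1"
      using Dm by (simp add: measure_restrict_space mult_ac)
    also have "\<dots> \<le> T\<^sup>2 * (m\<^sup>2 * measure lebesgue D) * \<delta>"
      using False by (intro mult_left_mono) auto
    also have "\<dots> \<le> T\<^sup>2 * (A * c + B + m\<^sup>2 * measure lebesgue D) * \<delta>"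
      using AB c \<delta>0 by (intro mult_left_mono mult_right_mono) auto
    finally show ?thesis .
  qed
  then show "(L2_norm S (\<lambda>X. td (rec_wavenumber ki M u X) - td (k X)))\<^sup>2
       \<le> T\<^sup>2 * (512 * ki\<^sup>2 / a\<^sup>2 * c + (512 * ki\<^sup>2 / a\<^sup>2 + 16 * m\<^sup>2 / a\<^sup>2) + m\<^sup>2 * measure lebesgue D) * L2_norm D \<epsilon>"
    by (simp add: dd_def A_def B_def \<delta>_def)
qed

text \<open>The 9 ki^2 in the assumption on C is the square of the factor 3 ki prescribed in the
  estimate, and \<gamma> <= 1 makes \<gamma> powr (-1/2) at least 1.\<close>

lemma sqrt_rate_bound:
  fixes N T ki Q \<delta> \<gamma> C :: real
  assumes N: "N\<^sup>2 \<le> T\<^sup>2 * C * \<delta>" and C: "C \<le> 9 * ki\<^sup>2 * Q"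
    and pos: "0 \<le> T" "0 \<le> ki" "0 \<le> Q" "0 \<le> \<delta>" and \<gamma>: "0 < \<gamma>" "\<gamma> \<le> 1"
  shows "N \<le> sqrt Q * \<gamma> powr (-1/2) * (3 * ki * T) * sqrt \<delta>"
proof -
  have "N\<^sup>2 \<le> T\<^sup>2 * (9 * ki\<^sup>2 * Q) * \<delta>"
    using N mult_right_mono[OF mult_left_mono[OF C, of "T\<^sup>2"], of \<delta>] pos by simp
  also have "\<dots> = (sqrt Q * (3 * ki * T) * sqrt \<delta>)\<^sup>2"
    using pos by (simp add: power_mult_distrib)
  finally have "N\<^sup>2 \<le> (sqrt Q * (3 * ki * T) * sqrt \<delta>)\<^sup>2" .
  then have "N \<le> sqrt Q * (3 * ki * T) * sqrt \<delta>"
    by (rule power2_le_imp_le) (use pos in simp)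
  then have "N \<le> sqrt Q * 1 * (3 * ki * T) * sqrt \<delta>" by simp
  also have "\<dots> \<le> sqrt Q * \<gamma> powr (-1/2) * (3 * ki * T) * sqrt \<delta>"
  proof (intro mult_right_mono mult_left_mono)
    show "1 \<le> \<gamma> powr (-1/2)" using powr_mono2'[of "-1/2" \<gamma> 1] \<gamma> by simp
  qed (use pos in auto)
  finally show ?thesis .
qed

theorem proposition4:
  fixes \<omega> g H0 a ki \<mu> :: real and kvec :: "real^2" and \<Omega> :: "(real^2) set"
  assumes "\<omega> > 0" and "g > 0" and "H0 > 0" and "a > 0"
    and "\<mu> = \<omega>\<^sup>2 / g"
    and "ki = norm kvec" and "ki > 0" and "\<omega>\<^sup>2 = g * ki * tanh (ki * H0)"
    and "smooth_compact_domain \<Omega>"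
  shows "\<exists>\<delta>max>0. \<forall>\<delta>0 (h :: real^2 \<Rightarrow> real) k q (\<eta> :: real^2 \<Rightarrow> complex) D.
    0 < \<delta>0 \<and> \<delta>0 \<le> \<delta>max \<and>
    mild_topography \<omega> g H0 \<Omega> \<delta>0 h \<and> (\<exists>X. h X \<noteq> 0) \<and>
    k = (\<lambda>X. wavenumber \<omega> g (H0 - h X)) \<and>
    q = (\<lambda>X. 1 - (k X)\<^sup>2 / ki\<^sup>2) \<and>
    total_field k ki (incoming_wave a kvec) \<eta> \<and>
    open D \<and> connected D \<and> bounded D \<and> \<Omega> \<subseteq> D \<longrightarrow>
    (\<exists>Ct>0. \<exists>lam :: real \<Rightarrow> real. (\<forall>\<delta>>0. lam \<delta> > 0) \<and>
      (\<forall>\<epsilon> M\<epsilon> \<delta> \<alpha> \<gamma> u k\<epsilon>.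
        L2 D \<epsilon> \<and> Linf D \<epsilon> \<and> \<not> (AE X in lebesgue_on D. \<epsilon> X = 0) \<and>
        M\<epsilon> = (\<lambda>X. \<eta> X + \<epsilon> X) \<and>
        \<delta> = L2_norm D (\<lambda>X. M\<epsilon> X - \<eta> X) \<and>
        \<alpha> > 0 \<and> 0 < \<gamma> \<and> \<gamma> \<le> 1 \<and>
        tikhonov D ki (\<lambda>X. incoming_wave a kvec X - M\<epsilon> X) (lam \<delta>) u \<and>
        k\<epsilon> = rec_wavenumber ki M\<epsilon> u \<longrightarrow>
        L2 (superlevel D M\<epsilon> \<gamma>) (\<lambda>X. trunc_depth \<mu> \<alpha> (k\<epsilon> X) - trunc_depth \<mu> \<alpha> (k X)) \<and>
        L2_norm (superlevel D M\<epsilon> \<gamma>) (\<lambda>X. trunc_depth \<mu> \<alpha> (k\<epsilon> X) - trunc_depth \<mu> \<alpha> (k X))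
          \<le> sqrt (sqrt (measure lebesgue D) *
                 (Linf_norm UNIV q + Ct * sqrt (H2_norm D (\<lambda>X. of_real (q X) * \<eta> X) / ki\<^sup>2)))
             * \<gamma> powr (-1/2) * (3 * ki / (\<alpha> * (\<alpha> + \<mu>))) * sqrt \<delta>))"
proof -
  note pos = assms(1,2,5)
  have \<mu>: "0 < \<mu>" using pos by simp
  have kiH: "ki * tanh (ki * H0) = \<mu>" using dispersion_iff[OF pos, of ki H0] assms(8) by simp
  have \<Omega>: "compact \<Omega>" "\<Omega> \<noteq> {}" using assms(9) by (auto simp: smooth_compact_domain_def)
  define C\<Omega> where "C\<Omega> = 3 * ki\<^sup>2 * ((1 + 1 / ki) * (2 * pi + 2 * measure lborel \<Omega>))"
  have C\<Omega>: "0 < C\<Omega>"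
    unfolding C\<Omega>_def using assms(7) by (intro mult_pos_pos add_pos_nonneg) auto
  \<comment> \<open>Two demands on the contrast: 1/3 keeps the square root in the wavenumber away
    from 0, and 1/C\<Omega> gives the lower bound a/2 on the field.\<close>
  define c where "c = min (1/3) (1 / C\<Omega>)"
  have c: "0 < c" "c \<le> 1/3" "c * C\<Omega> \<le> 1"
    using C\<Omega> by (auto simp: c_def min_def field_simps)
  obtain \<delta>max where \<delta>max: "0 < \<delta>max"
    "\<And>\<delta>0 h X. 0 < \<delta>0 \<Longrightarrow> \<delta>0 \<le> \<delta>max \<Longrightarrow> mild_topography \<omega> g H0 \<Omega> \<delta>0 h \<Longrightarrow> \<bar>wq \<omega> g ki H0 (h X)\<bar> < c"
    using mild_topography_q_small[OF pos assms(3,7) kiH compact_imp_bounded[OF \<Omega>(1)] c(1)] by metis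
  show ?thesis
  proof (rule exI[of _ \<delta>max], intro conjI allI impI \<delta>max(1))
    fix \<delta>0 h k q D and \<eta> :: "real^2 \<Rightarrow> complex"
    assume "0 < \<delta>0 \<and> \<delta>0 \<le> \<delta>max \<and>
      mild_topography \<omega> g H0 \<Omega> \<delta>0 h \<and> (\<exists>X. h X \<noteq> 0) \<and>
      k = (\<lambda>X. wavenumber \<omega> g (H0 - h X)) \<and>
      q = (\<lambda>X. 1 - (k X)\<^sup>2 / ki\<^sup>2) \<and>
      total_field k ki (incoming_wave a kvec) \<eta> \<and>
      open D \<and> connected D \<and> bounded D \<and> \<Omega> \<subseteq> D"
    then have \<delta>0: "0 < \<delta>0" "\<delta>0 \<le> \<delta>max" and mild: "mild_topography \<omega> g H0 \<Omega> \<delta>0 h" and hne: "\<exists>X. h X \<noteq> 0"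
      and k_def: "k = (\<lambda>X. wavenumber \<omega> g (H0 - h X))" and q_def: "q = (\<lambda>X. 1 - (k X)\<^sup>2 / ki\<^sup>2)"
      and field: "total_field k ki (incoming_wave a kvec) \<eta>"
      and D: "open D" "bounded D" "\<Omega> \<subseteq> D" by blast+
    have h: "Ck 2 h" "\<And>X. h X < H0" and sub: "support h \<subseteq> \<Omega>"
      using mild by (auto simp: mild_topography_def)
    have k_wnum: "k X = wnum \<omega> g (H0 - h X)" for X by (simp add: k_def wnum_def[OF pos])
    have k_pos: "0 < k X" for X unfolding k_wnum by (rule wnum_eq(1)[OF pos]) (use h in simp)
    have q_wq: "q X = wq \<omega> g ki H0 (h X)" for X by (simp add: q_def k_wnum wq_def[OF pos])
    have h0: "h X = 0" if "X \<notin> \<Omega>" for X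
      using that sub closure_subset[of "{X. h X \<noteq> 0}"] by (auto simp: support_def)
    have q0: "q X = 0" if "X \<notin> \<Omega>" for X
      unfolding q_wq h0[OF that] by (rule wq_0[OF pos assms(3,7) kiH])
    have qc: "\<bar>q X\<bar> \<le> c" for X unfolding q_wq by (rule less_imp_le[OF \<delta>max(2)[OF \<delta>0 mild]])
    obtain q1 q2 where wq: "c1 (\<lambda>X. complex_of_real (wq \<omega> g ki H0 (h X))) q1" "\<And>i. c1 (q1 i) (q2 i)"
      by (rule wq_c2[OF pos h assms(7)]) (rule that)
    note q12 = wq[folded q_wq]
    have q_cont: "continuous_on UNIV q"
      using continuous_on_Re[OF c1_cont[OF q12(1), of UNIV]] by simp
    have kq: "(k X)\<^sup>2 = ki\<^sup>2 * (1 - q X)" for X using assms(7) by (simp add: q_def)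
    have k_cont: "continuous_on UNIV k"
    proof -
      have "k = (\<lambda>X. sqrt (ki\<^sup>2 * (1 - q X)))"
        unfolding kq[symmetric] using less_imp_le[OF k_pos] by simp
      then show ?thesis by (simp only:) (intro continuous_intros q_cont)
    qed
    note sc_rules = small_contrast_field[OF assms(6,7,4) \<Omega> q_cont _ qc kq c(3)[unfolded C\<Omega>_def] field]
    have sc: "a / 2 \<le> norm (\<eta> X)"
      "incoming_wave a kvec X - \<eta> X = of_real (ki\<^sup>2) * (\<integral>Y. hlm_g ki ((norm (Y - X))\<^sup>2) * (of_real (q Y) * \<eta> Y) \<partial>lborel)" for X
      by (rule sc_rules, erule q0)+
    have "Ck 2 \<eta>" using field by (simp add: total_field_def)
    note c\<eta> = Ck_2_c1[OF this]
    have \<eta>_cont: "continuous_on UNIV \<eta>" by (rule c1_cont[OF c\<eta>(1)])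
    define f where "f = (\<lambda>X. of_real (q X) * \<eta> X)"
    have f_cont: "continuous_on UNIV f" unfolding f_def by (intro continuous_intros q_cont \<eta>_cont)
    have f0: "f X = 0" if "X \<notin> \<Omega>" for X using q0[OF that] by (simp add: f_def)
    have Dm: "D \<in> sets lebesgue" and Dlm: "D \<in> lmeasurable"
      using D by (auto simp: borel_open intro: lmeasurable_open)
    have L2_cont: "L2 D v" if v: "continuous_on UNIV v" for v :: "real^2 \<Rightarrow> complex"
    proof -
      have "compact (v ` closure D)"
        by (rule compact_continuous_image[OF continuous_on_subset[OF v]]) (use D in auto)
      then obtain B where "\<And>X. X \<in> closure D \<Longrightarrow> norm (v X) \<le> B"
        using compact_imp_bounded[of "v ` closure D"] by (auto simp: bounded_pos)
      then show ?thesis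
        using closure_subset by (intro L2_bounded[OF Dlm measurable_lebesgue_on[OF borel_measurable_continuous_onI[OF v]]]) blast
    qed
    have fL: "L2 D f" by (rule L2_cont[OF f_cont])
    have LS: "incoming_wave a kvec X - \<eta> X = of_real (ki\<^sup>2) * helmholtz_K D ki f X" for X
    proof -
      have "helmholtz_K D ki f X = (\<integral>Y. helmholtz_G ki X Y * f Y \<partial>lborel)"
        unfolding helmholtz_K_def
      proof (rule integral_lebesgue_on_lborel[OF Dm])
        show "(\<lambda>Y. helmholtz_G ki X Y * f Y) \<in> borel_measurable borel"
          by (intro borel_measurable_times helmholtz_G_measurable(1)[OF D(1,2) assms(7)] borel_measurable_continuous_onI f_cont)
        show "helmholtz_G ki X Y * f Y = 0" if "Y \<notin> D" for Y
          using f0[of Y] that D(3) by auto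
      qed
      then show ?thesis using sc(2)[of X] by (simp add: helmholtz_G_eq[OF D(1,2) assms(7)] f_def)
    qed
    have f12: "c1 f (\<lambda>j X. q1 j X * \<eta> X + of_real (q X) * pd j \<eta> X)"
      "c1 (\<lambda>X. q1 i X * \<eta> X + of_real (q X) * pd i \<eta> X)
         (\<lambda>j X. (q2 i j X * \<eta> X + q1 i X * pd j \<eta> X) + (q1 j X * pd i \<eta> X + of_real (q X) * pd j (pd i \<eta>) X))" for i
      unfolding f_def
      by (rule c1_mult[OF q12(1) c\<eta>(1)], rule c1_add[OF c1_mult[OF q12(2) c\<eta>(1)] c1_mult[OF q12(1) c\<eta>(2)]])
    obtain w B where w: "w \<in> borel_measurable (lebesgue_on D)" "\<And>X. X \<in> D \<Longrightarrow> norm (w X) \<le> B"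
      "\<And>Y. cnj (f Y) = helmholtz_K D ki w Y"
      by (rule source_condition[OF assms(7) f12 f0 D(1,2) \<Omega>(1) D(3)], assumption) (rule that)
    \<comment> \<open>The factor left in the Tikhonov estimate after putting \<lambda> = \<delta>
      and dividing by \<delta>^2. It depends on the field and the domain but not on the noise,
      because w is built from q \<eta> alone.\<close>
    define rate where "rate = 2 + 2 * (L2_norm D w)\<^sup>2 / (ki\<^sup>2)\<^sup>2"
    define C where "C = 512 * ki\<^sup>2 / a\<^sup>2 * rate + (512 * ki\<^sup>2 / a\<^sup>2 + 16 * \<mu>\<^sup>2 / a\<^sup>2) + \<mu>\<^sup>2 * measure lebesgue D"
    have rate0: "0 \<le> rate" by (simp add: rate_def)
    have C0: "0 \<le> C" unfolding C_def using rate0 by (intro add_nonneg_nonneg mult_nonneg_nonneg) auto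
    obtain X0 where X0: "h X0 \<noteq> 0" using hne by blast
    have "H2_norm D f > 0"
    proof (rule H2_norm_pos[OF D(1) f_cont fL])
      show "X0 \<in> D" using h0[of X0] X0 D(3) by auto
      \<comment> \<open>The depth can be recovered from the wavenumber, so a depth different from
        \<open>H0\<close> forces a wavenumber different from ki.\<close>
      have "q X0 \<noteq> 0"
      proof
        assume "q X0 = 0"
        then have "(k X0)\<^sup>2 = ki\<^sup>2" using kq[of X0] by simp
        then have "k X0 = ki" using k_pos[of X0] assms(7) by (simp add: power2_eq_iff_nonneg)
        moreover have "wnum \<omega> g H0 = ki" by (rule wnum_unique[OF pos assms(3,7) kiH])
        ultimately have "depth_of \<mu> (wnum \<omega> g (H0 - h X0)) = depth_of \<mu> (wnum \<omega> g H0)" by (simp add: k_wnum)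
        then show False using depth_of_wnum[OF pos, of "H0 - h X0"] depth_of_wnum[OF pos assms(3)] h(2)[of X0] X0 by simp
      qed
      moreover have "\<eta> X0 \<noteq> 0" using sc(1)[of X0] assms(4) by auto
      ultimately show "f X0 \<noteq> 0" by (simp add: f_def)
    qed
    define s where "s = sqrt (H2_norm D f / ki\<^sup>2)"
    have s: "0 < s" using \<open>H2_norm D f > 0\<close> assms(7) by (simp add: s_def)
    define m where "m = sqrt (measure lebesgue D)"
    have m: "0 < m"
    proof -
      have "\<not> negligible D" using D \<Omega>(2) by (intro open_not_negligible) auto
      then show ?thesis unfolding m_def negligible_iff_measure0[OF Dlm] by (simp add: zero_less_measure_iff)
    qed
    define L where "L = Linf_norm UNIV q"
    \<comment> \<open>Solves C <= 9 ki^2 m (L + Ct s) for Ct; the division is possible because the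
      Sobolev norm in s is positive. The maximum with 1 makes the constant positive.\<close>
    define Ct where "Ct = max 1 ((C / (9 * ki\<^sup>2 * m) - L) / s)"
    have Ct: "0 < Ct" by (simp add: Ct_def)
    have "(C / (9 * ki\<^sup>2 * m) - L) / s \<le> Ct" by (simp add: Ct_def)
    then have "C / (9 * ki\<^sup>2 * m) \<le> L + Ct * s"
      using s by (simp add: pos_divide_le_eq)
    then have "C \<le> (L + Ct * s) * (9 * ki\<^sup>2 * m)"
      using m assms(7) by (simp only: pos_divide_le_eq[of "9 * ki\<^sup>2 * m"] mult_pos_pos zero_less_power zero_less_numeral)
    then have CQ: "C \<le> 9 * ki\<^sup>2 * (m * (L + Ct * s))" by (simp add: mult_ac)
    \<comment> \<open>The sign comes from the choice of Ct: the sum in parentheses dominates the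
      nonnegative C/(9 ki^2 m).\<close>
    have Q0: "0 \<le> m * (L + Ct * s)"
    proof -
      have "0 \<le> C / (9 * ki\<^sup>2 * m)" using C0 m by simp
      then show ?thesis using \<open>C / (9 * ki\<^sup>2 * m) \<le> L + Ct * s\<close> m by simp
    qed
    show "\<exists>Ct>0. \<exists>lam :: real \<Rightarrow> real. (\<forall>\<delta>>0. lam \<delta> > 0) \<and>
      (\<forall>\<epsilon> M\<epsilon> \<delta> \<alpha> \<gamma> u k\<epsilon>.
        L2 D \<epsilon> \<and> Linf D \<epsilon> \<and> \<not> (AE X in lebesgue_on D. \<epsilon> X = 0) \<and>
        M\<epsilon> = (\<lambda>X. \<eta> X + \<epsilon> X) \<and>
        \<delta> = L2_norm D (\<lambda>X. M\<epsilon> X - \<eta> X) \<and>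
        \<alpha> > 0 \<and> 0 < \<gamma> \<and> \<gamma> \<le> 1 \<and>
        tikhonov D ki (\<lambda>X. incoming_wave a kvec X - M\<epsilon> X) (lam \<delta>) u \<and>
        k\<epsilon> = rec_wavenumber ki M\<epsilon> u \<longrightarrow>
        L2 (superlevel D M\<epsilon> \<gamma>) (\<lambda>X. trunc_depth \<mu> \<alpha> (k\<epsilon> X) - trunc_depth \<mu> \<alpha> (k X)) \<and>
        L2_norm (superlevel D M\<epsilon> \<gamma>) (\<lambda>X. trunc_depth \<mu> \<alpha> (k\<epsilon> X) - trunc_depth \<mu> \<alpha> (k X))
          \<le> sqrt (sqrt (measure lebesgue D) *
                 (Linf_norm UNIV q + Ct * sqrt (H2_norm D (\<lambda>X. of_real (q X) * \<eta> X) / ki\<^sup>2)))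
             * \<gamma> powr (-1/2) * (3 * ki / (\<alpha> * (\<alpha> + \<mu>))) * sqrt \<delta>)"
    \<comment> \<open>The regularization parameter is the noise level itself; it is positive for
      positive \<delta> and involves neither \<alpha> nor \<gamma>.\<close>
    proof (intro exI[of _ Ct] exI[of _ "\<lambda>\<delta>. \<delta>"] conjI[OF Ct] allI impI conjI)
      fix \<epsilon> M\<epsilon> u :: "real^2 \<Rightarrow> complex" and \<delta> \<alpha> \<gamma> :: real and k\<epsilon>
      assume "L2 D \<epsilon> \<and> Linf D \<epsilon> \<and> \<not> (AE X in lebesgue_on D. \<epsilon> X = 0) \<and>
        M\<epsilon> = (\<lambda>X. \<eta> X + \<epsilon> X) \<and>
        \<delta> = L2_norm D (\<lambda>X. M\<epsilon> X - \<eta> X) \<and>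
        \<alpha> > 0 \<and> 0 < \<gamma> \<and> \<gamma> \<le> 1 \<and>
        tikhonov D ki (\<lambda>X. incoming_wave a kvec X - M\<epsilon> X) \<delta> u \<and>
        k\<epsilon> = rec_wavenumber ki M\<epsilon> u"
      then have \<epsilon>: "L2 D \<epsilon>" "\<not> (AE X in lebesgue_on D. \<epsilon> X = 0)" and M: "M\<epsilon> = (\<lambda>X. \<eta> X + \<epsilon> X)"
        and \<delta>: "\<delta> = L2_norm D (\<lambda>X. M\<epsilon> X - \<eta> X)" and \<alpha>: "0 < \<alpha>" and \<gamma>: "0 < \<gamma>" "\<gamma> \<le> 1"
        and tik: "tikhonov D ki (\<lambda>X. incoming_wave a kvec X - M\<epsilon> X) \<delta> u" and k\<epsilon>: "k\<epsilon> = rec_wavenumber ki M\<epsilon> u"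
        by blast+
      have \<delta>_eq: "\<delta> = L2_norm D \<epsilon>" by (simp add: \<delta> M)
      \<comment> \<open>Noise that is not almost everywhere zero has a positive norm; this makes the
        Tikhonov penalty nondegenerate and allows division by \<delta>.\<close>
      have \<delta>_pos: "0 < \<delta>"
      proof (rule ccontr)
        assume "\<not> 0 < \<delta>"
        moreover have "0 \<le> \<delta>" by (simp add: \<delta>_eq L2_norm_def)
        ultimately have "(L2_norm D \<epsilon>)\<^sup>2 = 0" by (simp add: \<delta>_eq)
        then have "AE X in lebesgue_on D. (norm (\<epsilon> X))\<^sup>2 = 0"
          using integral_nonneg_eq_0_iff_AE[of "lebesgue_on D" "\<lambda>X. (norm (\<epsilon> X))\<^sup>2"] \<epsilon>(1)
          unfolding L2_norm_sq L2_def by simp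
        then show False using \<epsilon>(2) by simp
      qed
      have inc_cont: "continuous_on UNIV (incoming_wave a kvec)"
        unfolding incoming_wave_def by (intro continuous_intros)
      have bL: "L2 D (\<lambda>X. incoming_wave a kvec X - M\<epsilon> X)"
      proof -
        have "L2 D (\<lambda>X. (incoming_wave a kvec X - \<eta> X) - \<epsilon> X)"
          by (intro L2_diff L2_cont \<epsilon> inc_cont \<eta>_cont)
        then show ?thesis by (simp add: M diff_diff_eq)
      qed
      note tr = tikhonov_rate[OF D(1,2) assms(7) fL w(1,2) w(3) bL \<delta>_pos tik]
      \<comment> \<open>At the exact source q \<eta> the integral equation leaves precisely minus
        the noise, so the misfit of the comparison element is \<delta>.\<close>
      have "incoming_wave a kvec X - M\<epsilon> X - of_real (ki\<^sup>2) * helmholtz_K D ki f X = - \<epsilon> X" for X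
        unfolding LS[symmetric] by (simp add: M)
      then have "L2_norm D (\<lambda>X. incoming_wave a kvec X - M\<epsilon> X - of_real (ki\<^sup>2) * helmholtz_K D ki f X) = \<delta>"
        by (simp only: L2_norm_def norm_minus_cancel \<delta>_eq)
      then have "\<delta> * (L2_norm D (\<lambda>X. f X - u X))\<^sup>2 \<le> 2 * \<delta>\<^sup>2 + 2 * (\<delta> / ki\<^sup>2)\<^sup>2 * (L2_norm D w)\<^sup>2"
        using tr(2) by simp
      also have "\<dots> = \<delta> * (rate * \<delta>)"
        unfolding rate_def power_divide by (simp add: power2_eq_square distrib_left distrib_right mult_ac)
      finally have e: "(L2_norm D (\<lambda>X. f X - u X))\<^sup>2 \<le> rate * L2_norm D \<epsilon>"
        using \<delta>_pos by (simp add: \<delta>_eq)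
      define S where "S = superlevel D M\<epsilon> \<gamma>"
      have S: "S \<in> sets lebesgue" "S \<subseteq> D"
      proof -
        show "S \<subseteq> D" by (auto simp: S_def superlevel_def)
        have [measurable]: "\<epsilon> \<in> borel_measurable (lebesgue_on D)" "\<eta> \<in> borel_measurable (lebesgue_on D)"
          using \<epsilon>(1) L2_cont[OF \<eta>_cont] by (auto simp: L2_def)
        have "{X \<in> space (lebesgue_on D). \<gamma> \<le> norm (M\<epsilon> X) / Linf_norm D M\<epsilon>} \<in> sets (lebesgue_on D)"
          unfolding M by measurable
        then have "S \<in> sets (lebesgue_on D)" by (simp add: S_def superlevel_def)
        then show "S \<in> sets lebesgue" using Dm by (simp add: sets_restrict_space_iff)
      qed
      define T where "T = 1 / (\<alpha> * (\<alpha> + \<mu>))"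
      have T: "0 < T" using \<alpha> \<mu> by (simp add: T_def)
      have td: "\<bar>trunc_depth \<mu> \<alpha> x - trunc_depth \<mu> \<alpha> y\<bar> \<le> 2 * T * \<bar>x - y\<bar>"
        "0 \<le> trunc_depth \<mu> \<alpha> x" "trunc_depth \<mu> \<alpha> x \<le> \<mu> * T" for x y
        using trunc_depth_lipschitz[OF pos \<alpha>, of x y] trunc_depth_bounds[OF pos \<alpha>, of x] by (simp_all add: T_def)
      have q3: "\<bar>q X\<bar> \<le> 1 / 3" for X using qc[of X] c(2) by linarith
      note re = reconstruction_estimate[OF assms(7,4) T \<mu> td D(1,2) S \<eta>_cont sc(1) k_cont k_pos _ q3 \<epsilon>(1) tr(1)
          fL[unfolded f_def] M e[unfolded f_def] rate0, folded k\<epsilon>]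
      have qk: "q X = 1 - (k X)\<^sup>2 / ki\<^sup>2" for X by (simp add: q_def)
      have N: "(L2_norm S (\<lambda>X. trunc_depth \<mu> \<alpha> (k\<epsilon> X) - trunc_depth \<mu> \<alpha> (k X)))\<^sup>2 \<le> T\<^sup>2 * C * \<delta>"
        using re(2)[OF qk] by (simp only: C_def \<delta>_eq)
      show "L2 (superlevel D M\<epsilon> \<gamma>) (\<lambda>X. trunc_depth \<mu> \<alpha> (k\<epsilon> X) - trunc_depth \<mu> \<alpha> (k X))"
        using re(1)[OF qk] by (simp only: S_def)
      have T3: "3 * ki * T = 3 * ki / (\<alpha> * (\<alpha> + \<mu>))" by (simp add: T_def)
      show "L2_norm (superlevel D M\<epsilon> \<gamma>) (\<lambda>X. trunc_depth \<mu> \<alpha> (k\<epsilon> X) - trunc_depth \<mu> \<alpha> (k X))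
          \<le> sqrt (sqrt (measure lebesgue D) *
                 (Linf_norm UNIV q + Ct * sqrt (H2_norm D (\<lambda>X. of_real (q X) * \<eta> X) / ki\<^sup>2)))
             * \<gamma> powr (-1/2) * (3 * ki / (\<alpha> * (\<alpha> + \<mu>))) * sqrt \<delta>"
        using sqrt_rate_bound[OF N CQ less_imp_le[OF T] less_imp_le[OF assms(7)] Q0 less_imp_le[OF \<delta>_pos] \<gamma>]
        unfolding T3 S_def m_def L_def s_def f_def .
    qed
  qed
qed

end
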